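(* Let $D\in\tilde{\mathscr R}$, let $D^*$ be its polar and $T:bD\to bD^*$ the homeomorphism described in the context. Then the following hold. (a) $D^*\in\tilde{\mathscr R}$. (b) If $D\in\mathscr R$ then $D^*\in\mathscr R$. (c) The mapping $T|_{\gamma_+}:\gamma_+\to\gamma_+^*$ is a $C^1$-smooth diffeomorphism. (d) The following relations hold along $\gamma_+$: $$r_1\cdot(r_1\circ T)+r_2\cdot(r_2\circ T)=1,$$ $$(r_1\circ T)\,dr_1+(r_2\circ T)\,dr_2=0,$$ $$r_1\,d(r_1\circ T)+r_2\,d(r_2\circ T)=0,$$ $$r_1\cdot(r_1\circ T)=s,\qquad r_2\cdot(r_2\circ T)=1-s,$$ $$s\circ T=s,\qquad \frac1p+\frac1{p\circ T}=1.$$ (e) If $D$ is generated by $\breve p,b_2,b_1$ then $D^*$ is generated by $\breve p^*,b_2^{-1},b_1^{-1}$, where $\breve p^*(s)$ is the conjugate exponent of $\breve p(s)$. (f) If $d\mu=\omega(s)\,ds\,d\theta_1\,d\theta_2$ describes an admissible measure on $bD$ then $d\tilde\mu=\frac1{\omega(s)}\,ds\,d\theta_1\,d\theta_2$ describes an admissible measure on $bD^*$. (g) With $\mu,\tilde\mu$ as in (f), the operator $U_\mu: f\mapsto (f\circ T)\cdot\omega^{-1}$ defines an isometry between $L^2(bD^*,\tilde\mu)$ and $L^2(bD,\mu)$. (h) With $\mu,\tilde\mu$ as in (f), if $\mathbb L_D$ is bounded on $L^2(bD,\mu)$ then $\mathbb L_{D^*}$ is bounded on $L^2(bD^*,\tilde\mu)$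 and $$\mathbb L^*_{D,\mu}\circ U_\mu=U_\mu\circ\mathbb L_{D^*},\qquad \mathbb L_D\circ U_\mu=U_\mu\circ\mathbb L^*_{D^*,\tilde\mu}.$$ The norm of $\mathbb L_{D^*}$ on $L^2(bD^*,\tilde\mu)$ equals the norm of $\mathbb L_D$ on $L^2(bD,\mu)$, and the spectral data (spectrum, eigenvalues with multiplicity, essential spectrum) of $\mathbb L^*_{D^*,\tilde\mu}\mathbb L_{D^*}$ and of $\mathbb A_{\tilde\mu}=\mathbb L^*_{D^*,\tilde\mu}-\mathbb L_{D^*}$ match the spectral data of $\mathbb L^*_{D,\mu}\mathbb L_D$ and of $\mathbb A_\mu=\mathbb L^*_{D,\mu}-\mathbb L_D$, respectively. Here $\mathbb L^*_{D,\mu}$ is the adjoint of $\mathbb L_D$ in $L^2(bD,\mu)$, and similarly for $D^*,\tilde\mu$.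
   Context: $D\subset\mathbb C^2$ is Reinhardt if it is invariant under all rotations $(z_1,z_2)\mapsto(e^{i\theta_1}z_1,e^{i\theta_2}z_2)$; it is complete Reinhardt if also $z\in D$, $|w_j|\le|z_j|$ imply $w\in D$. $\tilde{\mathscr R}$ is the class of bounded convex complete $C^1$-smooth Reinhardt domains in $\mathbb C^2$ that are $C^2$-smooth and strongly convex away from the axes $\{\zeta_1\zeta_2=0\}$. Such $D$ has the form $D=\{|z_1|<b_1,\ |z_2|<\phi(|z_1|)\}$ with $\phi$ continuous on $[0,b_1]$, $\phi>0$ on $[0,b_1)$, $\phi(b_1)=0$, $\phi'$ continuous on $[0,b_1)$ and negative on $(0,b_1)$, $\phi'(0)=0$, $\phi'(t)\to-\infty$ as $t\to b_1$, $\phi''$ continuous and negative on $(0,b_1)$; put $b_2=\phi(0)$. $\mathscr R\subset\tilde{\mathscr R}$ consists of the $D$ such that for some constants $c_j>0$, $p_j>1$: $\phi(r_1)=b_2-c_2r_1^{p_1}+\epsilon_1(r_1)$ for $r_1$ near $0$ and $\phi^{-1}(r_2)=b_1-c_1r_2^{p_2}+\epsilon_2(r_2)$ for $r_2$ near $0$, where each $\epsilon_j$ is $C^1$ for $r_j\ge0$, $C^2$ for $r_j>0$, $\epsilon_j(0)=\epsilon_j'(0)=0$, $\epsilon_j''(r_j)=o(r_j^{p_j-2})$. $\gamma=bD\cap[0,\infty)^2$, $\gamma_+=bD\cap(0,\infty)^2$ (with $\mathbb R^2\subset\mathbb C^2$); $\gamma^*,\gamma^*_+$ are the same for $D^*$.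 $(r_1,r_2)$ are the coordinates on $[0,\infty)^2$; on $bD$, $\zeta_j=r_je^{i\theta_j}$, $r_j=|\zeta_j|$. On $\gamma_+$ (extended rotation-invariantly to $bD\setminus\{\zeta_1\zeta_2=0\}$): $$s=\frac{-r_1\phi'(r_1)}{\phi(r_1)-r_1\phi'(r_1)},\qquad p=1+\frac{r_1\phi(r_1)\phi''(r_1)}{\phi'(r_1)(\phi(r_1)-r_1\phi'(r_1))};$$ $s$ extends to a homeomorphism $\gamma\to[0,1]$, so $r_1,r_2$ are functions of $s$ and $(s,\theta_1,\theta_2)$ are coordinates on $bD$ off the axes. $r_j,s,p$ on $bD^*$ are the corresponding functions for $D^*$. Put $\breve p=p\circ s^{-1}:(0,1)\to(1,\infty)$. $D$ is said to be generated by $\breve p,b_2,b_1$; equivalently $$\gamma_+=\left\{\left(b_1e^{-\int_s^1\frac{dt}{t\breve p(t)}},\ b_2e^{-\int_0^s\frac{dt}{(1-t)\breve p(t)}}\right):0<s<1\right\}.$$ Polar: $D^*=\{z\in\mathbb C^2:\operatorname{Re}\langle z,\zeta\rangle<1\text{ for all }\zeta\in D\}$, $\langle\cdot,\cdot\rangle$ the standard Hermitian inner product; $T(\zeta)$ is the unique $z\in bD^*$ with $\langle z,\zeta\rangle=1$. $T$ is a homeomorphism $bD\to bD^*$ mapping $\gamma$ onto $\gamma^*$. Leray transform of $D\in\tilde{\mathscr R}$: for $w\in D$, $\mathbb L_Df(w)=\int_{bD}f(\zeta)L(\zeta,w)$ with $$L(\zeta,w)=\frac1{(2\pi i)^2}\frac{j^*(\partial\rho\wedge\bar\partial\partial\rho)(\zeta)}{\left[\frac{\partial\rho}{\partial\zeta_1}(\zeta_1-w_1)+\frac{\partial\rho}{\partial\zeta_2}(\zeta_2-w_2)\right]^2}=\frac{ds\wedge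 d\theta_1\wedge d\theta_2}{4\pi^2\left(1-e^{-i\theta_1}\frac s{r_1}w_1-e^{-i\theta_2}\frac{1-s}{r_2}w_2\right)^2},$$ $\rho$ any defining function of $bD$ off the axes, $j:bD\to\mathbb C^2$ the inclusion, points on the axes ignored, $ds\wedge d\theta_1\wedge d\theta_2$ positively oriented. A rotation-invariant measure which is a positive constant times $\omega(s)\,ds\,d\theta_1d\theta_2$ ($\omega$ measurable, positive a.e.) is admissible if $\int_0^1\omega\,ds$ and $\int_0^1\omega^{-1}ds$ are finite. An $(n,m)$-monomial is a function $g(s)e^{i(n\theta_1+m\theta_2)}$, $n,m\in\mathbb Z$. For $\mu$ admissible and an $(n,m)$-monomial $f\in L^2(bD,\mu)$, $\mathbb L_Df$ is a multiple of $w_1^nw_2^m$ ($0$ if $\min\{n,m\}<0$), so it has continuous boundary values $\mathbb L_{n,m}f$. Decomposing $f\in L^2(bD,\mu)$ as the orthogonal sum $\sum f_{n,m}$ of $(n,m)$-monomials, $\mathbb L_Df=\sum_{n,m\ge0}\mathbb L_{n,m}f_{n,m}$; $\mathbb L_D$ is bounded if this defines a bounded operator on $L^2(bD,\mu)$.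
   Formalization: The polar D* is taken to be the interior of {z : Re⟨z,ζ⟩<1 for all ζ∈D}, because for open D this set is closed (for the unit ball it is the closed ball) and so is not itself a domain in the class. *)

theory Defs
  imports "HOL-Analysis.Analysis" "HOL-Library.Landau_Symbols"
begin

section \<open>Smoothness\<close>

definition C1_on :: "('a::euclidean_space \<Rightarrow> 'b::real_normed_vector) \<Rightarrow> 'a set \<Rightarrow> bool" where
  "C1_on f U \<longleftrightarrow>
     (\<exists>f' :: 'a \<Rightarrow> 'a \<Rightarrow>\<^sub>L 'b.
        (\<forall>x\<in>U. (f has_derivative blinfun_apply (f' x)) (at x)) \<and> continuous_on U f')"

text \<open>Smooth maps between arbitrary subsets of Euclidean spaces: those that extend
  smoothly to a neighbourhood of each point.\<close>

definition C1_map_on :: "'a::euclidean_space set \<Rightarrow> ('a \<Rightarrow> 'b::real_normed_vector) \<Rightarrow> bool" where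
  "C1_map_on S f \<longleftrightarrow>
     (\<forall>x\<in>S. \<exists>U g. open U \<and> x \<in> U \<and> C1_on g U \<and> (\<forall>y\<in>S \<inter> U. g y = f y))"

definition C1_diffeomorphism ::
  "'a::euclidean_space set \<Rightarrow> 'b::euclidean_space set \<Rightarrow> ('a \<Rightarrow> 'b) \<Rightarrow> bool" where
  "C1_diffeomorphism S S' f \<longleftrightarrow>
     bij_betw f S S' \<and> C1_map_on S f \<and> C1_map_on S' (inv_into S f)"

text \<open>\<open>\<rho>\<close> is a \<open>C\<^sup>1\<close> defining function of \<open>D\<close> in \<open>U\<close>, with gradient \<open>g\<close>.  For open \<open>D\<close>
  the remaining requirement that \<open>\<rho> = 0\<close> exactly on the boundary is automatic,
  as the gradient does not vanish.\<close>

definition defining_function ::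
  "'a::euclidean_space set \<Rightarrow> 'a set \<Rightarrow> ('a \<Rightarrow> real) \<Rightarrow> ('a \<Rightarrow> 'a) \<Rightarrow> bool" where
  "defining_function D U \<rho> g \<longleftrightarrow>
     open U \<and> (\<forall>x\<in>U. (\<rho> has_derivative (\<lambda>h. g x \<bullet> h)) (at x)) \<and> continuous_on U g \<and>
     (\<forall>x\<in>U. g x \<noteq> 0) \<and> D \<inter> U = {x \<in> U. \<rho> x < 0}"

definition C1_boundary_at :: "'a::euclidean_space set \<Rightarrow> 'a \<Rightarrow> bool" where
  "C1_boundary_at D q \<longleftrightarrow> (\<exists>U \<rho> g. q \<in> U \<and> defining_function D U \<rho> g)"

text \<open>Strong convexity: the Hessian of a \<open>C\<^sup>2\<close> defining function is positive definite on
  the tangent space.  For a given boundary point this is independent of the choice of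
  defining function.\<close>

definition C2_strongly_convex_boundary_at :: "'a::euclidean_space set \<Rightarrow> 'a \<Rightarrow> bool" where
  "C2_strongly_convex_boundary_at D q \<longleftrightarrow>
     (\<exists>U \<rho> g (H :: 'a \<Rightarrow> 'a \<Rightarrow>\<^sub>L 'a).
        q \<in> U \<and> defining_function D U \<rho> g \<and>
        (\<forall>x\<in>U. (g has_derivative blinfun_apply (H x)) (at x)) \<and> continuous_on U H \<and>
        (\<forall>v. v \<noteq> 0 \<longrightarrow> g q \<bullet> v = 0 \<longrightarrow> 0 < v \<bullet> blinfun_apply (H q) v))"

text \<open>The 1-form \<open>g\<^sub>1 dh\<^sub>1 + g\<^sub>2 dh\<^sub>2\<close> vanishes along \<open>S\<close>, tested on all \<open>C\<^sup>1\<close> curves in \<open>S\<close>.\<close>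

definition one_form_vanishes_along ::
  "'a::real_normed_vector set \<Rightarrow> ('a \<Rightarrow> real) \<Rightarrow> ('a \<Rightarrow> real) \<Rightarrow> ('a \<Rightarrow> real) \<Rightarrow> ('a \<Rightarrow> real) \<Rightarrow> bool"
where
  "one_form_vanishes_along S g\<^sub>1 h\<^sub>1 g\<^sub>2 h\<^sub>2 \<longleftrightarrow>
     (\<forall>(c :: real \<Rightarrow> 'a) a b. c C1_differentiable_on {a<..<b} \<and> c ` {a<..<b} \<subseteq> S \<longrightarrow>
        (\<forall>t\<in>{a<..<b}. \<exists>d\<^sub>1 d\<^sub>2.
           ((\<lambda>u. h\<^sub>1 (c u)) has_real_derivative d\<^sub>1) (at t) \<and>
           ((\<lambda>u. h\<^sub>2 (c u)) has_real_derivative d\<^sub>2) (at t) \<and>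
           g\<^sub>1 (c t) * d\<^sub>1 + g\<^sub>2 (c t) * d\<^sub>2 = 0))"


section \<open>The classes of Reinhardt domains\<close>

type_synonym C2 = "complex \<times> complex"

definition reinhardt :: "C2 set \<Rightarrow> bool" where
  "reinhardt D \<longleftrightarrow> (\<forall>z\<in>D. \<forall>\<theta>\<^sub>1 \<theta>\<^sub>2. (cis \<theta>\<^sub>1 * fst z, cis \<theta>\<^sub>2 * snd z) \<in> D)"

definition complete_reinhardt :: "C2 set \<Rightarrow> bool" where
  "complete_reinhardt D \<longleftrightarrow> reinhardt D \<and>
     (\<forall>z\<in>D. \<forall>w. cmod (fst w) \<le> cmod (fst z) \<and> cmod (snd w) \<le> cmod (snd z) \<longrightarrow> w \<in> D)"

definition Rtilde :: "C2 set set" where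
  "Rtilde = {D. open D \<and> D \<noteq> {} \<and> bounded D \<and> convex D \<and> complete_reinhardt D \<and>
     (\<forall>q\<in>frontier D. C1_boundary_at D q) \<and>
     (\<forall>q\<in>frontier D. fst q * snd q \<noteq> 0 \<longrightarrow> C2_strongly_convex_boundary_at D q)}"

definition r1 :: "C2 \<Rightarrow> real" where "r1 \<zeta> = cmod (fst \<zeta>)"
definition r2 :: "C2 \<Rightarrow> real" where "r2 \<zeta> = cmod (snd \<zeta>)"

text \<open>For \<open>D\<close> in the class, \<open>D = {|z\<^sub>1| < b1 D, |z\<^sub>2| < phi D |z\<^sub>1|}\<close>.  As a function on the whole
  line, \<open>phi D\<close> is even, so that \<open>deriv (phi D) 0\<close> is the one-sided derivative there.\<close>

definition b1 :: "C2 set \<Rightarrow> real" where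
  "b1 D = Sup {cmod (fst z) | z. z \<in> D}"

definition phi :: "C2 set \<Rightarrow> real \<Rightarrow> real" where
  "phi D t = Sup {r. (complex_of_real t, complex_of_real r) \<in> closure D}"

definition b2 :: "C2 set \<Rightarrow> real" where
  "b2 D = phi D 0"

definition power_like_at_0 :: "(real \<Rightarrow> real) \<Rightarrow> real \<Rightarrow> real \<Rightarrow> real \<Rightarrow> bool" where
  "power_like_at_0 f b c p \<longleftrightarrow>
     (\<exists>\<delta>>0. \<exists>\<epsilon> \<epsilon>' \<epsilon>'' :: real \<Rightarrow> real.
        (\<forall>r\<in>{0..<\<delta>}. f r = b - c * r powr p + \<epsilon> r) \<and>
        (\<forall>r\<in>{0..<\<delta>}. (\<epsilon> has_real_derivative \<epsilon>' r) (at r within {0..<\<delta>})) \<and>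
        continuous_on {0..<\<delta>} \<epsilon>' \<and>
        (\<forall>r\<in>{0<..<\<delta>}. (\<epsilon>' has_real_derivative \<epsilon>'' r) (at r)) \<and>
        continuous_on {0<..<\<delta>} \<epsilon>'' \<and>
        \<epsilon> 0 = 0 \<and> \<epsilon>' 0 = 0 \<and>
        \<epsilon>'' \<in> o[at_right 0](\<lambda>r. r powr (p - 2)))"

definition Rclass :: "C2 set set" where
  "Rclass = {D \<in> Rtilde. \<exists>c\<^sub>1 c\<^sub>2 p\<^sub>1 p\<^sub>2. c\<^sub>1 > 0 \<and> c\<^sub>2 > 0 \<and> p\<^sub>1 > 1 \<and> p\<^sub>2 > 1 \<and>
     power_like_at_0 (phi D) (b2 D) c\<^sub>2 p\<^sub>1 \<and>
     power_like_at_0 (inv_into {0..b1 D} (phi D)) (b1 D) c\<^sub>1 p\<^sub>2}"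

definition gamma_plus :: "C2 set \<Rightarrow> C2 set" where
  "gamma_plus D =
     {\<zeta> \<in> frontier D. \<exists>x y. x > 0 \<and> y > 0 \<and> \<zeta> = (complex_of_real x, complex_of_real y)}"

text \<open>Rotation invariant versions on the whole boundary.  The value 1 on \<open>\<zeta>\<^sub>2 = 0\<close> is the
  continuous extension of \<open>s\<close>; on \<open>\<zeta>\<^sub>1 = 0\<close> the formula already yields the extension 0.\<close>

definition s_coord :: "C2 set \<Rightarrow> C2 \<Rightarrow> real" where
  "s_coord D \<zeta> = (if snd \<zeta> = 0 then 1 else
     - r1 \<zeta> * deriv (phi D) (r1 \<zeta>) / (phi D (r1 \<zeta>) - r1 \<zeta> * deriv (phi D) (r1 \<zeta>)))"

definition p_fun :: "C2 set \<Rightarrow> C2 \<Rightarrow> real" where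
  "p_fun D \<zeta> = 1 + r1 \<zeta> * phi D (r1 \<zeta>) * deriv (deriv (phi D)) (r1 \<zeta>) /
     (deriv (phi D) (r1 \<zeta>) * (phi D (r1 \<zeta>) - r1 \<zeta> * deriv (phi D) (r1 \<zeta>)))"

definition s_inv :: "C2 set \<Rightarrow> real \<Rightarrow> C2" where
  "s_inv D = inv_into (gamma_plus D) (s_coord D)"

definition p_breve :: "C2 set \<Rightarrow> real \<Rightarrow> real" where
  "p_breve D \<sigma> = p_fun D (s_inv D \<sigma>)"

definition generated_by :: "C2 set \<Rightarrow> (real \<Rightarrow> real) \<Rightarrow> real \<Rightarrow> real \<Rightarrow> bool" where
  "generated_by D q \<beta>\<^sub>2 \<beta>\<^sub>1 \<longleftrightarrow>
     (\<forall>\<sigma>\<in>{0<..<1}. p_breve D \<sigma> = q \<sigma>) \<and> b2 D = \<beta>\<^sub>2 \<and> b1 D = \<beta>\<^sub>1"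

definition conjugate_exponent :: "real \<Rightarrow> real" where
  "conjugate_exponent p = p / (p - 1)"


section \<open>Polar domain and duality map\<close>

definition herm :: "C2 \<Rightarrow> C2 \<Rightarrow> complex" where
  "herm z \<zeta> = fst z * cnj (fst \<zeta>) + snd z * cnj (snd \<zeta>)"

text \<open>For open bounded \<open>D\<close> the set of all \<open>z\<close> with \<open>Re \<langle>z, \<zeta>\<rangle> < 1\<close> for every \<open>\<zeta> \<in> D\<close> is closed
  (the supremum over \<open>D\<close> is never attained); the polar domain is its interior.\<close>

definition polar :: "C2 set \<Rightarrow> C2 set" where
  "polar D = interior {z. \<forall>\<zeta>\<in>D. Re (herm z \<zeta>) < 1}"

definition T :: "C2 set \<Rightarrow> C2 \<Rightarrow> C2" where
  "T D \<zeta> = (THE z. z \<in> frontier (polar D) \<and> herm z \<zeta> = 1)"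


section \<open>Measures on the boundary\<close>

text \<open>The coordinates \<open>(s, \<theta>\<^sub>1, \<theta>\<^sub>2)\<close> on the boundary off the axes, and the measure
  \<open>\<omega>(s) ds d\<theta>\<^sub>1 d\<theta>\<^sub>2\<close>.\<close>

definition bd_param :: "C2 set \<Rightarrow> real \<times> real \<times> real \<Rightarrow> C2" where
  "bd_param D = (\<lambda>(\<sigma>, \<theta>\<^sub>1, \<theta>\<^sub>2).
     (complex_of_real (r1 (s_inv D \<sigma>)) * cis \<theta>\<^sub>1, complex_of_real (r2 (s_inv D \<sigma>)) * cis \<theta>\<^sub>2))"

definition bd_measure :: "C2 set \<Rightarrow> (real \<Rightarrow> real) \<Rightarrow> C2 measure" where
  "bd_measure D \<omega> =
     distr
       (density (restrict_space lborel ({0<..<1} \<times> {0..<2*pi} \<times> {0..<2*pi}))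
         (\<lambda>(\<sigma>, \<theta>\<^sub>1, \<theta>\<^sub>2). ennreal (\<omega> \<sigma>)))
       (restrict_space borel (frontier D)) (bd_param D)"

definition positive_weight :: "(real \<Rightarrow> real) \<Rightarrow> bool" where
  "positive_weight \<omega> \<longleftrightarrow>
     \<omega> \<in> borel_measurable (restrict_space borel {0<..<1}) \<and>
     (AE \<sigma> in lborel. \<sigma> \<in> {0<..<1} \<longrightarrow> \<omega> \<sigma> > 0)"

definition admissible_measure :: "C2 set \<Rightarrow> C2 measure \<Rightarrow> bool" where
  "admissible_measure D M \<longleftrightarrow>
     (\<exists>c \<omega>. c > 0 \<and> positive_weight \<omega> \<and>
        set_integrable lborel {0<..<1} \<omega> \<and> set_integrable lborel {0<..<1} (\<lambda>\<sigma>. 1 / \<omega> \<sigma>) \<and>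
        M = scale_measure (ennreal c) (bd_measure D \<omega>))"


section \<open>Operators on \<open>L\<^sup>2\<close>\<close>

text \<open>Elements of \<open>L\<^sup>2(M)\<close> are represented by square integrable functions; all notions below
  are invariant under almost everywhere equality, and operators act on representatives.\<close>

definition L2 :: "'a measure \<Rightarrow> ('a \<Rightarrow> complex) set" where
  "L2 M = {f \<in> borel_measurable M. integrable M (\<lambda>x. (cmod (f x))\<^sup>2)}"

definition ip2 :: "'a measure \<Rightarrow> ('a \<Rightarrow> complex) \<Rightarrow> ('a \<Rightarrow> complex) \<Rightarrow> complex" where
  "ip2 M f g = (\<integral>x. f x * cnj (g x) \<partial>M)"

definition norm2 :: "'a measure \<Rightarrow> ('a \<Rightarrow> complex) \<Rightarrow> real" where
  "norm2 M f = sqrt (\<integral>x. (cmod (f x))\<^sup>2 \<partial>M)"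

definition has_sum2 ::
  "'a measure \<Rightarrow> ('i \<Rightarrow> 'a \<Rightarrow> complex) \<Rightarrow> 'i set \<Rightarrow> ('a \<Rightarrow> complex) \<Rightarrow> bool" where
  "has_sum2 M f I g \<longleftrightarrow>
     (\<forall>i\<in>I. f i \<in> L2 M) \<and> g \<in> L2 M \<and>
     ((\<lambda>F. norm2 M (\<lambda>x. g x - (\<Sum>i\<in>F. f i x))) \<longlongrightarrow> 0) (finite_subsets_at_top I)"

definition linear2 ::
  "'a measure \<Rightarrow> 'b measure \<Rightarrow> (('a \<Rightarrow> complex) \<Rightarrow> 'b \<Rightarrow> complex) \<Rightarrow> bool" where
  "linear2 M N A \<longleftrightarrow>
     (\<forall>f\<in>L2 M. A f \<in> L2 N) \<and>
     (\<forall>f\<in>L2 M. \<forall>g\<in>L2 M. (AE x in M. f x = g x) \<longrightarrow> (AE y in N. A f y = A g y)) \<and>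
     (\<forall>f\<in>L2 M. \<forall>g\<in>L2 M. AE y in N. A (\<lambda>x. f x + g x) y = A f y + A g y) \<and>
     (\<forall>f\<in>L2 M. \<forall>c. AE y in N. A (\<lambda>x. c * f x) y = c * A f y)"

definition bounded_op :: "'a measure \<Rightarrow> (('a \<Rightarrow> complex) \<Rightarrow> 'a \<Rightarrow> complex) \<Rightarrow> bool" where
  "bounded_op M A \<longleftrightarrow> linear2 M M A \<and> (\<exists>C. \<forall>f\<in>L2 M. norm2 M (A f) \<le> C * norm2 M f)"

definition op_norm :: "'a measure \<Rightarrow> (('a \<Rightarrow> complex) \<Rightarrow> 'a \<Rightarrow> complex) \<Rightarrow> real" where
  "op_norm M A = Inf {C. 0 \<le> C \<and> (\<forall>f\<in>L2 M. norm2 M (A f) \<le> C * norm2 M f)}"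

definition surjective_isometry2 ::
  "'a measure \<Rightarrow> 'b measure \<Rightarrow> (('a \<Rightarrow> complex) \<Rightarrow> 'b \<Rightarrow> complex) \<Rightarrow> bool" where
  "surjective_isometry2 M N U \<longleftrightarrow> linear2 M N U \<and>
     (\<forall>f\<in>L2 M. norm2 N (U f) = norm2 M f) \<and>
     (\<forall>g\<in>L2 N. \<exists>f\<in>L2 M. AE y in N. U f y = g y)"

definition adjoint2 ::
  "'a measure \<Rightarrow> (('a \<Rightarrow> complex) \<Rightarrow> 'a \<Rightarrow> complex) \<Rightarrow> ('a \<Rightarrow> complex) \<Rightarrow> 'a \<Rightarrow> complex" where
  "adjoint2 M A = (SOME B. bounded_op M B \<and> (\<forall>f\<in>L2 M. \<forall>g\<in>L2 M. ip2 M (A f) g = ip2 M f (B g)))"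

definition shift_op ::
  "(('a \<Rightarrow> complex) \<Rightarrow> 'a \<Rightarrow> complex) \<Rightarrow> complex \<Rightarrow> ('a \<Rightarrow> complex) \<Rightarrow> 'a \<Rightarrow> complex" where
  "shift_op A l f = (\<lambda>x. A f x - l * f x)"

definition spectrum2 :: "'a measure \<Rightarrow> (('a \<Rightarrow> complex) \<Rightarrow> 'a \<Rightarrow> complex) \<Rightarrow> complex set" where
  "spectrum2 M A = {l. \<not> (\<exists>B. bounded_op M B \<and>
     (\<forall>f\<in>L2 M. (AE x in M. B (shift_op A l f) x = f x) \<and> (AE x in M. shift_op A l (B f) x = f x)))}"

definition kernel2 ::
  "'a measure \<Rightarrow> (('a \<Rightarrow> complex) \<Rightarrow> 'a \<Rightarrow> complex) \<Rightarrow> ('a \<Rightarrow> complex) set" where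
  "kernel2 M A = {f \<in> L2 M. AE x in M. A f x = 0}"

text \<open>Dimension of (the image in \<open>L\<^sup>2(M)\<close> of) a space of functions.\<close>

definition dim2 :: "'a measure \<Rightarrow> ('a \<Rightarrow> complex) set \<Rightarrow> enat" where
  "dim2 M E = Sup {enat n | n. \<exists>e :: nat \<Rightarrow> 'a \<Rightarrow> complex. (\<forall>i<n. e i \<in> E) \<and>
     (\<forall>c. (AE x in M. (\<Sum>i<n. c i * e i x) = 0) \<longrightarrow> (\<forall>i<n. c i = 0))}"

text \<open>Multiplicity of \<open>l\<close> as an eigenvalue, which is 0 if \<open>l\<close> is not an eigenvalue.\<close>

definition eigen_mult :: "'a measure \<Rightarrow> (('a \<Rightarrow> complex) \<Rightarrow> 'a \<Rightarrow> complex) \<Rightarrow> complex \<Rightarrow> enat" where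
  "eigen_mult M A l = dim2 M (kernel2 M (shift_op A l))"

text \<open>Finite codimension of the range of a bounded operator implies that the range is closed.\<close>

definition fredholm2 :: "'a measure \<Rightarrow> (('a \<Rightarrow> complex) \<Rightarrow> 'a \<Rightarrow> complex) \<Rightarrow> bool" where
  "fredholm2 M A \<longleftrightarrow> dim2 M (kernel2 M A) \<noteq> \<infinity> \<and>
     (\<exists>n (e :: nat \<Rightarrow> 'a \<Rightarrow> complex). (\<forall>i<n. e i \<in> L2 M) \<and>
        (\<forall>f\<in>L2 M. \<exists>g\<in>L2 M. \<exists>c. AE x in M. f x = A g x + (\<Sum>i<n. c i * e i x)))"

definition ess_spectrum2 :: "'a measure \<Rightarrow> (('a \<Rightarrow> complex) \<Rightarrow> 'a \<Rightarrow> complex) \<Rightarrow> complex set" where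
  "ess_spectrum2 M A = {l. \<not> fredholm2 M (shift_op A l)}"

definition same_spectral_data ::
  "'a measure \<Rightarrow> (('a \<Rightarrow> complex) \<Rightarrow> 'a \<Rightarrow> complex) \<Rightarrow>
   'b measure \<Rightarrow> (('b \<Rightarrow> complex) \<Rightarrow> 'b \<Rightarrow> complex) \<Rightarrow> bool" where
  "same_spectral_data M A N B \<longleftrightarrow>
     spectrum2 M A = spectrum2 N B \<and>
     (\<forall>l. eigen_mult M A l = eigen_mult N B l) \<and>
     ess_spectrum2 M A = ess_spectrum2 N B"


section \<open>The Leray transform\<close>

definition monomial :: "C2 set \<Rightarrow> int \<Rightarrow> int \<Rightarrow> (C2 \<Rightarrow> complex) \<Rightarrow> bool" where
  "monomial D n m f \<longleftrightarrow>
     (\<exists>g. \<forall>\<zeta>\<in>frontier D. fst \<zeta> * snd \<zeta> \<noteq> 0 \<longrightarrow>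
        f \<zeta> = g (s_coord D \<zeta>) * cis (of_int n * Arg (fst \<zeta>) + of_int m * Arg (snd \<zeta>)))"

text \<open>The Leray kernel
  \<open>(2\<pi>i)\<^sup>-\<^sup>2 j\<^sup>*(\<partial>\<rho> \<and> dbar \<partial>\<rho>)(\<zeta>) / [\<partial>\<^sub>1\<rho>(\<zeta>)(\<zeta>\<^sub>1 - w\<^sub>1) + \<partial>\<^sub>2\<rho>(\<zeta>)(\<zeta>\<^sub>2 - w\<^sub>2)]\<^sup>2\<close>
  in the coordinates \<open>(s, \<theta>\<^sub>1, \<theta>\<^sub>2)\<close>: its density with respect to the positively oriented
  \<open>ds \<and> d\<theta>\<^sub>1 \<and> d\<theta>\<^sub>2\<close>, which is independent of the defining function \<open>\<rho>\<close>.\<close>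

definition leray_kernel :: "C2 set \<Rightarrow> C2 \<Rightarrow> C2 \<Rightarrow> complex" where
  "leray_kernel D \<zeta> w = 1 / (4 * complex_of_real pi ^ 2 *
     (1 - cis (- Arg (fst \<zeta>)) * complex_of_real (s_coord D \<zeta> / r1 \<zeta>) * fst w
        - cis (- Arg (snd \<zeta>)) * complex_of_real ((1 - s_coord D \<zeta>) / r2 \<zeta>) * snd w) ^ 2)"

definition leray_integral :: "C2 set \<Rightarrow> (C2 \<Rightarrow> complex) \<Rightarrow> C2 \<Rightarrow> complex" where
  "leray_integral D f w = (\<integral>\<zeta>. f \<zeta> * leray_kernel D \<zeta> w \<partial>bd_measure D (\<lambda>_. 1))"

definition leray_boundary :: "C2 set \<Rightarrow> (C2 \<Rightarrow> complex) \<Rightarrow> C2 \<Rightarrow> complex" where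
  "leray_boundary D f \<zeta> = Lim (at \<zeta> within D) (leray_integral D f)"

text \<open>\<open>f = \<Sum> F n m\<close> with \<open>F n m\<close> an \<open>(n, m)\<close>-monomial.  Monomials of different bidegrees are
  orthogonal for every rotation invariant measure, so the \<open>F n m\<close> are unique almost everywhere.\<close>

definition monomial_decomposition ::
  "C2 set \<Rightarrow> C2 measure \<Rightarrow> (C2 \<Rightarrow> complex) \<Rightarrow> (int \<Rightarrow> int \<Rightarrow> C2 \<Rightarrow> complex) \<Rightarrow> bool" where
  "monomial_decomposition D M f F \<longleftrightarrow>
     (\<forall>n m. monomial D n m (F n m)) \<and> has_sum2 M (\<lambda>(n, m). F n m) UNIV f"

definition leray_value :: "C2 set \<Rightarrow> C2 measure \<Rightarrow> (C2 \<Rightarrow> complex) \<Rightarrow> (C2 \<Rightarrow> complex) \<Rightarrow> bool" where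
  "leray_value D M f h \<longleftrightarrow>
     (\<exists>F. monomial_decomposition D M f F \<and>
        has_sum2 M (\<lambda>(n, m). leray_boundary D (F n m)) ({0..} \<times> {0..}) h)"

definition leray :: "C2 set \<Rightarrow> C2 measure \<Rightarrow> (C2 \<Rightarrow> complex) \<Rightarrow> C2 \<Rightarrow> complex" where
  "leray D M f = (SOME h. leray_value D M f h)"

definition leray_bounded :: "C2 set \<Rightarrow> C2 measure \<Rightarrow> bool" where
  "leray_bounded D M \<longleftrightarrow> (\<forall>f\<in>L2 M. \<exists>h. leray_value D M f h) \<and> bounded_op M (leray D M)"

definition leray_adj :: "C2 set \<Rightarrow> C2 measure \<Rightarrow> (C2 \<Rightarrow> complex) \<Rightarrow> C2 \<Rightarrow> complex" where
  "leray_adj D M = adjoint2 M (leray D M)"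

definition leray_anti :: "C2 set \<Rightarrow> C2 measure \<Rightarrow> (C2 \<Rightarrow> complex) \<Rightarrow> C2 \<Rightarrow> complex" where
  "leray_anti D M f = (\<lambda>\<zeta>. leray_adj D M f \<zeta> - leray D M f \<zeta>)"

definition U_op :: "C2 set \<Rightarrow> (real \<Rightarrow> real) \<Rightarrow> (C2 \<Rightarrow> complex) \<Rightarrow> C2 \<Rightarrow> complex" where
  "U_op D \<omega> f = (\<lambda>\<zeta>. f (T D \<zeta>) * complex_of_real (1 / \<omega> (s_coord D \<zeta>)))"

end

theory Submission
  imports Defs
begin

text \<open>A domain \<open>D\<close> of the class has one supporting hyperplane at each boundary point and touches
  each of them in one point.  Hence \<open>T \<zeta>\<close> is the unique \<open>z\<close> in the closure of the polar with
  \<open>Re \<langle>z, \<zeta>\<rangle> = 1\<close>, and by bipolarity the map \<open>T\<close> of the polar inverts it.  The gauge of the polar,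
  \<open>z \<mapsto> max Re \<langle>z, \<zeta>\<rangle>\<close> over the closure of \<open>D\<close>, has the maximising point as its gradient, which
  is continuous, and is continuously differentiable off the axes because \<open>\<phi>'\<close> is invertible
  there with \<open>\<phi>'' < 0\<close>.  On the profile curve \<open>s = r\<^sub>1 (r\<^sub>1 \<circ> T)\<close> is symmetric in \<open>D\<close> and its polar,
  and \<open>p\<close> is computed from the logarithmic derivative of \<open>\<phi>'\<close>, which turns into the conjugate
  exponent under duality.

  For an \<open>(n, m)\<close>-monomial \<open>f\<close>, expanding the kernel gives
  \<open>L f = a\<^sub>n\<^sub>m \<langle>f, Q\<^sub>n\<^sub>m\<rangle> P\<^sub>n\<^sub>m\<close> with \<open>P\<^sub>n\<^sub>m = w\<^sub>1\<^sup>n w\<^sub>2\<^sup>m\<close>, \<open>Q\<^sub>n\<^sub>m = U P\<^sub>n\<^sub>m\<close> and a constant \<open>a\<^sub>n\<^sub>m > 0\<close>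
  that does not depend on \<open>D\<close>.  The adjoint has the roles of \<open>P\<close> and \<open>Q\<close> interchanged, and so has the
  image under \<open>U\<close> of the Leray transform of the polar.  Since \<open>\<langle>P\<^sub>n\<^sub>m, Q\<^sub>n\<^sub>m\<rangle>\<close> is real, a reflection
  in each plane spanned by \<open>P\<^sub>n\<^sub>m\<close> and \<open>Q\<^sub>n\<^sub>m\<close> swaps the normalised vectors; composed with \<open>U\<close> it
  conjugates both the transform and its adjoint to those of \<open>D\<close>, which yields the norm and the
  spectral data.\<close>

section \<open>Convex sets and defining functions\<close>

text \<open>The isometry \<open>U\<close> alone does not give the last claims: it conjugates the
  transform of the polar to the adjoint of the transform of \<open>D\<close>, so
  \<open>leray_adj \<circ> leray\<close> turns into the product in the opposite order and
  \<open>leray_anti\<close> changes sign. Products in opposite orders need not agree at 0 in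
  general, multiplicities included, so a second unitary is required; the rank-one form of the blocks
  makes it explicit. On the geometric side the boundary is only \<open>C1\<close> where it meets the
  axes, so strong convexity is missing there. Completeness supplies strict convexity at those
  points, and all second derivatives are kept off the axes. For the smaller class, the conditions at
  the axes are condensed to a limit of a rescaled second derivative, and the condition on the
  inverse profile is treated as the condition on the profile of the domain with exchanged
  coordinates. Operators act on representatives and several are defined by choice, so most operator
  identities are statements up to null sets.\<close>

lemma inner_eq_Re_herm: "z \<bullet> w = Re (herm z w)"
  by (simp add: herm_def inner_prod_def inner_complex_def)

text \<open>A segment from an interior point to a point of the closure stays in the interior before
  its end. Radial shrinking thus replaces limits, and monotonicity in the moduli passes from
  \<open>D\<close> to its closure.\<close>

lemma mem_closure_iff_scaleR:
  fixes S :: "'a::euclidean_space set"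
  assumes "open S" "convex S" "0 \<in> S"
  shows "x \<in> closure S \<longleftrightarrow> (\<forall>t. 0 \<le> t \<and> t < 1 \<longrightarrow> t *\<^sub>R x \<in> S)"
proof
  assume x: "x \<in> closure S"
  show "\<forall>t. 0 \<le> t \<and> t < 1 \<longrightarrow> t *\<^sub>R x \<in> S"
  proof (intro allI impI)
    fix t :: real assume t: "0 \<le> t \<and> t < 1"
    show "t *\<^sub>R x \<in> S"
    proof (cases "t = 0 \<or> x = 0")
      case True then show ?thesis using assms by auto
    next
      case False
      then have "t *\<^sub>R x \<in> open_segment 0 x"
        using t by (auto simp: in_segment intro!: exI[of _ t])
      then show ?thesis
        using in_interior_closure_convex_segment[of S 0 x] assms x by (auto simp: interior_open)
    qed
  qed
next
  assume *: "\<forall>t. 0 \<le> t \<and> t < 1 \<longrightarrow> t *\<^sub>R x \<in> S"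
  have "(\<lambda>n. (1 - inverse (real (Suc n))) *\<^sub>R x) \<longlonglongrightarrow> (1 - 0) *\<^sub>R x"
    by (intro tendsto_intros LIMSEQ_inverse_real_of_nat)
  moreover have "(1 - inverse (real (Suc n))) *\<^sub>R x \<in> S" for n
    using * by (simp add: field_simps)
  ultimately show "x \<in> closure S"
    unfolding closure_sequential by (intro exI[of _ "\<lambda>n. (1 - inverse (real (Suc n))) *\<^sub>R x"]) simp
qed

lemma has_real_derivative_along_line:
  assumes "(\<rho> has_derivative (\<lambda>h. g \<bullet> h)) (at (q + t *\<^sub>R v))"
  shows "((\<lambda>t. \<rho> (q + t *\<^sub>R v)) has_real_derivative g \<bullet> v) (at t)"
proof -
  have "((\<lambda>t. q + t *\<^sub>R v) has_derivative (\<lambda>h. h *\<^sub>R v)) (at t)"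
    by (auto intro!: derivative_eq_intros)
  from diff_chain_at[OF this, of \<rho> "\<lambda>h. g \<bullet> h"] assms
  show ?thesis
    unfolding has_field_derivative_def
    by (simp add: o_def mult_commute_abs)
qed

lemma defining_function_nonpos_on_closure:
  assumes "defining_function D U \<rho> g" "x \<in> U" "x \<in> closure D"
  shows "\<rho> x \<le> 0"
proof (rule ccontr)
  assume "\<not> \<rho> x \<le> 0"
  have U: "open U" and DU: "D \<inter> U = {x \<in> U. \<rho> x < 0}"
    and c: "continuous_on U \<rho>"
    using assms(1) unfolding defining_function_def
    by (auto intro!: continuous_at_imp_continuous_on dest: has_derivative_continuous)
  have "open {y \<in> U. 0 < \<rho> y}"
    using continuous_open_preimage[OF c U open_greaterThan[of 0]]
    by (simp add: vimage_def Int_def)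
  then have "{y \<in> U. 0 < \<rho> y} \<inter> D \<noteq> {}"
    using assms(2,3) \<open>\<not> \<rho> x \<le> 0\<close> open_Int_closure_eq_empty[of "{y \<in> U. 0 < \<rho> y}" D] by force
  then obtain y where "y \<in> U" "0 < \<rho> y" "y \<in> D \<inter> U" by blast
  then show False unfolding DU by auto
qed

lemma defining_function_zero_on_frontier:
  assumes "defining_function D U \<rho> g" "open D" "x \<in> U" "x \<in> frontier D"
  shows "\<rho> x = 0"
proof -
  have "x \<notin> D" using assms by (auto simp: frontier_def interior_open)
  then have "\<not> \<rho> x < 0" using assms(1,3) unfolding defining_function_def by blast
  then show ?thesis
    using defining_function_nonpos_on_closure[OF assms(1,3)] assms(4) by (simp add: frontier_def)
qed

text \<open>\<open>\<rho>\<close> vanishes at \<open>q\<close> with negative slope along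
  \<open>v\<close>, so a short step makes it negative without leaving \<open>U\<close>.\<close>

lemma defining_function_enter:
  assumes d: "defining_function D U \<rho> g" and "open D" "q \<in> U" "q \<in> frontier D" "g q \<bullet> v < 0"
  shows "\<exists>h>0. q + h *\<^sub>R v \<in> D"
proof -
  have U: "open U" and DU: "D \<inter> U = {x \<in> U. \<rho> x < 0}"
    and dr: "(\<rho> has_derivative (\<lambda>h. g q \<bullet> h)) (at q)"
    using assms unfolding defining_function_def by auto
  have "((\<lambda>t. \<rho> (q + t *\<^sub>R v)) has_real_derivative g q \<bullet> v) (at 0)"
    using has_real_derivative_along_line[of \<rho> "g q" q 0 v] dr by simp
  from DERIV_neg_dec_right[OF this assms(5)]
  obtain e where e: "e > 0" "\<And>h. 0 < h \<Longrightarrow> h < e \<Longrightarrow> \<rho> (q + h *\<^sub>R v) < 0"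
    using defining_function_zero_on_frontier[OF d assms(2,3,4)] by auto
  have "((\<lambda>t. q + t *\<^sub>R v) \<longlongrightarrow> q + 0 *\<^sub>R v) (at_right 0)"
    by (intro tendsto_intros)
  then have "eventually (\<lambda>t. q + t *\<^sub>R v \<in> U) (at_right 0)"
    using U assms(3) by (simp add: topological_tendstoD)
  moreover have "eventually (\<lambda>t. 0 < t \<and> t < e) (at_right (0::real))"
    using e(1) eventually_at_right_less[of "0::real"] eventually_at_right_field by blast
  ultimately have "eventually (\<lambda>t. t > 0 \<and> q + t *\<^sub>R v \<in> D) (at_right 0)"
    by eventually_elim (use e(2) DU in auto)
  then show ?thesis
    using eventually_happens'[OF trivial_limit_at_right_real] by blast
qed

text \<open>Every \<open>v\<close> with \<open>g q \<bullet> v < 0\<close> points into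
  \<open>D\<close>, so \<open>z\<close> is nonpositive on this open half-space, which leaves only
  multiples of the gradient. This is where \<open>C1\<close> boundaries get a unique normalised
  support functional.\<close>

lemma supporting_functional_parallel:
  assumes d: "defining_function D U \<rho> g" and "open D" "q \<in> U" "q \<in> frontier D"
    and sup: "\<And>x. x \<in> D \<Longrightarrow> z \<bullet> x \<le> z \<bullet> q"
  shows "\<exists>l. z = l *\<^sub>R g q"
proof -
  have neg: "z \<bullet> v \<le> 0" if gv: "g q \<bullet> v < 0" for v
  proof -
    obtain h where "h > 0" "q + h *\<^sub>R v \<in> D"
      using defining_function_enter[OF d assms(2,3,4) gv] by blast
    then have "h * (z \<bullet> v) \<le> 0" using sup[of "q + h *\<^sub>R v"] by (simp add: inner_add_right)
    then show ?thesis using \<open>h > 0\<close> by (simp add: mult_le_0_iff)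
  qed
  have g0: "g q \<bullet> g q > 0" using d assms(3) by (auto simp: defining_function_def)
  \<comment> \<open>The part of \<open>z\<close> orthogonal to the gradient, to be shown
    zero.\<close>
  define w where "w = z - ((z \<bullet> g q) / (g q \<bullet> g q)) *\<^sub>R g q"
  have gw: "g q \<bullet> w = 0"
    using g0 by (simp add: w_def inner_diff_right inner_commute)
  have zw: "z \<bullet> w = w \<bullet> w"
    using gw by (simp add: w_def inner_diff_left inner_commute)
  \<comment> \<open>\<open>w\<close> is only tangent; subtracting a small multiple of
    \<open>g q\<close> tilts it into the half-space where \<open>neg\<close> applies, and the
    multiple then tends to 0.\<close>
  have "w \<bullet> w \<le> \<epsilon> * (z \<bullet> g q)" if "\<epsilon> > 0" for \<epsilon>
  proof -
    have "g q \<bullet> (w - \<epsilon> *\<^sub>R g q) < 0"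
      using gw g0 that by (simp add: inner_diff_right)
    from neg[OF this] show ?thesis by (simp add: inner_diff_right zw)
  qed
  then have "eventually (\<lambda>\<epsilon>. w \<bullet> w \<le> \<epsilon> * (z \<bullet> g q)) (at_right 0)"
    by (simp add: eventually_at_filter)
  moreover have "((\<lambda>\<epsilon>. \<epsilon> * (z \<bullet> g q)) \<longlongrightarrow> 0 * (z \<bullet> g q)) (at_right 0)"
    by (intro tendsto_intros)
  ultimately have "w \<bullet> w \<le> 0 * (z \<bullet> g q)"
    using tendsto_lowerbound[of "\<lambda>\<epsilon>. \<epsilon> * (z \<bullet> g q)" _ "at_right 0" "w \<bullet> w"] by simp
  then have "w \<bullet> w = 0" using inner_ge_zero[of w] by linarith
  then have "w = 0" by simp
  then have "z = ((z \<bullet> g q) / (g q \<bullet> g q)) *\<^sub>R g q" unfolding w_def by (simp only: right_minus_eq)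
  then show ?thesis by blast
qed

section \<open>Convex complete Reinhardt domains and their polars\<close>

text \<open>Smoothness is left out on purpose: the polar inherits these properties directly, so
  bipolarity is available before any regularity of the polar is known.\<close>

locale convex_reinhardt =
  fixes D :: "C2 set"
  assumes open_D: "open D" and nonempty: "D \<noteq> {}" and bounded_D: "bounded D"
    and convex_D: "convex D" and complete_D: "complete_reinhardt D"
begin

lemma D_mono: "z \<in> D \<Longrightarrow> cmod (fst w) \<le> cmod (fst z) \<Longrightarrow> cmod (snd w) \<le> cmod (snd z) \<Longrightarrow> w \<in> D"
  using complete_D unfolding complete_reinhardt_def by blast

lemma zero_mem: "0 \<in> D"
  using nonempty D_mono[of _ 0] by auto

lemma zero_closure: "0 \<in> closure D"
  using zero_mem closure_subset by blast

lemma compact_closure: "compact (closure D)"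
  using bounded_D by (simp add: compact_closure)

lemma closure_iff: "z \<in> closure D \<longleftrightarrow> (\<forall>t. 0 \<le> t \<and> t < 1 \<longrightarrow> t *\<^sub>R z \<in> D)"
  by (rule mem_closure_iff_scaleR[OF open_D convex_D zero_mem])

lemma closure_mono: "z \<in> closure D \<Longrightarrow> cmod (fst w) \<le> cmod (fst z) \<Longrightarrow> cmod (snd w) \<le> cmod (snd z) \<Longrightarrow>
    w \<in> closure D"
  unfolding closure_iff
proof (intro allI impI)
  fix t :: real
  assume *: "\<forall>t. 0 \<le> t \<and> t < 1 \<longrightarrow> t *\<^sub>R z \<in> D" and t: "0 \<le> t \<and> t < 1"
    and le: "cmod (fst w) \<le> cmod (fst z)" "cmod (snd w) \<le> cmod (snd z)"
  show "t *\<^sub>R w \<in> D"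
    by (rule D_mono[of "t *\<^sub>R z"]) (use * t le in \<open>auto intro: mult_left_mono\<close>)
qed

lemma frontier_iff: "z \<in> frontier D \<longleftrightarrow> z \<in> closure D \<and> z \<notin> D"
  using open_D by (auto simp: frontier_def interior_open)

lemma frontier_rotate:
  "z \<in> frontier D \<Longrightarrow> cmod (fst w) = cmod (fst z) \<Longrightarrow> cmod (snd w) = cmod (snd z) \<Longrightarrow> w \<in> frontier D"
proof -
  assume z: "z \<in> frontier D" and eq: "cmod (fst w) = cmod (fst z)" "cmod (snd w) = cmod (snd z)"
  have "w \<in> closure D" by (rule closure_mono[of z]) (use z eq in \<open>simp_all add: frontier_iff\<close>)
  moreover have "w \<notin> D"
  proof
    assume "w \<in> D"
    then have "z \<in> D" by (rule D_mono) (simp_all add: eq)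
    then show False using z by (simp add: frontier_iff)
  qed
  ultimately show ?thesis by (simp add: frontier_iff)
qed

lemma compact_frontier: "compact (frontier D)"
  using bounded_D by (simp add: compact_frontier_bounded)

lemma inner_le_cmod: "z \<bullet> w \<le> cmod (fst z) * cmod (fst w) + cmod (snd z) * cmod (snd w)"
  by (simp add: inner_prod_def add_mono norm_cauchy_schwarz)

text \<open>Rotating the coordinates of \<open>\<zeta>\<close> to the arguments of those of
  \<open>z\<close> turns the inner product into products of moduli. Where a coordinate of
  \<open>z\<close> vanishes, \<open>sgn\<close> gives 0 and completeness keeps the point in the
  closure.\<close>

lemma aligned_mem_closure:
  assumes "\<zeta> \<in> closure D"
  shows "\<exists>\<eta>\<in>closure D. z \<bullet> \<eta> = cmod (fst z) * cmod (fst \<zeta>) + cmod (snd z) * cmod (snd \<zeta>)"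
proof
  let ?\<eta> = "(cmod (fst \<zeta>) *\<^sub>R sgn (fst z), cmod (snd \<zeta>) *\<^sub>R sgn (snd z))"
  show "?\<eta> \<in> closure D"
    using assms by (rule closure_mono) (auto simp: norm_sgn)
  have "u \<bullet> sgn u = norm u" for u :: complex
    by (cases "u = 0") (simp_all add: sgn_div_norm dot_square_norm power2_eq_square)
  then show "z \<bullet> ?\<eta> = cmod (fst z) * cmod (fst \<zeta>) + cmod (snd z) * cmod (snd \<zeta>)"
    by (simp add: inner_prod_def mult.commute)
qed

section \<open>The polar set and bipolarity\<close>

lemma open_polar_set: "open {z. \<forall>\<zeta>\<in>closure D. z \<bullet> \<zeta> < 1}"
proof -
  define S where "S = {z :: C2 \<times> C2. 1 \<le> fst z \<bullet> snd z}"
  have "closed S" unfolding S_def by (intro closed_Collect_le continuous_intros)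
  then have "closed {x. \<exists>y. y \<in> closure D \<and> (y, x) \<in> S}"
    by (rule closed_compact_projection[OF compact_closure])
  moreover have "{z. \<forall>\<zeta>\<in>closure D. z \<bullet> \<zeta> < 1} = - {x. \<exists>y. y \<in> closure D \<and> (y, x) \<in> S}"
    by (rule set_eqI) (simp only: mem_Collect_eq Compl_iff S_def fst_conv snd_conv, metis inner_commute not_le)
  ultimately show ?thesis by (simp add: open_Compl)
qed

text \<open>At an interior point of the polar set, \<open>z\<close> can still be pushed a little
  towards \<open>\<zeta>\<close>, which makes the inequality strict on the closure. Conversely a
  strict inequality over a compact set is an open condition on \<open>z\<close>.\<close>

lemma polar_iff: "z \<in> polar D \<longleftrightarrow> (\<forall>\<zeta>\<in>closure D. z \<bullet> \<zeta> < 1)"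
proof
  assume "z \<in> polar D"
  then obtain e where e: "e > 0" "ball z e \<subseteq> {z. \<forall>\<zeta>\<in>D. Re (herm z \<zeta>) < 1}"
    unfolding polar_def mem_interior by blast
  show "\<forall>\<zeta>\<in>closure D. z \<bullet> \<zeta> < 1"
  proof
    fix \<zeta> assume \<zeta>: "\<zeta> \<in> closure D"
    show "z \<bullet> \<zeta> < 1"
    proof (cases "\<zeta> = 0")
      case False
      define z' where "z' = z + (e / 2 / norm \<zeta>) *\<^sub>R \<zeta>"
      have "z' \<in> ball z e" using e(1) False by (simp add: z'_def dist_norm)
      then have "D \<subseteq> {\<zeta>. z' \<bullet> \<zeta> \<le> 1}" using e(2) unfolding inner_eq_Re_herm by force
      then have "closure D \<subseteq> {\<zeta>. z' \<bullet> \<zeta> \<le> 1}"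
        by (intro closure_minimal closed_halfspace_le)
      then have "z \<bullet> \<zeta> + (e / 2 / norm \<zeta>) * (norm \<zeta>)\<^sup>2 \<le> 1"
        using \<zeta> by (auto simp: z'_def inner_add_left power2_norm_eq_inner)
      moreover have "(e / 2 / norm \<zeta>) * (norm \<zeta>)\<^sup>2 > 0" using e(1) False by simp
      ultimately show ?thesis by linarith
    qed simp
  qed
next
  assume "\<forall>\<zeta>\<in>closure D. z \<bullet> \<zeta> < 1"
  moreover have "{z. \<forall>\<zeta>\<in>closure D. z \<bullet> \<zeta> < 1} \<subseteq> {z. \<forall>\<zeta>\<in>D. Re (herm z \<zeta>) < 1}"
    using closure_subset[of D] by (auto simp: inner_eq_Re_herm)
  ultimately show "z \<in> polar D"
    unfolding polar_def using open_polar_set interior_maximal by blast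
qed

text \<open>By alignment of arguments only the moduli matter; the polar is then complete Reinhardt
  by inspection.\<close>

lemma polar_iff_cmod:
  "z \<in> polar D \<longleftrightarrow> (\<forall>\<zeta>\<in>closure D. cmod (fst z) * cmod (fst \<zeta>) + cmod (snd z) * cmod (snd \<zeta>) < 1)"
proof
  assume z: "z \<in> polar D"
  show "\<forall>\<zeta>\<in>closure D. cmod (fst z) * cmod (fst \<zeta>) + cmod (snd z) * cmod (snd \<zeta>) < 1"
  proof
    fix \<zeta> assume "\<zeta> \<in> closure D"
    from aligned_mem_closure[OF this, of z] z
    show "cmod (fst z) * cmod (fst \<zeta>) + cmod (snd z) * cmod (snd \<zeta>) < 1"
      unfolding polar_iff by force
  qed
next
  assume "\<forall>\<zeta>\<in>closure D. cmod (fst z) * cmod (fst \<zeta>) + cmod (snd z) * cmod (snd \<zeta>) < 1"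
  then show "z \<in> polar D" unfolding polar_iff
    using inner_le_cmod[of z] by (blast intro: order.strict_trans1)
qed

lemma convex_polar: "convex (polar D)"
proof -
  have "polar D = (\<Inter>\<zeta>\<in>closure D. {z. \<zeta> \<bullet> z < 1})"
    by (rule set_eqI) (simp add: polar_iff inner_commute)
  then show ?thesis by (auto intro!: convex_INT convex_halfspace_lt)
qed

lemma bounded_polar: "bounded (polar D)"
proof -
  obtain e where e: "e > 0" "cball 0 e \<subseteq> D"
    using open_D zero_mem open_contains_cball by blast
  have "norm z \<le> 1 / e" if "z \<in> polar D" for z
  proof (cases "z = 0")
    case False
    have "(e / norm z) *\<^sub>R z \<in> closure D" using e False closure_subset[of D] by (auto simp: subset_eq)
    then have "z \<bullet> (e / norm z) *\<^sub>R z < 1" using that polar_iff by blast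
    then have "e * norm z < 1" using False by (simp add: dot_square_norm power2_eq_square)
    then show ?thesis using e(1) by (simp add: field_simps)
  qed (use e in auto)
  then show ?thesis unfolding bounded_iff by blast
qed

lemma complete_polar: "complete_reinhardt (polar D)"
  unfolding complete_reinhardt_def reinhardt_def
proof (intro conjI ballI allI impI)
  fix z w assume z: "z \<in> polar D" and "cmod (fst w) \<le> cmod (fst z) \<and> cmod (snd w) \<le> cmod (snd z)"
  then have "cmod (fst w) * cmod (fst \<zeta>) + cmod (snd w) * cmod (snd \<zeta>)
      \<le> cmod (fst z) * cmod (fst \<zeta>) + cmod (snd z) * cmod (snd \<zeta>)" for \<zeta> :: C2
    by (intro add_mono mult_right_mono) auto
  then show "w \<in> polar D" using z unfolding polar_iff_cmod by (meson order.strict_trans1)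
next
  fix z \<theta>\<^sub>1 \<theta>\<^sub>2 assume "z \<in> polar D"
  then show "(cis \<theta>\<^sub>1 * fst z, cis \<theta>\<^sub>2 * snd z) \<in> polar D"
    unfolding polar_iff_cmod by (simp add: norm_mult)
qed

lemma convex_reinhardt_polar: "convex_reinhardt (polar D)"
proof
  show "open (polar D)" by (simp add: polar_def)
  have "0 \<in> polar D" by (simp add: polar_iff)
  then show "polar D \<noteq> {}" by blast
qed (rule bounded_polar convex_polar complete_polar)+

lemma closure_polar_iff: "z \<in> closure (polar D) \<longleftrightarrow> (\<forall>\<zeta>\<in>closure D. z \<bullet> \<zeta> \<le> 1)"
proof -
  interpret P: convex_reinhardt "polar D" by (rule convex_reinhardt_polar)
  have "(\<forall>t. 0 \<le> t \<and> t < 1 \<longrightarrow> t * a < 1) \<longleftrightarrow> a \<le> 1" for a :: real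
  proof
    assume *: "\<forall>t. 0 \<le> t \<and> t < 1 \<longrightarrow> t * a < 1"
    show "a \<le> 1"
    proof (rule ccontr)
      assume "\<not> a \<le> 1"
      then show False using *[rule_format, of "1 / a"] by simp
    qed
  next
    assume "a \<le> 1"
    then show "\<forall>t. 0 \<le> t \<and> t < 1 \<longrightarrow> t * a < 1"
      using mult_left_mono by fastforce
  qed
  then show ?thesis
    unfolding P.closure_iff polar_iff inner_scaleR_left by blast
qed

lemma frontier_polar_iff:
  "z \<in> frontier (polar D) \<longleftrightarrow> (\<forall>\<zeta>\<in>closure D. z \<bullet> \<zeta> \<le> 1) \<and> (\<exists>\<zeta>\<in>closure D. z \<bullet> \<zeta> = 1)"
proof -
  interpret P: convex_reinhardt "polar D" by (rule convex_reinhardt_polar)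
  show ?thesis unfolding P.frontier_iff closure_polar_iff polar_iff
    by (auto simp: not_less intro: order.antisym) (metis order.antisym)
qed

text \<open>A point outside the closure of \<open>D\<close> is cut off by a hyperplane. Since 0 lies
  in \<open>D\<close> the level of the hyperplane is nonzero, so its normal can be rescaled to a
  point of the closed polar that violates the bipolar inequality.\<close>

lemma closure_bipolar: "closure (polar (polar D)) = closure D"
proof -
  interpret P: convex_reinhardt "polar D" by (rule convex_reinhardt_polar)
  show ?thesis
  proof (intro equalityI subsetI)
    fix \<zeta> assume "\<zeta> \<in> closure D"
    then show "\<zeta> \<in> closure (polar (polar D))"
      unfolding P.closure_polar_iff using closure_polar_iff by (simp add: inner_commute[of \<zeta>])
  next
    fix \<zeta> assume \<zeta>: "\<zeta> \<in> closure (polar (polar D))"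
    show "\<zeta> \<in> closure D"
    proof (rule ccontr)
      assume "\<zeta> \<notin> closure D"
      then obtain a b where ab: "a \<bullet> \<zeta> < b" "\<forall>x\<in>closure D. a \<bullet> x > b"
        using separating_hyperplane_closed_point[of "closure D" \<zeta>] convex_closure[OF convex_D] by auto
      then have b: "b < 0" using zero_closure by force
      have "(1 / b) *\<^sub>R a \<in> closure (polar D)"
        unfolding closure_polar_iff using ab(2) b by (auto simp: divide_simps less_imp_le)
      then have "\<zeta> \<bullet> (1 / b) *\<^sub>R a \<le> 1" using \<zeta> P.closure_polar_iff by blast
      then show False using ab(1) b by (auto simp: divide_simps inner_commute split: if_splits)
    qed
  qed
qed

text \<open>Open convex sets are the interiors of their closures, so equality of the closures
  suffices.\<close>

lemma bipolar: "polar (polar D) = D"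
proof -
  interpret P: convex_reinhardt "polar D" by (rule convex_reinhardt_polar)
  interpret PP: convex_reinhardt "polar (polar D)" by (rule P.convex_reinhardt_polar)
  have "interior (closure (polar (polar D))) = interior (closure D)"
    by (simp add: closure_bipolar)
  then show ?thesis
    by (simp add: convex_interior_closure convex_D PP.convex_D interior_open open_D PP.open_D)
qed

text \<open>\<open>T\<close> is defined by a complex equation, while convexity only yields its real
  part. Multiplying \<open>\<zeta>\<close> by a common phase shows that
  \<open>herm z \<zeta>\<close> has modulus at most 1, so real part 1 leaves no imaginary
  part.\<close>

lemma herm_eq_1:
  assumes "z \<in> closure (polar D)" "\<zeta> \<in> closure D" "z \<bullet> \<zeta> = 1"
  shows "herm z \<zeta> = 1"
proof -
  define c where "c = sgn (herm z \<zeta>)"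
  have "cmod c \<le> 1" by (simp add: c_def norm_sgn)
  then have "(c * fst \<zeta>, c * snd \<zeta>) \<in> closure D"
    by (intro closure_mono[OF assms(2)]) (auto simp: norm_mult mult_left_le_one_le)
  then have "Re (herm z (c * fst \<zeta>, c * snd \<zeta>)) \<le> 1"
    using assms(1) by (simp add: closure_polar_iff inner_eq_Re_herm)
  also have "herm z (c * fst \<zeta>, c * snd \<zeta>) = cnj c * herm z \<zeta>" by (simp add: herm_def algebra_simps)
  also have "\<dots> = of_real (cmod (herm z \<zeta>))"
    by (cases "herm z \<zeta> = 0")
      (auto simp: c_def sgn_eq complex_norm_square[symmetric] mult.commute field_simps power2_eq_square)
  finally have "cmod (herm z \<zeta>) \<le> 1" by simp
  then have "(cmod (herm z \<zeta>))\<^sup>2 \<le> 1" by (simp add: power_le_one)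
  moreover have "Re (herm z \<zeta>) = 1" using assms(3) by (simp add: inner_eq_Re_herm)
  ultimately have "(Im (herm z \<zeta>))\<^sup>2 \<le> 0" unfolding cmod_power2 by simp
  then show ?thesis using \<open>Re (herm z \<zeta>) = 1\<close> by (simp add: complex_eq_iff)
qed

text \<open>A supporting functional at \<open>\<zeta>\<close> has a nonzero value there because 0 is
  an interior point; dividing by this value places it on the boundary of the polar.\<close>

lemma exists_support:
  assumes "\<zeta> \<in> frontier D"
  shows "\<exists>z\<in>frontier (polar D). z \<bullet> \<zeta> = 1"
proof -
  have \<zeta>: "\<zeta> \<in> closure D" "\<zeta> \<notin> rel_interior D"
    using assms by (auto simp: frontier_iff rel_interior_open open_D)
  obtain a where a: "\<And>y. y \<in> closure D \<Longrightarrow> a \<bullet> \<zeta> \<le> a \<bullet> y" "\<And>y. y \<in> rel_interior D \<Longrightarrow> a \<bullet> \<zeta> < a \<bullet> y"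
    using supporting_hyperplane_relative_frontier[OF convex_D \<zeta>] by metis
  have neg: "a \<bullet> \<zeta> < 0" using a(2)[of 0] zero_mem by (simp add: rel_interior_open open_D)
  have "(1 / (a \<bullet> \<zeta>)) *\<^sub>R a \<in> frontier (polar D)"
    unfolding frontier_polar_iff using a(1) neg \<zeta> by (auto simp: divide_simps)
  then show ?thesis using neg by (intro bexI[of _ "(1 / (a \<bullet> \<zeta>)) *\<^sub>R a"]) auto
qed

lemma frontier_of_inner_eq_1:
  assumes "z \<in> closure (polar D)" "\<zeta> \<in> closure D" "z \<bullet> \<zeta> = 1"
  shows "z \<in> frontier (polar D)" "\<zeta> \<in> frontier D"
proof -
  interpret P: convex_reinhardt "polar D" by (rule convex_reinhardt_polar)
  show "z \<in> frontier (polar D)" using assms by (auto simp: frontier_polar_iff closure_polar_iff)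
  show "\<zeta> \<in> frontier D"
    using assms P.frontier_polar_iff[of \<zeta>] P.closure_polar_iff[of \<zeta>] closure_bipolar bipolar
    by (auto simp: inner_commute)
qed

end

section \<open>Smoothness and strict convexity\<close>

locale rtilde =
  fixes D :: "C2 set"
  assumes mem: "D \<in> Rtilde"

sublocale rtilde \<subseteq> convex_reinhardt D
  using mem by unfold_locales (auto simp: Rtilde_def)

context rtilde begin

text \<open>Both vectors are multiples of the gradient at \<open>\<zeta>\<close>, and the value 1 at
  \<open>\<zeta>\<close> fixes the factor.\<close>

lemma unique_normal:
  assumes "z \<in> closure (polar D)" "z' \<in> closure (polar D)" "\<zeta> \<in> closure D" "z \<bullet> \<zeta> = 1" "z' \<bullet> \<zeta> = 1"
  shows "z = z'"
proof -
  have fr: "\<zeta> \<in> frontier D" using assms frontier_of_inner_eq_1 by blast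
  then obtain U \<rho> g where d: "defining_function D U \<rho> g" and U: "\<zeta> \<in> U"
    using mem unfolding Rtilde_def C1_boundary_at_def by blast
  have "z \<bullet> x \<le> z \<bullet> \<zeta>" "z' \<bullet> x \<le> z' \<bullet> \<zeta>" if "x \<in> D" for x
    using that assms closure_subset[of D] by (auto simp: closure_polar_iff)
  then obtain l l' where l: "z = l *\<^sub>R g \<zeta>" "z' = l' *\<^sub>R g \<zeta>"
    using supporting_functional_parallel[OF d open_D U fr] by metis
  then have "l * (g \<zeta> \<bullet> \<zeta>) = 1" "l' * (g \<zeta> \<bullet> \<zeta>) = 1" using assms by auto
  then have "l = l'" by (metis mult_cancel_right zero_neq_one mult_zero_right)
  then show ?thesis using l by simp
qed

text \<open>If the midpoint were on the boundary, the defining function restricted to the chord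
  would have its maximum 0 there, so the chord would be tangent; the Hessian would then make the
  function increase beyond 0 on the chord.\<close>

lemma strictly_convex_off_axes:
  assumes xy: "x \<in> closure D" "y \<in> closure D" "x \<noteq> y" and m: "fst (midpoint x y) * snd (midpoint x y) \<noteq> 0"
  shows "midpoint x y \<in> D"
proof (rule ccontr)
  let ?m = "midpoint x y"
  assume "?m \<notin> D"
  have cl: "closed_segment x y \<subseteq> closure D"
    using xy convex_closure[OF convex_D] by (simp add: closed_segment_subset)
  then have "?m \<in> closure D" using midpoints_in_convex_hull by (auto simp: midpoint_in_closed_segment subset_eq)
  then have fr: "?m \<in> frontier D" using \<open>?m \<notin> D\<close> by (simp add: frontier_iff)
  then have "C2_strongly_convex_boundary_at D ?m" using mem m unfolding Rtilde_def by blast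
  then obtain U \<rho> g H where U: "?m \<in> U" and d: "defining_function D U \<rho> g"
    and H: "\<And>x. x \<in> U \<Longrightarrow> (g has_derivative blinfun_apply (H x)) (at x)"
    and pos: "\<And>v. v \<noteq> 0 \<Longrightarrow> g ?m \<bullet> v = 0 \<Longrightarrow> 0 < v \<bullet> blinfun_apply (H ?m) v"
    unfolding C2_strongly_convex_boundary_at_def by blast
  \<comment> \<open>Half the chord, so that parameters in [-1, 1] sweep out the segment.\<close>
  define v where "v = (1/2) *\<^sub>R (y - x)"
  have v0: "v \<noteq> 0" using xy by (simp add: v_def)
  have line: "?m + t *\<^sub>R v \<in> closure D" if "\<bar>t\<bar> \<le> 1" for t
  proof -
    have "?m + t *\<^sub>R v = (1 - (1 + t) / 2) *\<^sub>R x + ((1 + t) / 2) *\<^sub>R y"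
      by (simp add: midpoint_def v_def prod_eq_iff complex_eq_iff field_simps)
    moreover have "0 \<le> (1 + t) / 2" "(1 + t) / 2 \<le> 1" using that by auto
    ultimately have "?m + t *\<^sub>R v \<in> closed_segment x y" unfolding in_segment by blast
    then show ?thesis using cl by blast
  qed
  have oU: "open U" and dr: "\<And>x. x \<in> U \<Longrightarrow> (\<rho> has_derivative (\<lambda>h. g x \<bullet> h)) (at x)"
    using d by (auto simp: defining_function_def)
  have "((\<lambda>t. ?m + t *\<^sub>R v) \<longlongrightarrow> ?m + 0 *\<^sub>R v) (nhds 0)" by (intro tendsto_intros filterlim_ident)
  then have "eventually (\<lambda>t. ?m + t *\<^sub>R v \<in> U) (nhds 0)"
    using oU U by (simp add: topological_tendstoD)
  then obtain e where e: "e > 0" "\<And>t. \<bar>t\<bar> < e \<Longrightarrow> ?m + t *\<^sub>R v \<in> U"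
    unfolding eventually_nhds_metric by (auto simp: dist_real_def)
  define r where "r = (\<lambda>t. \<rho> (?m + t *\<^sub>R v))"
  define r' where "r' = (\<lambda>t. g (?m + t *\<^sub>R v) \<bullet> v)"
  have r: "(r has_real_derivative r' t) (at t)" if "\<bar>t\<bar> < e" for t
    unfolding r_def r'_def by (rule has_real_derivative_along_line, rule dr, rule e(2)[OF that])
  have r0: "r 0 = 0" using defining_function_zero_on_frontier[OF d open_D U fr] by (simp add: r_def)
  have rle: "r t \<le> 0" if "\<bar>t\<bar> < e" "\<bar>t\<bar> \<le> 1" for t
    unfolding r_def using defining_function_nonpos_on_closure[OF d e(2) line] that by blast
  have r'0: "r' 0 = 0"
    by (rule DERIV_local_max[of r _ 0 "min e 1"]) (use r[of 0] e(1) r0 rle in auto)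
  have "((\<lambda>t. ?m + t *\<^sub>R v) has_derivative (\<lambda>h. h *\<^sub>R v)) (at 0)"
    by (auto intro!: derivative_eq_intros)
  from diff_chain_at[OF this, of g] H[OF U]
  have "((\<lambda>t. g (?m + t *\<^sub>R v)) has_derivative (\<lambda>h. blinfun_apply (H ?m) (h *\<^sub>R v))) (at 0)"
    by (simp add: o_def)
  then have "(r' has_derivative (\<lambda>h. blinfun_apply (H ?m) (h *\<^sub>R v) \<bullet> v)) (at 0)"
    unfolding r'_def by (auto intro!: derivative_eq_intros)
  then have "(r' has_real_derivative v \<bullet> blinfun_apply (H ?m) v) (at 0)"
    unfolding has_field_derivative_def
    by (simp add: blinfun.scaleR_right inner_commute mult_commute_abs)
  moreover have "0 < v \<bullet> blinfun_apply (H ?m) v" using pos[OF v0] r'0 by (simp add: r'_def)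
  ultimately obtain k where k: "k > 0" "\<And>h. 0 < h \<Longrightarrow> h < k \<Longrightarrow> 0 < r' h"
    using DERIV_pos_inc_right[of r' _ 0] r'0 by fastforce
  \<comment> \<open>Small enough to stay in \<open>U\<close>, on the chord, and in the range where
    \<open>r'\<close> is positive.\<close>
  define t where "t = min (min e 1) k / 2"
  have t: "0 < t" "t < e" "t \<le> 1" "t < k" using e(1) k(1) by (auto simp: t_def)
  have "\<exists>z>0. z < t \<and> r t - r 0 = (t - 0) * r' z"
    by (rule MVT2[OF t(1)]) (use t r in auto)
  then obtain z where "z > 0" "z < t" "r t = t * r' z" using r0 by auto
  then show False using rle[of t] k(2)[of z] t by (auto simp: mult_le_0_iff)
qed

text \<open>Only midpoints on an axis remain. Maximality of the modulus of the other coordinate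
  forces the end points to agree in it; half of the chord then has its midpoint off the axes, hence
  in \<open>D\<close>, and completeness brings the original midpoint into \<open>D\<close>.\<close>

lemma strictly_convex:
  assumes xy: "x \<in> closure D" "y \<in> closure D" "x \<noteq> y"
  shows "midpoint x y \<in> D"
proof (rule ccontr)
  let ?m = "midpoint x y"
  assume nm: "?m \<notin> D"
  have ax: "fst ?m * snd ?m = 0" using strictly_convex_off_axes[OF xy] nm by blast
  \<comment> \<open>Parallelogram law: no nontrivial chord of a disc has a midpoint of maximal
    modulus.\<close>
  have disc: "a = b" if "cmod a \<le> cmod ((a + b) / 2)" "cmod b \<le> cmod ((a + b) / 2)" for a b :: complex
  proof -
    have "(cmod (a - b))\<^sup>2 + (cmod (a + b))\<^sup>2 = 2 * (cmod a)\<^sup>2 + 2 * (cmod b)\<^sup>2"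
      by (simp add: cmod_power2) (simp add: power2_eq_square algebra_simps)
    moreover from that have "(cmod a)\<^sup>2 \<le> (cmod ((a + b) / 2))\<^sup>2" "(cmod b)\<^sup>2 \<le> (cmod ((a + b) / 2))\<^sup>2"
      by (auto intro: power_mono)
    then have "4 * (cmod a)\<^sup>2 \<le> (cmod (a + b))\<^sup>2" "4 * (cmod b)\<^sup>2 \<le> (cmod (a + b))\<^sup>2"
      by (simp_all add: norm_divide power_divide)
    ultimately have "(cmod (a - b))\<^sup>2 \<le> 0" by linarith
    then show ?thesis by (simp add: power2_less_eq_zero_iff)
  qed
  have m: "?m = ((fst x + fst y) / 2, (snd x + snd y) / 2)"
    by (simp add: midpoint_def prod_eq_iff scaleR_conv_of_real)
  have half: "midpoint ?m x \<notin> D"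
    if "fst ?m = 0 \<and> snd x = snd ?m \<or> snd ?m = 0 \<and> fst x = fst ?m"
  proof
    have avg: "midpoint ?m x = ((fst ?m + fst x) / 2, (snd ?m + snd x) / 2)"
      unfolding midpoint_def[of ?m x] by (simp add: prod_eq_iff scaleR_conv_of_real)
    assume "midpoint ?m x \<in> D"
    then have "?m \<in> D" by (rule D_mono; unfold avg) (use that in auto)
    then show False using nm by simp
  qed
  have clm: "?m \<in> closure D"
    using xy convex_closure[OF convex_D] by (meson closed_segment_subset midpoint_in_closed_segment subsetD)
  have nz: "?m \<noteq> 0" using nm zero_mem by metis
  show False
  proof (cases "fst ?m = 0")
    case True
    \<comment> \<open>A point with larger second modulus, scaled down to that of the midpoint, would
      lie in \<open>D\<close> and dominate the midpoint.\<close>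
    have le: "cmod (snd u) \<le> cmod (snd ?m)" if u: "u \<in> closure D" for u
    proof (rule ccontr)
      assume c: "\<not> ?thesis"
      then have c': "cmod (snd ?m) / cmod (snd u) < 1" by (auto simp: divide_simps)
      have "(cmod (snd ?m) / cmod (snd u)) *\<^sub>R u \<in> D"
        using u c' unfolding closure_iff by simp
      then have "?m \<in> D" by (rule D_mono) (use True c in \<open>auto simp: divide_simps\<close>)
      then show False using nm by simp
    qed
    then have "snd x = snd y" using disc[of "snd x" "snd y"] xy m by simp
    then have s: "snd x = snd ?m" using m by simp
    have f: "fst x \<noteq> 0" using True m xy(3) \<open>snd x = snd y\<close> by (auto simp: prod_eq_iff)
    have "midpoint ?m x \<in> D"
      by (rule strictly_convex_off_axes[OF clm xy(1)])
        (use True f s nz in \<open>auto simp: midpoint_def prod_eq_iff\<close>)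
    then show False using half True s by blast
  next
    case False
    then have True: "snd ?m = 0" using ax by simp
    have le: "cmod (fst u) \<le> cmod (fst ?m)" if u: "u \<in> closure D" for u
    proof (rule ccontr)
      assume c: "\<not> ?thesis"
      then have c': "cmod (fst ?m) / cmod (fst u) < 1" by (auto simp: divide_simps)
      have "(cmod (fst ?m) / cmod (fst u)) *\<^sub>R u \<in> D"
        using u c' unfolding closure_iff by simp
      then have "?m \<in> D" by (rule D_mono) (use True c in \<open>auto simp: divide_simps\<close>)
      then show False using nm by simp
    qed
    then have "fst x = fst y" using disc[of "fst x" "fst y"] xy m by simp
    then have s: "fst x = fst ?m" using m by simp
    have f: "snd x \<noteq> 0" using True m xy(3) \<open>fst x = fst y\<close> by (auto simp: prod_eq_iff)
    have "midpoint ?m x \<in> D"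
      by (rule strictly_convex_off_axes[OF clm xy(1)])
        (use True f s nz in \<open>auto simp: midpoint_def prod_eq_iff\<close>)
    then show False using half True s by blast
  qed
qed

text \<open>The midpoint of two contact points is again a contact point, but strict convexity puts
  it inside \<open>D\<close>.\<close>

lemma unique_support:
  assumes z: "z \<in> closure (polar D)" and "\<zeta> \<in> closure D" "\<zeta>' \<in> closure D" "z \<bullet> \<zeta> = 1" "z \<bullet> \<zeta>' = 1"
  shows "\<zeta> = \<zeta>'"
proof (rule ccontr)
  assume "\<zeta> \<noteq> \<zeta>'"
  then have mD: "midpoint \<zeta> \<zeta>' \<in> D" using strictly_convex assms by blast
  then have "midpoint \<zeta> \<zeta>' \<in> closure D" using closure_subset by blast
  moreover have "z \<bullet> midpoint \<zeta> \<zeta>' = 1" using assms by (simp add: midpoint_def inner_add_right)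
  ultimately have "midpoint \<zeta> \<zeta>' \<in> frontier D" using z frontier_of_inner_eq_1 by blast
  then show False using mD by (simp add: frontier_iff)
qed

end

context rtilde begin

subsection \<open>The duality map\<close>

text \<open>Reduces the evaluation of \<open>T\<close> to one real equation and membership in two
  closures; the values of \<open>T\<close> found below come from it.\<close>

lemma T_eqI:
  assumes "z \<in> closure (polar D)" "\<zeta> \<in> closure D" "z \<bullet> \<zeta> = 1"
  shows "T D \<zeta> = z"
  unfolding T_def
proof (rule the_equality)
  show "z \<in> frontier (polar D) \<and> herm z \<zeta> = 1"
    using frontier_of_inner_eq_1(1)[OF assms] herm_eq_1[OF assms] by blast
next
  fix w assume w: "w \<in> frontier (polar D) \<and> herm w \<zeta> = 1"
  then have "w \<in> closure (polar D)" "w \<bullet> \<zeta> = 1"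
    by (simp_all add: frontier_def inner_eq_Re_herm)
  then show "w = z" using unique_normal assms by blast
qed

lemma T_frontier:
  assumes "\<zeta> \<in> frontier D"
  shows "T D \<zeta> \<in> frontier (polar D)" "T D \<zeta> \<bullet> \<zeta> = 1" "herm (T D \<zeta>) \<zeta> = 1"
proof -
  obtain z where z: "z \<in> frontier (polar D)" "z \<bullet> \<zeta> = 1" using exists_support[OF assms] by blast
  have c: "z \<in> closure (polar D)" "\<zeta> \<in> closure D" using z(1) assms by (simp_all add: frontier_def)
  have "T D \<zeta> = z" by (rule T_eqI[OF c z(2)])
  then show "T D \<zeta> \<in> frontier (polar D)" "T D \<zeta> \<bullet> \<zeta> = 1" "herm (T D \<zeta>) \<zeta> = 1"
    using z herm_eq_1[OF c z(2)] by simp_all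
qed

lemma T_inner_le:
  assumes "\<zeta> \<in> frontier D" "\<eta> \<in> closure D"
  shows "T D \<zeta> \<bullet> \<eta> \<le> 1"
  using T_frontier(1)[OF assms(1)] assms(2) unfolding frontier_polar_iff by blast

lemma T_in_closure: "\<zeta> \<in> frontier D \<Longrightarrow> T D \<zeta> \<in> closure (polar D)"
  using T_frontier(1) by (simp add: frontier_def)

text \<open>The graph is cut out of a compact product by the closed condition
  \<open>snd p \<bullet> fst p = 1\<close>, and a map into a compact set with closed graph is
  continuous.\<close>

lemma continuous_on_T: "continuous_on (frontier D) (T D)"
proof (rule continuous_from_closed_graph)
  interpret P: convex_reinhardt "polar D" by (rule convex_reinhardt_polar)
  show "compact (frontier (polar D))" by (rule P.compact_frontier)
  show "T D \<in> frontier D \<rightarrow> frontier (polar D)" using T_frontier by blast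
  have "(\<lambda>x. (x, T D x)) ` frontier D = frontier D \<times> frontier (polar D) \<inter> {p. snd p \<bullet> fst p = 1}"
  proof (intro equalityI subsetI)
    fix p assume "p \<in> (\<lambda>x. (x, T D x)) ` frontier D"
    then show "p \<in> frontier D \<times> frontier (polar D) \<inter> {p. snd p \<bullet> fst p = 1}"
      using T_frontier by fastforce
  next
    fix p assume p: "p \<in> frontier D \<times> frontier (polar D) \<inter> {p. snd p \<bullet> fst p = 1}"
    then have "fst p \<in> frontier D" "snd p \<in> frontier (polar D)" "snd p \<bullet> fst p = 1" by (auto simp: mem_Times_iff)
    moreover from this have "snd p = T D (fst p)"
      by (intro T_eqI[symmetric]) (simp_all add: frontier_def)
    ultimately show "p \<in> (\<lambda>x. (x, T D x)) ` frontier D"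
      unfolding image_iff by (intro bexI[of _ "fst p"]) (simp_all add: prod_eq_iff)
  qed
  moreover have "closed (frontier D \<times> frontier (polar D) \<inter> {p. snd p \<bullet> fst p = 1})"
    by (intro closed_Int closed_Times frontier_closed closed_Collect_eq continuous_intros)
  ultimately show "closed ((\<lambda>x. (x, T D x)) ` frontier D)" by simp
qed

lemma T_rotate:
  assumes \<zeta>: "\<zeta> \<in> frontier D" and c: "cmod c = 1" "cmod d = 1"
  shows "T D (c * fst \<zeta>, d * snd \<zeta>) = (c * fst (T D \<zeta>), d * snd (T D \<zeta>))"
proof (rule T_eqI)
  interpret P: convex_reinhardt "polar D" by (rule convex_reinhardt_polar)
  show "(c * fst (T D \<zeta>), d * snd (T D \<zeta>)) \<in> closure (polar D)"
    by (rule P.closure_mono[OF T_in_closure[OF \<zeta>]]) (simp_all add: norm_mult c)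
  show "(c * fst \<zeta>, d * snd \<zeta>) \<in> closure D"
    by (rule closure_mono[of \<zeta>]) (use \<zeta> in \<open>simp_all add: norm_mult c frontier_def\<close>)
  have "herm (c * fst (T D \<zeta>), d * snd (T D \<zeta>)) (c * fst \<zeta>, d * snd \<zeta>) =
      (c * cnj c) * (fst (T D \<zeta>) * cnj (fst \<zeta>)) + (d * cnj d) * (snd (T D \<zeta>) * cnj (snd \<zeta>))"
    by (simp add: herm_def algebra_simps)
  also have "\<dots> = herm (T D \<zeta>) \<zeta>"
    using c by (simp add: complex_norm_square[symmetric] herm_def)
  finally show "(c * fst (T D \<zeta>), d * snd (T D \<zeta>)) \<bullet> (c * fst \<zeta>, d * snd \<zeta>) = 1"
    using T_frontier(3)[OF \<zeta>] by (simp add: inner_eq_Re_herm)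
qed

text \<open>One inequality is Cauchy-Schwarz in each coordinate. For the other, a rotated copy of
  \<open>\<zeta>\<close> in the closure attains the products of moduli, and
  \<open>T D \<zeta>\<close> is at most 1 on it.\<close>

lemma T_cmod:
  assumes \<zeta>: "\<zeta> \<in> frontier D"
  shows "r1 \<zeta> * r1 (T D \<zeta>) + r2 \<zeta> * r2 (T D \<zeta>) = 1"
proof (rule antisym)
  show "1 \<le> r1 \<zeta> * r1 (T D \<zeta>) + r2 \<zeta> * r2 (T D \<zeta>)"
    using inner_le_cmod[of "T D \<zeta>" \<zeta>] T_frontier(2)[OF \<zeta>] by (simp add: r1_def r2_def mult.commute)
  have "\<zeta> \<in> closure D" using \<zeta> by (simp add: frontier_def)
  then obtain \<eta> where "\<eta> \<in> closure D"
    "T D \<zeta> \<bullet> \<eta> = cmod (fst (T D \<zeta>)) * cmod (fst \<zeta>) + cmod (snd (T D \<zeta>)) * cmod (snd \<zeta>)"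
    using aligned_mem_closure by blast
  then show "r1 \<zeta> * r1 (T D \<zeta>) + r2 \<zeta> * r2 (T D \<zeta>) \<le> 1"
    using T_inner_le[OF \<zeta>, of \<eta>] by (simp add: r1_def r2_def mult.commute)
qed

text \<open>Equality in \<open>T_cmod\<close> forces equality in Cauchy-Schwarz for each coordinate,
  so the arguments agree. As \<open>sgn 0 = 0\<close>, the formula also claims that vanishing
  coordinates are preserved, which needs a separate symmetry argument.\<close>

lemma T_aligned:
  assumes \<zeta>: "\<zeta> \<in> frontier D"
  shows "fst (T D \<zeta>) = complex_of_real (r1 (T D \<zeta>)) * sgn (fst \<zeta>)"
    and "snd (T D \<zeta>) = complex_of_real (r2 (T D \<zeta>)) * sgn (snd \<zeta>)"
proof -
  have *: "u = complex_of_real (cmod u) * sgn v" if "u \<bullet> v = cmod u * cmod v" "v = 0 \<Longrightarrow> u = 0" for u v :: complex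
  proof (cases "v = 0")
    case False
    have "norm u *\<^sub>R v = norm v *\<^sub>R u" using that norm_cauchy_schwarz_eq by blast
    then show ?thesis using False by (simp add: sgn_div_norm scaleR_conv_of_real field_simps)
  qed (use that in simp)
  have sum: "fst (T D \<zeta>) \<bullet> fst \<zeta> + snd (T D \<zeta>) \<bullet> snd \<zeta> =
      cmod (fst (T D \<zeta>)) * cmod (fst \<zeta>) + cmod (snd (T D \<zeta>)) * cmod (snd \<zeta>)"
    using T_frontier(2)[OF \<zeta>] T_cmod[OF \<zeta>] by (simp add: inner_prod_def r1_def r2_def mult.commute)
  have le: "fst (T D \<zeta>) \<bullet> fst \<zeta> \<le> cmod (fst (T D \<zeta>)) * cmod (fst \<zeta>)"
    "snd (T D \<zeta>) \<bullet> snd \<zeta> \<le> cmod (snd (T D \<zeta>)) * cmod (snd \<zeta>)"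
    by (rule norm_cauchy_schwarz)+
  \<comment> \<open>Changing the sign of a vanishing coordinate fixes \<open>\<zeta>\<close>, hence
    also \<open>T D \<zeta>\<close>.\<close>
  have z1: "fst (T D \<zeta>) = 0" if "fst \<zeta> = 0"
  proof -
    have "(- 1 * fst \<zeta>, 1 * snd \<zeta>) = \<zeta>" using that by (simp add: prod_eq_iff)
    then have "T D \<zeta> = (- 1 * fst (T D \<zeta>), 1 * snd (T D \<zeta>))" using T_rotate[OF \<zeta>, of "-1" 1] by simp
    then have "fst (T D \<zeta>) = - fst (T D \<zeta>)" by (metis fst_conv mult_minus1)
    then show ?thesis by simp
  qed
  have z2: "snd (T D \<zeta>) = 0" if "snd \<zeta> = 0"
  proof -
    have "(1 * fst \<zeta>, - 1 * snd \<zeta>) = \<zeta>" using that by (simp add: prod_eq_iff)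
    then have "T D \<zeta> = (1 * fst (T D \<zeta>), - 1 * snd (T D \<zeta>))" using T_rotate[OF \<zeta>, of 1 "-1"] by simp
    then have "snd (T D \<zeta>) = - snd (T D \<zeta>)" by (metis snd_conv mult_minus1)
    then show ?thesis by simp
  qed
  show "fst (T D \<zeta>) = complex_of_real (r1 (T D \<zeta>)) * sgn (fst \<zeta>)"
    unfolding r1_def using sum le z1 by (intro *) auto
  show "snd (T D \<zeta>) = complex_of_real (r2 (T D \<zeta>)) * sgn (snd \<zeta>)"
    unfolding r2_def using sum le z2 by (intro *) auto
qed

subsection \<open>The profile function\<close>

lemma cmod_fst_le_b1: "z \<in> closure D \<Longrightarrow> cmod (fst z) \<le> b1 D"
proof -
  obtain B where B: "\<And>z. z \<in> D \<Longrightarrow> norm z \<le> B" using bounded_D unfolding bounded_iff by blast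
  have "bdd_above {cmod (fst z) | z. z \<in> D}"
    unfolding bdd_above_def
  proof (intro exI ballI)
    fix x assume "x \<in> {cmod (fst z) | z. z \<in> D}"
    then obtain z where "z \<in> D" "x = cmod (fst z)" by blast
    then show "x \<le> B" using B[of z] norm_fst_le[of "fst z" "snd z"] by simp
  qed
  then have "cmod (fst z) \<le> b1 D" if "z \<in> D" for z
    unfolding b1_def using that by (intro cSup_upper) blast+
  then have "D \<subseteq> {z. cmod (fst z) \<le> b1 D}" by blast
  moreover have "closed {z :: C2. cmod (fst z) \<le> b1 D}"
    by (intro closed_Collect_le continuous_intros)
  ultimately show "z \<in> closure D \<Longrightarrow> cmod (fst z) \<le> b1 D"
    using closure_minimal by blast
qed

lemma b1_pos: "0 < b1 D"
proof -
  obtain e where e: "e > 0" "ball 0 e \<subseteq> D" using open_D zero_mem open_contains_ball by blast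
  have "(complex_of_real (e / 2), 0) \<in> ball (0 :: C2) e" using e(1) by (simp add: dist_norm norm_Pair)
  then have "(complex_of_real (e / 2), 0) \<in> closure D" using e(2) closure_subset by blast
  from cmod_fst_le_b1[OF this] show ?thesis using e(1) by simp
qed

lemma b1_closure: "(complex_of_real (b1 D), 0) \<in> closure D"
  unfolding closure_iff
proof (intro allI impI)
  fix t :: real assume t: "0 \<le> t \<and> t < 1"
  have "t * b1 D < Sup {cmod (fst z) | z. z \<in> D}" using t b1_pos unfolding b1_def[symmetric] by simp
  then obtain x where "x \<in> {cmod (fst z) | z. z \<in> D}" "t * b1 D < x"
    using less_cSupE[of "t * b1 D" "{cmod (fst z) | z. z \<in> D}"] nonempty by blast
  then obtain z where z: "z \<in> D" "t * b1 D < cmod (fst z)" by blast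
  show "t *\<^sub>R (complex_of_real (b1 D), 0) \<in> D"
    by (rule D_mono[OF z(1)]) (use z t b1_pos in auto)
qed

lemma phi_closure:
  assumes "\<bar>t\<bar> \<le> b1 D"
  shows "(complex_of_real t, complex_of_real (phi D t)) \<in> closure D"
    and "(complex_of_real t, complex_of_real r) \<in> closure D \<Longrightarrow> r \<le> phi D t"
    and "0 \<le> phi D t"
proof -
  let ?A = "{r. (complex_of_real t, complex_of_real r) \<in> closure D}"
  have "closed ?A"
    by (rule closed_vimage[unfolded vimage_def, of "closure D" "\<lambda>r. (complex_of_real t, complex_of_real r)"])
      (auto intro!: continuous_intros)
  moreover have ne: "0 \<in> ?A"
    using closure_mono[OF b1_closure, of "(complex_of_real t, 0)"] assms by simp
  moreover have bdd: "bdd_above ?A"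
  proof -
    have "bounded (closure D)" using bounded_D by (rule bounded_closure)
    then obtain B where B: "\<And>z. z \<in> closure D \<Longrightarrow> norm z \<le> B" unfolding bounded_iff by blast
    have "r \<le> B" if "r \<in> ?A" for r
      using B[of "(complex_of_real t, complex_of_real r)"] that
        norm_snd_le[of "complex_of_real r" "complex_of_real t"] by simp
    then show ?thesis unfolding bdd_above_def by blast
  qed
  ultimately have "Sup ?A \<in> ?A" by (intro closed_contains_Sup) blast+
  then show "(complex_of_real t, complex_of_real (phi D t)) \<in> closure D" by (simp add: phi_def)
  show "r \<le> phi D t" if "(complex_of_real t, complex_of_real r) \<in> closure D" for r
    unfolding phi_def using that bdd by (intro cSup_upper) auto
  from this[of 0] ne show "0 \<le> phi D t" by simp
qed

lemma phi_abs: "phi D \<bar>t\<bar> = phi D t"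
proof -
  have "(complex_of_real \<bar>t\<bar>, complex_of_real r) \<in> closure D \<longleftrightarrow> (complex_of_real t, complex_of_real r) \<in> closure D" for r
    using closure_mono[of "(complex_of_real \<bar>t\<bar>, complex_of_real r)" "(complex_of_real t, complex_of_real r)"]
      closure_mono[of "(complex_of_real t, complex_of_real r)" "(complex_of_real \<bar>t\<bar>, complex_of_real r)"]
    by auto
  then show ?thesis by (simp add: phi_def)
qed

lemma closure_iff_phi: "z \<in> closure D \<longleftrightarrow> cmod (fst z) \<le> b1 D \<and> cmod (snd z) \<le> phi D (cmod (fst z))"
proof
  assume z: "z \<in> closure D"
  have "(complex_of_real (cmod (fst z)), complex_of_real (cmod (snd z))) \<in> closure D"
    by (rule closure_mono[OF z]) auto
  then show "cmod (fst z) \<le> b1 D \<and> cmod (snd z) \<le> phi D (cmod (fst z))"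
    using phi_closure(2)[of "cmod (fst z)"] cmod_fst_le_b1[OF z] by simp
next
  assume z: "cmod (fst z) \<le> b1 D \<and> cmod (snd z) \<le> phi D (cmod (fst z))"
  then have "(complex_of_real (cmod (fst z)), complex_of_real (phi D (cmod (fst z)))) \<in> closure D"
    by (intro phi_closure(1)) simp
  then show "z \<in> closure D" by (rule closure_mono) (use z in auto)
qed

text \<open>Below the height \<open>phi D\<close> a point is the midpoint of two points of the
  closure on a vertical line, so strict convexity puts it in \<open>D\<close>; at that height an
  outward step leaves the closure.\<close>

lemma frontier_iff_phi: "z \<in> frontier D \<longleftrightarrow> cmod (fst z) \<le> b1 D \<and> cmod (snd z) = phi D (cmod (fst z))"
proof
  assume z: "z \<in> frontier D"
  then have zc: "z \<in> closure D" and zn: "z \<notin> D" by (simp_all add: frontier_iff)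
  have "\<not> cmod (snd z) < phi D (cmod (fst z))"
  proof
    assume lt: "cmod (snd z) < phi D (cmod (fst z))"
    define \<delta> where "\<delta> = phi D (cmod (fst z)) - cmod (snd z)"
    have \<delta>: "\<delta> > 0" "cmod (snd z) + \<delta> = phi D (cmod (fst z))" using lt by (simp_all add: \<delta>_def)
    have le: "cmod (snd z + \<delta>) \<le> phi D (cmod (fst z))" "cmod (snd z - \<delta>) \<le> phi D (cmod (fst z))"
      using norm_triangle_ineq[of "snd z" "complex_of_real \<delta>"] norm_triangle_ineq4[of "snd z" "complex_of_real \<delta>"] \<delta>
      by simp_all
    have "midpoint (fst z, snd z + of_real \<delta>) (fst z, snd z - of_real \<delta>) \<in> D"
      by (rule strictly_convex) (use zc le \<delta> in \<open>auto simp: closure_iff_phi\<close>)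
    moreover have "midpoint (fst z, snd z + of_real \<delta>) (fst z, snd z - of_real \<delta>) = z"
      by (simp add: midpoint_def prod_eq_iff scaleR_conv_of_real)
    ultimately show False using zn by simp
  qed
  then show "cmod (fst z) \<le> b1 D \<and> cmod (snd z) = phi D (cmod (fst z))"
    using zc unfolding closure_iff_phi by simp
next
  assume z: "cmod (fst z) \<le> b1 D \<and> cmod (snd z) = phi D (cmod (fst z))"
  then have zc: "z \<in> closure D" by (simp add: closure_iff_phi)
  have "z \<notin> D"
  proof
    assume "z \<in> D"
    then obtain e where e: "e > 0" "ball z e \<subseteq> D" using open_D open_contains_ball by blast
    \<comment> \<open>A unit vector along \<open>snd z\<close>, with default 1 so that an outward
      direction exists when \<open>snd z = 0\<close>.\<close>
    define u where "u = (if snd z = 0 then 1 else sgn (snd z))"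
    have u: "cmod u = 1" "snd z = of_real (cmod (snd z)) * u"
      by (auto simp: u_def norm_sgn) (simp add: sgn_div_norm scaleR_conv_of_real)
    define w where "w = (fst z, of_real (cmod (snd z) + e / 2) * u)"
    have "w - z = (0, of_real (e / 2) * u)" using u(2) by (simp add: w_def prod_eq_iff algebra_simps)
    then have "norm (w - z) < e" using e(1) u(1) by (simp add: norm_Pair norm_mult)
    then have "w \<in> ball z e" by (simp add: dist_norm norm_minus_commute)
    then have "w \<in> closure D" using e(2) closure_subset[of D] by blast
    then have "cmod (snd w) \<le> phi D (cmod (fst z))" using closure_iff_phi[of w] by (simp add: w_def)
    moreover have "cmod (snd w) = cmod (snd z) + e / 2"
      using u(1) e(1) norm_ge_zero[of "snd z"] unfolding w_def snd_conv norm_mult norm_of_real by simp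
    ultimately show False using z e(1) by simp
  qed
  then show "z \<in> frontier D" using zc by (simp add: frontier_iff)
qed

definition curve :: "real \<Rightarrow> C2" where
  "curve t = (complex_of_real t, complex_of_real (phi D t))"

lemma fst_curve [simp]: "fst (curve t) = complex_of_real t"
  and snd_curve [simp]: "snd (curve t) = complex_of_real (phi D t)"
  by (simp_all add: curve_def)

lemma curve_frontier: "\<bar>t\<bar> \<le> b1 D \<Longrightarrow> curve t \<in> frontier D"
  by (simp add: frontier_iff_phi phi_abs phi_closure(3))

lemma curve_closure: "\<bar>t\<bar> \<le> b1 D \<Longrightarrow> curve t \<in> closure D"
  using curve_frontier by (simp add: frontier_def)

lemma phi_b1: "phi D (b1 D) = 0"
proof -
  have "(complex_of_real (b1 D), 0 :: complex) \<notin> D"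
  proof
    assume "(complex_of_real (b1 D), 0) \<in> D"
    then obtain e where e: "e > 0" "ball (complex_of_real (b1 D), 0) e \<subseteq> D" using open_D open_contains_ball by blast
    have "norm ((complex_of_real (b1 D), 0 :: complex) - (complex_of_real (b1 D + e / 2), 0 :: complex)) < e"
      using e(1) by (simp add: norm_Pair)
    then have "(complex_of_real (b1 D + e / 2), 0 :: complex) \<in> ball (complex_of_real (b1 D), 0) e"
      by (simp only: mem_ball dist_norm)
    then have "(complex_of_real (b1 D + e / 2), 0 :: complex) \<in> closure D" using e(2) closure_subset by blast
    from cmod_fst_le_b1[OF this] have "\<bar>b1 D + e / 2\<bar> \<le> b1 D" unfolding fst_conv norm_of_real .
    then show False using e(1) by linarith
  qed
  then have "(complex_of_real (b1 D), 0) \<in> frontier D" using b1_closure by (simp add: frontier_iff)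
  then show ?thesis using b1_pos by (simp add: frontier_iff_phi)
qed

lemma phi_pos: assumes "\<bar>t\<bar> < b1 D" shows "0 < phi D t"
proof (rule ccontr)
  assume "\<not> 0 < phi D t"
  then have "phi D t = 0" using phi_closure(3)[of t] assms by simp
  then have "(complex_of_real t, 0) \<in> frontier D"
    using curve_frontier[of t] assms by (simp add: curve_def)
  moreover have "(\<bar>t\<bar> / b1 D) *\<^sub>R (complex_of_real (b1 D), 0 :: complex) \<in> D"
    using b1_closure assms b1_pos by (simp only: closure_iff) simp
  then have "(complex_of_real t, 0) \<in> D"
    by (rule D_mono) (use b1_pos in auto)
  ultimately show False by (simp add: frontier_iff)
qed

text \<open>Closed graph again: over nonnegative second coordinates the graph is a slice of the
  frontier, and \<open>phi D\<close> is bounded by its value at 0.\<close>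

lemma continuous_on_phi: "continuous_on {- b1 D..b1 D} (phi D)"
proof (rule continuous_from_closed_graph)
  show "compact {0..phi D 0}" by simp
  have le: "phi D t \<le> phi D 0" if "\<bar>t\<bar> \<le> b1 D" for t
    by (rule phi_closure(2)) (use closure_mono[OF curve_closure[OF that], of "(0, complex_of_real (phi D t))"] b1_pos in auto)
  then show "phi D \<in> {- b1 D..b1 D} \<rightarrow> {0..phi D 0}" using phi_closure(3) by auto
  have "(\<lambda>x. (x, phi D x)) ` {- b1 D..b1 D} =
      (\<lambda>p. (complex_of_real (fst p), complex_of_real (snd p))) -` frontier D \<inter> {p. 0 \<le> snd p} \<inter> {p. \<bar>fst p\<bar> \<le> b1 D}"
  proof (intro equalityI subsetI)
    fix p assume "p \<in> (\<lambda>x. (x, phi D x)) ` {- b1 D..b1 D}"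
    then show "p \<in> (\<lambda>p. (complex_of_real (fst p), complex_of_real (snd p))) -` frontier D \<inter> {p. 0 \<le> snd p} \<inter> {p. \<bar>fst p\<bar> \<le> b1 D}"
      using curve_frontier phi_closure(3) by (auto simp: curve_def abs_le_iff)
  next
    fix p assume "p \<in> (\<lambda>p. (complex_of_real (fst p), complex_of_real (snd p))) -` frontier D \<inter> {p. 0 \<le> snd p} \<inter> {p. \<bar>fst p\<bar> \<le> b1 D}"
    then have "snd p = phi D (fst p)" "fst p \<in> {- b1 D..b1 D}"
      by (auto simp: frontier_iff_phi phi_abs)
    then show "p \<in> (\<lambda>x. (x, phi D x)) ` {- b1 D..b1 D}"
      unfolding image_iff by (intro bexI[of _ "fst p"]) (simp_all add: prod_eq_iff)
  qed
  moreover have "closed ((\<lambda>p :: real \<times> real. (complex_of_real (fst p), complex_of_real (snd p))) -` frontier D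
      \<inter> {p. 0 \<le> snd p} \<inter> {p. \<bar>fst p\<bar> \<le> b1 D})"
    by (intro closed_Int closed_Collect_le continuous_intros closed_vimage frontier_closed)
  ultimately show "closed ((\<lambda>x. (x, phi D x)) ` {- b1 D..b1 D})" by simp
qed

section \<open>Support lines of the profile curve and the derivatives of
  \<open>phi D\<close>\<close>

definition F1 :: "real \<Rightarrow> real" where "F1 t = Re (fst (T D (curve t)))"
definition F2 :: "real \<Rightarrow> real" where "F2 t = Re (snd (T D (curve t)))"

lemma T_curve:
  assumes "\<bar>t\<bar> \<le> b1 D"
  shows "T D (curve t) = (complex_of_real (F1 t), complex_of_real (F2 t))"
proof -
  have sg: "sgn (complex_of_real x) = complex_of_real (sgn x)" for x
    by (simp add: sgn_div_norm sgn_real_def scaleR_conv_of_real)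
  note a = T_aligned[OF curve_frontier[OF assms]]
  have "fst (T D (curve t)) = complex_of_real (r1 (T D (curve t)) * sgn t)"
    using a(1) by (simp only: fst_curve sg of_real_mult)
  moreover have "snd (T D (curve t)) = complex_of_real (r2 (T D (curve t)) * sgn (phi D t))"
    using a(2) by (simp only: snd_curve sg of_real_mult)
  ultimately show ?thesis unfolding F1_def F2_def by (metis Re_complex_of_real prod.collapse)
qed

text \<open>In the real plane of moduli this is the support line of the profile over
  \<open>t\<close>, normalised to level 1. Its slope \<open>- F1 t / F2 t\<close> will turn out to
  be the derivative of \<open>phi D\<close>.\<close>

lemma F_supports:
  assumes "\<bar>t\<bar> \<le> b1 D"
  shows "F1 t * t + F2 t * phi D t = 1"
    and "\<bar>u\<bar> \<le> b1 D \<Longrightarrow> F1 t * u + F2 t * phi D u \<le> 1"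
  using T_frontier(2)[OF curve_frontier[OF assms]] T_inner_le[OF curve_frontier[OF assms] curve_closure[of u]]
  by (simp_all add: T_curve[OF assms] inner_prod_def inner_complex_def)

text \<open>With \<open>F2 t = 0\<close> the support line would be vertical through an interior
  abscissa, and one of the end points over \<open>b1 D\<close> and \<open>- b1 D\<close> would lie
  beyond it.\<close>

lemma F2_pos:
  assumes "\<bar>t\<bar> < b1 D" shows "0 < F2 t"
proof -
  have t: "\<bar>t\<bar> \<le> b1 D" using assms by simp
  have p: "0 < phi D t" by (rule phi_pos[OF assms])
  have "snd (T D (curve t)) = complex_of_real (r2 (T D (curve t)) * sgn (phi D t))"
    using T_aligned(2)[OF curve_frontier[OF t]] p by (simp add: sgn_div_norm scaleR_conv_of_real)
  then have "F2 t = r2 (T D (curve t)) * sgn (phi D t)" unfolding F2_def by (simp only: Re_complex_of_real)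
  then have "0 \<le> F2 t" using p by (simp add: r2_def)
  moreover have "F2 t \<noteq> 0"
  proof
    assume z: "F2 t = 0"
    have "F1 t * t = 1" "F1 t * b1 D \<le> 1" "F1 t * (- b1 D) \<le> 1"
      using F_supports(1)[OF t] F_supports(2)[OF t, of "b1 D"] F_supports(2)[OF t, of "- b1 D"] z b1_pos by auto
    then have "\<bar>F1 t\<bar> * b1 D \<le> 1" by (auto simp: abs_if)
    moreover have "1 = \<bar>F1 t\<bar> * \<bar>t\<bar>" using \<open>F1 t * t = 1\<close> by (simp add: abs_mult[symmetric])
    moreover have "\<bar>F1 t\<bar> > 0" using \<open>F1 t * t = 1\<close> by auto
    ultimately show False using assms by (metis mult_less_cancel_left_pos not_le)
  qed
  ultimately show ?thesis by simp
qed

lemma F1_nonneg: assumes "0 \<le> t" "t \<le> b1 D" shows "0 \<le> F1 t"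
proof -
  have t: "\<bar>t\<bar> \<le> b1 D" using assms by simp
  have "fst (T D (curve t)) = complex_of_real (r1 (T D (curve t)) * sgn t)"
    using T_aligned(1)[OF curve_frontier[OF t]] by (simp add: sgn_div_norm scaleR_conv_of_real sgn_real_def)
  then have "F1 t = r1 (T D (curve t)) * sgn t" unfolding F1_def by (simp only: Re_complex_of_real)
  then show ?thesis using assms by (simp add: r1_def sgn_real_def)
qed

lemma F2_nonneg: assumes "\<bar>t\<bar> \<le> b1 D" shows "0 \<le> F2 t"
proof -
  have "snd (T D (curve t)) = complex_of_real (r2 (T D (curve t)) * sgn (phi D t))"
    using T_aligned(2)[OF curve_frontier[OF assms]] by (simp add: sgn_div_norm scaleR_conv_of_real sgn_real_def)
  then have "F2 t = r2 (T D (curve t)) * sgn (phi D t)" unfolding F2_def by (simp only: Re_complex_of_real)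
  then show ?thesis using phi_closure(3)[OF assms] by (simp add: r2_def sgn_real_def)
qed

lemma F_zero: "F1 0 = 0" "F2 (b1 D) = 0"
proof -
  show "F1 0 = 0"
    using T_aligned(1)[OF curve_frontier[of 0]] b1_pos by (simp add: F1_def)
  show "F2 (b1 D) = 0"
    using T_aligned(2)[OF curve_frontier[of "b1 D"]] b1_pos by (simp add: F2_def phi_b1)
qed

text \<open>A horizontal support line at \<open>t\<close> would also touch the curve over 0, against
  \<open>unique_support\<close>.\<close>

lemma F1_pos: assumes "0 < t" "t \<le> b1 D" shows "0 < F1 t"
proof -
  have t: "\<bar>t\<bar> \<le> b1 D" and 0: "\<bar>0\<bar> \<le> b1 D" using assms b1_pos by auto
  have "F1 t \<noteq> 0"
  proof
    assume z: "F1 t = 0"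
    then have p: "F2 t * phi D t = 1" using F_supports(1)[OF t] by simp
    have "phi D t \<le> phi D 0"
      by (rule phi_closure(2)) (use closure_mono[OF curve_closure[OF t], of "(0, complex_of_real (phi D t))"] b1_pos in auto)
    then have "F2 t * phi D t \<le> F2 t * phi D 0" using F2_nonneg[OF t] by (rule mult_left_mono)
    then have "F2 t * phi D 0 = 1" using p F_supports(2)[OF t 0] z by simp
    then have "T D (curve t) \<bullet> curve 0 = 1"
      using z by (simp add: T_curve[OF t] inner_prod_def inner_complex_def)
    then have "curve t = curve 0"
      using unique_support[OF T_in_closure[OF curve_frontier[OF t]] curve_closure[OF t] curve_closure[OF 0]]
        T_frontier(2)[OF curve_frontier[OF t]] by blast
    then show False using assms by (simp add: curve_def)
  qed
  then show ?thesis using F1_nonneg[of t] assms by simp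
qed

lemma continuous_on_curve: "continuous_on {- b1 D..b1 D} curve"
  unfolding curve_def by (intro continuous_intros continuous_on_phi)

lemma continuous_on_F: "continuous_on {- b1 D..b1 D} F1" "continuous_on {- b1 D..b1 D} F2"
proof -
  have "continuous_on {- b1 D..b1 D} (\<lambda>t. T D (curve t))"
    by (rule continuous_on_compose2[OF continuous_on_T continuous_on_curve]) (use curve_frontier in auto)
  then show "continuous_on {- b1 D..b1 D} F1" "continuous_on {- b1 D..b1 D} F2"
    unfolding F1_def F2_def by (intro continuous_intros; simp)+
qed

lemma F2_ne: "t \<in> {- b1 D<..<b1 D} \<Longrightarrow> F2 t \<noteq> 0"
  using F2_pos[of t] by (auto simp: abs_less_iff)

text \<open>The difference quotient between \<open>t\<close> and \<open>u\<close> lies between the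
  slopes of the support lines at the two points, and these slopes vary continuously because
  \<open>T\<close> does.\<close>

lemma phi_has_derivative:
  assumes "\<bar>t\<bar> < b1 D"
  shows "(phi D has_real_derivative - F1 t / F2 t) (at t)"
proof -
  define m where "m u = - F1 u / F2 u" for u
  let ?I = "{- b1 D<..<b1 D}"
  have "continuous_on ?I m"
    unfolding m_def
    by (intro continuous_intros continuous_on_subset[OF continuous_on_F(1)] continuous_on_subset[OF continuous_on_F(2)])
      (use F2_ne in auto)
  then have mt: "m \<midarrow>t\<rightarrow> m t"
    using assms by (simp add: continuous_on_eq_continuous_at isCont_def abs_less_iff)
  have slope: "F2 t * phi D u - F2 t * phi D t \<le> - F1 t * (u - t)" if "\<bar>t\<bar> < b1 D" "\<bar>u\<bar> < b1 D" for t u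
    using F_supports(2)[of t u] F_supports(1)[of t] that by (simp add: algebra_simps)
  have slope': "phi D u - phi D t \<le> m t * (u - t)" if tu: "\<bar>t\<bar> < b1 D" "\<bar>u\<bar> < b1 D" for t u
    using slope[OF tu] F2_pos[OF tu(1)] by (simp add: m_def field_simps)
  have bound: "norm ((phi D u - phi D t) / (u - t) - m t) \<le> norm (m u - m t)" if u: "u \<noteq> t" "\<bar>u\<bar> < b1 D" for u
  proof -
    have up: "phi D u - phi D t \<le> m t * (u - t)" by (rule slope'[OF assms u(2)])
    have lo: "m u * (u - t) \<le> phi D u - phi D t" using slope'[OF u(2) assms] by (simp add: algebra_simps)
    show ?thesis
    proof (cases "t < u")
      case True
      then have "m u \<le> (phi D u - phi D t) / (u - t)" "(phi D u - phi D t) / (u - t) \<le> m t"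
        using up lo by (simp_all add: field_simps)
      then show ?thesis by simp
    next
      case False
      then have "m t \<le> (phi D u - phi D t) / (u - t)" "(phi D u - phi D t) / (u - t) \<le> m u"
        using up lo u(1) by (simp_all add: neg_divide_le_eq neg_le_divide_eq)
      then show ?thesis by simp
    qed
  qed
  have "eventually (\<lambda>u. u \<in> ?I) (at t)"
    using assms by (intro eventually_at_in_open') (auto simp: abs_less_iff)
  then have ev: "eventually (\<lambda>u. norm ((phi D u - phi D t) / (u - t) - m t) \<le> norm (m u - m t)) (at t)"
    using eventually_neq_at_within[of t t UNIV]
    by eventually_elim (use bound in \<open>auto simp: abs_less_iff\<close>)
  have "((\<lambda>u. norm (m u - m t)) \<longlongrightarrow> norm (m t - m t)) (at t)"
    by (intro tendsto_intros mt)
  then have "((\<lambda>u. (phi D u - phi D t) / (u - t) - m t) \<longlongrightarrow> 0) (at t)"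
    using Lim_null_comparison[OF ev] by simp
  from LIM_zero_cancel[OF this, unfolded m_def] show ?thesis
    unfolding has_field_derivative_iff .
qed

lemma deriv_phi: "\<bar>t\<bar> < b1 D \<Longrightarrow> deriv (phi D) t = - F1 t / F2 t"
  using phi_has_derivative by (rule DERIV_imp_deriv)

lemma phi_DERIV: "\<bar>t\<bar> < b1 D \<Longrightarrow> (phi D has_real_derivative deriv (phi D) t) (at t)"
  using phi_has_derivative deriv_phi by simp

lemma deriv_phi_neg: "0 < t \<Longrightarrow> t < b1 D \<Longrightarrow> deriv (phi D) t < 0"
  using F1_pos[of t] F2_pos[of t] by (simp add: deriv_phi)

lemma continuous_on_deriv_phi: "continuous_on {- b1 D<..<b1 D} (deriv (phi D))"
proof -
  have "continuous_on {- b1 D<..<b1 D} (\<lambda>t. - F1 t / F2 t)"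
    by (intro continuous_intros continuous_on_subset[OF continuous_on_F(1)] continuous_on_subset[OF continuous_on_F(2)])
      (use F2_ne in auto)
  then show ?thesis by (rule continuous_on_eq) (simp add: deriv_phi abs_less_iff)
qed

text \<open>Rotation reduces to the curve. There the support identity turns the denominator of
  \<open>s\<close> into \<open>1 / F2 t\<close>, and the quotient collapses to
  \<open>t * F1 t\<close>.\<close>

lemma s_coord_frontier:
  assumes \<zeta>: "\<zeta> \<in> frontier D"
  shows "s_coord D \<zeta> = r1 \<zeta> * r1 (T D \<zeta>)"
proof (cases "snd \<zeta> = 0")
  case True
  then show ?thesis using T_cmod[OF \<zeta>] by (simp add: s_coord_def r2_def)
next
  case False
  define t where "t = r1 \<zeta>"
  have t: "0 \<le> t" "t < b1 D"
    using False \<zeta> phi_b1 unfolding frontier_iff_phi t_def r1_def by (force simp: less_le)+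
  then have t': "\<bar>t\<bar> < b1 D" "\<bar>t\<bar> \<le> b1 D" by auto
  have cmods: "cmod (fst \<zeta>) = t" "cmod (snd \<zeta>) = phi D t"
    using \<zeta> by (simp_all add: frontier_iff_phi t_def r1_def)
  have sg: "cmod (sgn w) = 1" "sgn w * of_real (cmod w) = w" if "w \<noteq> 0" for w :: complex
    using that by (simp_all add: norm_sgn, simp add: sgn_div_norm scaleR_conv_of_real)
  obtain c where c: "cmod c = 1" "c * of_real t = fst \<zeta>"
  proof (cases "fst \<zeta> = 0")
    case True then show ?thesis using cmods by (intro that[of 1]) auto
  next
    case False then show ?thesis using cmods sg by (intro that[of "sgn (fst \<zeta>)"]) auto
  qed
  obtain d where d: "cmod d = 1" "d * of_real (phi D t) = snd \<zeta>"
    using cmods False sg[of "snd \<zeta>"] by (intro that[of "sgn (snd \<zeta>)"]) auto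
  have "T D \<zeta> = (c * fst (T D (curve t)), d * snd (T D (curve t)))"
    using T_rotate[OF curve_frontier[OF t'(2)] c(1) d(1)] c(2) d(2) by simp
  then have r: "r1 (T D \<zeta>) = F1 t"
    using F1_nonneg[of t] t c(1) by (simp add: T_curve[OF t'(2)] r1_def norm_mult)
  have F2: "F2 t > 0" by (rule F2_pos[OF t'(1)])
  have "s_coord D \<zeta> = (t * F1 t / F2 t) / (phi D t + t * F1 t / F2 t)"
    using False by (simp add: s_coord_def deriv_phi[OF t'(1)] t_def[symmetric])
  also have "phi D t + t * F1 t / F2 t = 1 / F2 t"
    using F_supports(1)[OF t'(2)] F2 by (simp add: field_simps)
  finally show ?thesis using F2 by (simp add: r t_def[symmetric])
qed

text \<open>Differentiating the slope \<open>- g\<^sub>1 / g\<^sub>2\<close> of the tangent line along the curve brings out the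
  Hessian of the defining function in the tangent direction.\<close>

lemma deriv_phi_differentiable:
  assumes "0 < t" "t < b1 D"
  shows "\<exists>e>0. \<exists>m'. (\<forall>u\<in>ball t e. (deriv (phi D) has_real_derivative m' u) (at u)) \<and>
    continuous_on (ball t e) m' \<and> m' t < 0"
proof -
  let ?q = "curve t"
  have fr: "?q \<in> frontier D" using assms by (intro curve_frontier) auto
  have pt: "phi D t > 0" using assms by (intro phi_pos) auto
  have "fst ?q * snd ?q \<noteq> 0" using assms pt by simp
  then have "C2_strongly_convex_boundary_at D ?q" using mem fr unfolding Rtilde_def by blast
  then obtain U \<rho> g H where U: "?q \<in> U" and d: "defining_function D U \<rho> g"
    and H: "\<And>x. x \<in> U \<Longrightarrow> (g has_derivative blinfun_apply (H x)) (at x)" and cH: "continuous_on U H"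
    and pos: "\<And>v. v \<noteq> 0 \<Longrightarrow> g ?q \<bullet> v = 0 \<Longrightarrow> 0 < v \<bullet> blinfun_apply (H ?q) v"
    unfolding C2_strongly_convex_boundary_at_def by blast
  have oU: "open U" and cg: "continuous_on U g" using d by (auto simp: defining_function_def)
  let ?I = "{0<..<b1 D}"
  have I: "\<bar>u\<bar> < b1 D" "\<bar>u\<bar> \<le> b1 D" if "u \<in> ?I" for u using that by auto
  have cI: "continuous_on ?I curve" by (rule continuous_on_subset[OF continuous_on_curve]) auto
  have "open (?I \<inter> curve -` U)" by (rule continuous_open_preimage[OF cI _ oU]) simp
  then obtain e where e: "e > 0" "ball t e \<subseteq> ?I \<inter> curve -` U"
    by (rule openE) (use assms U in auto)
  define A where "A u = Re (fst (g (curve u)))" for u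
  define B where "B u = Re (snd (g (curve u)))" for u
  let ?m = "deriv (phi D)"
  define v where "v u = (1 :: complex, complex_of_real (?m u))" for u
  define W where "W u = blinfun_apply (H (curve u)) (v u)" for u
  define m' where "m' u = - (v u \<bullet> W u) / B u" for u
  \<comment> \<open>The support functional \<open>T D (curve u)\<close> is a multiple of the
    gradient, so the gradient has real components in the ratio \<open>F1 u / F2 u\<close>. The sign
    of \<open>B u\<close> is found by moving vertically out of \<open>D\<close>.\<close>
  have B: "B u > 0" and AB: "?m u = - A u / B u" and gr: "g (curve u) = (of_real (A u), of_real (B u))"
    if u: "u \<in> ball t e" for u
  proof -
    have uI: "u \<in> ?I" and uU: "curve u \<in> U" using u e by auto
    have cfr: "curve u \<in> frontier D" by (rule curve_frontier[OF I(2)[OF uI]])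
    have "\<exists>l. T D (curve u) = l *\<^sub>R g (curve u)"
    proof (rule supporting_functional_parallel[OF d open_D uU cfr])
      fix x assume "x \<in> D"
      then show "T D (curve u) \<bullet> x \<le> T D (curve u) \<bullet> curve u"
        using T_inner_le[OF cfr, of x] T_frontier(2)[OF cfr] closure_subset[of D] by (simp add: subsetD)
    qed
    then obtain l where l: "T D (curve u) = l *\<^sub>R g (curve u)" by blast
    then have F: "F1 u = l * A u" "F2 u = l * B u" by (simp_all add: F1_def F2_def A_def B_def)
    have F2: "F2 u > 0" by (rule F2_pos[OF I(1)[OF uI]])
    then have l0: "l \<noteq> 0" "B u \<noteq> 0" using F by auto
    show AB: "?m u = - A u / B u" using deriv_phi[OF I(1)[OF uI]] F l0 by simp
    have "\<not> B u < 0"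
    proof
      assume "B u < 0"
      then have "g (curve u) \<bullet> (0, 1) < 0" by (simp add: B_def inner_prod_def inner_complex_def)
      from defining_function_enter[OF d open_D uU cfr this]
      obtain h where h: "h > 0" "curve u + h *\<^sub>R (0, 1) \<in> D" by blast
      then have "(complex_of_real u, complex_of_real (phi D u + h)) \<in> closure D"
        using closure_subset[of D] by (auto simp: curve_def scaleR_conv_of_real)
      then show False using phi_closure(2)[OF I(2)[OF uI]] h(1) by fastforce
    qed
    then show "B u > 0" using l0 by simp
    have "l *\<^sub>R g (curve u) = (complex_of_real (F1 u), complex_of_real (F2 u))"
      using T_curve[OF I(2)[OF uI]] l by simp
    then have "l * Im (fst (g (curve u))) = 0" "l * Im (snd (g (curve u))) = 0"
      by (metis Im_complex_of_real fst_conv fst_scaleR scaleR_complex.sel(2), metis Im_complex_of_real snd_conv snd_scaleR scaleR_complex.sel(2))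
    then show "g (curve u) = (of_real (A u), of_real (B u))"
      using l0 by (simp add: A_def B_def prod_eq_iff complex_eq_iff)
  qed
  have der: "(?m has_real_derivative m' u) (at u)" if u: "u \<in> ball t e" for u
  proof -
    have uI: "u \<in> ?I" and uU: "curve u \<in> U" using u e by auto
    have cd: "(curve has_vector_derivative v u) (at u)"
      unfolding curve_def v_def using phi_DERIV[OF I(1)[OF uI]]
      by (intro has_vector_derivative_Pair has_vector_derivative_of_real)
         (auto intro!: derivative_eq_intros simp: has_real_derivative_iff_has_vector_derivative)
    then have "((\<lambda>u. g (curve u)) has_derivative (\<lambda>h. blinfun_apply (H (curve u)) (h *\<^sub>R v u))) (at u)"
      using diff_chain_at[OF cd[unfolded has_vector_derivative_def], of g "blinfun_apply (H (curve u))"] H[OF uU]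
      by (simp add: o_def)
    then have gd: "((\<lambda>u. g (curve u)) has_vector_derivative W u) (at u)"
      by (simp add: has_vector_derivative_def W_def blinfun.scaleR_right)
    have dA: "(A has_real_derivative Re (fst (W u))) (at u)"
      using bounded_linear.has_vector_derivative[OF bounded_linear_compose[OF bounded_linear_Re bounded_linear_fst] gd]
      by (simp add: A_def[abs_def] has_real_derivative_iff_has_vector_derivative)
    have dB: "(B has_real_derivative Re (snd (W u))) (at u)"
      using bounded_linear.has_vector_derivative[OF bounded_linear_compose[OF bounded_linear_Re bounded_linear_snd] gd]
      by (simp add: B_def[abs_def] has_real_derivative_iff_has_vector_derivative)
    have B0: "B u \<noteq> 0" using B[OF u] by simp
    \<comment> \<open>The numerator of the quotient rule regroups into
      \<open>v u \<bullet> W u\<close>, because \<open>A u = - ?m u * B u\<close>.\<close>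
    have "((\<lambda>u. - A u / B u) has_real_derivative m' u) (at u)"
    proof (rule DERIV_cong[OF DERIV_divide[OF DERIV_minus[OF dA] dB B0]])
      show "(- Re (fst (W u)) * B u - - A u * Re (snd (W u))) / (B u * B u) = m' u"
        using B0 AB[OF u] by (simp add: m'_def v_def inner_prod_def inner_complex_def field_simps)
    qed
    moreover have "eventually (\<lambda>u. - A u / B u = ?m u) (nhds u)"
      using u by (intro eventually_nhds_in_open[of "ball t e", THEN eventually_mono]) (auto simp: AB)
    ultimately show ?thesis
      using DERIV_cong_ev[of u u "\<lambda>u. - A u / B u" ?m "m' u" "m' u"] by simp
  qed
  have bI: "ball t e \<subseteq> ?I" using e(2) by blast
  have cc: "continuous_on (ball t e) curve" using continuous_on_subset[OF cI bI] .
  have "continuous_on (ball t e) m'"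
    unfolding m'_def W_def B_def v_def
    using B e(2)
    by (intro continuous_intros continuous_on_compose2[OF cH cc] continuous_on_compose2[OF cg cc]
        continuous_on_subset[OF continuous_on_deriv_phi]) (force simp: B_def)+
  moreover have "m' t < 0"
  proof -
    have tb: "t \<in> ball t e" using e(1) by simp
    have "g ?q \<bullet> v t = A t + ?m t * B t" using gr[OF tb] by (simp add: v_def inner_prod_def inner_complex_def)
    also have "\<dots> = 0" using AB[OF tb] B[OF tb] by simp
    finally have "0 < v t \<bullet> W t" unfolding W_def by (intro pos) (simp_all add: v_def zero_prod_def)
    then show ?thesis using B[OF tb] by (simp add: m'_def)
  qed
  ultimately show ?thesis using e(1) der by blast
qed

lemma deriv_phi_DERIV:
  assumes "0 < t" "t < b1 D"
  shows "(deriv (phi D) has_real_derivative deriv (deriv (phi D)) t) (at t)" "deriv (deriv (phi D)) t < 0"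
proof -
  obtain e m' where e: "e > 0" and "\<forall>u\<in>ball t e. (deriv (phi D) has_real_derivative m' u) (at u)" "m' t < 0"
    using deriv_phi_differentiable[OF assms] by blast
  then have m: "(deriv (phi D) has_real_derivative m' t) (at t)" "m' t < 0" by auto
  then have "deriv (deriv (phi D)) t = m' t" by (intro DERIV_imp_deriv)
  then show "(deriv (phi D) has_real_derivative deriv (deriv (phi D)) t) (at t)" "deriv (deriv (phi D)) t < 0"
    using m by simp_all
qed

lemma continuous_on_deriv2_phi: "continuous_on {0<..<b1 D} (deriv (deriv (phi D)))"
  unfolding continuous_on_eq_continuous_at[OF open_greaterThanLessThan]
proof
  fix t assume "t \<in> {0<..<b1 D}"
  then obtain e m' where e: "e > 0" and m: "\<forall>u\<in>ball t e. (deriv (phi D) has_real_derivative m' u) (at u)"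
    "continuous_on (ball t e) m'" using deriv_phi_differentiable[of t] by auto
  have "continuous_on (ball t e) (deriv (deriv (phi D)))"
    by (rule continuous_on_eq[OF m(2)]) (use m(1) DERIV_imp_deriv in fastforce)
  then show "isCont (deriv (deriv (phi D))) t" using e by (simp add: continuous_on_eq_continuous_at)
qed

end

subsection \<open>The polar domain belongs to the class\<close>

text \<open>In finite dimensions continuity of \<open>f' x v\<close> in \<open>x\<close> for each
  fixed \<open>v\<close> gives continuity in operator norm. Derivatives can thus be handled as plain
  functions and bundled at the end.\<close>

lemma blinfun_derivative_exists:
  fixes f :: "'a::euclidean_space \<Rightarrow> 'b::real_normed_vector"
  assumes der: "\<And>x. x \<in> U \<Longrightarrow> (f has_derivative f' x) (at x)"
    and cont: "\<And>v. continuous_on U (\<lambda>x. f' x v)"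
  shows "\<exists>H. (\<forall>x\<in>U. blinfun_apply (H x) = f' x) \<and> continuous_on U H"
proof (intro exI conjI ballI)
  show app: "blinfun_apply (Blinfun (f' x)) = f' x" if "x \<in> U" for x
    using has_derivative_bounded_linear[OF der[OF that]] by (rule bounded_linear_Blinfun_apply)
  show "continuous_on U (\<lambda>x. Blinfun (f' x))"
    by (rule continuous_on_blinfun_componentwise, rule continuous_on_eq[OF cont]) (simp add: app)
qed

text \<open>The component of \<open>v\<close> tangent to the circle through \<open>u\<close>,
  divided by the modulus of \<open>u\<close>: normalisation ignores radial motion.\<close>

definition sgn_deriv :: "complex \<Rightarrow> complex \<Rightarrow> complex" where
  "sgn_deriv u v = (1 / norm u) *\<^sub>R (v - (sgn u \<bullet> v) *\<^sub>R sgn u)"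

lemma sgn_has_derivative:
  assumes "u \<noteq> 0" shows "(sgn has_derivative sgn_deriv u) (at (u :: complex))"
proof -
  have n: "(norm has_derivative (\<lambda>h. sgn u \<bullet> h)) (at u)"
    using has_derivative_norm[OF assms] by (simp add: inner_commute)
  have inv: "((\<lambda>u. inverse (norm u)) has_derivative (\<lambda>h. (sgn u \<bullet> h) * - (inverse (norm u) ^ Suc (Suc 0)))) (at u)"
    by (rule DERIV_compose_FDERIV[OF DERIV_inverse n]) (use assms in simp)
  have alg: "inverse (norm u) *\<^sub>R h + (c * - (inverse (norm u) ^ Suc (Suc 0))) *\<^sub>R u =
      (1 / norm u) *\<^sub>R (h - c *\<^sub>R (inverse (norm u) *\<^sub>R u))" for c h
    by (simp add: algebra_simps divide_inverse)
  have "((\<lambda>u. inverse (norm u) *\<^sub>R u) has_derivative sgn_deriv u) (at u)"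
    using has_derivative_scaleR[OF inv has_derivative_ident]
    unfolding alg sgn_div_norm[symmetric] sgn_deriv_def[abs_def] .
  then show ?thesis unfolding sgn_div_norm[symmetric] .
qed

text \<open>Exhibits the angular contribution to the Hessian of the gauge as a square.\<close>

lemma sgn_deriv_quadratic:
  assumes "u \<noteq> 0"
  shows "v \<bullet> sgn_deriv u v = (norm (v - (sgn u \<bullet> v) *\<^sub>R sgn u))\<^sup>2 / norm u"
proof -
  have "sgn u \<bullet> sgn u = 1" using assms by (simp add: dot_square_norm norm_sgn)
  then show ?thesis
    by (simp add: sgn_deriv_def power2_norm_eq_inner inner_diff_left inner_diff_right inner_commute)
qed

section \<open>The gauge of the polar and its gradient\<close>

context rtilde begin

text \<open>The contact point of the support hyperplane with outer normal \<open>z\<close>. For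
  \<open>z \<noteq> 0\<close> the choice is forced by \<open>supp_unique\<close>; at 0 it is
  arbitrary, so the origin is kept out of the domains of the defining functions.\<close>

definition supp :: "C2 \<Rightarrow> C2" where
  "supp z = (SOME \<zeta>. \<zeta> \<in> closure D \<and> (\<forall>\<eta>\<in>closure D. z \<bullet> \<eta> \<le> z \<bullet> \<zeta>))"

lemma supp_closure: "supp z \<in> closure D"
  and supp_max: "\<eta> \<in> closure D \<Longrightarrow> z \<bullet> \<eta> \<le> z \<bullet> supp z"
proof -
  have "\<exists>\<zeta>\<in>closure D. \<forall>\<eta>\<in>closure D. z \<bullet> \<eta> \<le> z \<bullet> \<zeta>"
    using nonempty by (intro continuous_attains_sup compact_closure) (auto intro!: continuous_intros)
  then have "\<exists>\<zeta>. \<zeta> \<in> closure D \<and> (\<forall>\<eta>\<in>closure D. z \<bullet> \<eta> \<le> z \<bullet> \<zeta>)" by blast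
  from someI_ex[OF this, folded supp_def]
  show "supp z \<in> closure D" "\<eta> \<in> closure D \<Longrightarrow> z \<bullet> \<eta> \<le> z \<bullet> supp z" by blast+
qed

lemma supp_inner_pos: assumes "z \<noteq> 0" shows "0 < z \<bullet> supp z"
proof -
  obtain e where e: "e > 0" "ball 0 e \<subseteq> D" using open_D zero_mem open_contains_ball by blast
  have "(e / 2 / norm z) *\<^sub>R z \<in> ball 0 e" using e assms by (simp add: dist_norm)
  then have "(e / 2 / norm z) *\<^sub>R z \<in> closure D" using e closure_subset by blast
  from supp_max[OF this, of z] have "(e / 2 / norm z) * (z \<bullet> z) \<le> z \<bullet> supp z" by simp
  moreover have "0 < (e / 2 / norm z) * (z \<bullet> z)" using e assms by simp
  ultimately show ?thesis by linarith
qed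

lemma normalized_polar:
  assumes "z \<noteq> 0"
  shows "(1 / (z \<bullet> supp z)) *\<^sub>R z \<in> closure (polar D)" "(1 / (z \<bullet> supp z)) *\<^sub>R z \<bullet> supp z = 1"
proof -
  have m: "0 < z \<bullet> supp z" by (rule supp_inner_pos[OF assms])
  then show "(1 / (z \<bullet> supp z)) *\<^sub>R z \<bullet> supp z = 1" by simp
  show "(1 / (z \<bullet> supp z)) *\<^sub>R z \<in> closure (polar D)"
    unfolding closure_polar_iff
  proof
    fix \<eta> assume "\<eta> \<in> closure D"
    then show "(1 / (z \<bullet> supp z)) *\<^sub>R z \<bullet> \<eta> \<le> 1" using m supp_max by (simp add: pos_divide_le_eq)
  qed
qed

lemma supp_frontier: "z \<noteq> 0 \<Longrightarrow> supp z \<in> frontier D"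
  using frontier_of_inner_eq_1(2)[OF normalized_polar(1) supp_closure normalized_polar(2)] .

lemma T_supp: "z \<noteq> 0 \<Longrightarrow> T D (supp z) = (1 / (z \<bullet> supp z)) *\<^sub>R z"
  by (rule T_eqI[OF normalized_polar(1) supp_closure normalized_polar(2)])

lemma supp_unique:
  assumes "z \<noteq> 0" "\<zeta> \<in> closure D" "\<And>\<eta>. \<eta> \<in> closure D \<Longrightarrow> z \<bullet> \<eta> \<le> z \<bullet> \<zeta>"
  shows "\<zeta> = supp z"
proof (rule unique_support[OF normalized_polar(1)[OF assms(1)] assms(2) supp_closure _ normalized_polar(2)[OF assms(1)]])
  have "z \<bullet> \<zeta> = z \<bullet> supp z" using assms(3)[OF supp_closure] supp_max[OF assms(2)] by (rule antisym[rotated])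
  then show "(1 / (z \<bullet> supp z)) *\<^sub>R z \<bullet> \<zeta> = 1" using supp_inner_pos[OF assms(1)] by simp
qed

text \<open>Closed graph with compact target: the maximality inequalities, one for each point of the
  closure, are closed conditions on the pair.\<close>

lemma continuous_on_supp: "continuous_on (- {0}) supp"
proof -
  have "(\<lambda>x. (x, supp x)) ` (- {0}) = (- {0}) \<times> closure D \<inter> (\<Inter>\<eta>\<in>closure D. {p. fst p \<bullet> \<eta> \<le> fst p \<bullet> snd p})"
  proof (intro equalityI subsetI)
    fix p assume "p \<in> (\<lambda>x. (x, supp x)) ` (- {0})"
    then obtain x where "p = (x, supp x)" "x \<noteq> 0" by blast
    then show "p \<in> (- {0}) \<times> closure D \<inter> (\<Inter>\<eta>\<in>closure D. {p. fst p \<bullet> \<eta> \<le> fst p \<bullet> snd p})"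
      using supp_closure supp_max by simp
  next
    fix p assume p: "p \<in> (- {0}) \<times> closure D \<inter> (\<Inter>\<eta>\<in>closure D. {p. fst p \<bullet> \<eta> \<le> fst p \<bullet> snd p})"
    then have "snd p = supp (fst p)" by (intro supp_unique) (simp_all add: mem_Times_iff)
    then show "p \<in> (\<lambda>x. (x, supp x)) ` (- {0})"
      using p unfolding image_iff by (intro bexI[of _ "fst p"]) (simp_all add: mem_Times_iff prod_eq_iff)
  qed
  moreover have "closed (\<Inter>\<eta>\<in>closure D. {p. fst p \<bullet> \<eta> \<le> fst p \<bullet> snd p})"
    by (intro closed_INT ballI closed_Collect_le continuous_intros)
  ultimately have "closedin (top_of_set ((- {0}) \<times> closure D)) ((\<lambda>x. (x, supp x)) ` (- {0}))"
    by (simp add: closedin_closed_Int)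
  then show ?thesis
    using continuous_closed_graph_eq[OF compact_closure, of supp "- {0}"] supp_closure by auto
qed

text \<open>Maximality at \<open>z\<close> and at \<open>y\<close> traps the linearisation error
  between 0 and \<open>norm (supp y - supp z) * norm (y - z)\<close>, so continuity of
  \<open>supp\<close> suffices.\<close>

lemma gauge_has_derivative:
  assumes "z \<noteq> 0"
  shows "((\<lambda>z. z \<bullet> supp z) has_derivative (\<lambda>h. supp z \<bullet> h)) (at z)"
proof (rule has_derivativeI_sandwich[where e = 1 and H = "\<lambda>y. norm (supp y - supp z)"])
  show "bounded_linear ((\<bullet>) (supp z))" by (rule bounded_linear_inner_right)
  have "isCont supp z"
    using continuous_on_supp assms by (simp add: continuous_on_eq_continuous_at open_Compl)
  then show "((\<lambda>y. norm (supp y - supp z)) \<longlongrightarrow> 0) (at z)"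
    unfolding isCont_def by (intro tendsto_norm_zero LIM_zero)
  fix y assume "y \<noteq> z"
  have lo: "0 \<le> y \<bullet> supp y - z \<bullet> supp z - supp z \<bullet> (y - z)"
    using supp_max[OF supp_closure, of y z] by (simp add: inner_diff_right inner_commute[of "supp z"])
  have "y \<bullet> supp y - z \<bullet> supp z - supp z \<bullet> (y - z) \<le> (supp y - supp z) \<bullet> (y - z)"
    using supp_max[OF supp_closure, of z y]
    by (simp add: inner_diff_right inner_diff_left inner_commute[of "supp z"] inner_commute[of "supp y"])
  also have "\<dots> \<le> norm (supp y - supp z) * norm (y - z)" by (rule norm_cauchy_schwarz)
  finally show "norm (y \<bullet> supp y - z \<bullet> supp z - supp z \<bullet> (y - z)) / norm (y - z) \<le> norm (supp y - supp z)"
    using lo \<open>y \<noteq> z\<close> by (simp add: divide_simps)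
qed simp

lemma polar_iff_supp: "z \<in> polar D \<longleftrightarrow> z \<bullet> supp z < 1"
  unfolding polar_iff using supp_closure supp_max by (meson order.strict_trans1)

lemma polar_defining_function: 
  assumes "open U" "0 \<notin> U"
  shows "defining_function (polar D) U (\<lambda>z. z \<bullet> supp z - 1) supp"
  unfolding defining_function_def
proof (intro conjI ballI)
  show "open U" by (rule assms(1))
  show "continuous_on U supp" by (rule continuous_on_subset[OF continuous_on_supp]) (use assms in auto)
  show "polar D \<inter> U = {x \<in> U. x \<bullet> supp x - 1 < 0}" by (rule set_eqI) (simp add: polar_iff_supp conj_commute)
  fix x assume "x \<in> U"
  then have x: "x \<noteq> 0" using assms by blast
  show "supp x \<noteq> 0" using supp_inner_pos[OF x] by auto
  show "((\<lambda>z. z \<bullet> supp z - 1) has_derivative (\<lambda>h. supp x \<bullet> h)) (at x)"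
    using has_derivative_diff[OF gauge_has_derivative[OF x] has_derivative_const[of 1]] by simp
qed

text \<open>The inverse function of \<open>- phi'\<close>: the abscissa where the profile has slope
  \<open>- k\<close>. Reading it off from \<open>supp\<close> provides existence and continuity at
  once.\<close>

definition tau :: "real \<Rightarrow> real" where "tau k = Re (fst (supp (complex_of_real k, 1)))"

text \<open>\<open>T D (supp z)\<close> is a positive multiple of \<open>z\<close>. Alignment passes
  the arguments of \<open>z\<close> to \<open>supp z\<close>, and comparing moduli with
  \<open>F1\<close> and \<open>F2\<close> identifies the slope over \<open>t\<close>.\<close>

lemma supp_off_axes:
  assumes z: "fst z \<noteq> 0" "snd z \<noteq> 0"
  defines "t \<equiv> r1 (supp z)"
  shows "0 < t" "t < b1 D" "supp z = (t *\<^sub>R sgn (fst z), phi D t *\<^sub>R sgn (snd z))"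
    "deriv (phi D) t = - (cmod (fst z) / cmod (snd z))"
proof -
  have z0: "z \<noteq> 0" using z by auto
  define m where "m = z \<bullet> supp z"
  have m: "m > 0" using supp_inner_pos[OF z0] by (simp add: m_def)
  have Tz: "T D (supp z) = (1 / m) *\<^sub>R z" using T_supp[OF z0] by (simp add: m_def)
  have fr: "supp z \<in> frontier D" by (rule supp_frontier[OF z0])
  have al: "(1 / m) *\<^sub>R fst z = complex_of_real (cmod (fst z) / m) * sgn (fst (supp z))"
    "(1 / m) *\<^sub>R snd z = complex_of_real (cmod (snd z) / m) * sgn (snd (supp z))"
    using T_aligned[OF fr] m by (simp_all add: Tz r1_def r2_def)
  have sg: "sgn (fst (supp z)) = sgn (fst z)" "sgn (snd (supp z)) = sgn (snd z)"
    using al m z by (simp_all add: sgn_div_norm[of "fst z"] sgn_div_norm[of "snd z"] scaleR_conv_of_real field_simps)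
  then have nz: "fst (supp z) \<noteq> 0" "snd (supp z) \<noteq> 0" using z sgn_zero_iff by (metis, metis)
  have c: "cmod (fst (supp z)) \<le> b1 D" "cmod (snd (supp z)) = phi D t" "cmod (fst (supp z)) = t"
    using fr by (simp_all add: frontier_iff_phi t_def r1_def)
  show t: "0 < t" using nz c by auto
  show t1: "t < b1 D" using nz c phi_b1 by (metis less_le norm_eq_zero)
  have un: "u = norm u *\<^sub>R sgn u" for u :: complex by (cases "u = 0") (simp_all add: sgn_div_norm)
  show su: "supp z = (t *\<^sub>R sgn (fst z), phi D t *\<^sub>R sgn (snd z))"
    using un[of "fst (supp z)"] un[of "snd (supp z)"] c sg by (simp add: prod_eq_iff)
  have t': "\<bar>t\<bar> < b1 D" "\<bar>t\<bar> \<le> b1 D" using t t1 by auto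
  have "T D (sgn (fst z) * fst (curve t), sgn (snd z) * snd (curve t)) =
      (sgn (fst z) * fst (T D (curve t)), sgn (snd z) * snd (T D (curve t)))"
    by (rule T_rotate[OF curve_frontier[OF t'(2)]]) (use z in \<open>auto simp: norm_sgn\<close>)
  moreover have "(sgn (fst z) * fst (curve t), sgn (snd z) * snd (curve t)) = supp z"
    by (simp add: su scaleR_conv_of_real mult.commute)
  ultimately have "(1 / m) *\<^sub>R z = (sgn (fst z) * of_real (F1 t), sgn (snd z) * of_real (F2 t))"
    by (simp add: T_curve[OF t'(2)] Tz)
  then have "cmod ((1 / m) *\<^sub>R fst z) = cmod (sgn (fst z) * of_real (F1 t))"
    "cmod ((1 / m) *\<^sub>R snd z) = cmod (sgn (snd z) * of_real (F2 t))"
    by (metis fst_conv fst_scaleR, metis snd_conv snd_scaleR)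
  then have "cmod (fst z) / m = F1 t" "cmod (snd z) / m = F2 t"
    using z m F1_nonneg[of t] F2_pos[OF t'(1)] t t1 by (simp_all add: norm_mult norm_sgn)
  then have "cmod (fst z) = m * F1 t" "cmod (snd z) = m * F2 t" using m by (simp_all add: field_simps)
  then show "deriv (phi D) t = - (cmod (fst z) / cmod (snd z))"
    using m by (simp add: deriv_phi[OF t'(1)])
qed

lemma deriv_phi_strict_antimono: 
  assumes "0 < t" "t < u" "u < b1 D" shows "deriv (phi D) u < deriv (phi D) t"
proof (rule DERIV_neg_imp_decreasing[OF assms(2)])
  fix x assume "t \<le> x" "x \<le> u"
  then show "\<exists>y. (deriv (phi D) has_real_derivative y) (at x) \<and> y < 0"
    using deriv_phi_DERIV[of x] assms by fastforce
qed

lemma tau: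
  assumes "0 < k"
  shows "0 < tau k" "tau k < b1 D" "deriv (phi D) (tau k) = - k"
proof -
  let ?z = "(complex_of_real k, 1 :: complex)"
  have sg: "sgn (complex_of_real k) = 1" using assms by (simp add: sgn_div_norm scaleR_conv_of_real)
  have z: "fst ?z \<noteq> 0" "snd ?z \<noteq> 0" using assms by auto
  note s = supp_off_axes[OF z]
  have "tau k = r1 (supp ?z)" unfolding tau_def using arg_cong[OF s(3), of "\<lambda>z. Re (fst z)"] by (simp add: sg)
  then show "0 < tau k" "tau k < b1 D" "deriv (phi D) (tau k) = - k" using s assms by simp_all
qed

text \<open>A slope determines its abscissa because \<open>phi'\<close> is strictly decreasing, so
  the moduli of \<open>supp z\<close> depend only on the quotient of those of
  \<open>z\<close>.\<close>

lemma supp_eq_tau: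
  assumes z: "fst z \<noteq> 0" "snd z \<noteq> 0"
  shows "supp z = (tau (cmod (fst z) / cmod (snd z)) *\<^sub>R sgn (fst z), phi D (tau (cmod (fst z) / cmod (snd z))) *\<^sub>R sgn (snd z))"
proof -
  let ?k = "cmod (fst z) / cmod (snd z)"
  have k: "0 < ?k" using z by simp
  note s = supp_off_axes[OF z]
  have "r1 (supp z) = tau ?k"
    using deriv_phi_strict_antimono[of "r1 (supp z)" "tau ?k"] deriv_phi_strict_antimono[of "tau ?k" "r1 (supp z)"]
      s(1,2,4) tau[OF k] by (metis less_irrefl linorder_neqE)
  then show ?thesis using s(3) by simp
qed

lemma continuous_on_tau: "continuous_on {0<..} tau"
proof -
  have "continuous_on {0<..} (\<lambda>k. supp (complex_of_real k, 1))"
    by (rule continuous_on_compose2[OF continuous_on_supp]) (auto intro!: continuous_intros simp: zero_prod_def)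
  then show ?thesis unfolding tau_def by (intro continuous_intros)
qed

definition tau' :: "real \<Rightarrow> real" where "tau' k = - 1 / deriv (deriv (phi D)) (tau k)"

lemma tau'_pos: "0 < k \<Longrightarrow> 0 < tau' k"
  using deriv_phi_DERIV(2)[of "tau k"] tau[of k] by (simp add: tau'_def divide_neg_neg)

lemma tau_DERIV:
  assumes "0 < k" shows "(tau has_real_derivative tau' k) (at k)"
proof -
  have "(tau has_real_derivative inverse (- deriv (deriv (phi D)) (tau k))) (at k)"
  proof (rule DERIV_inverse_function[where f = "\<lambda>t. - deriv (phi D) t" and a = 0 and b = "k + 1"])
    show "((\<lambda>t. - deriv (phi D) t) has_real_derivative - deriv (deriv (phi D)) (tau k)) (at (tau k))"
      by (intro DERIV_minus deriv_phi_DERIV tau assms)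
    show "- deriv (deriv (phi D)) (tau k) \<noteq> 0" using deriv_phi_DERIV(2)[of "tau k"] tau[OF assms] by simp
    show "isCont tau k" using continuous_on_tau assms by (simp add: continuous_on_eq_continuous_at)
  qed (use assms tau in auto)
  then show ?thesis by (simp add: tau'_def divide_inverse)
qed

lemma continuous_on_tau': "continuous_on {0<..} tau'"
proof -
  have "continuous_on {0<..} (\<lambda>k. deriv (deriv (phi D)) (tau k))"
    by (rule continuous_on_compose2[OF continuous_on_deriv2_phi continuous_on_tau]) (use tau in auto)
  moreover have "deriv (deriv (phi D)) (tau k) \<noteq> 0" if "0 < k" for k
    using deriv_phi_DERIV(2)[of "tau k"] tau[OF that] by simp
  ultimately show ?thesis unfolding tau'_def by (intro continuous_intros) auto
qed

section \<open>The Hessian of the gauge off the axes\<close>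

definition off_axes :: "C2 set" where "off_axes = {z. fst z \<noteq> 0 \<and> snd z \<noteq> 0}"

lemma open_off_axes: "open off_axes"
  unfolding off_axes_def by (intro open_Collect_conj open_Collect_neq continuous_intros)

definition ratio :: "C2 \<Rightarrow> real" where "ratio z = cmod (fst z) / cmod (snd z)"

definition ratio' :: "C2 \<Rightarrow> C2 \<Rightarrow> real" where
  "ratio' z v = (sgn (fst z) \<bullet> fst v - ratio z * (sgn (snd z) \<bullet> snd v)) / cmod (snd z)"

lemma ratio_pos: "z \<in> off_axes \<Longrightarrow> 0 < ratio z"
  by (simp add: off_axes_def ratio_def)

lemma ratio_has_derivative:
  assumes "z \<in> off_axes" shows "(ratio has_derivative ratio' z) (at z)"
proof -
  have nz: "fst z \<noteq> 0" "snd z \<noteq> 0" using assms by (auto simp: off_axes_def)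
  have n1: "((\<lambda>z. cmod (fst z)) has_derivative (\<lambda>v. sgn (fst z) \<bullet> fst v)) (at z)"
    using diff_chain_at[OF has_derivative_fst[OF has_derivative_ident] has_derivative_norm[OF nz(1)]]
    by (simp add: o_def inner_commute)
  have n2: "((\<lambda>z. cmod (snd z)) has_derivative (\<lambda>v. sgn (snd z) \<bullet> snd v)) (at z)"
    using diff_chain_at[OF has_derivative_snd[OF has_derivative_ident] has_derivative_norm[OF nz(2)]]
    by (simp add: o_def inner_commute)
  have "(ratio has_derivative (\<lambda>v. - cmod (fst z) * (inverse (cmod (snd z)) * (sgn (snd z) \<bullet> snd v) * inverse (cmod (snd z))) +
      (sgn (fst z) \<bullet> fst v) / cmod (snd z))) (at z)"
    unfolding ratio_def using nz by (intro has_derivative_divide n1 n2) auto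
  moreover have "(\<lambda>v. - cmod (fst z) * (inverse (cmod (snd z)) * (sgn (snd z) \<bullet> snd v) * inverse (cmod (snd z))) +
      (sgn (fst z) \<bullet> fst v) / cmod (snd z)) = ratio' z"
    using nz by (auto simp: ratio'_def ratio_def fun_eq_iff field_simps)
  ultimately show ?thesis by simp
qed

text \<open>Product rule for the formula in \<open>supp_eq_tau\<close>; the factor
  \<open>- ratio z\<close> in the second component is the slope of \<open>phi D\<close> at
  \<open>tau (ratio z)\<close>.\<close>

definition supp' :: "C2 \<Rightarrow> C2 \<Rightarrow> C2" where
  "supp' z v =
    ((tau' (ratio z) * ratio' z v) *\<^sub>R sgn (fst z) + tau (ratio z) *\<^sub>R sgn_deriv (fst z) (fst v),
     (- ratio z * tau' (ratio z) * ratio' z v) *\<^sub>R sgn (snd z) + phi D (tau (ratio z)) *\<^sub>R sgn_deriv (snd z) (snd v))"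

lemma supp_has_derivative:
  assumes z: "z \<in> off_axes" shows "(supp has_derivative supp' z) (at z)"
proof -
  have nz: "fst z \<noteq> 0" "snd z \<noteq> 0" using assms by (auto simp: off_axes_def)
  note k = ratio_pos[OF z]
  have d1: "((\<lambda>z. tau (ratio z)) has_derivative (\<lambda>v. ratio' z v * tau' (ratio z))) (at z)"
    by (rule DERIV_compose_FDERIV[OF tau_DERIV[OF k] ratio_has_derivative[OF z]])
  have "(phi D has_real_derivative - ratio z) (at (tau (ratio z)))"
    using phi_DERIV[of "tau (ratio z)"] tau[OF k] by simp
  from DERIV_compose_FDERIV[OF this d1]
  have d2: "((\<lambda>z. phi D (tau (ratio z))) has_derivative (\<lambda>v. ratio' z v * tau' (ratio z) * - ratio z)) (at z)" .
  have s1: "((\<lambda>z. sgn (fst z)) has_derivative (\<lambda>v. sgn_deriv (fst z) (fst v))) (at z)"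
    using diff_chain_at[OF has_derivative_fst[OF has_derivative_ident] sgn_has_derivative[OF nz(1)]] by (simp add: o_def)
  have s2: "((\<lambda>z. sgn (snd z)) has_derivative (\<lambda>v. sgn_deriv (snd z) (snd v))) (at z)"
    using diff_chain_at[OF has_derivative_snd[OF has_derivative_ident] sgn_has_derivative[OF nz(2)]] by (simp add: o_def)
  have "((\<lambda>z. (tau (ratio z) *\<^sub>R sgn (fst z), phi D (tau (ratio z)) *\<^sub>R sgn (snd z))) has_derivative supp' z) (at z)"
    using has_derivative_Pair[OF has_derivative_scaleR[OF d1 s1] has_derivative_scaleR[OF d2 s2]]
    by (simp add: supp'_def[abs_def] algebra_simps)
  then show ?thesis
    by (rule has_derivative_transform_within_open[OF _ open_off_axes z])
      (simp add: off_axes_def ratio_def supp_eq_tau)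
qed

lemma continuous_on_supp': "continuous_on off_axes (\<lambda>z. supp' z v)"
proof -
  have cr: "continuous_on off_axes ratio"
    unfolding ratio_def off_axes_def by (intro continuous_intros) auto
  have cs: "continuous_on off_axes (\<lambda>z. sgn (fst z))" "continuous_on off_axes (\<lambda>z. sgn (snd z))"
    unfolding off_axes_def by (intro continuous_on_sgn continuous_intros; simp)+
  have cr': "continuous_on off_axes (\<lambda>z. ratio' z v)"
    unfolding ratio'_def by (intro continuous_intros cr cs) (auto simp: off_axes_def)
  have ct: "continuous_on off_axes (\<lambda>z. tau (ratio z))" "continuous_on off_axes (\<lambda>z. tau' (ratio z))"
    by (rule continuous_on_compose2[OF continuous_on_tau cr], use ratio_pos in auto)
       (rule continuous_on_compose2[OF continuous_on_tau' cr], use ratio_pos in auto)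
  have cp: "continuous_on off_axes (\<lambda>z. phi D (tau (ratio z)))"
  proof (rule continuous_on_compose2[OF continuous_on_phi ct(1)])
    show "(\<lambda>z. tau (ratio z)) ` off_axes \<subseteq> {- b1 D..b1 D}"
      using tau ratio_pos b1_pos by (force intro: less_imp_le order.trans)
  qed
  show ?thesis
    unfolding supp'_def sgn_deriv_def
    by (intro continuous_intros cr cs cr' ct cp) (auto simp: off_axes_def)
qed

text \<open>The quadratic form is a sum of three squares with positive coefficients: the variation
  of the ratio of moduli and the two angular variations. They vanish together only along real
  multiples of \<open>z\<close>, the direction in which the gauge is homogeneous and which is not
  tangent.\<close>

lemma supp'_positive:
  assumes z: "z \<in> off_axes" and v: "v \<noteq> 0" "supp z \<bullet> v = 0"
  shows "0 < v \<bullet> supp' z v"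
proof (rule ccontr)
  assume neg: "\<not> ?thesis"
  have nz: "fst z \<noteq> 0" "snd z \<noteq> 0" using z by (auto simp: off_axes_def)
  define k where "k = ratio z"
  have k: "0 < k" using ratio_pos[OF z] by (simp add: k_def)
  have t: "0 < tau k" "0 < tau' k" "0 < phi D (tau k)"
    using tau[OF k] tau'_pos[OF k] phi_pos[of "tau k"] by auto
  \<comment> \<open>Radial components along the two coordinates of \<open>z\<close>; the
    \<open>e1\<close>, \<open>e2\<close> below are the angular remainders.\<close>
  define a1 a2 where "a1 = sgn (fst z) \<bullet> fst v" and "a2 = sgn (snd z) \<bullet> snd v"
  define e1 e2 where "e1 = fst v - a1 *\<^sub>R sgn (fst z)" and "e2 = snd v - a2 *\<^sub>R sgn (snd z)"
  define d where "d = ratio' z v"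
  have ad: "a1 - k * a2 = cmod (snd z) * d" using nz by (simp add: d_def ratio'_def a1_def a2_def k_def)
  have "v \<bullet> supp' z v = tau' k * d * (a1 - k * a2) + tau k * (fst v \<bullet> sgn_deriv (fst z) (fst v)) +
      phi D (tau k) * (snd v \<bullet> sgn_deriv (snd z) (snd v))"
    by (simp add: supp'_def inner_prod_def inner_add_right a1_def a2_def d_def k_def inner_commute algebra_simps)
  also have "\<dots> = tau' k * cmod (snd z) * d\<^sup>2 + tau k * ((norm e1)\<^sup>2 / cmod (fst z)) + phi D (tau k) * ((norm e2)\<^sup>2 / cmod (snd z))"
    by (simp only: ad sgn_deriv_quadratic[OF nz(1)] sgn_deriv_quadratic[OF nz(2)] e1_def e2_def a1_def[symmetric] a2_def[symmetric])
      (simp add: power2_eq_square)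
  finally have q: "v \<bullet> supp' z v =
      tau' k * cmod (snd z) * d\<^sup>2 + tau k * ((norm e1)\<^sup>2 / cmod (fst z)) + phi D (tau k) * ((norm e2)\<^sup>2 / cmod (snd z))" .
  have nn: "0 \<le> tau' k * cmod (snd z) * d\<^sup>2" "0 \<le> tau k * ((norm e1)\<^sup>2 / cmod (fst z))"
     "0 \<le> phi D (tau k) * ((norm e2)\<^sup>2 / cmod (snd z))"
    using t by simp_all
  then have "tau' k * cmod (snd z) * d\<^sup>2 = 0" "tau k * ((norm e1)\<^sup>2 / cmod (fst z)) = 0"
     "phi D (tau k) * ((norm e2)\<^sup>2 / cmod (snd z)) = 0"
    using neg q by linarith+
  then have 0: "d = 0" "e1 = 0" "e2 = 0" using t nz by auto
  \<comment> \<open>With \<open>d\<close>, \<open>e1\<close> and \<open>e2\<close> zero,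
    \<open>v\<close> is a real multiple of \<open>z\<close>; the tangency condition now forces the
    multiple to be 0.\<close>
  have "supp z \<bullet> v = tau k * a1 + phi D (tau k) * a2"
    using nz by (simp add: supp_eq_tau inner_prod_def a1_def a2_def k_def ratio_def)
  also have "\<dots> = (tau k * k + phi D (tau k)) * a2" using ad 0 by (simp add: algebra_simps)
  finally have "(tau k * k + phi D (tau k)) * a2 = 0" using v by simp
  moreover have "tau k * k + phi D (tau k) > 0" using t k by (intro add_pos_pos mult_pos_pos)
  ultimately have "a2 = 0" by auto
  then have "a1 = 0" using ad 0 by simp
  then have "v = 0" using 0 \<open>a2 = 0\<close> by (simp add: e1_def e2_def prod_eq_iff)
  then show False using v by simp
qed

text \<open>The gauge minus 1 is a single defining function for the whole boundary,
  \<open>C1\<close> away from 0 and \<open>C2\<close> off the axes.\<close>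

lemma polar_Rtilde: "polar D \<in> Rtilde"
proof -
  interpret P: convex_reinhardt "polar D" by (rule convex_reinhardt_polar)
  have "C1_boundary_at (polar D) q" if "q \<in> frontier (polar D)" for q
    unfolding C1_boundary_at_def
  proof (intro exI conjI)
    show "q \<in> - {0}" using that P.zero_mem P.frontier_iff by auto
    show "defining_function (polar D) (- {0}) (\<lambda>z. z \<bullet> supp z - 1) supp"
      by (rule polar_defining_function) auto
  qed
  moreover have "C2_strongly_convex_boundary_at (polar D) q" if "fst q * snd q \<noteq> 0" for q
  proof -
    obtain H where H: "\<And>z. z \<in> off_axes \<Longrightarrow> blinfun_apply (H z) = supp' z" "continuous_on off_axes H"
      using blinfun_derivative_exists[of off_axes supp supp', OF supp_has_derivative continuous_on_supp'] by blast
    show ?thesis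
      unfolding C2_strongly_convex_boundary_at_def
    proof (intro exI conjI ballI allI impI)
      show q: "q \<in> off_axes" using that by (simp add: off_axes_def)
      show "defining_function (polar D) off_axes (\<lambda>z. z \<bullet> supp z - 1) supp"
        by (rule polar_defining_function[OF open_off_axes]) (simp add: off_axes_def)
      show "(supp has_derivative blinfun_apply (H x)) (at x)" if "x \<in> off_axes" for x
        using supp_has_derivative[OF that] H(1)[OF that] by simp
      show "continuous_on off_axes H" by (rule H(2))
      show "0 < v \<bullet> blinfun_apply (H q) v" if "v \<noteq> 0" "supp q \<bullet> v = 0" for v
        using supp'_positive[OF q that] H(1)[OF q] by simp
    qed
  qed
  ultimately show ?thesis
    using P.open_D P.nonempty P.bounded_D P.convex_D P.complete_D unfolding Rtilde_def by blast
qed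

lemma rtilde_polar: "rtilde (polar D)"
  by unfold_locales (rule polar_Rtilde)

end

subsection \<open>Duality along the profile curve\<close>

context rtilde begin

text \<open>The hypotheses of \<open>T_eqI\<close> are symmetric in the two points once the bipolar
  is replaced by \<open>D\<close>.\<close>

lemma T_T:
  assumes "\<zeta> \<in> frontier D" shows "T (polar D) (T D \<zeta>) = \<zeta>"
proof -
  interpret P: rtilde "polar D" by (rule rtilde_polar)
  show ?thesis
    by (rule P.T_eqI[OF _ T_in_closure[OF assms]])
      (use assms T_frontier(2)[OF assms] in \<open>simp_all add: bipolar frontier_def inner_commute\<close>)
qed

lemma s_coord_T:
  assumes "\<zeta> \<in> frontier D" shows "s_coord (polar D) (T D \<zeta>) = s_coord D \<zeta>"
proof -
  interpret P: rtilde "polar D" by (rule rtilde_polar)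
  show ?thesis
    using P.s_coord_frontier[OF T_frontier(1)[OF assms]] s_coord_frontier[OF assms] T_T[OF assms]
    by (simp add: mult.commute)
qed

lemma continuous_on_s_coord: "continuous_on (frontier D) (s_coord D)"
proof -
  have "continuous_on (frontier D) (\<lambda>\<zeta>. r1 \<zeta> * r1 (T D \<zeta>))"
    unfolding r1_def by (intro continuous_intros continuous_on_T)
  then show ?thesis by (rule continuous_on_eq) (simp add: s_coord_frontier)
qed

lemma gamma_plus_eq: "gamma_plus D = curve ` {0<..<b1 D}"
proof (intro equalityI subsetI)
  fix z assume "z \<in> gamma_plus D"
  then obtain x y where z: "z \<in> frontier D" "x > 0" "y > 0" "z = (complex_of_real x, complex_of_real y)"
    unfolding gamma_plus_def by blast
  then have "x \<le> b1 D" "y = phi D x" by (simp_all add: frontier_iff_phi)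
  moreover have "x \<noteq> b1 D" using phi_b1 z(3) calculation by auto
  ultimately show "z \<in> curve ` {0<..<b1 D}" using z by (auto simp: curve_def)
next
  fix z assume "z \<in> curve ` {0<..<b1 D}"
  then obtain t where t: "0 < t" "t < b1 D" "z = curve t" by auto
  then have "0 < phi D t" by (intro phi_pos) auto
  then show "z \<in> gamma_plus D"
    using t curve_frontier[of t] unfolding gamma_plus_def curve_def by auto
qed

lemma gamma_plus_frontier: "\<zeta> \<in> gamma_plus D \<Longrightarrow> \<zeta> \<in> frontier D"
  by (simp add: gamma_plus_def)

lemma T_gamma_plus:
  assumes "\<zeta> \<in> gamma_plus D" shows "T D \<zeta> \<in> gamma_plus (polar D)"
proof -
  obtain t where t: "0 < t" "t < b1 D" "\<zeta> = curve t" using assms by (auto simp: gamma_plus_eq)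
  have "T D \<zeta> = (complex_of_real (F1 t), complex_of_real (F2 t))" using t T_curve[of t] by simp
  moreover have "F1 t > 0" "F2 t > 0" using F1_pos[of t] F2_pos[of t] t by auto
  ultimately show ?thesis
    using T_frontier(1)[OF gamma_plus_frontier[OF assms]] unfolding gamma_plus_def by blast
qed

lemma bij_T: "bij_betw (T D) (gamma_plus D) (gamma_plus (polar D))"
proof -
  interpret P: rtilde "polar D" by (rule rtilde_polar)
  show ?thesis
  proof (rule bij_betw_byWitness[where f' = "T (polar D)"])
    show "\<forall>\<zeta>\<in>gamma_plus D. T (polar D) (T D \<zeta>) = \<zeta>" using T_T gamma_plus_frontier by blast
    show "\<forall>\<zeta>\<in>gamma_plus (polar D). T D (T (polar D) \<zeta>) = \<zeta>"
      using P.T_T P.gamma_plus_frontier by (simp add: bipolar)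
    show "T D ` gamma_plus D \<subseteq> gamma_plus (polar D)" using T_gamma_plus by blast
    show "T (polar D) ` gamma_plus (polar D) \<subseteq> gamma_plus D" using P.T_gamma_plus by (auto simp: bipolar)
  qed
qed

text \<open>The height at which the tangent at \<open>t\<close> meets the vertical axis. It is the
  reciprocal of \<open>F2 t\<close> and occurs in the denominators of both \<open>s\<close> and
  \<open>p\<close>.\<close>

definition M :: "real \<Rightarrow> real" where "M t = phi D t - t * deriv (phi D) t"

lemma M_F:
  assumes "\<bar>t\<bar> < b1 D" shows "M t > 0" "F1 t = - deriv (phi D) t / M t" "F2 t = 1 / M t"
proof -
  have "F2 t * M t = F1 t * t + F2 t * phi D t"
    using F2_pos[OF assms] by (simp add: M_def deriv_phi[OF assms] field_simps)
  also have "\<dots> = 1" using F_supports(1)[of t] assms by simp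
  finally have F2M: "F2 t * M t = 1" .
  then show "M t > 0" using F2_pos[OF assms] by (metis zero_less_mult_pos zero_less_one)
  then show F2: "F2 t = 1 / M t" using F2M by (simp add: field_simps)
  have "F1 t = - deriv (phi D) t * F2 t" using F2_pos[OF assms] by (simp add: deriv_phi[OF assms])
  then show "F1 t = - deriv (phi D) t / M t" by (simp add: F2)
qed

definition F1' :: "real \<Rightarrow> real" where "F1' t = - deriv (deriv (phi D)) t * phi D t / (M t)\<^sup>2"
definition F2' :: "real \<Rightarrow> real" where "F2' t = t * deriv (deriv (phi D)) t / (M t)\<^sup>2"

lemma F_DERIV:
  assumes "0 < t" "t < b1 D"
  shows "(F1 has_real_derivative F1' t) (at t)" "(F2 has_real_derivative F2' t) (at t)"
proof -
  let ?d = "deriv (phi D)"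
  have t: "\<bar>t\<bar> < b1 D" using assms by auto
  have tI: "t \<in> {- b1 D<..<b1 D}" using assms by auto
  have M0: "M t \<noteq> 0" using M_F(1)[OF t] by simp
  have dM: "(M has_real_derivative - t * deriv ?d t) (at t)"
    unfolding M_def by (rule derivative_eq_intros phi_DERIV[OF t] deriv_phi_DERIV(1)[OF assms] refl)+ simp
  have "((\<lambda>t. - ?d t / M t) has_real_derivative F1' t) (at t)"
  proof (rule DERIV_cong[OF DERIV_divide[OF DERIV_minus[OF deriv_phi_DERIV(1)[OF assms]] dM M0]])
    show "(- deriv ?d t * M t - - ?d t * (- t * deriv ?d t)) / (M t * M t) = F1' t"
      by (simp add: F1'_def power2_eq_square M_def algebra_simps)
  qed
  then show "(F1 has_real_derivative F1' t) (at t)"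
    by (rule has_field_derivative_transform_within_open[OF _ open_greaterThanLessThan tI])
      (use M_F in \<open>auto simp: abs_less_iff\<close>)
  have "((\<lambda>t. 1 / M t) has_real_derivative F2' t) (at t)"
  proof (rule DERIV_cong[OF DERIV_divide[OF DERIV_const dM M0]])
    show "(0 * M t - 1 * (- t * deriv ?d t)) / (M t * M t) = F2' t"
      by (simp add: F2'_def power2_eq_square)
  qed
  then show "(F2 has_real_derivative F2' t) (at t)"
    by (rule has_field_derivative_transform_within_open[OF _ open_greaterThanLessThan tI])
      (use M_F in \<open>auto simp: abs_less_iff\<close>)
qed

lemma F1'_pos: "0 < t \<Longrightarrow> t < b1 D \<Longrightarrow> 0 < F1' t"
  using deriv_phi_DERIV(2)[of t] phi_pos[of t] M_F(1)[of t]
  unfolding F1'_def by (intro divide_pos_pos mult_pos_pos) auto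

lemma continuous_on_M: "continuous_on {- b1 D<..<b1 D} M"
  unfolding M_def
  by (intro continuous_intros continuous_on_deriv_phi continuous_on_subset[OF continuous_on_phi]) auto

lemma continuous_on_F': "continuous_on {0<..<b1 D} F1'" "continuous_on {0<..<b1 D} F2'"
proof -
  have M: "continuous_on {0<..<b1 D} M" by (rule continuous_on_subset[OF continuous_on_M]) auto
  have p: "continuous_on {0<..<b1 D} (phi D)" by (rule continuous_on_subset[OF continuous_on_phi]) auto
  have nz: "\<forall>t\<in>{0<..<b1 D}. (M t)\<^sup>2 \<noteq> 0"
  proof
    fix t assume "t \<in> {0<..<b1 D}"
    then have "M t > 0" by (intro M_F(1)) auto
    then show "(M t)\<^sup>2 \<noteq> 0" by simp
  qed
  show "continuous_on {0<..<b1 D} F1'" "continuous_on {0<..<b1 D} F2'"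
    unfolding F1'_def F2'_def by (intro continuous_intros M p nz continuous_on_deriv2_phi)+
qed

text \<open>The local extension of \<open>T\<close> off the curve is taken to depend on the real
  part of the first coordinate alone, where \<open>F1\<close> and \<open>F2\<close> are
  \<open>C1\<close>.\<close>

lemma C1_map_T: "C1_map_on (gamma_plus D) (T D)"
  unfolding C1_map_on_def
proof
  fix \<zeta> assume \<zeta>: "\<zeta> \<in> gamma_plus D"
  define U :: "C2 set" where "U = {z. 0 < Re (fst z) \<and> Re (fst z) < b1 D}"
  define g where "g z = (complex_of_real (F1 (Re (fst z))), complex_of_real (F2 (Re (fst z))))" for z :: C2
  define g' where "g' z h = (complex_of_real (Re (fst h) * F1' (Re (fst z))), complex_of_real (Re (fst h) * F2' (Re (fst z))))"
    for z h :: C2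
  have "open U" unfolding U_def by (intro open_Collect_conj open_Collect_less continuous_intros)
  moreover have "\<zeta> \<in> U" using \<zeta> by (auto simp: gamma_plus_eq U_def)
  moreover have "C1_on g U"
  proof -
    have "(g has_derivative g' z) (at z)" if "z \<in> U" for z
    proof -
      have z: "0 < Re (fst z)" "Re (fst z) < b1 D" using that by (simp_all add: U_def)
      have hd: "((\<lambda>z. Re (fst z)) has_derivative (\<lambda>h. Re (fst h))) (at z)"
        by (intro bounded_linear_imp_has_derivative bounded_linear_compose[OF bounded_linear_Re] bounded_linear_fst)
      have "((\<lambda>z. F1 (Re (fst z))) has_derivative (\<lambda>h. Re (fst h) * F1' (Re (fst z)))) (at z)"
        "((\<lambda>z. F2 (Re (fst z))) has_derivative (\<lambda>h. Re (fst h) * F2' (Re (fst z)))) (at z)"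
        by (rule DERIV_compose_FDERIV[OF _ hd], rule F_DERIV[OF z])+
      then show ?thesis
        unfolding g_def g'_def by (intro has_derivative_Pair has_derivative_of_real)
    qed
    moreover have "continuous_on U (\<lambda>z. g' z h)" for h
    proof -
      have "continuous_on U (\<lambda>z. F1' (Re (fst z)))" "continuous_on U (\<lambda>z. F2' (Re (fst z)))"
        by (rule continuous_on_compose2[OF continuous_on_F'(1)] continuous_on_compose2[OF continuous_on_F'(2)],
            auto simp: U_def intro!: continuous_intros)+
      then show ?thesis unfolding g'_def by (intro continuous_intros)
    qed
    ultimately obtain H where "\<forall>x\<in>U. blinfun_apply (H x) = g' x" "continuous_on U H" "\<And>z. z \<in> U \<Longrightarrow> (g has_derivative g' z) (at z)"
      using blinfun_derivative_exists[of U g g'] by blast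
    then show ?thesis unfolding C1_on_def by (intro exI[of _ H]) simp
  qed
  moreover have "\<forall>y\<in>gamma_plus D \<inter> U. g y = T D y"
    by (auto simp: gamma_plus_eq g_def T_curve)
  ultimately show "\<exists>U g. open U \<and> \<zeta> \<in> U \<and> C1_on g U \<and> (\<forall>y\<in>gamma_plus D \<inter> U. g y = T D y)" by blast
qed

lemma C1_diffeomorphism_T: "C1_diffeomorphism (gamma_plus D) (gamma_plus (polar D)) (T D)"
  unfolding C1_diffeomorphism_def
proof (intro conjI bij_T C1_map_T)
  interpret P: rtilde "polar D" by (rule rtilde_polar)
  have "inv_into (gamma_plus D) (T D) w = T (polar D) w" if "w \<in> gamma_plus (polar D)" for w
  proof (rule inv_into_f_eq)
    show "inj_on (T D) (gamma_plus D)" using bij_T by (simp add: bij_betw_def)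
    show "T (polar D) w \<in> gamma_plus D" using P.T_gamma_plus[OF that] by (simp add: bipolar)
    show "T D (T (polar D) w) = w" using P.T_T[OF P.gamma_plus_frontier[OF that]] by (simp add: bipolar)
  qed
  then show "C1_map_on (gamma_plus (polar D)) (inv_into (gamma_plus D) (T D))"
    using P.C1_map_T unfolding C1_map_on_def by (metis IntD1)
qed

text \<open>A path in \<open>gamma_plus D\<close> is \<open>curve\<close> applied to its own first
  coordinate, so the chain rule reduces derivatives along any path to derivatives in
  \<open>t\<close>. The quantified \<open>h\<close> lets one statement serve \<open>r1\<close>,
  \<open>r2\<close> and their compositions with \<open>T\<close>.\<close>

lemma DERIV_along_curve:
  assumes c: "c C1_differentiable_on {a<..<b}" and im: "c ` {a<..<b} \<subseteq> gamma_plus D" and t: "t \<in> {a<..<b}"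
  obtains t0 x' where "0 < t0" "t0 < b1 D" "c t = curve t0"
    "\<And>h f f'. (f has_real_derivative f') (at t0) \<Longrightarrow> (\<And>u. 0 < u \<Longrightarrow> u < b1 D \<Longrightarrow> h (curve u) = f u) \<Longrightarrow>
      ((\<lambda>u. h (c u)) has_real_derivative f' * x') (at t)"
proof -
  define x where "x u = Re (fst (c u))" for u
  obtain c' where "(c has_vector_derivative c') (at t)" using c t unfolding C1_differentiable_on_def by blast
  from bounded_linear.has_vector_derivative[OF bounded_linear_compose[OF bounded_linear_Re bounded_linear_fst] this]
  have x': "(x has_real_derivative Re (fst c')) (at t)"
    by (simp add: x_def[abs_def] has_real_derivative_iff_has_vector_derivative)
  have cu: "0 < x u \<and> x u < b1 D \<and> c u = curve (x u)" if "u \<in> {a<..<b}" for u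
    using im that by (force simp: gamma_plus_eq x_def)
  show ?thesis
  proof (rule that[of "x t" "Re (fst c')"])
    show "0 < x t" "x t < b1 D" "c t = curve (x t)" using cu[OF t] by simp_all
    fix h f f' assume f: "(f has_real_derivative f') (at (x t))"
      and h: "\<And>u. 0 < u \<Longrightarrow> u < b1 D \<Longrightarrow> h (curve u) = f u"
    have "((\<lambda>u. f (x u)) has_real_derivative f' * Re (fst c')) (at t)" by (rule DERIV_chain2[OF f x'])
    then show "((\<lambda>u. h (c u)) has_real_derivative f' * Re (fst c')) (at t)"
      by (rule has_field_derivative_transform_within_open[OF _ open_greaterThanLessThan t]) (use cu h in simp)
  qed
qed

lemma r_curve: 
  assumes "0 < t" "t < b1 D"
  shows "r1 (curve t) = t" "r2 (curve t) = phi D t" "r1 (T D (curve t)) = F1 t" "r2 (T D (curve t)) = F2 t"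
  using assms F1_pos[of t] F2_pos[of t] phi_pos[of t] by (simp_all add: r1_def r2_def T_curve)

lemma one_form_1: "one_form_vanishes_along (gamma_plus D) (r1 \<circ> T D) r1 (r2 \<circ> T D) r2"
  unfolding one_form_vanishes_along_def o_def
proof (intro allI impI ballI)
  fix c a b t assume "c C1_differentiable_on {a<..<b} \<and> c ` {a<..<b} \<subseteq> gamma_plus D" "t \<in> {a<..<b}"
  then obtain t0 x' where t0: "0 < t0" "t0 < b1 D" "c t = curve t0"
    and *: "\<And>h f f'. (f has_real_derivative f') (at t0) \<Longrightarrow> (\<And>u. 0 < u \<Longrightarrow> u < b1 D \<Longrightarrow> h (curve u) = f u) \<Longrightarrow>
      ((\<lambda>u. h (c u)) has_real_derivative f' * x') (at t)"
    using DERIV_along_curve by metis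
  have d: "((\<lambda>u. r1 (c u)) has_real_derivative 1 * x') (at t)" "((\<lambda>u. r2 (c u)) has_real_derivative deriv (phi D) t0 * x') (at t)"
    by (rule *[OF DERIV_ident], simp add: r_curve, rule *[OF phi_DERIV], use t0 in \<open>simp_all add: r_curve\<close>)
  have "F2 t0 \<noteq> 0" using F2_pos[of t0] t0 by simp
  then have "r1 (T D (c t)) * (1 * x') + r2 (T D (c t)) * (deriv (phi D) t0 * x') = 0"
    using t0 by (simp add: r_curve deriv_phi)
  with d show "\<exists>d\<^sub>1 d\<^sub>2. ((\<lambda>u. r1 (c u)) has_real_derivative d\<^sub>1) (at t) \<and>
      ((\<lambda>u. r2 (c u)) has_real_derivative d\<^sub>2) (at t) \<and> r1 (T D (c t)) * d\<^sub>1 + r2 (T D (c t)) * d\<^sub>2 = 0" by blast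
qed

lemma one_form_2: "one_form_vanishes_along (gamma_plus D) r1 (r1 \<circ> T D) r2 (r2 \<circ> T D)"
  unfolding one_form_vanishes_along_def o_def
proof (intro allI impI ballI)
  fix c a b t assume "c C1_differentiable_on {a<..<b} \<and> c ` {a<..<b} \<subseteq> gamma_plus D" "t \<in> {a<..<b}"
  then obtain t0 x' where t0: "0 < t0" "t0 < b1 D" "c t = curve t0"
    and *: "\<And>h f f'. (f has_real_derivative f') (at t0) \<Longrightarrow> (\<And>u. 0 < u \<Longrightarrow> u < b1 D \<Longrightarrow> h (curve u) = f u) \<Longrightarrow>
      ((\<lambda>u. h (c u)) has_real_derivative f' * x') (at t)"
    using DERIV_along_curve by metis
  have d: "((\<lambda>u. r1 (T D (c u))) has_real_derivative F1' t0 * x') (at t)"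
    "((\<lambda>u. r2 (T D (c u))) has_real_derivative F2' t0 * x') (at t)"
    by (rule *[where h = "\<lambda>z. r1 (T D z)", OF F_DERIV(1)], use t0 in \<open>simp_all add: r_curve\<close>)
       (rule *[where h = "\<lambda>z. r2 (T D z)", OF F_DERIV(2)], use t0 in \<open>simp_all add: r_curve\<close>)
  have "r1 (c t) * (F1' t0 * x') + r2 (c t) * (F2' t0 * x') = 0"
    using t0 by (simp add: r_curve F1'_def F2'_def)
  with d show "\<exists>d\<^sub>1 d\<^sub>2. ((\<lambda>u. r1 (T D (c u))) has_real_derivative d\<^sub>1) (at t) \<and>
      ((\<lambda>u. r2 (T D (c u))) has_real_derivative d\<^sub>2) (at t) \<and> r1 (c t) * d\<^sub>1 + r2 (c t) * d\<^sub>2 = 0" by blast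
qed

text \<open>In this form \<open>p - 1\<close> is the derivative of \<open>ln F1\<close> with respect
  to \<open>ln t\<close>.\<close>

lemma p_fun_curve:
  assumes "0 < t" "t < b1 D"
  shows "p_fun D (curve t) = 1 + t * F1' t / F1 t"
proof -
  have "M t > 0" "F1 t = - deriv (phi D) t / M t" using M_F[of t] assms by auto
  moreover have "deriv (phi D) t \<noteq> 0" using deriv_phi_neg[OF assms] by simp
  ultimately show ?thesis
    using assms by (simp add: p_fun_def r1_def F1'_def M_def[symmetric] power2_eq_square field_simps)
qed

lemma p_fun_gt_1: "0 < t \<Longrightarrow> t < b1 D \<Longrightarrow> 1 < p_fun D (curve t)"
  using F1'_pos[of t] F1_pos[of t] by (simp add: p_fun_curve)

lemma F1_bounds:
  assumes "0 < t" "t < b1 D"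
  shows "0 < F1 t" "F1 t < b1 (polar D)" "rtilde.curve (polar D) (F1 t) = T D (curve t)"
    "rtilde.F1 (polar D) (F1 t) = t"
proof -
  interpret P: rtilde "polar D" by (rule rtilde_polar)
  have g: "curve t \<in> gamma_plus D" using assms by (auto simp: gamma_plus_eq)
  have "T D (curve t) \<in> P.curve ` {0<..<b1 (polar D)}" using T_gamma_plus[OF g] by (simp add: P.gamma_plus_eq)
  then obtain y where y: "0 < y" "y < b1 (polar D)" "T D (curve t) = P.curve y" by auto
  moreover have "F1 t = y" by (simp add: F1_def y(3))
  ultimately show 1: "0 < F1 t" "F1 t < b1 (polar D)" "P.curve (F1 t) = T D (curve t)" by simp_all
  show "P.F1 (F1 t) = t"
    unfolding P.F1_def 1(3) T_T[OF gamma_plus_frontier[OF g]] by simp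
qed

text \<open>The functions \<open>F1\<close> of \<open>D\<close> and of its polar are mutually
  inverse, so their logarithmic derivatives, which are the two values of \<open>p - 1\<close>, are
  reciprocal.\<close>

lemma p_fun_conjugate:
  assumes "0 < t" "t < b1 D"
  shows "(p_fun D (curve t) - 1) * (p_fun (polar D) (T D (curve t)) - 1) = 1"
    "p_fun (polar D) (T D (curve t)) > 1"
proof -
  interpret P: rtilde "polar D" by (rule rtilde_polar)
  note b = F1_bounds[OF assms]
  have tI: "t \<in> {0<..<b1 D}" using assms by simp
  have "((\<lambda>t. P.F1 (F1 t)) has_real_derivative P.F1' (F1 t) * F1' t) (at t)"
    by (rule DERIV_chain2[OF P.F_DERIV(1)[OF b(1,2)] F_DERIV(1)[OF assms]])
  then have "((\<lambda>t. t) has_real_derivative P.F1' (F1 t) * F1' t) (at t)"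
    by (rule has_field_derivative_transform_within_open[OF _ open_greaterThanLessThan tI])
      (use F1_bounds(4) in auto)
  then have 1: "P.F1' (F1 t) * F1' t = 1" using DERIV_ident DERIV_unique by blast
  have "p_fun (polar D) (T D (curve t)) = 1 + F1 t * P.F1' (F1 t) / t"
    using P.p_fun_curve[OF b(1,2)] by (simp add: b)
  then have "(p_fun D (curve t) - 1) * (p_fun (polar D) (T D (curve t)) - 1) = P.F1' (F1 t) * F1' t"
    using assms b(1) by (simp add: p_fun_curve)
  then show "(p_fun D (curve t) - 1) * (p_fun (polar D) (T D (curve t)) - 1) = 1" using 1 by simp
  show "p_fun (polar D) (T D (curve t)) > 1" using P.p_fun_gt_1[OF b(1,2)] by (simp add: b)
qed

lemma p_fun_T:
  assumes "\<zeta> \<in> gamma_plus D"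
  shows "1 / p_fun D \<zeta> + 1 / p_fun (polar D) (T D \<zeta>) = 1"
    and "p_fun (polar D) (T D \<zeta>) = conjugate_exponent (p_fun D \<zeta>)"
proof -
  obtain t where t: "0 < t" "t < b1 D" "\<zeta> = curve t" using assms by (auto simp: gamma_plus_eq)
  define p q where "p = p_fun D \<zeta>" and "q = p_fun (polar D) (T D \<zeta>)"
  have pq: "(p - 1) * (q - 1) = 1" "1 < p" "1 < q"
    using p_fun_conjugate[OF t(1,2)] p_fun_gt_1[OF t(1,2)] by (simp_all add: p_def q_def t(3))
  then have *: "p + q = p * q" by (simp add: algebra_simps)
  then show "1 / p_fun D \<zeta> + 1 / p_fun (polar D) (T D \<zeta>) = 1"
    using pq by (simp add: p_def[symmetric] q_def[symmetric] field_simps)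
  have "q * (p - 1) = p" using * by (simp add: algebra_simps)
  then show "p_fun (polar D) (T D \<zeta>) = conjugate_exponent (p_fun D \<zeta>)"
    using pq(2) by (simp add: p_def[symmetric] q_def[symmetric] conjugate_exponent_def field_simps)
qed

subsection \<open>The coordinate \<open>s\<close>\<close>

text \<open>The coordinate \<open>s\<close> as a function of \<open>r1\<close>, by
  \<open>s_coord_frontier\<close>.\<close>

definition S :: "real \<Rightarrow> real" where "S t = t * F1 t"

lemma S_ends: "S 0 = 0" "S (b1 D) = 1"
  using F_supports(1)[of "b1 D"] F_zero b1_pos by (simp_all add: S_def mult.commute)

lemma continuous_on_S: "continuous_on {0..b1 D} S"
  unfolding S_def by (intro continuous_intros continuous_on_subset[OF continuous_on_F(1)]) auto

lemma S_strict_mono: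
  assumes "0 \<le> t" "t < u" "u \<le> b1 D" shows "S t < S u"
proof (rule DERIV_pos_imp_increasing_open[OF assms(2)])
  fix x assume x: "t < x" "x < u"
  then have x': "0 < x" "x < b1 D" using assms by auto
  have "(S has_real_derivative F1 x + x * F1' x) (at x)"
    unfolding S_def by (rule derivative_eq_intros F_DERIV(1)[OF x'] refl)+ simp
  moreover have "F1 x + x * F1' x > 0" using F1_pos[of x] F1'_pos[OF x'] x' by (simp add: add_pos_pos)
  ultimately show "\<exists>y. (S has_real_derivative y) (at x) \<and> 0 < y" by blast
qed (rule continuous_on_subset[OF continuous_on_S], use assms in auto)

lemma S_inj: "inj_on S {0..b1 D}"
  by (rule linorder_inj_onI) (use S_strict_mono in fastforce)+

lemma s_coord_curve: "0 \<le> t \<Longrightarrow> t \<le> b1 D \<Longrightarrow> s_coord D (curve t) = S t"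
  using s_coord_frontier[OF curve_frontier[of t]] F1_nonneg[of t] T_curve[of t] by (simp add: r1_def S_def)

lemma S_image: "S ` {0..b1 D} = {0..1}" "S ` {0<..<b1 D} = {0<..<1}"
proof -
  have im: "\<exists>x. 0 \<le> x \<and> x \<le> b1 D \<and> S x = y" if "0 \<le> y" "y \<le> 1" for y
    using IVT'[of S 0 y "b1 D"] continuous_on_S that S_ends b1_pos by auto
  have le: "0 \<le> S x \<and> S x \<le> 1" if "0 \<le> x" "x \<le> b1 D" for x
    using S_strict_mono[of 0 x] S_strict_mono[of x "b1 D"] S_ends that by force
  show "S ` {0..b1 D} = {0..1}"
  proof (intro equalityI subsetI)
    fix y :: real assume "y \<in> {0..1}"
    then obtain x where "0 \<le> x" "x \<le> b1 D" "S x = y" using im[of y] by auto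
    then show "y \<in> S ` {0..b1 D}" by (intro image_eqI[of _ _ x]) auto
  qed (use le in auto)
  show "S ` {0<..<b1 D} = {0<..<1}"
  proof (intro equalityI subsetI)
    fix y assume "y \<in> S ` {0<..<b1 D}"
    then show "y \<in> {0<..<1}" using S_strict_mono[of 0] S_strict_mono[of _ "b1 D"] S_ends by fastforce
  next
    fix y :: real assume y: "y \<in> {0<..<1}"
    then obtain x where "0 \<le> x" "x \<le> b1 D" "S x = y" using im[of y] by auto
    then show "y \<in> S ` {0<..<b1 D}" using S_ends y by (intro image_eqI[of _ _ x]) (auto simp: less_le)
  qed
qed

lemma bij_s_coord: "bij_betw (s_coord D) (gamma_plus D) {0<..<1}"
proof -
  have "s_coord D ` gamma_plus D = S ` {0<..<b1 D}"
    unfolding gamma_plus_eq image_image by (intro image_cong) (simp_all add: s_coord_curve)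
  moreover have "inj_on (s_coord D) (gamma_plus D)"
  proof (rule inj_onI)
    fix x y assume "x \<in> gamma_plus D" "y \<in> gamma_plus D" and eq: "s_coord D x = s_coord D y"
    then obtain t u where t: "t \<in> {0<..<b1 D}" "x = curve t" and u: "u \<in> {0<..<b1 D}" "y = curve u"
      unfolding gamma_plus_eq by blast
    have "S t = S u" using eq t u by (simp add: s_coord_curve)
    then have "t = u" using inj_onD[OF S_inj, of t u] t(1) u(1) by simp
    then show "x = y" using t u by simp
  qed
  ultimately show ?thesis by (simp add: bij_betw_def S_image)
qed

lemma s_inv: 
  assumes "\<sigma> \<in> {0<..<1}" shows "s_inv D \<sigma> \<in> gamma_plus D" "s_coord D (s_inv D \<sigma>) = \<sigma>"
  using assms bij_s_coord unfolding s_inv_def bij_betw_def by (metis inv_into_into, metis f_inv_into_f)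

lemma s_inv_eqI: "\<zeta> \<in> gamma_plus D \<Longrightarrow> s_coord D \<zeta> = \<sigma> \<Longrightarrow> s_inv D \<sigma> = \<zeta>"
  using bij_s_coord unfolding s_inv_def bij_betw_def by (auto intro: inv_into_f_eq)

lemma s_inv_polar:
  assumes "\<sigma> \<in> {0<..<1}" shows "s_inv (polar D) \<sigma> = T D (s_inv D \<sigma>)"
proof -
  interpret P: rtilde "polar D" by (rule rtilde_polar)
  show ?thesis
    using s_inv[OF assms] by (intro P.s_inv_eqI T_gamma_plus) (simp_all add: s_coord_T gamma_plus_frontier)
qed

lemma r_s_inv:
  assumes "\<sigma> \<in> {0<..<1}"
  shows "0 < r1 (s_inv D \<sigma>)" "0 < r2 (s_inv D \<sigma>)"
    "s_inv D \<sigma> = (complex_of_real (r1 (s_inv D \<sigma>)), complex_of_real (r2 (s_inv D \<sigma>)))"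
  using s_inv(1)[OF assms] unfolding gamma_plus_def r1_def r2_def by auto

text \<open>\<open>r1\<close> as a function of \<open>s\<close> inverts the continuous injection
  \<open>S\<close> on a compact interval; \<open>r2\<close> follows through
  \<open>phi D\<close>.\<close>

lemma continuous_on_r_s_inv:
  "continuous_on {0<..<1} (\<lambda>\<sigma>. r1 (s_inv D \<sigma>))" "continuous_on {0<..<1} (\<lambda>\<sigma>. r2 (s_inv D \<sigma>))"
proof -
  have "continuous_on (S ` {0..b1 D}) (inv_into {0..b1 D} S)"
    by (rule continuous_on_inv[OF continuous_on_S]) (use S_inj in auto)
  then have ci: "continuous_on {0<..<1} (inv_into {0..b1 D} S)"
    unfolding S_image by (rule continuous_on_subset) auto
  have eq: "inv_into {0..b1 D} S \<sigma> = r1 (s_inv D \<sigma>)" "r2 (s_inv D \<sigma>) = phi D (r1 (s_inv D \<sigma>))"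
    "r1 (s_inv D \<sigma>) \<in> {0<..<b1 D}" if \<sigma>: "\<sigma> \<in> {0<..<1}" for \<sigma>
  proof -
    obtain t where t: "0 < t" "t < b1 D" "s_inv D \<sigma> = curve t" using s_inv(1)[OF \<sigma>] by (auto simp: gamma_plus_eq)
    then have "S t = \<sigma>" using s_inv(2)[OF \<sigma>] by (simp add: s_coord_curve)
    then show "inv_into {0..b1 D} S \<sigma> = r1 (s_inv D \<sigma>)" "r2 (s_inv D \<sigma>) = phi D (r1 (s_inv D \<sigma>))"
       "r1 (s_inv D \<sigma>) \<in> {0<..<b1 D}"
      using t S_inj by (auto simp: r_curve intro!: inv_into_f_eq)
  qed
  show c: "continuous_on {0<..<1} (\<lambda>\<sigma>. r1 (s_inv D \<sigma>))"
    by (rule continuous_on_eq[OF ci eq(1)])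
  have "continuous_on {0<..<1} (\<lambda>\<sigma>. phi D (r1 (s_inv D \<sigma>)))"
    by (rule continuous_on_compose2[OF continuous_on_phi c]) (use eq(3) b1_pos in force)
  then show "continuous_on {0<..<1} (\<lambda>\<sigma>. r2 (s_inv D \<sigma>))" by (rule continuous_on_eq) (simp add: eq)
qed

text \<open>\<open>T\<close> sends the end points of the profile of \<open>D\<close> to those of the
  polar. There the support identity has a single term, which makes the coordinates
  reciprocal.\<close>

lemma b_polar: "b1 (polar D) = inverse (b1 D)" "b2 (polar D) = inverse (b2 D)"
proof -
  interpret P: rtilde "polar D" by (rule rtilde_polar)
  have b: "\<bar>b1 D\<bar> \<le> b1 D" "\<bar>0\<bar> \<le> b1 D" using b1_pos by auto
  have F1b: "F1 (b1 D) * b1 D = 1" using F_supports(1)[OF b(1)] F_zero by simp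
  then have F1b': "F1 (b1 D) = inverse (b1 D)" using b1_pos by (simp add: field_simps)
  have "T D (curve (b1 D)) \<in> frontier (polar D)" by (rule T_frontier[OF curve_frontier[OF b(1)]])
  then have "\<bar>F1 (b1 D)\<bar> \<le> b1 (polar D)" "0 = phi (polar D) (F1 (b1 D))"
    by (simp_all add: T_curve[OF b(1)] P.frontier_iff_phi F_zero P.phi_abs)
  then show "b1 (polar D) = inverse (b1 D)" using P.phi_pos[of "F1 (b1 D)"] b1_pos unfolding F1b' by force
  have F2b: "F2 0 * phi D 0 = 1" using F_supports(1)[OF b(2)] by simp
  have "T D (curve 0) \<in> frontier (polar D)" by (rule T_frontier[OF curve_frontier[OF b(2)]])
  then have "\<bar>F2 0\<bar> = phi (polar D) 0"
    by (simp add: T_curve[OF b(2)] P.frontier_iff_phi F_zero)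
  moreover have "F2 0 > 0" using F2_pos[of 0] b1_pos by simp
  ultimately show "b2 (polar D) = inverse (b2 D)" using inverse_unique[of "phi D 0" "F2 0"] F2b unfolding b2_def by (simp add: mult.commute)
qed

lemma generated_by_polar:
  assumes "generated_by D q \<beta>\<^sub>2 \<beta>\<^sub>1"
  shows "generated_by (polar D) (\<lambda>\<sigma>. conjugate_exponent (q \<sigma>)) (inverse \<beta>\<^sub>2) (inverse \<beta>\<^sub>1)"
  unfolding generated_by_def
proof (intro conjI ballI)
  show "b2 (polar D) = inverse \<beta>\<^sub>2" "b1 (polar D) = inverse \<beta>\<^sub>1"
    using assms b_polar by (simp_all add: generated_by_def)
  fix \<sigma> :: real assume \<sigma>: "\<sigma> \<in> {0<..<1}"
  have "p_breve D \<sigma> = q \<sigma>" using assms \<sigma> by (simp add: generated_by_def)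
  then show "p_breve (polar D) \<sigma> = conjugate_exponent (q \<sigma>)"
    using p_fun_T(2)[OF s_inv(1)[OF \<sigma>]] by (simp add: p_breve_def s_inv_polar[OF \<sigma>])
qed

end

subsection \<open>Power-like behaviour at the axes\<close>

text \<open>The notion concerns only the germ at 0. This matters for the inverse of
  \<open>phi D\<close>, which is compared with another profile function on an initial interval
  only.\<close>

lemma power_like_cong:
  assumes "power_like_at_0 f b c p" "d > 0" and eq: "\<And>r. r \<in> {0..<d} \<Longrightarrow> g r = f r"
  shows "power_like_at_0 g b c p"
proof -
  obtain \<delta> \<epsilon> \<epsilon>' \<epsilon>'' where \<delta>: "\<delta> > 0" and f: "\<forall>r\<in>{0..<\<delta>}. f r = b - c * r powr p + \<epsilon> r"
    and 1: "\<forall>r\<in>{0..<\<delta>}. (\<epsilon> has_real_derivative \<epsilon>' r) (at r within {0..<\<delta>})" "continuous_on {0..<\<delta>} \<epsilon>'"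
    and 2: "\<forall>r\<in>{0<..<\<delta>}. (\<epsilon>' has_real_derivative \<epsilon>'' r) (at r)" "continuous_on {0<..<\<delta>} \<epsilon>''"
    and 0: "\<epsilon> 0 = 0" "\<epsilon>' 0 = 0" "\<epsilon>'' \<in> o[at_right 0](\<lambda>r. r powr (p - 2))"
    using assms(1) unfolding power_like_at_0_def by blast
  define m where "m = min \<delta> d"
  have m: "m > 0" "m \<le> \<delta>" "m \<le> d" using \<delta> assms(2) by (auto simp: m_def)
  have sub: "{0..<m} \<subseteq> {0..<\<delta>}" "{0<..<m} \<subseteq> {0<..<\<delta>}" using m by auto
  show ?thesis
    unfolding power_like_at_0_def
  proof (intro exI conjI ballI)
    show "g r = b - c * r powr p + \<epsilon> r" if "r \<in> {0..<m}" for r using that m f eq by auto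
    show "(\<epsilon> has_real_derivative \<epsilon>' r) (at r within {0..<m})" if "r \<in> {0..<m}" for r
      using that 1(1) sub DERIV_subset by blast
    show "(\<epsilon>' has_real_derivative \<epsilon>'' r) (at r)" if "r \<in> {0<..<m}" for r using that 2(1) sub by blast
  qed (use m 0 continuous_on_subset[OF 1(2) sub(1)] continuous_on_subset[OF 2(2) sub(2)] in simp_all)
qed

lemma tendsto_eq_eventually:
  assumes "(f \<longlongrightarrow> l) F" "eventually (\<lambda>x. f x = g x) F" "l = l'"
  shows "(g \<longlongrightarrow> l') F"
  using Lim_transform_eventually[OF assms(1,2)] assms(3) by simp

lemma powr_tendsto_0: "0 < a \<Longrightarrow> ((\<lambda>r::real. r powr a) \<longlongrightarrow> 0) (at_right 0)"
  by (rule tendsto_zero_powrI[OF _ tendsto_const])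
    (auto intro!: tendsto_intros simp: eventually_at_filter)

text \<open>At 0 the difference quotient is \<open>y powr (p - 1)\<close>, which tends to 0, and
  \<open>0 powr (p - 1)\<close> is 0 as well.\<close>

lemma powr_DERIV_within:
  fixes p r :: real
  assumes "1 < p" "r \<in> {0..<\<delta>}"
  shows "((\<lambda>r. r powr p) has_real_derivative p * r powr (p - 1)) (at r within {0..<\<delta>})"
proof (cases "r = 0")
  case False
  then have "0 < r" using assms by auto
  from has_real_derivative_powr[OF this, of p] show ?thesis by (rule has_field_derivative_at_within)
next
  case True
  have le: "at (0::real) within {0..<\<delta>} \<le> at_right 0"
    unfolding at_within_def by (intro inf_mono) auto
  have "((\<lambda>y::real. y powr (p - 1)) \<longlongrightarrow> 0) (at 0 within {0..<\<delta>})"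
    by (rule tendsto_mono[OF le powr_tendsto_0]) (use assms in simp)
  moreover have "eventually (\<lambda>y. y powr (p - 1) = (y powr p - 0 powr p) / (y - 0)) (at 0 within {0..<\<delta>})"
    by (auto simp: eventually_at_filter powr_diff)
  ultimately have "((\<lambda>y. (y powr p - 0 powr p) / (y - 0)) \<longlongrightarrow> 0) (at 0 within {0..<\<delta>})"
    by (rule Lim_transform_eventually)
  then show ?thesis using True by (simp add: has_field_derivative_iff)
qed

text \<open>For such an \<open>f\<close> the remainder is determined by \<open>f\<close> and has the
  required regularity automatically. Its value at 0 amounts to \<open>f 0 = b\<close>, and the
  little-o bound to the limit of the rescaled second derivative.\<close>

lemma power_like_iff:
  fixes f f' f'' :: "real \<Rightarrow> real"
  assumes r0: "r0 > 0" and d1: "\<And>r. r \<in> {0..<r0} \<Longrightarrow> (f has_real_derivative f' r) (at r within {0..<r0})"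
    and c1: "continuous_on {0..<r0} f'" and "f' 0 = 0"
    and d2: "\<And>r. r \<in> {0<..<r0} \<Longrightarrow> (f' has_real_derivative f'' r) (at r)"
    and c2: "continuous_on {0<..<r0} f''" and p: "p > 1"
  shows "power_like_at_0 f b c p \<longleftrightarrow>
    f 0 = b \<and> ((\<lambda>r. f'' r / r powr (p - 2)) \<longlongrightarrow> - c * p * (p - 1)) (at_right 0)"
proof
  assume "power_like_at_0 f b c p"
  then obtain \<delta> \<epsilon> \<epsilon>' \<epsilon>'' where \<delta>: "\<delta> > 0" and f: "\<forall>r\<in>{0..<\<delta>}. f r = b - c * r powr p + \<epsilon> r"
    and e1: "\<forall>r\<in>{0..<\<delta>}. (\<epsilon> has_real_derivative \<epsilon>' r) (at r within {0..<\<delta>})"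
    and e2: "\<forall>r\<in>{0<..<\<delta>}. (\<epsilon>' has_real_derivative \<epsilon>'' r) (at r)"
    and 0: "\<epsilon> 0 = 0" "\<epsilon>'' \<in> o[at_right 0](\<lambda>r. r powr (p - 2))"
    unfolding power_like_at_0_def by blast
  define m where "m = min \<delta> r0"
  have m: "m > 0" "m \<le> \<delta>" "m \<le> r0" using \<delta> r0 by (auto simp: m_def)
  have at: "(g has_real_derivative l) (at r)" if "(g has_real_derivative l) (at r within {0..<a})" "0 < r" "r < a" for g l r a
    using that at_within_interior[of r "{0..<a}"] by (simp add: interior_atLeastLessThan)
  have f': "f' r = - c * p * r powr (p - 1) + \<epsilon>' r" if r: "r \<in> {0<..<m}" for r
  proof -
    have "((\<lambda>r. b - c * r powr p + \<epsilon> r) has_real_derivative - c * p * r powr (p - 1) + \<epsilon>' r) (at r)"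
      by (rule derivative_eq_intros has_real_derivative_powr at[of \<epsilon> "\<epsilon>' r" r \<delta>] refl | use r m e1 in simp)+
    then have "(f has_real_derivative - c * p * r powr (p - 1) + \<epsilon>' r) (at r)"
      by (rule has_field_derivative_transform_within_open[OF _ open_greaterThanLessThan r]) (use f m in auto)
    moreover have "(f has_real_derivative f' r) (at r)" by (rule at[OF d1]) (use r m in auto)
    ultimately show ?thesis using DERIV_unique by blast
  qed
  have f'': "f'' r = - c * p * (p - 1) * r powr (p - 2) + \<epsilon>'' r" if r: "r \<in> {0<..<m}" for r
  proof -
    have "((\<lambda>r. - c * p * r powr (p - 1) + \<epsilon>' r) has_real_derivative - c * p * (p - 1) * r powr (p - 2) + \<epsilon>'' r) (at r)"
      by (rule derivative_eq_intros has_real_derivative_powr e2[rule_format] refl | use r m in \<open>simp add: algebra_simps\<close>)+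
    then have "(f' has_real_derivative - c * p * (p - 1) * r powr (p - 2) + \<epsilon>'' r) (at r)"
      by (rule has_field_derivative_transform_within_open[OF _ open_greaterThanLessThan r]) (simp add: f')
    moreover have "(f' has_real_derivative f'' r) (at r)" by (rule d2) (use r m in auto)
    ultimately show ?thesis using DERIV_unique by blast
  qed
  have "((\<lambda>r. \<epsilon>'' r / r powr (p - 2)) \<longlongrightarrow> 0) (at_right 0)" by (rule smalloD_tendsto[OF 0(2)])
  from tendsto_add[OF tendsto_const[of "- c * p * (p - 1)"] this]
  have "((\<lambda>r. - c * p * (p - 1) + \<epsilon>'' r / r powr (p - 2)) \<longlongrightarrow> - c * p * (p - 1)) (at_right 0)" by simp
  moreover have "eventually (\<lambda>r. r \<in> {0<..<m}) (at_right (0::real))"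
    using eventually_at_right_real[OF m(1)] .
  then have "eventually (\<lambda>r. - c * p * (p - 1) + \<epsilon>'' r / r powr (p - 2) = f'' r / r powr (p - 2)) (at_right 0)"
    by eventually_elim (simp add: f'' field_simps)
  ultimately have "((\<lambda>r. f'' r / r powr (p - 2)) \<longlongrightarrow> - c * p * (p - 1)) (at_right 0)"
    by (rule Lim_transform_eventually)
  moreover have "f 0 = b" using f \<delta> 0(1) p by simp
  ultimately show "f 0 = b \<and> ((\<lambda>r. f'' r / r powr (p - 2)) \<longlongrightarrow> - c * p * (p - 1)) (at_right 0)" by blast
next
  assume lim: "f 0 = b \<and> ((\<lambda>r. f'' r / r powr (p - 2)) \<longlongrightarrow> - c * p * (p - 1)) (at_right 0)"
  define \<epsilon> \<epsilon>' \<epsilon>'' where "\<epsilon> r = f r - b + c * r powr p" and "\<epsilon>' r = f' r + c * (p * r powr (p - 1))"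
    and "\<epsilon>'' r = f'' r + c * (p * ((p - 1) * r powr (p - 2)))" for r
  show "power_like_at_0 f b c p"
    unfolding power_like_at_0_def
  proof (intro exI conjI ballI)
    show "f r = b - c * r powr p + \<epsilon> r" for r by (simp add: \<epsilon>_def)
    show "(\<epsilon> has_real_derivative \<epsilon>' r) (at r within {0..<r0})" if "r \<in> {0..<r0}" for r
      unfolding \<epsilon>_def \<epsilon>'_def
      using DERIV_add[OF DERIV_diff[OF d1[OF that] DERIV_const] DERIV_cmult[OF powr_DERIV_within[OF p that]], of b c] by simp
    show "continuous_on {0..<r0} \<epsilon>'"
      unfolding \<epsilon>'_def by (intro continuous_intros c1 continuous_on_powr') (use p in auto)
    show "(\<epsilon>' has_real_derivative \<epsilon>'' r) (at r)" if "r \<in> {0<..<r0}" for r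
    proof -
      have "((\<lambda>r. r powr (p - 1)) has_real_derivative (p - 1) * r powr (p - 2)) (at r)"
        using has_real_derivative_powr[of r "p - 1"] that by simp
      from DERIV_add[OF d2[OF that] DERIV_cmult[OF DERIV_cmult[OF this, of p], of c]]
      show ?thesis unfolding \<epsilon>'_def \<epsilon>''_def .
    qed
    show "continuous_on {0<..<r0} \<epsilon>''"
      unfolding \<epsilon>''_def by (intro continuous_intros c2 continuous_on_powr) auto
    show "\<epsilon>'' \<in> o[at_right 0](\<lambda>r. r powr (p - 2))"
    proof (rule smalloI_tendsto)
      from tendsto_add[OF conjunct2[OF lim] tendsto_const[of "c * p * (p - 1)"]]
      have "((\<lambda>r. f'' r / r powr (p - 2) + c * p * (p - 1)) \<longlongrightarrow> 0) (at_right 0)" by (simp add: algebra_simps)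
      moreover have "eventually (\<lambda>r. f'' r / r powr (p - 2) + c * p * (p - 1) = \<epsilon>'' r / r powr (p - 2)) (at_right 0)"
        by (auto simp: eventually_at_filter \<epsilon>''_def field_simps)
      ultimately show "((\<lambda>r. \<epsilon>'' r / r powr (p - 2)) \<longlongrightarrow> 0) (at_right 0)" by (rule Lim_transform_eventually)
      show "eventually (\<lambda>r. r powr (p - 2) \<noteq> 0) (at_right (0::real))" by (auto simp: eventually_at_filter)
    qed
    show "\<epsilon> 0 = 0" "\<epsilon>' 0 = 0" using lim p assms(4) by (simp_all add: \<epsilon>_def \<epsilon>'_def)
  qed (use r0 in simp)
qed

context rtilde begin

text \<open>What is left of \<open>power_like_at_0\<close> for the profile, whose value and slope at
  0 are known; see \<open>power_like_phi_iff\<close>.\<close>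

definition power_lim :: "real \<Rightarrow> real \<Rightarrow> bool" where
  "power_lim c p \<longleftrightarrow> ((\<lambda>r. deriv (deriv (phi D)) r / r powr (p - 2)) \<longlongrightarrow> - c * p * (p - 1)) (at_right 0)"

lemma deriv_phi_0: "deriv (phi D) 0 = 0"
  using deriv_phi[of 0] b1_pos by (simp add: F_zero)

lemma power_like_phi_iff:
  assumes "p > 1" shows "power_like_at_0 (phi D) (b2 D) c p \<longleftrightarrow> power_lim c p"
proof -
  have "power_like_at_0 (phi D) (b2 D) c p \<longleftrightarrow> phi D 0 = b2 D \<and> power_lim c p"
    unfolding power_lim_def
  proof (rule power_like_iff[OF b1_pos])
    show "(phi D has_real_derivative deriv (phi D) r) (at r within {0..<b1 D})" if "r \<in> {0..<b1 D}" for r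
      by (rule has_field_derivative_at_within[OF phi_DERIV]) (use that in auto)
    show "continuous_on {0..<b1 D} (deriv (phi D))"
      by (rule continuous_on_subset[OF continuous_on_deriv_phi]) (use b1_pos in auto)
    show "(deriv (phi D) has_real_derivative deriv (deriv (phi D)) r) (at r)" if "r \<in> {0<..<b1 D}" for r
      by (rule deriv_phi_DERIV) (use that in auto)
  qed (rule deriv_phi_0 continuous_on_deriv2_phi assms)+
  then show ?thesis by (simp add: b2_def)
qed

lemma near_0: "eventually (\<lambda>r. 0 < r \<and> r < b1 D) (at_right 0)"
  using eventually_at_right_real[OF b1_pos] by simp

lemma tendsto_at_0:
  "(phi D \<longlongrightarrow> phi D 0) (at_right 0)" "(F1 \<longlongrightarrow> F1 0) (at_right 0)" "(F2 \<longlongrightarrow> F2 0) (at_right 0)"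
proof -
  have 0: "0 \<in> {- b1 D<..<b1 D}" using b1_pos by simp
  have "(f \<longlongrightarrow> f 0) (at_right 0)" if "continuous_on {- b1 D..b1 D} f" for f :: "real \<Rightarrow> real"
  proof -
    have "continuous_on {- b1 D<..<b1 D} f" by (rule continuous_on_subset[OF that]) auto
    then have "isCont f 0" using 0 by (simp add: continuous_on_eq_continuous_at)
    then show ?thesis unfolding isCont_def by (rule filterlim_at_split[THEN iffD1, THEN conjunct2])
  qed
  then show "(phi D \<longlongrightarrow> phi D 0) (at_right 0)" "(F1 \<longlongrightarrow> F1 0) (at_right 0)" "(F2 \<longlongrightarrow> F2 0) (at_right 0)"
    using continuous_on_phi continuous_on_F by blast+
qed

lemma F1_at_right_0: "filterlim F1 (at_right 0) (at_right 0)"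
  unfolding filterlim_at
proof
  show "eventually (\<lambda>r. F1 r \<in> {0<..} \<and> F1 r \<noteq> 0) (at_right 0)"
    using near_0 by eventually_elim (use F1_pos in force)
qed (use tendsto_at_0(2) in \<open>simp add: F_zero\<close>)

lemma M_tendsto: "(M \<longlongrightarrow> b2 D) (at_right 0)"
proof -
  have "((\<lambda>r. 1 / F2 r) \<longlongrightarrow> 1 / F2 0) (at_right 0)"
    using F2_pos[of 0] b1_pos by (intro tendsto_intros tendsto_at_0) auto
  moreover have "eventually (\<lambda>r. 1 / F2 r = M r) (at_right 0)"
    using near_0 by eventually_elim (simp add: M_F)
  moreover have "1 / F2 0 = b2 D"
    using F_supports(1)[of 0] b1_pos F2_pos[of 0] by (simp add: b2_def field_simps)
  ultimately show ?thesis by (rule tendsto_eq_eventually)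
qed

text \<open>L'Hopital's rule passes from \<open>phi''\<close> to \<open>phi'\<close>. Since
  \<open>F1\<close> is \<open>- phi' / M\<close> and \<open>M\<close> tends to \<open>b2 D\<close>,
  the other limits follow; the last one recovers the exponent as the boundary value of
  \<open>p_fun\<close>.\<close>

lemma power_lim_first_order:
  assumes p: "p > 1" and c: "c > 0" and "power_lim c p"
  shows "((\<lambda>r. deriv (phi D) r / r powr (p - 1)) \<longlongrightarrow> - c * p) (at_right 0)"
    "((\<lambda>r. F1 r / r powr (p - 1)) \<longlongrightarrow> c * p / b2 D) (at_right 0)"
    "((\<lambda>r. p_fun D (curve r)) \<longlongrightarrow> p) (at_right 0)"
proof -
  let ?d = "deriv (phi D)"
  have b2: "b2 D > 0" using phi_pos[of 0] b1_pos by (simp add: b2_def)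
  show lim1: "((\<lambda>r. ?d r / r powr (p - 1)) \<longlongrightarrow> - c * p) (at_right 0)"
  proof (rule lhopital_right_0[where f' = "deriv ?d" and g' = "\<lambda>r. (p - 1) * r powr (p - 2)"])
    show "(?d \<longlongrightarrow> 0) (at_right 0)"
    proof -
      have "((\<lambda>r. - F1 r / F2 r) \<longlongrightarrow> - F1 0 / F2 0) (at_right 0)"
        using F2_pos[of 0] b1_pos by (intro tendsto_intros tendsto_at_0) auto
      moreover have "eventually (\<lambda>r. - F1 r / F2 r = ?d r) (at_right 0)"
        using near_0 by eventually_elim (simp add: deriv_phi)
      ultimately show ?thesis by (rule tendsto_eq_eventually) (simp add: F_zero)
    qed
    show "((\<lambda>r. r powr (p - 1)) \<longlongrightarrow> 0) (at_right (0::real))" using p by (intro powr_tendsto_0) simp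
    show "eventually (\<lambda>r. r powr (p - 1) \<noteq> 0) (at_right (0::real))"
      "eventually (\<lambda>r. (p - 1) * r powr (p - 2) \<noteq> 0) (at_right (0::real))"
      using p by (auto simp: eventually_at_filter)
    show "eventually (\<lambda>r. (?d has_real_derivative deriv ?d r) (at r)) (at_right 0)"
      using near_0 by eventually_elim (use deriv_phi_DERIV in blast)
    show "eventually (\<lambda>r. ((\<lambda>r. r powr (p - 1)) has_real_derivative (p - 1) * r powr (p - 2)) (at r)) (at_right 0)"
      using near_0
    proof eventually_elim
      case (elim r)
      then show ?case using has_real_derivative_powr[of r "p - 1"] by simp
    qed
    have "((\<lambda>r. deriv ?d r / r powr (p - 2) * (1 / (p - 1))) \<longlongrightarrow> - c * p * (p - 1) * (1 / (p - 1))) (at_right 0)"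
      using assms(3) unfolding power_lim_def by (intro tendsto_intros)
    then show "((\<lambda>r. deriv ?d r / ((p - 1) * r powr (p - 2))) \<longlongrightarrow> - c * p) (at_right 0)"
      using p by (simp add: mult.commute)
  qed
  have "((\<lambda>r. - (?d r / r powr (p - 1)) / M r) \<longlongrightarrow> - (- c * p) / b2 D) (at_right 0)"
    using b2 by (intro tendsto_intros lim1 M_tendsto) auto
  moreover have "eventually (\<lambda>r. - (?d r / r powr (p - 1)) / M r = F1 r / r powr (p - 1)) (at_right 0)"
    using near_0 by eventually_elim (simp add: M_F)
  ultimately show "((\<lambda>r. F1 r / r powr (p - 1)) \<longlongrightarrow> c * p / b2 D) (at_right 0)"
    by (rule tendsto_eq_eventually) simp
  have "((\<lambda>r. 1 + (deriv ?d r / r powr (p - 2)) / (?d r / r powr (p - 1)) * (phi D r / M r)) \<longlongrightarrow>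
      1 + (- c * p * (p - 1)) / (- c * p) * (phi D 0 / b2 D)) (at_right 0)"
    using assms(3) c p b2 unfolding power_lim_def
    by (intro tendsto_intros lim1 M_tendsto tendsto_at_0) auto
  moreover have "eventually (\<lambda>r. 1 + (deriv ?d r / r powr (p - 2)) / (?d r / r powr (p - 1)) * (phi D r / M r) =
      p_fun D (curve r)) (at_right 0)"
    using near_0
  proof eventually_elim
    case (elim r)
    then have r: "0 < r" "r < b1 D" by auto
    have "r powr (p - 1) = r powr (p - 2) * r" using r by (simp add: powr_mult_base[symmetric] mult.commute[of _ r])
        (simp add: powr_mult_base)
    moreover have "M r > 0" using M_F(1)[of r] r by simp
    moreover have "?d r \<noteq> 0" using deriv_phi_neg[OF r] by simp
    moreover have "r powr (p - 2) > 0" using r by simp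
    ultimately show ?case
      using r by (simp add: p_fun_def r_curve M_def[symmetric] field_simps)
  qed
  ultimately show "((\<lambda>r. p_fun D (curve r)) \<longlongrightarrow> p) (at_right 0)"
    by (rule tendsto_eq_eventually) (use c p b2 in \<open>simp add: b2_def\<close>)
qed

text \<open>With \<open>x\<close> dual to \<open>y\<close>, the first-order asymptotics of \<open>y = F1 x\<close> invert to
  \<open>x ~ \<kappa> y powr (q - 1)\<close>, and the second derivative of the dual profile is expressed through
  \<open>x\<close> and the dual exponent function, whose limit is \<open>q\<close>.\<close>

lemma power_lim_polar:
  assumes p: "p > 1" and c: "c > 0" and lim: "power_lim c p"
  shows "\<exists>c'>0. rtilde.power_lim (polar D) c' (p / (p - 1))"
proof -
  interpret P: rtilde "polar D" by (rule rtilde_polar)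
  define q where "q = p / (p - 1)"
  have q: "q > 1" "q - 1 = 1 / (p - 1)" using p by (simp_all add: q_def field_simps)
  have b2: "b2 D > 0" using phi_pos[of 0] b1_pos by (simp add: b2_def)
  have b2P: "b2 (polar D) = inverse (b2 D)" by (rule b_polar)
  let ?x = "P.F1"
  let ?d = "deriv (phi (polar D))"
  \<comment> \<open>Solving \<open>y ~ (c * p / b2 D) * x powr (p - 1)\<close> for \<open>x\<close>
    raises the inverse constant to the power \<open>1 / (p - 1) = q - 1\<close>.\<close>
  define \<kappa> where "\<kappa> = (b2 D / (c * p)) powr (q - 1)"
  have \<kappa>: "\<kappa> > 0" using b2 c p by (simp add: \<kappa>_def)
  have x: "0 < ?x y" "?x y < b1 D" "F1 (?x y) = y" "T D (curve (?x y)) = P.curve y" if "0 < y" "y < b1 (polar D)" for y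
  proof -
    have "T (polar D) (P.curve y) = curve (?x y)" using P.F1_bounds(3)[OF that] by (simp add: bipolar)
    moreover have "P.curve y \<in> frontier (polar D)" using that by (intro P.curve_frontier) auto
    ultimately show "T D (curve (?x y)) = P.curve y" using P.T_T by (metis bipolar)
  qed (use P.F1_bounds[OF that] in \<open>simp_all add: bipolar\<close>)
  have "((\<lambda>y. F1 (?x y) / ?x y powr (p - 1)) \<longlongrightarrow> c * p / b2 D) (at_right 0)"
    by (rule filterlim_compose[OF power_lim_first_order(2)[OF p c lim] P.F1_at_right_0])
  from tendsto_powr[OF tendsto_inverse[OF this] tendsto_const[of "q - 1"]]
  have "((\<lambda>y. inverse (F1 (?x y) / ?x y powr (p - 1)) powr (q - 1)) \<longlongrightarrow> \<kappa>) (at_right 0)"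
    using b2 c p by (simp add: \<kappa>_def)
  moreover have "eventually (\<lambda>y. inverse (F1 (?x y) / ?x y powr (p - 1)) powr (q - 1) = ?x y / y powr (q - 1)) (at_right 0)"
    using P.near_0
  proof eventually_elim
    case (elim y)
    then have y: "0 < y" "0 < ?x y" "F1 (?x y) = y" using x[of y] by auto
    have "(?x y powr (p - 1)) powr (q - 1) = ?x y"
      using y p q by (simp add: powr_powr)
    then show ?case using y by (simp add: powr_divide)
  qed
  ultimately have lx: "((\<lambda>y. ?x y / y powr (q - 1)) \<longlongrightarrow> \<kappa>) (at_right 0)" by (rule Lim_transform_eventually)
  have lp: "((\<lambda>y. p_fun D (curve (?x y))) \<longlongrightarrow> p) (at_right 0)"
    by (rule filterlim_compose[OF power_lim_first_order(3)[OF p c lim] P.F1_at_right_0])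
  have lim_eq1: "phi (polar D) 0 * (P.F2 0)\<^sup>2 = b2 D"
  proof -
    have "P.F2 0 * phi (polar D) 0 = 1" using P.F_supports(1)[of 0] P.b1_pos by simp
    moreover have "phi (polar D) 0 = inverse (b2 D)" using b2P by (simp add: b2_def)
    ultimately show ?thesis using b2 by (simp add: power2_eq_square field_simps)
  qed
  \<comment> \<open>The right side has the shape \<open>- c' * q * (q - 1)\<close> demanded by
    \<open>power_lim\<close>, with \<open>c' = \<kappa> / (b2 D * q)\<close>.\<close>
  have lim_eq2: "- (1 / (p - 1)) * \<kappa> / b2 D = - (\<kappa> / (b2 D * q)) * q * (q - 1)"
    using q b2 by simp
  have "((\<lambda>y. - (1 / (p_fun D (curve (?x y)) - 1)) * (?x y / y powr (q - 1)) / (phi (polar D) y * (P.F2 y)\<^sup>2)) \<longlongrightarrow>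
      - (1 / (p - 1)) * \<kappa> / (phi (polar D) 0 * (P.F2 0)\<^sup>2)) (at_right 0)"
    using p P.F2_pos[of 0] P.b1_pos P.phi_pos[of 0]
    by (intro tendsto_intros lx lp P.tendsto_at_0) auto
  moreover have "eventually (\<lambda>y. - (1 / (p_fun D (curve (?x y)) - 1)) * (?x y / y powr (q - 1)) / (phi (polar D) y * (P.F2 y)\<^sup>2)
      = deriv ?d y / y powr (q - 2)) (at_right 0)"
    using P.near_0
  proof eventually_elim
    case (elim y)
    then have y: "0 < y" "y < b1 (polar D)" "\<bar>y\<bar> < b1 (polar D)" by auto
    note xy = x[OF y(1,2)]
    have F2: "P.F2 y > 0" by (rule P.F2_pos[OF y(3)])
    have ph: "phi (polar D) y > 0" by (rule P.phi_pos[OF y(3)])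
    have F1: "P.F1 y > 0" by (rule xy(1))
    have yq: "y powr (q - 1) = y * y powr (q - 2)" using y by (simp add: powr_mult_base)
    have yq0: "y powr (q - 2) > 0" using y by simp
    \<comment> \<open>Conjugacy trades the dual exponent function, which contains the wanted second
      derivative, for \<open>p_fun D\<close>, whose limit is known.\<close>
    have "(p_fun D (curve (?x y)) - 1) * (p_fun (polar D) (P.curve y) - 1) = 1"
      using p_fun_conjugate(1)[OF xy(1,2)] by (simp add: xy)
    then have "1 / (p_fun D (curve (?x y)) - 1) = p_fun (polar D) (P.curve y) - 1"
      by (metis mult_not_zero nonzero_eq_divide_eq mult.commute zero_neq_one)
    also have "\<dots> = y * P.F1' y / P.F1 y" using P.p_fun_curve[OF y(1,2)] by simp
    also have "P.F1' y = - deriv ?d y * phi (polar D) y * (P.F2 y)\<^sup>2"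
      using P.M_F(3)[OF y(3)] by (simp add: P.F1'_def power_divide)
    finally have e: "1 / (p_fun D (curve (?x y)) - 1) = y * (- deriv ?d y * phi (polar D) y * (P.F2 y)\<^sup>2) / P.F1 y" .
    show ?case unfolding e yq using y(1) F1 F2 ph yq0 by (simp add: field_simps)
  qed
  ultimately have "P.power_lim (\<kappa> / (b2 D * q)) q"
    unfolding P.power_lim_def by (rule tendsto_eq_eventually) (simp only: lim_eq1 lim_eq2)
  moreover have "\<kappa> / (b2 D * q) > 0" using \<kappa> b2 q by simp
  ultimately show ?thesis unfolding q_def by blast
qed

end

subsection \<open>Interchanging the coordinates\<close>

text \<open>The inverse of \<open>phi D\<close> is the profile of the domain with coordinates
  exchanged, so the second condition of \<open>Rclass\<close> becomes the first one for another
  member of \<open>Rtilde\<close>.\<close>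

abbreviation swap_domain :: "C2 set \<Rightarrow> C2 set" where "swap_domain D \<equiv> prod.swap ` D"

lemma swap_image_eq_vimage: "prod.swap ` (A :: ('a \<times> 'a) set) = prod.swap -` A"
  by force

lemma mem_swap: "z \<in> prod.swap ` (A :: ('a \<times> 'a) set) \<longleftrightarrow> prod.swap z \<in> A"
  by (simp add: swap_image_eq_vimage)

lemma linear_swap: "linear (prod.swap :: C2 \<Rightarrow> C2)"
  by (rule linearI) auto

lemma bounded_linear_swap: "bounded_linear (prod.swap :: C2 \<Rightarrow> C2)"
  using linear_swap by (simp add: linear_conv_bounded_linear)

lemma inner_swap: "prod.swap x \<bullet> prod.swap y = (x :: C2) \<bullet> y"
  by (simp add: inner_prod_def)

lemma closure_swap: "closure (prod.swap ` (A :: C2 set)) = prod.swap ` closure A"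
  using closure_injective_linear_image[OF linear_swap] by (metis inj_swap)

lemma continuous_on_swap: "continuous_on A (prod.swap :: C2 \<Rightarrow> C2)"
  by (rule linear_continuous_on[OF bounded_linear_swap])

lemma open_swap: "open A \<Longrightarrow> open (prod.swap ` (A :: C2 set))"
  unfolding swap_image_eq_vimage by (rule open_vimage[OF _ continuous_on_swap])

lemma frontier_swap: "open A \<Longrightarrow> frontier (prod.swap ` (A :: C2 set)) = prod.swap ` frontier A"
  by (simp add: frontier_def interior_open open_swap closure_swap image_set_diff)

lemma defining_function_swap:
  fixes D :: "C2 set"
  assumes "defining_function D U \<rho> g"
  shows "defining_function (prod.swap ` D) (prod.swap ` U) (\<lambda>z. \<rho> (prod.swap z)) (\<lambda>z. prod.swap (g (prod.swap z)))"
proof -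
  have d: "open U" "\<And>x. x \<in> U \<Longrightarrow> (\<rho> has_derivative (\<lambda>h. g x \<bullet> h)) (at x)" "continuous_on U g"
    "\<And>x. x \<in> U \<Longrightarrow> g x \<noteq> 0" "D \<inter> U = {x \<in> U. \<rho> x < 0}"
    using assms by (auto simp: defining_function_def)
  have sw: "(prod.swap has_derivative prod.swap) (at z)" for z :: C2
    by (rule bounded_linear_imp_has_derivative[OF bounded_linear_swap])
  show ?thesis
    unfolding defining_function_def
  proof (intro conjI ballI)
    show "open (prod.swap ` U)" by (rule open_swap[OF d(1)])
    show "continuous_on (prod.swap ` U) (\<lambda>z. prod.swap (g (prod.swap z)))"
      by (rule continuous_on_compose2[OF continuous_on_swap continuous_on_compose2[OF d(3) continuous_on_swap]]) auto
    show "prod.swap ` D \<inter> prod.swap ` U = {x \<in> prod.swap ` U. \<rho> (prod.swap x) < 0}"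
    proof (rule set_eqI)
      fix x :: C2
      have "prod.swap x \<in> D \<inter> U \<longleftrightarrow> prod.swap x \<in> U \<and> \<rho> (prod.swap x) < 0" unfolding d(5) by simp
      then show "x \<in> prod.swap ` D \<inter> prod.swap ` U \<longleftrightarrow> x \<in> {x \<in> prod.swap ` U. \<rho> (prod.swap x) < 0}"
        unfolding swap_image_eq_vimage by simp
    qed
    fix z :: C2 assume "z \<in> prod.swap ` U"
    then have z: "prod.swap z \<in> U" by (simp add: swap_image_eq_vimage)
    show "prod.swap (g (prod.swap z)) \<noteq> 0"
      using d(4)[OF z] by (auto simp: prod_eq_iff)
    have "((\<lambda>z. \<rho> (prod.swap z)) has_derivative (\<lambda>h. g (prod.swap z) \<bullet> prod.swap h)) (at z)"
      using diff_chain_at[OF sw, of \<rho> "\<lambda>h. g (prod.swap z) \<bullet> h"] d(2)[OF z] by (simp add: o_def)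
    moreover have "g (prod.swap z) \<bullet> prod.swap h = prod.swap (g (prod.swap z)) \<bullet> h" for h
      using inner_swap[of "prod.swap (g (prod.swap z))" h] by simp
    ultimately show "((\<lambda>z. \<rho> (prod.swap z)) has_derivative (\<lambda>h. prod.swap (g (prod.swap z)) \<bullet> h)) (at z)" by simp
  qed
qed

lemma swap_Rtilde:
  assumes "D \<in> Rtilde" shows "swap_domain D \<in> Rtilde"
proof -
  interpret rtilde D by unfold_locales (rule assms)
  have "complete_reinhardt (prod.swap ` D)"
    unfolding complete_reinhardt_def reinhardt_def
  proof (intro conjI ballI allI impI)
    fix z \<theta>\<^sub>1 \<theta>\<^sub>2 assume "z \<in> prod.swap ` D"
    then have "prod.swap z \<in> D" by (simp add: swap_image_eq_vimage)
    then have "prod.swap (cis \<theta>\<^sub>1 * fst z, cis \<theta>\<^sub>2 * snd z) \<in> D" by (rule D_mono) (simp_all add: norm_mult)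
    then show "(cis \<theta>\<^sub>1 * fst z, cis \<theta>\<^sub>2 * snd z) \<in> prod.swap ` D" by (simp only: swap_image_eq_vimage vimage_eq)
  next
    fix z w assume "z \<in> prod.swap ` D" and le: "cmod (fst w) \<le> cmod (fst z) \<and> cmod (snd w) \<le> cmod (snd z)"
    then have "prod.swap z \<in> D" by (simp add: swap_image_eq_vimage)
    then have "prod.swap w \<in> D" by (rule D_mono) (use le in simp_all)
    then show "w \<in> prod.swap ` D" by (simp only: swap_image_eq_vimage vimage_eq)
  qed
  moreover have "C1_boundary_at (prod.swap ` D) q" if q: "q \<in> frontier (prod.swap ` D)" for q
  proof -
    have "prod.swap q \<in> frontier D" using q by (simp only: frontier_swap[OF open_D] mem_swap)
    then obtain U \<rho> g where "prod.swap q \<in> U" "defining_function D U \<rho> g"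
      using assms unfolding Rtilde_def C1_boundary_at_def by blast
    then show ?thesis
      unfolding C1_boundary_at_def using defining_function_swap by (metis swap_image_eq_vimage vimage_eq)
  qed
  moreover have "C2_strongly_convex_boundary_at (prod.swap ` D) q"
    if q: "q \<in> frontier (prod.swap ` D)" and nz: "fst q * snd q \<noteq> 0" for q
  proof -
    have "prod.swap q \<in> frontier D" using q by (simp only: frontier_swap[OF open_D] mem_swap)
    moreover have "fst (prod.swap q) * snd (prod.swap q) \<noteq> 0" using nz by simp
    ultimately have "C2_strongly_convex_boundary_at D (prod.swap q)" using assms unfolding Rtilde_def by blast
    then obtain U \<rho> g H where U: "prod.swap q \<in> U" and d: "defining_function D U \<rho> g"
      and H: "\<And>x. x \<in> U \<Longrightarrow> (g has_derivative blinfun_apply (H x)) (at x)" "continuous_on U H"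
      and pos: "\<And>v. v \<noteq> 0 \<Longrightarrow> g (prod.swap q) \<bullet> v = 0 \<Longrightarrow> 0 < v \<bullet> blinfun_apply (H (prod.swap q)) v"
      unfolding C2_strongly_convex_boundary_at_def by blast
    \<comment> \<open>The swap as a bounded operator: the transported Hessian is the old one
      composed with \<open>W\<close> on both sides, which keeps it continuous.\<close>
    define W :: "C2 \<Rightarrow>\<^sub>L C2" where "W = Blinfun prod.swap"
    have W: "blinfun_apply W = prod.swap" unfolding W_def by (rule bounded_linear_Blinfun_apply[OF bounded_linear_swap])
    show ?thesis
      unfolding C2_strongly_convex_boundary_at_def
    proof (intro exI conjI ballI allI impI)
      show "q \<in> prod.swap ` U" using U by (simp only: swap_image_eq_vimage vimage_eq)
      show "defining_function (prod.swap ` D) (prod.swap ` U) (\<lambda>z. \<rho> (prod.swap z)) (\<lambda>z. prod.swap (g (prod.swap z)))"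
        by (rule defining_function_swap[OF d])
      show "continuous_on (prod.swap ` U) (\<lambda>z. W o\<^sub>L H (prod.swap z) o\<^sub>L W)"
        by (intro continuous_intros continuous_on_compose2[OF H(2) continuous_on_swap]) auto
      show "((\<lambda>z. prod.swap (g (prod.swap z))) has_derivative blinfun_apply (W o\<^sub>L H (prod.swap z) o\<^sub>L W)) (at z)"
        if "z \<in> prod.swap ` U" for z
      proof -
        have z: "prod.swap z \<in> U" using that by (simp only: swap_image_eq_vimage vimage_eq)
        have sw: "(prod.swap has_derivative prod.swap) (at x)" for x :: C2
          by (rule bounded_linear_imp_has_derivative[OF bounded_linear_swap])
        have "((\<lambda>z. g (prod.swap z)) has_derivative (\<lambda>h. blinfun_apply (H (prod.swap z)) (prod.swap h))) (at z)"
          using diff_chain_at[OF sw, of g "blinfun_apply (H (prod.swap z))"] H(1)[OF z] by (simp add: o_def)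
        from diff_chain_at[OF this sw] show ?thesis by (simp add: o_def W blinfun_compose.rep_eq)
      qed
      fix v :: C2 assume v: "v \<noteq> 0" "prod.swap (g (prod.swap q)) \<bullet> v = 0"
      then have "0 < prod.swap v \<bullet> blinfun_apply (H (prod.swap q)) (prod.swap v)"
        using inner_swap[of "g (prod.swap q)" "prod.swap v"] by (intro pos) (auto simp: prod_eq_iff)
      then show "0 < v \<bullet> blinfun_apply (W o\<^sub>L H (prod.swap q) o\<^sub>L W) v"
        using inner_swap[of v "prod.swap (blinfun_apply (H (prod.swap q)) (prod.swap v))"]
        by (simp add: W blinfun_compose.rep_eq)
    qed
  qed
  moreover have "bounded (prod.swap ` D)" by (rule bounded_linear_image[OF bounded_D bounded_linear_swap])
  moreover have "convex (prod.swap ` D)" by (rule convex_linear_image[OF linear_swap convex_D])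
  ultimately show ?thesis
    unfolding Rtilde_def using open_swap[OF open_D] nonempty by blast
qed

context rtilde begin

lemma rtilde_swap: "rtilde (swap_domain D)"
  by unfold_locales (rule swap_Rtilde[OF mem])

lemma polar_swap: "polar (swap_domain D) = swap_domain (polar D)"
proof -
  interpret S: rtilde "swap_domain D" by (rule rtilde_swap)
  show ?thesis
  proof (rule set_eqI)
    fix z :: C2
    have "z \<in> polar (swap_domain D) \<longleftrightarrow> (\<forall>\<zeta>\<in>closure D. z \<bullet> prod.swap \<zeta> < 1)"
      unfolding S.polar_iff closure_swap by simp
    also have "\<dots> \<longleftrightarrow> prod.swap z \<in> polar D"
      unfolding polar_iff using inner_swap[of "prod.swap z"] by simp
    finally show "z \<in> polar (swap_domain D) \<longleftrightarrow> z \<in> swap_domain (polar D)" by (simp add: swap_image_eq_vimage)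
  qed
qed

lemma phi_inj: "inj_on (phi D) {0..b1 D}"
proof -
  have "phi D u < phi D t" if "0 \<le> t" "t < u" "u \<le> b1 D" for t u
  proof (rule DERIV_neg_imp_decreasing_open[OF that(2)])
    fix x assume "t < x" "x < u"
    then show "\<exists>y. (phi D has_real_derivative y) (at x) \<and> y < 0"
      using phi_DERIV[of x] deriv_phi_neg[of x] that by auto
  qed (rule continuous_on_subset[OF continuous_on_phi], use that in auto)
  then show ?thesis by (intro linorder_inj_onI) (fastforce)+
qed

text \<open>Frontiers correspond under the swap, and on a frontier the second modulus is the profile
  value of the first; injectivity of \<open>phi D\<close> does the rest.\<close>

lemma phi_swap:
  shows "b2 (swap_domain D) = b1 D"
    and "r \<in> {0..b2 D} \<Longrightarrow> inv_into {0..b1 D} (phi D) r = phi (swap_domain D) r"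
proof -
  interpret S: rtilde "swap_domain D" by (rule rtilde_swap)
  have fr: "z \<in> frontier (swap_domain D) \<longleftrightarrow> prod.swap z \<in> frontier D" for z
    by (simp only: frontier_swap[OF open_D] mem_swap)
  have 0: "\<bar>0\<bar> \<le> b1 (swap_domain D)" using S.b1_pos by simp
  have "prod.swap (curve (b1 D)) \<in> frontier (swap_domain D)"
    unfolding fr using curve_frontier[of "b1 D"] b1_pos by simp
  then show "b2 (swap_domain D) = b1 D" using b1_pos by (simp add: S.frontier_iff_phi phi_b1 b2_def)
  have b1S: "b1 (swap_domain D) = b2 D"
  proof -
    have "prod.swap (S.curve (b1 (swap_domain D))) \<in> frontier D"
      unfolding fr[symmetric] using S.curve_frontier[of "b1 (swap_domain D)"] S.b1_pos by simp
    then show ?thesis using S.b1_pos by (simp add: frontier_iff_phi S.phi_b1 b2_def)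
  qed
  show "inv_into {0..b1 D} (phi D) r = phi (swap_domain D) r" if r: "r \<in> {0..b2 D}"
  proof (rule inv_into_f_eq[OF phi_inj])
    have ab: "\<bar>r\<bar> \<le> b1 (swap_domain D)" using r b1S by simp
    have "prod.swap (S.curve r) \<in> frontier D" unfolding fr[symmetric] by (rule S.curve_frontier[OF ab]) 
    then show "phi (swap_domain D) r \<in> {0..b1 D}" "phi D (phi (swap_domain D) r) = r"
      using S.phi_closure(3)[OF ab] r by (auto simp: frontier_iff_phi)
  qed
qed

lemma power_like_inv_iff:
  assumes "p > 1"
  shows "power_like_at_0 (inv_into {0..b1 D} (phi D)) (b1 D) c p \<longleftrightarrow> rtilde.power_lim (swap_domain D) c p"
proof -
  interpret S: rtilde "swap_domain D" by (rule rtilde_swap)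
  have b2: "b2 D > 0" using phi_pos[of 0] b1_pos by (simp add: b2_def)
  have eq: "inv_into {0..b1 D} (phi D) r = phi (swap_domain D) r" if "r \<in> {0..<b2 D}" for r
    using phi_swap(2)[of r] that by auto
  have "power_like_at_0 (inv_into {0..b1 D} (phi D)) (b1 D) c p \<longleftrightarrow> power_like_at_0 (phi (swap_domain D)) (b1 D) c p"
    using power_like_cong[OF _ b2] eq by metis
  then show ?thesis using S.power_like_phi_iff[OF assms] phi_swap(1) by simp
qed

lemma Rclass_iff:
  "D \<in> Rclass \<longleftrightarrow> (\<exists>c p. c > 0 \<and> p > 1 \<and> power_lim c p) \<and> (\<exists>c p. c > 0 \<and> p > 1 \<and> rtilde.power_lim (swap_domain D) c p)"
  unfolding Rclass_def using mem power_like_phi_iff power_like_inv_iff by blast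

text \<open>The behaviour at each axis is transferred separately, using that polar and swap
  commute.\<close>

lemma Rclass_polar:
  assumes "D \<in> Rclass" shows "polar D \<in> Rclass"
proof -
  interpret P: rtilde "polar D" by (rule rtilde_polar)
  interpret S: rtilde "swap_domain D" by (rule rtilde_swap)
  obtain c p c' p' where "c > 0" "p > 1" "power_lim c p" "c' > 0" "p' > 1" "S.power_lim c' p'"
    using assms Rclass_iff by blast
  moreover have "p / (p - 1) > 1" if "p > 1" for p :: real using that by simp
  ultimately show ?thesis
    unfolding P.Rclass_iff polar_swap[symmetric]
    using power_lim_polar[of p c] S.power_lim_polar[of p' c'] by blast
qed

end

section \<open>Square integrable functions\<close>

lemma borel_measurable_cnj [measurable]: "cnj \<in> borel_measurable borel"
  by (intro borel_measurable_continuous_onI continuous_intros)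

lemma L2_I: "f \<in> borel_measurable M \<Longrightarrow> integrable M (\<lambda>x. (cmod (f x))\<^sup>2) \<Longrightarrow> f \<in> L2 M"
  by (simp add: L2_def)

lemma L2_meas: "f \<in> L2 M \<Longrightarrow> f \<in> borel_measurable M"
  and L2_int: "f \<in> L2 M \<Longrightarrow> integrable M (\<lambda>x. (cmod (f x))\<^sup>2)"
  by (simp_all add: L2_def)

lemma L2_zero: "(\<lambda>x. 0) \<in> L2 M" by (simp add: L2_def)

lemma cmod_add_square_le: "(cmod (a + b))\<^sup>2 \<le> 2 * (cmod a)\<^sup>2 + 2 * (cmod b)\<^sup>2"
proof -
  have "(cmod (a + b))\<^sup>2 \<le> (cmod a + cmod b)\<^sup>2" by (intro power_mono norm_triangle_ineq) simp
  also have "\<dots> \<le> 2 * (cmod a)\<^sup>2 + 2 * (cmod b)\<^sup>2"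
    using zero_le_power2[of "cmod a - cmod b"] by (simp add: power2_eq_square algebra_simps)
  finally show ?thesis .
qed

lemma L2_add:
  assumes "f \<in> L2 M" "g \<in> L2 M" shows "(\<lambda>x. f x + g x) \<in> L2 M"
proof (rule L2_I)
  have [measurable]: "f \<in> borel_measurable M" "g \<in> borel_measurable M" using assms L2_meas by auto
  show "(\<lambda>x. f x + g x) \<in> borel_measurable M" by measurable
  show "integrable M (\<lambda>x. (cmod (f x + g x))\<^sup>2)"
    by (rule Bochner_Integration.integrable_bound[of M "\<lambda>x. 2 * (cmod (f x))\<^sup>2 + 2 * (cmod (g x))\<^sup>2"])
      (use L2_int[OF assms(1)] L2_int[OF assms(2)] cmod_add_square_le in auto)
qed

lemma L2_cmult:
  assumes "f \<in> L2 M" shows "(\<lambda>x. c * f x) \<in> L2 M"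
proof (rule L2_I)
  have [measurable]: "f \<in> borel_measurable M" using assms L2_meas by auto
  show "(\<lambda>x. c * f x) \<in> borel_measurable M" by measurable
  show "integrable M (\<lambda>x. (cmod (c * f x))\<^sup>2)"
    using L2_int[OF assms] by (simp add: norm_mult power_mult_distrib)
qed

lemma L2_diff: "f \<in> L2 M \<Longrightarrow> g \<in> L2 M \<Longrightarrow> (\<lambda>x. f x - g x) \<in> L2 M"
  using L2_add[OF _ L2_cmult[of g M "-1"]] by simp

lemma L2_sum: "(\<And>i. i \<in> F \<Longrightarrow> f i \<in> L2 M) \<Longrightarrow> (\<lambda>x. \<Sum>i\<in>F. f i x) \<in> L2 M"
  by (induction F rule: infinite_finite_induct) (auto intro: L2_zero L2_add)

lemma L2_mult_integrable:
  assumes "f \<in> L2 M" "g \<in> L2 M" shows "integrable M (\<lambda>x. f x * cnj (g x))"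
proof (rule Bochner_Integration.integrable_bound[of M "\<lambda>x. (cmod (f x))\<^sup>2 + (cmod (g x))\<^sup>2"])
  have [measurable]: "f \<in> borel_measurable M" "g \<in> borel_measurable M" using assms L2_meas by auto
  show "integrable M (\<lambda>x. (cmod (f x))\<^sup>2 + (cmod (g x))\<^sup>2)" using L2_int[OF assms(1)] L2_int[OF assms(2)] by simp
  show "(\<lambda>x. f x * cnj (g x)) \<in> borel_measurable M" by measurable
  have "a * b \<le> a\<^sup>2 + b\<^sup>2" if "0 \<le> a" "0 \<le> b" for a b :: real
  proof -
    have "2 * (a * b) \<le> a\<^sup>2 + b\<^sup>2" using zero_le_power2[of "a - b"] by (simp add: power2_eq_square algebra_simps)
    moreover have "0 \<le> a * b" using that by simp
    ultimately show ?thesis by linarith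
  qed
  then show "AE x in M. norm (f x * cnj (g x)) \<le> norm ((cmod (f x))\<^sup>2 + (cmod (g x))\<^sup>2)"
    by (simp add: norm_mult)
qed

lemma ip2_add_left: "f \<in> L2 M \<Longrightarrow> g \<in> L2 M \<Longrightarrow> h \<in> L2 M \<Longrightarrow> ip2 M (\<lambda>x. f x + g x) h = ip2 M f h + ip2 M g h"
  by (simp add: ip2_def distrib_right L2_mult_integrable)

lemma ip2_cmult_left: "ip2 M (\<lambda>x. c * f x) h = c * ip2 M f h"
  by (simp add: ip2_def mult.assoc)

lemma ip2_diff_left: "f \<in> L2 M \<Longrightarrow> g \<in> L2 M \<Longrightarrow> h \<in> L2 M \<Longrightarrow> ip2 M (\<lambda>x. f x - g x) h = ip2 M f h - ip2 M g h"
  by (simp add: ip2_def left_diff_distrib L2_mult_integrable)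

lemma ip2_commute: "ip2 M g f = cnj (ip2 M f g)"
  unfolding ip2_def by (subst Bochner_Integration.integral_cnj[symmetric]) (simp add: mult.commute)

lemma ip2_cmult_right: "ip2 M f (\<lambda>x. c * g x) = cnj c * ip2 M f g"
  using ip2_commute[of M f "\<lambda>x. c * g x"] ip2_commute[of M f g] by (simp add: ip2_cmult_left)

lemma ip2_add_right: "f \<in> L2 M \<Longrightarrow> g \<in> L2 M \<Longrightarrow> h \<in> L2 M \<Longrightarrow> ip2 M h (\<lambda>x. f x + g x) = ip2 M h f + ip2 M h g"
  by (subst (1 2 3) ip2_commute) (simp add: ip2_add_left)

lemma ip2_diff_right: "f \<in> L2 M \<Longrightarrow> g \<in> L2 M \<Longrightarrow> h \<in> L2 M \<Longrightarrow> ip2 M h (\<lambda>x. f x - g x) = ip2 M h f - ip2 M h g"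
  by (subst (1 2 3) ip2_commute) (simp add: ip2_diff_left)

lemma ip2_sum_left:
  assumes "\<And>i. i \<in> F \<Longrightarrow> f i \<in> L2 M" "h \<in> L2 M"
  shows "ip2 M (\<lambda>x. \<Sum>i\<in>F. f i x) h = (\<Sum>i\<in>F. ip2 M (f i) h)"
  using assms(1)
proof (induction F rule: infinite_finite_induct)
  case (insert i F)
  then show ?case using ip2_add_left[of "f i" M "\<lambda>x. \<Sum>i\<in>F. f i x" h] by (simp add: L2_sum assms(2))
qed (simp_all add: ip2_def)

lemma norm2_nonneg: "0 \<le> norm2 M f" by (simp add: norm2_def)

lemma norm2_square: "(norm2 M f)\<^sup>2 = (\<integral>x. (cmod (f x))\<^sup>2 \<partial>M)"
  by (simp add: norm2_def integral_nonneg_AE)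

lemma ip2_self: "ip2 M f f = complex_of_real ((norm2 M f)\<^sup>2)"
proof -
  have "ip2 M f f = (\<integral>x. complex_of_real ((cmod (f x))\<^sup>2) \<partial>M)"
    unfolding ip2_def by (simp only: complex_norm_square)
  then show ?thesis by (simp only: norm2_square integral_complex_of_real)
qed

lemma norm2_cmult: "norm2 M (\<lambda>x. c * f x) = cmod c * norm2 M f"
  by (simp add: norm2_def norm_mult power_mult_distrib real_sqrt_mult)

lemma norm2_eq_0_iff:
  assumes "f \<in> L2 M" shows "norm2 M f = 0 \<longleftrightarrow> (AE x in M. f x = 0)"
  using integral_nonneg_eq_0_iff_AE[OF L2_int[OF assms]] by (simp add: norm2_def)

lemma ip2_cong_AE:
  assumes "f \<in> L2 M" "g \<in> L2 M" "f' \<in> L2 M" "g' \<in> L2 M" "AE x in M. f x = f' x" "AE x in M. g x = g' x"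
  shows "ip2 M f g = ip2 M f' g'"
proof -
  have [measurable]: "f \<in> borel_measurable M" "g \<in> borel_measurable M" "f' \<in> borel_measurable M" "g' \<in> borel_measurable M"
    using assms L2_meas by auto
  show ?thesis unfolding ip2_def
  proof (rule integral_cong_AE)
    show "AE x in M. f x * cnj (g x) = f' x * cnj (g' x)" using assms(5,6) by eventually_elim simp
  qed measurable
qed

lemma norm2_cong_AE:
  assumes "f \<in> borel_measurable M" "f' \<in> borel_measurable M" "AE x in M. f x = f' x"
  shows "norm2 M f = norm2 M f'"
proof -
  have "(\<integral>x. (cmod (f x))\<^sup>2 \<partial>M) = (\<integral>x. (cmod (f' x))\<^sup>2 \<partial>M)"
    using assms by (intro integral_cong_AE) auto
  then show ?thesis by (simp add: norm2_def)
qed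

lemma Cauchy_Schwarz2:
  assumes f: "f \<in> L2 M" and g: "g \<in> L2 M" shows "cmod (ip2 M f g) \<le> norm2 M f * norm2 M g"
proof (cases "norm2 M g = 0")
  case True
  then have "AE x in M. g x = 0" using norm2_eq_0_iff[OF g] by simp
  then have "ip2 M f g = ip2 M f (\<lambda>x. 0)" by (intro ip2_cong_AE f g L2_zero) auto
  then show ?thesis by (simp add: ip2_def norm2_nonneg)
next
  case False
  then have gp: "(norm2 M g)\<^sup>2 > 0" by simp
  define c where "c = ip2 M f g / complex_of_real ((norm2 M g)\<^sup>2)"
  define h where "h x = f x - c * g x" for x
  have h: "h \<in> L2 M" unfolding h_def by (intro L2_diff f L2_cmult g)
  have hd: "h = (\<lambda>x. f x - c * g x)" by (auto simp: h_def)
  have "ip2 M h g = ip2 M f g - c * ip2 M g g"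
    by (subst hd) (simp add: ip2_diff_left ip2_cmult_left f g L2_cmult)
  also have "\<dots> = 0" using gp by (simp add: c_def ip2_self)
  finally have hg: "ip2 M h g = 0" .
  have "ip2 M h h = ip2 M h f - cnj c * ip2 M h g"
    by (subst (2) hd) (simp add: ip2_diff_right ip2_cmult_right f g h L2_cmult)
  also have "\<dots> = ip2 M f f - c * ip2 M g f"
    unfolding hg by (subst hd) (simp add: ip2_diff_left ip2_cmult_left f g L2_cmult)
  also have "\<dots> = complex_of_real ((norm2 M f)\<^sup>2) - c * ip2 M g f" by (simp add: ip2_self)
  also have "c * ip2 M g f = complex_of_real ((cmod (ip2 M f g))\<^sup>2 / (norm2 M g)\<^sup>2)"
    by (simp add: c_def ip2_commute[of M g f] complex_norm_square[symmetric])
  finally have "complex_of_real ((norm2 M h)\<^sup>2) = complex_of_real ((norm2 M f)\<^sup>2 - (cmod (ip2 M f g))\<^sup>2 / (norm2 M g)\<^sup>2)"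
    by (simp add: ip2_self)
  then have "(norm2 M h)\<^sup>2 = (norm2 M f)\<^sup>2 - (cmod (ip2 M f g))\<^sup>2 / (norm2 M g)\<^sup>2"
    by (simp only: of_real_eq_iff)
  then have "(cmod (ip2 M f g))\<^sup>2 / (norm2 M g)\<^sup>2 \<le> (norm2 M f)\<^sup>2" by (smt (verit) zero_le_power2)
  then have "(cmod (ip2 M f g))\<^sup>2 \<le> (norm2 M f * norm2 M g)\<^sup>2"
    using gp by (simp add: pos_divide_le_eq power_mult_distrib)
  then show ?thesis by (rule power2_le_imp_le) (simp add: norm2_nonneg)
qed

lemma norm2_add_square:
  assumes "f \<in> L2 M" "g \<in> L2 M"
  shows "(norm2 M (\<lambda>x. f x + g x))\<^sup>2 = (norm2 M f)\<^sup>2 + 2 * Re (ip2 M f g) + (norm2 M g)\<^sup>2"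
proof -
  have fg: "(\<lambda>x. f x + g x) \<in> L2 M" by (rule L2_add[OF assms])
  have "complex_of_real ((norm2 M (\<lambda>x. f x + g x))\<^sup>2) = ip2 M f f + ip2 M f g + (ip2 M g f + ip2 M g g)"
    unfolding ip2_self[symmetric] using assms fg by (simp add: ip2_add_left ip2_add_right)
  from arg_cong[OF this, of Re] show ?thesis
    by (simp add: ip2_self ip2_commute[of M g f] flip: of_real_power)
qed

lemma norm2_triangle:
  assumes "f \<in> L2 M" "g \<in> L2 M" shows "norm2 M (\<lambda>x. f x + g x) \<le> norm2 M f + norm2 M g"
proof (rule power2_le_imp_le)
  have "Re (ip2 M f g) \<le> norm2 M f * norm2 M g"
    using Cauchy_Schwarz2[OF assms] complex_Re_le_cmod order_trans by blast
  then show "(norm2 M (\<lambda>x. f x + g x))\<^sup>2 \<le> (norm2 M f + norm2 M g)\<^sup>2"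
    by (simp add: norm2_add_square[OF assms] power2_sum)
qed (simp add: norm2_nonneg)

lemma norm2_minus_commute: "norm2 M (\<lambda>x. f x - g x) = norm2 M (\<lambda>x. g x - f x)"
  by (simp add: norm2_def norm_minus_commute)

lemma norm2_triangle_diff:
  assumes "f \<in> L2 M" "g \<in> L2 M" "h \<in> L2 M"
  shows "norm2 M (\<lambda>x. f x - h x) \<le> norm2 M (\<lambda>x. f x - g x) + norm2 M (\<lambda>x. g x - h x)"
  using norm2_triangle[OF L2_diff[OF assms(1,2)] L2_diff[OF assms(2,3)]] by simp

subsection \<open>Completeness\<close>

lemma nn_integral_eq_norm2:
  assumes "f \<in> L2 M" shows "(\<integral>\<^sup>+x. ennreal ((cmod (f x))\<^sup>2) \<partial>M) = ennreal ((norm2 M f)\<^sup>2)"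
  unfolding norm2_square by (rule nn_integral_eq_integral[OF L2_int[OF assms]]) simp

text \<open>Passing to a subsequence with \<open>\<Sum> 2\<^sup>k \<parallel>u\<^bsub>r(k+1)\<^esub> - u\<^bsub>r(k)\<^esub>\<parallel>\<^sup>2 < \<infinity>\<close> makes the increments
  pointwise dominated by a geometric sequence almost everywhere.\<close>

lemma L2_AE_convergent_subseq:
  assumes u: "\<And>n. u n \<in> L2 M"
    and v: "\<And>k. norm2 M (\<lambda>x. u (Suc k) x - u k x) \<le> (1/2) ^ k"
  shows "AE x in M. convergent (\<lambda>k. u k x)"
proof -
  have [measurable]: "u n \<in> borel_measurable M" for n using u L2_meas by auto
  \<comment> \<open>The factor \<open>2 ^ k\<close> buys pointwise decay, while the squared norms,
    at most \<open>((1/2) ^ k)\<^sup>2\<close>, still leave summable integrals.\<close>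
  define w where "w k x = 2 ^ k * (cmod (u (Suc k) x - u k x))\<^sup>2" for k x
  have wn: "0 \<le> w k x" for k x by (simp add: w_def)
  have [measurable]: "w k \<in> borel_measurable M" for k unfolding w_def by measurable
  have int: "(\<integral>\<^sup>+x. ennreal (w k x) \<partial>M) \<le> ennreal ((1/2) ^ k)" for k
  proof -
    have "(\<integral>\<^sup>+x. ennreal (w k x) \<partial>M) = ennreal (2 ^ k) * (\<integral>\<^sup>+x. ennreal ((cmod (u (Suc k) x - u k x))\<^sup>2) \<partial>M)"
      unfolding w_def by (subst nn_integral_cmult[symmetric]) (auto simp: ennreal_mult[symmetric])
    also have "\<dots> = ennreal (2 ^ k * (norm2 M (\<lambda>x. u (Suc k) x - u k x))\<^sup>2)"
      by (subst nn_integral_eq_norm2) (auto intro: L2_diff u simp: ennreal_mult)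
    also have "\<dots> \<le> ennreal (2 ^ k * ((1/2) ^ k)\<^sup>2)"
      using v by (intro ennreal_leI mult_left_mono power_mono) (auto simp: norm2_nonneg)
    also have "2 ^ k * ((1/2) ^ k)\<^sup>2 = (1/2 :: real) ^ k"
      by (simp add: power2_eq_square flip: power_mult_distrib)
    finally show ?thesis .
  qed
  have "(\<integral>\<^sup>+x. (\<Sum>k. ennreal (w k x)) \<partial>M) = (\<Sum>k. \<integral>\<^sup>+x. ennreal (w k x) \<partial>M)"
    by (rule nn_integral_suminf) simp
  also have "\<dots> \<le> (\<Sum>k. ennreal ((1/2) ^ k))"
    by (intro suminf_le int) auto
  also have "\<dots> = ennreal (\<Sum>k. (1/2) ^ k)"
    by (rule suminf_ennreal2) (auto intro: summable_geometric)
  finally have "(\<integral>\<^sup>+x. (\<Sum>k. ennreal (w k x)) \<partial>M) \<noteq> \<infinity>"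
    using ennreal_less_top order.strict_trans1 infinity_ennreal_def by (metis less_irrefl)
  then have "AE x in M. (\<Sum>k. ennreal (w k x)) \<noteq> \<infinity>"
    by (intro nn_integral_PInf_AE) measurable
  then show ?thesis
  proof eventually_elim
    case (elim x)
    then have "summable (\<lambda>k. w k x)" using summable_suminf_not_top[of "\<lambda>k. w k x"] wn by simp
    then have "Bseq (\<lambda>k. w k x)" using summable_LIMSEQ_zero convergentI convergent_imp_Bseq by blast
    then obtain C where C: "\<And>k. norm (w k x) \<le> C" "C > 0" unfolding Bseq_def by blast
    have bound: "cmod (u (Suc k) x - u k x) \<le> sqrt C * (1 / sqrt 2) ^ k" for k
    proof (rule power2_le_imp_le)
      have "2 ^ k * (cmod (u (Suc k) x - u k x))\<^sup>2 \<le> C" using C(1)[of k] wn[of k x] by (simp add: w_def)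
      then have "(cmod (u (Suc k) x - u k x))\<^sup>2 \<le> C * (1/2) ^ k" by (simp add: field_simps power_divide)
      also have "\<dots> = (sqrt C * (1 / sqrt 2) ^ k)\<^sup>2"
      proof -
        have "((1 / sqrt 2) ^ k)\<^sup>2 = ((1 / sqrt 2)\<^sup>2) ^ k" by (simp only: power_mult[symmetric] mult.commute[of k 2])
        then show ?thesis using C(2) by (simp add: power_mult_distrib power_divide)
      qed
      finally show "(cmod (u (Suc k) x - u k x))\<^sup>2 \<le> (sqrt C * (1 / sqrt 2) ^ k)\<^sup>2" .
    qed (use C(2) in simp)
    have "summable (\<lambda>k. u (Suc k) x - u k x)"
      by (rule summable_comparison_test'[of "\<lambda>k. sqrt C * (1 / sqrt 2) ^ k" 0])
        (auto intro!: summable_mult summable_geometric bound simp: real_less_rsqrt)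
    then have "convergent (\<lambda>n. \<Sum>k<n. u (Suc k) x - u k x)" by (rule summable_iff_convergent[THEN iffD1])
    then have "convergent (\<lambda>n. u 0 x + (\<Sum>k<n. u (Suc k) x - u k x))" by (intro convergent_add convergent_const)
    then show "convergent (\<lambda>k. u k x)" by (simp add: sum_lessThan_telescope[of "\<lambda>k. u k x"])
  qed
qed

text \<open>Stated for geometric increments, the form in which orthogonal series call for it.
  Fatou's lemma carries the tail bound of the sequence over to its pointwise limit.\<close>

lemma L2_complete:
  assumes u: "\<And>n. u n \<in> L2 M"
    and v: "\<And>k. norm2 M (\<lambda>x. u (Suc k) x - u k x) \<le> (1/2) ^ k"
  obtains g where "g \<in> L2 M" "(\<lambda>n. norm2 M (\<lambda>x. g x - u n x)) \<longlonglongrightarrow> 0"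
proof -
  have [measurable]: "u n \<in> borel_measurable M" for n using u L2_meas by auto
  have tail: "norm2 M (\<lambda>x. u (n + k) x - u n x) \<le> 2 * (1/2) ^ n" for n k
  proof -
    have "norm2 M (\<lambda>x. u (n + k) x - u n x) \<le> (\<Sum>j<k. (1/2) ^ (n + j))"
    proof (induction k)
      case 0 then show ?case by (simp add: norm2_def)
    next
      case (Suc k)
      have "norm2 M (\<lambda>x. u (n + Suc k) x - u n x) \<le> norm2 M (\<lambda>x. u (Suc (n + k)) x - u (n + k) x) + norm2 M (\<lambda>x. u (n + k) x - u n x)"
        using norm2_triangle_diff[OF u[of "Suc (n + k)"] u[of "n + k"] u[of n]] by simp
      then show ?case using Suc v[of "n + k"] by simp
    qed
    also have "\<dots> = (1/2) ^ n * (\<Sum>j<k. (1/2) ^ j)" by (simp add: power_add sum_distrib_left)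
    also have "(\<Sum>j<k. (1/2 :: real) ^ j) \<le> 2" by (simp add: geometric_sum)
    finally show ?thesis by (simp add: mult.commute)
  qed
  define g where "g x = lim (\<lambda>k. u k x)" for x
  have [measurable]: "g \<in> borel_measurable M" unfolding g_def by measurable
  have ae: "AE x in M. (\<lambda>k. u k x) \<longlonglongrightarrow> g x"
    using L2_AE_convergent_subseq[OF u v] by eventually_elim (simp add: g_def convergent_LIMSEQ_iff)
  have fatou: "(\<integral>\<^sup>+x. ennreal ((cmod (g x - u n x))\<^sup>2) \<partial>M) \<le> ennreal ((2 * (1/2) ^ n)\<^sup>2)" for n
  proof -
    have "(\<integral>\<^sup>+x. ennreal ((cmod (g x - u n x))\<^sup>2) \<partial>M) = (\<integral>\<^sup>+x. liminf (\<lambda>k. ennreal ((cmod (u (n + k) x - u n x))\<^sup>2)) \<partial>M)"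
    proof (rule nn_integral_cong_AE)
      show "AE x in M. ennreal ((cmod (g x - u n x))\<^sup>2) = liminf (\<lambda>k. ennreal ((cmod (u (n + k) x - u n x))\<^sup>2))"
        using ae
      proof eventually_elim
        case (elim x)
        have "(\<lambda>k. u (n + k) x) \<longlonglongrightarrow> g x" using LIMSEQ_ignore_initial_segment[OF elim, of n] by (simp add: add.commute)
        then have "(\<lambda>k. ennreal ((cmod (u (n + k) x - u n x))\<^sup>2)) \<longlonglongrightarrow> ennreal ((cmod (g x - u n x))\<^sup>2)"
          by (intro tendsto_intros tendsto_ennrealI)
        from lim_imp_Liminf[OF trivial_limit_sequentially this] show ?case by (rule sym)
      qed
    qed
    also have "\<dots> \<le> liminf (\<lambda>k. \<integral>\<^sup>+x. ennreal ((cmod (u (n + k) x - u n x))\<^sup>2) \<partial>M)"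
      by (rule nn_integral_liminf) measurable
    also have "\<dots> \<le> liminf (\<lambda>k. ennreal ((2 * (1/2) ^ n)\<^sup>2))"
    proof (rule Liminf_mono, rule always_eventually, rule allI)
      fix k
      have "(norm2 M (\<lambda>x. u (n + k) x - u n x))\<^sup>2 \<le> (2 * (1/2) ^ n)\<^sup>2"
        by (intro power_mono tail norm2_nonneg)
      then show "(\<integral>\<^sup>+x. ennreal ((cmod (u (n + k) x - u n x))\<^sup>2) \<partial>M) \<le> ennreal ((2 * (1/2) ^ n)\<^sup>2)"
        unfolding nn_integral_eq_norm2[OF L2_diff[OF u u]] by (rule ennreal_leI)
    qed
    finally show ?thesis by (simp add: Liminf_const)
  qed
  have gu: "(\<lambda>x. g x - u n x) \<in> L2 M" for n
  proof (rule L2_I)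
    show "integrable M (\<lambda>x. (cmod (g x - u n x))\<^sup>2)"
      using fatou[of n] by (intro integrableI_bounded) (auto simp: order.strict_trans1)
  qed measurable
  have "g \<in> L2 M" using L2_add[OF gu[of 0] u[of 0]] by simp
  moreover have "(\<lambda>n. norm2 M (\<lambda>x. g x - u n x)) \<longlonglongrightarrow> 0"
  proof (rule tendsto_sandwich[of "\<lambda>n. 0" _ _ "\<lambda>n. 2 * (1/2) ^ n"])
    have "norm2 M (\<lambda>x. g x - u n x) \<le> 2 * (1/2) ^ n" for n
    proof (rule power2_le_imp_le)
      have "ennreal ((norm2 M (\<lambda>x. g x - u n x))\<^sup>2) \<le> ennreal ((2 * (1/2) ^ n)\<^sup>2)"
        using fatou[of n] by (simp add: nn_integral_eq_norm2[OF gu])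
      then show "(norm2 M (\<lambda>x. g x - u n x))\<^sup>2 \<le> (2 * (1/2) ^ n)\<^sup>2" by (simp add: ennreal_le_iff)
    qed simp
    then show "\<forall>\<^sub>F n in sequentially. norm2 M (\<lambda>x. g x - u n x) \<le> 2 * (1/2) ^ n" by simp
    show "(\<lambda>n. 2 * (1/2 :: real) ^ n) \<longlonglongrightarrow> 0"
      using tendsto_mult_right[OF LIMSEQ_power_zero[of "1/2 :: real"], of 2] by (simp add: mult.commute)
  qed (simp_all add: norm2_nonneg)
  ultimately show thesis by (rule that)
qed

subsection \<open>Unconditional sums\<close>

lemma tendsto_0_squeeze:
  fixes f g :: "'a \<Rightarrow> real"
  assumes "(g \<longlongrightarrow> l) F" "eventually (\<lambda>x. f x \<le> g x) F" "\<And>x. 0 \<le> f x" "l = 0"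
  shows "(f \<longlongrightarrow> 0) F"
  by (rule tendsto_sandwich[of "\<lambda>_. 0" f F g 0]) (use assms in auto)

lemma has_sum2_L2: "has_sum2 M f I g \<Longrightarrow> i \<in> I \<Longrightarrow> f i \<in> L2 M" "has_sum2 M f I g \<Longrightarrow> g \<in> L2 M"
  by (simp_all add: has_sum2_def)

lemma has_sum2_tendsto: "has_sum2 M f I g \<Longrightarrow> ((\<lambda>F. norm2 M (\<lambda>x. g x - (\<Sum>i\<in>F. f i x))) \<longlongrightarrow> 0) (finite_subsets_at_top I)"
  by (simp add: has_sum2_def)

lemma has_sum2_sum_L2: "has_sum2 M f I g \<Longrightarrow> F \<subseteq> I \<Longrightarrow> (\<lambda>x. \<Sum>i\<in>F. f i x) \<in> L2 M"
  by (rule L2_sum) (auto intro: has_sum2_L2(1))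

lemma has_sum2_unique:
  assumes g: "has_sum2 M f I g" and h: "has_sum2 M f I h" shows "AE x in M. g x = h x"
proof -
  have L: "g \<in> L2 M" "h \<in> L2 M" using has_sum2_L2(2) g h by auto
  let ?S = "\<lambda>F x. \<Sum>i\<in>F. f i x"
  have "((\<lambda>F. norm2 M (\<lambda>x. g x - ?S F x) + norm2 M (\<lambda>x. h x - ?S F x)) \<longlongrightarrow> 0 + 0) (finite_subsets_at_top I)"
    by (intro tendsto_add has_sum2_tendsto g h)
  moreover have "\<forall>\<^sub>F F in finite_subsets_at_top I. norm2 M (\<lambda>x. g x - h x) \<le> norm2 M (\<lambda>x. g x - ?S F x) + norm2 M (\<lambda>x. h x - ?S F x)"
    using eventually_finite_subsets_at_top_weakI[of I "\<lambda>F. F \<subseteq> I"]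
  proof (rule eventually_mono)
    fix F assume F: "F \<subseteq> I"
    show "norm2 M (\<lambda>x. g x - h x) \<le> norm2 M (\<lambda>x. g x - ?S F x) + norm2 M (\<lambda>x. h x - ?S F x)"
      using norm2_triangle_diff[OF L(1) has_sum2_sum_L2[OF g F] L(2)] by (simp add: norm2_minus_commute[of M h])
  qed simp
  ultimately have "norm2 M (\<lambda>x. g x - h x) \<le> 0 + 0"
    by (rule tendsto_lowerbound) simp
  then have "norm2 M (\<lambda>x. g x - h x) = 0" using norm2_nonneg[of M "\<lambda>x. g x - h x"] by linarith
  then show ?thesis using norm2_eq_0_iff[OF L2_diff[OF L]] by simp
qed

lemma has_sum2_cong_AE:
  assumes f: "has_sum2 M f I g" and f': "\<And>i. i \<in> I \<Longrightarrow> f' i \<in> L2 M" and g': "g' \<in> L2 M"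
    and eq: "\<And>i. i \<in> I \<Longrightarrow> AE x in M. f i x = f' i x" and "AE x in M. g x = g' x"
  shows "has_sum2 M f' I g'"
  unfolding has_sum2_def
proof (intro conjI ballI f' g')
  show "((\<lambda>F. norm2 M (\<lambda>x. g' x - (\<Sum>i\<in>F. f' i x))) \<longlongrightarrow> 0) (finite_subsets_at_top I)"
  proof (rule Lim_transform_eventually[OF has_sum2_tendsto[OF f]])
    show "\<forall>\<^sub>F F in finite_subsets_at_top I. norm2 M (\<lambda>x. g x - (\<Sum>i\<in>F. f i x)) = norm2 M (\<lambda>x. g' x - (\<Sum>i\<in>F. f' i x))"
    proof (rule eventually_finite_subsets_at_top_weakI)
      fix F assume F: "finite F" "F \<subseteq> I"
      have "AE x in M. \<forall>i\<in>F. f i x = f' i x" using F eq by (intro AE_finite_allI) auto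
      then have "AE x in M. g x - (\<Sum>i\<in>F. f i x) = g' x - (\<Sum>i\<in>F. f' i x)"
        using assms(5) by eventually_elim simp
      then show "norm2 M (\<lambda>x. g x - (\<Sum>i\<in>F. f i x)) = norm2 M (\<lambda>x. g' x - (\<Sum>i\<in>F. f' i x))"
        using F f' by (intro norm2_cong_AE L2_meas L2_diff g' has_sum2_L2(2)[OF f] has_sum2_sum_L2[OF f] L2_sum) auto
    qed
  qed
qed

lemma has_sum2_add:
  assumes f: "has_sum2 M f I g" and f': "has_sum2 M f' I g'"
  shows "has_sum2 M (\<lambda>i x. f i x + f' i x) I (\<lambda>x. g x + g' x)"
  unfolding has_sum2_def
proof (intro conjI ballI L2_add has_sum2_L2[OF f] has_sum2_L2[OF f'])
  have "((\<lambda>F. norm2 M (\<lambda>x. g x - (\<Sum>i\<in>F. f i x)) + norm2 M (\<lambda>x. g' x - (\<Sum>i\<in>F. f' i x))) \<longlongrightarrow> 0 + 0) (finite_subsets_at_top I)"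
    by (intro tendsto_add has_sum2_tendsto f f')
  moreover have "\<forall>\<^sub>F F in finite_subsets_at_top I. norm2 M (\<lambda>x. g x + g' x - (\<Sum>i\<in>F. f i x + f' i x))
      \<le> norm2 M (\<lambda>x. g x - (\<Sum>i\<in>F. f i x)) + norm2 M (\<lambda>x. g' x - (\<Sum>i\<in>F. f' i x))"
  proof (rule eventually_finite_subsets_at_top_weakI)
    fix F assume F: "finite F" "F \<subseteq> I"
    show "norm2 M (\<lambda>x. g x + g' x - (\<Sum>i\<in>F. f i x + f' i x))
      \<le> norm2 M (\<lambda>x. g x - (\<Sum>i\<in>F. f i x)) + norm2 M (\<lambda>x. g' x - (\<Sum>i\<in>F. f' i x))"
      using norm2_triangle[OF L2_diff[OF has_sum2_L2(2)[OF f] has_sum2_sum_L2[OF f F(2)]]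
          L2_diff[OF has_sum2_L2(2)[OF f'] has_sum2_sum_L2[OF f' F(2)]]]
      by (simp add: sum.distrib algebra_simps)
  qed
  ultimately show "((\<lambda>F. norm2 M (\<lambda>x. g x + g' x - (\<Sum>i\<in>F. f i x + f' i x))) \<longlongrightarrow> 0) (finite_subsets_at_top I)"
    by (rule tendsto_0_squeeze) (simp_all add: norm2_nonneg)
qed

lemma has_sum2_cmult:
  assumes f: "has_sum2 M f I g"
  shows "has_sum2 M (\<lambda>i x. c * f i x) I (\<lambda>x. c * g x)"
  unfolding has_sum2_def
proof (intro conjI ballI L2_cmult has_sum2_L2[OF f])
  have "((\<lambda>F. cmod c * norm2 M (\<lambda>x. g x - (\<Sum>i\<in>F. f i x))) \<longlongrightarrow> cmod c * 0) (finite_subsets_at_top I)"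
    by (intro tendsto_mult_left has_sum2_tendsto f)
  then show "((\<lambda>F. norm2 M (\<lambda>x. c * g x - (\<Sum>i\<in>F. c * f i x))) \<longlongrightarrow> 0) (finite_subsets_at_top I)"
    unfolding sum_distrib_left[symmetric] right_diff_distrib[symmetric] norm2_cmult by simp
qed

lemma has_sum2_ip:
  assumes f: "has_sum2 M f I g" and h: "h \<in> L2 M"
  shows "((\<lambda>i. ip2 M (f i) h) has_sum ip2 M g h) I"
  unfolding has_sum_def
proof (rule LIM_zero_cancel, rule tendsto_norm_zero_cancel)
  have "((\<lambda>F. norm2 M (\<lambda>x. g x - (\<Sum>i\<in>F. f i x)) * norm2 M h) \<longlongrightarrow> 0 * norm2 M h) (finite_subsets_at_top I)"
    by (intro tendsto_mult_right has_sum2_tendsto f)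
  moreover have "\<forall>\<^sub>F F in finite_subsets_at_top I. norm ((\<Sum>i\<in>F. ip2 M (f i) h) - ip2 M g h) \<le> norm2 M (\<lambda>x. g x - (\<Sum>i\<in>F. f i x)) * norm2 M h"
  proof (rule eventually_finite_subsets_at_top_weakI)
    fix F assume F: "finite F" "F \<subseteq> I"
    have "ip2 M (\<lambda>x. g x - (\<Sum>i\<in>F. f i x)) h = ip2 M g h - (\<Sum>i\<in>F. ip2 M (f i) h)"
      using F has_sum2_L2(1)[OF f]
      by (subst ip2_diff_left) (auto intro!: has_sum2_L2(2)[OF f] has_sum2_sum_L2[OF f] h ip2_sum_left)
    then show "norm ((\<Sum>i\<in>F. ip2 M (f i) h) - ip2 M g h) \<le> norm2 M (\<lambda>x. g x - (\<Sum>i\<in>F. f i x)) * norm2 M h"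
      using Cauchy_Schwarz2[OF L2_diff[OF has_sum2_L2(2)[OF f] has_sum2_sum_L2[OF f F(2)]] h]
      by (simp add: norm_minus_commute)
  qed
  ultimately show "((\<lambda>F. norm ((\<Sum>i\<in>F. ip2 M (f i) h) - ip2 M g h)) \<longlongrightarrow> 0) (finite_subsets_at_top I)"
    by (rule tendsto_0_squeeze) simp_all
qed

lemma norm2_has_sum2_le:
  assumes f: "has_sum2 M f I g" and le: "\<And>F. finite F \<Longrightarrow> F \<subseteq> I \<Longrightarrow> norm2 M (\<lambda>x. \<Sum>i\<in>F. f i x) \<le> B"
  shows "norm2 M g \<le> B"
proof -
  have "((\<lambda>F. norm2 M (\<lambda>x. g x - (\<Sum>i\<in>F. f i x)) + B) \<longlongrightarrow> 0 + B) (finite_subsets_at_top I)"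
    by (intro tendsto_add has_sum2_tendsto f tendsto_const)
  moreover have "\<forall>\<^sub>F F in finite_subsets_at_top I. norm2 M g \<le> norm2 M (\<lambda>x. g x - (\<Sum>i\<in>F. f i x)) + B"
  proof (rule eventually_finite_subsets_at_top_weakI)
    fix F assume F: "finite F" "F \<subseteq> I"
    show "norm2 M g \<le> norm2 M (\<lambda>x. g x - (\<Sum>i\<in>F. f i x)) + B"
      using norm2_triangle[OF L2_diff[OF has_sum2_L2(2)[OF f] has_sum2_sum_L2[OF f F(2)]] has_sum2_sum_L2[OF f F(2)]]
        le[OF F] by simp
  qed
  ultimately have "norm2 M g \<le> 0 + B" by (rule tendsto_lowerbound) simp
  then show ?thesis by simp
qed

subsection \<open>Orthogonal expansions\<close>

text \<open>Zero vectors and arbitrary lengths are allowed, since the systems of interest are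
  unnormalised monomials and their images.\<close>

definition orthogonal2 :: "'a measure \<Rightarrow> 'i set \<Rightarrow> ('i \<Rightarrow> 'a \<Rightarrow> complex) \<Rightarrow> bool" where
  "orthogonal2 M I P \<longleftrightarrow> (\<forall>i\<in>I. P i \<in> L2 M) \<and> (\<forall>i\<in>I. \<forall>j\<in>I. i \<noteq> j \<longrightarrow> ip2 M (P i) (P j) = 0)"

lemma orthogonal2_L2: "orthogonal2 M I P \<Longrightarrow> i \<in> I \<Longrightarrow> P i \<in> L2 M"
  by (simp add: orthogonal2_def)

lemma orthogonal2_cmult: "orthogonal2 M I P \<Longrightarrow> orthogonal2 M I (\<lambda>i x. c i * P i x)"
  by (simp add: orthogonal2_def L2_cmult ip2_cmult_left ip2_cmult_right)

lemma pythagoras2: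
  assumes "orthogonal2 M I h" "finite F" "F \<subseteq> I"
  shows "(norm2 M (\<lambda>x. \<Sum>i\<in>F. h i x))\<^sup>2 = (\<Sum>i\<in>F. (norm2 M (h i))\<^sup>2)"
  using assms(2,3)
proof (induction F)
  case (insert i F)
  have L: "h j \<in> L2 M" if "j \<in> insert i F" for j using assms(1) insert.prems that by (auto simp: orthogonal2_def)
  have "ip2 M (h i) (\<lambda>x. \<Sum>j\<in>F. h j x) = cnj (\<Sum>j\<in>F. ip2 M (h j) (h i))"
    using L by (subst ip2_commute) (simp add: ip2_sum_left)
  also have "(\<Sum>j\<in>F. ip2 M (h j) (h i)) = 0"
    using assms(1) insert by (intro sum.neutral) (auto simp: orthogonal2_def)
  finally show ?case
    using insert L by (simp add: norm2_add_square L2_sum)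
qed (simp add: norm2_def)

text \<open>The sum of the components of \<open>f\<close> along the \<open>Q i\<close> has inner
  product with \<open>f\<close> equal to its own squared norm, so Cauchy-Schwarz bounds it. A
  vanishing \<open>Q i\<close> contributes 0 because division by zero gives 0.\<close>

lemma bessel2:
  assumes Q: "orthogonal2 M I Q" and F: "finite F" "F \<subseteq> I" and f: "f \<in> L2 M"
  shows "(\<Sum>i\<in>F. (cmod (ip2 M f (Q i)))\<^sup>2 / (norm2 M (Q i))\<^sup>2) \<le> (norm2 M f)\<^sup>2"
proof -
  define c where "c i = ip2 M f (Q i) / complex_of_real ((norm2 M (Q i))\<^sup>2)" for i
  let ?S = "\<lambda>x. \<Sum>i\<in>F. c i * Q i x"
  have L: "Q i \<in> L2 M" if "i \<in> F" for i using Q F that by (auto simp: orthogonal2_def)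
  have S: "?S \<in> L2 M" by (intro L2_sum L2_cmult L)
  have nc: "cmod (c i) = cmod (ip2 M f (Q i)) / (norm2 M (Q i))\<^sup>2" for i
    by (simp add: c_def norm_divide norm_power)
  have t: "(norm2 M (\<lambda>x. c i * Q i x))\<^sup>2 = (cmod (ip2 M f (Q i)))\<^sup>2 / (norm2 M (Q i))\<^sup>2" for i
    unfolding norm2_cmult nc by (cases "norm2 M (Q i) = 0") (simp_all add: power2_eq_square)
  have nS: "(norm2 M ?S)\<^sup>2 = (\<Sum>i\<in>F. (cmod (ip2 M f (Q i)))\<^sup>2 / (norm2 M (Q i))\<^sup>2)"
    using pythagoras2[OF orthogonal2_cmult[OF Q] F, of c] by (simp add: t)
  have "ip2 M ?S f = (\<Sum>i\<in>F. c i * ip2 M (Q i) f)"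
    using L by (subst ip2_sum_left) (auto intro: L2_cmult f simp: ip2_cmult_left)
  also have "\<dots> = (\<Sum>i\<in>F. complex_of_real ((cmod (ip2 M f (Q i)))\<^sup>2 / (norm2 M (Q i))\<^sup>2))"
    by (intro sum.cong refl) (simp add: c_def ip2_commute[of M "Q _" f] complex_norm_square[symmetric])
  finally have ipS: "ip2 M ?S f = complex_of_real ((norm2 M ?S)\<^sup>2)" by (simp add: nS)
  have "(norm2 M ?S)\<^sup>2 \<le> norm2 M ?S * norm2 M f"
    using Cauchy_Schwarz2[OF S f] unfolding ipS by (simp add: norm_power)
  then have "norm2 M ?S \<le> norm2 M f"
    using norm2_nonneg[of M ?S] norm2_nonneg[of M f] by (cases "norm2 M ?S = 0") (auto simp: power2_eq_square)
  then have "(norm2 M ?S)\<^sup>2 \<le> (norm2 M f)\<^sup>2" by (intro power_mono norm2_nonneg)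
  then show ?thesis by (simp add: nS)
qed

text \<open>The net of finite sums is replaced by a sequence: finite sets are chosen outside of
  which little mass remains, completeness gives a limit, and Pythagoras compares it with all larger
  finite sets.\<close>

lemma orthogonal_has_sum2:
  assumes h: "orthogonal2 M I h" and s: "(\<lambda>i. (norm2 M (h i))\<^sup>2) summable_on I"
  shows "\<exists>g. has_sum2 M h I g"
proof -
  define c where "c i = (norm2 M (h i))\<^sup>2" for i
  have c0: "0 \<le> c i" for i by (simp add: c_def)
  obtain A where A: "(c has_sum A) I" using s unfolding c_def summable_on_def by blast
  have tails: "\<exists>F. finite F \<and> F \<subseteq> I \<and> (\<forall>G. finite G \<longrightarrow> G \<subseteq> I \<longrightarrow> G \<inter> F = {} \<longrightarrow> sum c G \<le> e)" if "e > 0" for e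
  proof -
    have "\<forall>\<^sub>F F in finite_subsets_at_top I. dist (sum c F) A < e / 2"
      using A that unfolding has_sum_def tendsto_iff by (meson half_gt_zero)
    then obtain F where "finite F \<and> F \<subseteq> I \<and> (\<forall>Y. finite Y \<and> F \<subseteq> Y \<and> Y \<subseteq> I \<longrightarrow> dist (sum c Y) A < e / 2)"
      unfolding eventually_finite_subsets_at_top by (elim exE)
    then have F: "finite F" "F \<subseteq> I" "\<And>Y. finite Y \<Longrightarrow> F \<subseteq> Y \<Longrightarrow> Y \<subseteq> I \<Longrightarrow> dist (sum c Y) A < e / 2"
      by simp_all
    have "sum c G \<le> e" if G: "finite G" "G \<subseteq> I" "G \<inter> F = {}" for G
    proof -
      have "sum c (F \<union> G) = sum c F + sum c G" using F G by (intro sum.union_disjoint) auto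
      moreover have "dist (sum c (F \<union> G)) A < e / 2" "dist (sum c F) A < e / 2" using F G by auto
      ultimately show ?thesis unfolding dist_real_def by linarith
    qed
    then show ?thesis using F by blast
  qed
  \<comment> \<open>Squares of half the increments allowed by \<open>L2_complete\<close>, because
    passing from one set to the next costs two such terms.\<close>
  define e :: "nat \<Rightarrow> real" where "e k = ((1/2) ^ k / 2)\<^sup>2" for k
  have "\<forall>k. \<exists>F. finite F \<and> F \<subseteq> I \<and> (\<forall>G. finite G \<longrightarrow> G \<subseteq> I \<longrightarrow> G \<inter> F = {} \<longrightarrow> sum c G \<le> e k)"
    using tails by (simp add: e_def)
  then obtain F where F: "\<And>k. finite (F k)" "\<And>k. F k \<subseteq> I"
    "\<And>k G. finite G \<Longrightarrow> G \<subseteq> I \<Longrightarrow> G \<inter> F k = {} \<Longrightarrow> sum c G \<le> e k" by metis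
  have L: "(\<lambda>x. \<Sum>i\<in>G. h i x) \<in> L2 M" if "G \<subseteq> I" for G
    using h that by (intro L2_sum) (auto simp: orthogonal2_def)
  have disj: "norm2 M (\<lambda>x. \<Sum>i\<in>G. h i x) \<le> (1/2) ^ k / 2" if "finite G" "G \<subseteq> I" "G \<inter> F k = {}" for G k
    by (rule power2_le_imp_le) (use pythagoras2[OF h that(1,2)] F(3)[OF that] in \<open>simp_all add: c_def e_def\<close>)
  define u where "u k x = (\<Sum>i\<in>F k. h i x)" for k x
  \<comment> \<open>The sets \<open>F k\<close> need not be nested, so both set differences
    appear.\<close>
  have split: "(\<Sum>i\<in>G. h i x) - u k x = (\<Sum>i\<in>G - F k. h i x) - (\<Sum>i\<in>F k - G. h i x)" if "finite G" for G k x
  proof -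
    have "(\<Sum>i\<in>G. h i x) = (\<Sum>i\<in>G - F k. h i x) + (\<Sum>i\<in>G \<inter> F k. h i x)"
      using that by (metis Int_Diff_disjoint Int_Diff_Un finite_Diff finite_Int inf_commute sum.union_disjoint add.commute)
    moreover have "u k x = (\<Sum>i\<in>F k - G. h i x) + (\<Sum>i\<in>G \<inter> F k. h i x)"
      unfolding u_def using F(1)[of k]
      by (metis Int_Diff_disjoint Int_Diff_Un finite_Diff finite_Int inf_commute sum.union_disjoint add.commute)
    ultimately show ?thesis by simp
  qed
  have uL: "u k \<in> L2 M" for k unfolding u_def by (rule L[OF F(2)])
  have "norm2 M (\<lambda>x. u (Suc k) x - u k x) \<le> (1/2) ^ k" for k
  proof -
    have "norm2 M (\<lambda>x. u (Suc k) x - u k x) = norm2 M (\<lambda>x. (\<Sum>i\<in>F (Suc k) - F k. h i x) + (-1) * (\<Sum>i\<in>F k - F (Suc k). h i x))"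
      using split[OF F(1)[of "Suc k"], of _ k] by (simp add: u_def)
    also have "\<dots> \<le> norm2 M (\<lambda>x. \<Sum>i\<in>F (Suc k) - F k. h i x) + norm2 M (\<lambda>x. (-1) * (\<Sum>i\<in>F k - F (Suc k). h i x))"
      using F(2) by (intro norm2_triangle L2_cmult L) auto
    also have "\<dots> \<le> (1/2) ^ k / 2 + (1/2) ^ Suc k / 2"
      unfolding norm2_cmult using disj[of "F (Suc k) - F k" k] disj[of "F k - F (Suc k)" "Suc k"] F(1,2)
      by (intro add_mono) auto
    also have "\<dots> \<le> (1/2) ^ k" by simp
    finally show ?thesis .
  qed
  from L2_complete[OF uL this] obtain g where g: "g \<in> L2 M" "(\<lambda>n. norm2 M (\<lambda>x. g x - u n x)) \<longlonglongrightarrow> 0" by blast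
  have "((\<lambda>F. norm2 M (\<lambda>x. g x - (\<Sum>i\<in>F. h i x))) \<longlongrightarrow> 0) (finite_subsets_at_top I)"
  proof (rule tendstoI)
    fix \<epsilon> :: real assume "\<epsilon> > 0"
    have "(\<lambda>n. norm2 M (\<lambda>x. g x - u n x) + (1/2) ^ n / 2) \<longlonglongrightarrow> 0 + 0 / 2"
      by (intro tendsto_add g(2) tendsto_divide LIMSEQ_power_zero tendsto_const) auto
    then have "\<forall>\<^sub>F n in sequentially. norm2 M (\<lambda>x. g x - u n x) + (1/2) ^ n / 2 < \<epsilon>"
      using \<open>\<epsilon> > 0\<close> by (simp add: order_tendsto_iff)
    from eventually_happens'[OF sequentially_bot this]
    obtain n where n: "norm2 M (\<lambda>x. g x - u n x) + (1/2) ^ n / 2 < \<epsilon>" by blast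
    show "\<forall>\<^sub>F F in finite_subsets_at_top I. dist (norm2 M (\<lambda>x. g x - (\<Sum>i\<in>F. h i x))) 0 < \<epsilon>"
      unfolding eventually_finite_subsets_at_top
    proof (intro exI conjI allI impI)
      show "finite (F n)" by (rule F(1))
      show "F n \<subseteq> I" by (rule F(2))
      fix Y assume Y: "finite Y \<and> F n \<subseteq> Y \<and> Y \<subseteq> I"
      have "norm2 M (\<lambda>x. g x - (\<Sum>i\<in>Y. h i x)) \<le> norm2 M (\<lambda>x. g x - u n x) + norm2 M (\<lambda>x. u n x - (\<Sum>i\<in>Y. h i x))"
        using Y by (intro norm2_triangle_diff g(1) uL L) auto
      also have "norm2 M (\<lambda>x. u n x - (\<Sum>i\<in>Y. h i x)) = norm2 M (\<lambda>x. \<Sum>i\<in>Y - F n. h i x)"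
        using Y split[of Y _ n] by (subst norm2_minus_commute) (simp add: Diff_eq_empty_iff[THEN iffD2])
      also have "\<dots> \<le> (1/2) ^ n / 2" using Y by (intro disj) auto
      finally show "dist (norm2 M (\<lambda>x. g x - (\<Sum>i\<in>Y. h i x))) 0 < \<epsilon>" using n by (simp add: norm2_nonneg)
    qed
  qed
  then show ?thesis using g(1) h by (auto simp: has_sum2_def orthogonal2_def)
qed

section \<open>Operators\<close>

lemma linear2_L2: "linear2 M N A \<Longrightarrow> f \<in> L2 M \<Longrightarrow> A f \<in> L2 N"
  and linear2_cong: "linear2 M N A \<Longrightarrow> f \<in> L2 M \<Longrightarrow> g \<in> L2 M \<Longrightarrow> AE x in M. f x = g x \<Longrightarrow> AE y in N. A f y = A g y"
  and linear2_add: "linear2 M N A \<Longrightarrow> f \<in> L2 M \<Longrightarrow> g \<in> L2 M \<Longrightarrow> AE y in N. A (\<lambda>x. f x + g x) y = A f y + A g y"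
  and linear2_cmult: "linear2 M N A \<Longrightarrow> f \<in> L2 M \<Longrightarrow> AE y in N. A (\<lambda>x. c * f x) y = c * A f y"
  unfolding linear2_def by blast+

lemma linear2_diff:
  assumes A: "linear2 M N A" and f: "f \<in> L2 M" and g: "g \<in> L2 M"
  shows "AE y in N. A (\<lambda>x. f x - g x) y = A f y - A g y"
  using linear2_add[OF A f L2_cmult[OF g, of "-1"]] linear2_cmult[OF A g, of "-1"]
  by eventually_elim simp

lemma linear2_zero: assumes A: "linear2 M N A" shows "AE y in N. A (\<lambda>x. 0) y = 0"
  using linear2_cmult[OF A L2_zero, of 0] by simp

lemma linear2_AE_zero:
  assumes A: "linear2 M N A" and f: "f \<in> L2 M" "AE x in M. f x = 0" shows "AE y in N. A f y = 0"
  using linear2_cong[OF A f(1) L2_zero f(2)] linear2_zero[OF A] by eventually_elim simp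

lemma linear2_sum:
  assumes A: "linear2 M N A" and f: "\<And>i. i \<in> F \<Longrightarrow> f i \<in> L2 M" and F: "finite F"
  shows "AE y in N. A (\<lambda>x. \<Sum>i\<in>F. f i x) y = (\<Sum>i\<in>F. A (f i) y)"
  using F f
proof (induction F)
  case empty then show ?case using linear2_zero[OF A] by simp
next
  case (insert i F)
  have "AE y in N. A (\<lambda>x. f i x + (\<Sum>i\<in>F. f i x)) y = A (f i) y + A (\<lambda>x. \<Sum>i\<in>F. f i x) y"
    using insert.prems by (intro linear2_add[OF A] L2_sum) auto
  moreover have "AE y in N. A (\<lambda>x. \<Sum>i\<in>F. f i x) y = (\<Sum>i\<in>F. A (f i) y)"
    by (rule insert.IH) (use insert.prems in auto)
  ultimately show ?case by eventually_elim (simp add: insert.hyps)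
qed

lemma linear2_comp:
  assumes A: "linear2 M N A" and B: "linear2 N P B" shows "linear2 M P (\<lambda>f. B (A f))"
  unfolding linear2_def
proof (intro conjI ballI allI impI)
  fix f assume f: "f \<in> L2 M"
  show "B (A f) \<in> L2 P" by (intro linear2_L2[OF B] linear2_L2[OF A] f)
  fix g assume g: "g \<in> L2 M"
  note L = linear2_L2[OF A f] linear2_L2[OF A g]
  show "AE y in P. B (A f) y = B (A g) y" if "AE x in M. f x = g x"
    by (rule linear2_cong[OF B L linear2_cong[OF A f g that]])
  show "AE y in P. B (A (\<lambda>x. f x + g x)) y = B (A f) y + B (A g) y"
    using linear2_cong[OF B linear2_L2[OF A L2_add[OF f g]] L2_add[OF L] linear2_add[OF A f g]] linear2_add[OF B L]
    by eventually_elim simp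
next
  fix f c assume f: "f \<in> L2 M"
  note L = linear2_L2[OF A f]
  show "AE y in P. B (A (\<lambda>x. c * f x)) y = c * B (A f) y"
    using linear2_cong[OF B linear2_L2[OF A L2_cmult[OF f, of c]] L2_cmult[OF L, of c] linear2_cmult[OF A f, of c]] linear2_cmult[OF B L, of c]
    by eventually_elim simp
qed

lemma linear2_diff_op:
  assumes A: "linear2 M N A" and B: "linear2 M N B" shows "linear2 M N (\<lambda>f x. A f x - B f x)"
  unfolding linear2_def
proof (intro conjI ballI allI impI)
  fix f assume f: "f \<in> L2 M"
  show "(\<lambda>x. A f x - B f x) \<in> L2 N" by (intro L2_diff linear2_L2[OF A f] linear2_L2[OF B f])
  fix g assume g: "g \<in> L2 M"
  show "AE y in N. A f y - B f y = A g y - B g y" if "AE x in M. f x = g x"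
    using linear2_cong[OF A f g that] linear2_cong[OF B f g that] by eventually_elim simp
  show "AE y in N. A (\<lambda>x. f x + g x) y - B (\<lambda>x. f x + g x) y = A f y - B f y + (A g y - B g y)"
    using linear2_add[OF A f g] linear2_add[OF B f g] by eventually_elim simp
next
  fix f c assume f: "f \<in> L2 M"
  show "AE y in N. A (\<lambda>x. c * f x) y - B (\<lambda>x. c * f x) y = c * (A f y - B f y)"
    using linear2_cmult[OF A f, of c] linear2_cmult[OF B f, of c] by eventually_elim (simp add: algebra_simps)
qed

lemma linear2_id: "linear2 M M (\<lambda>f. f)"
  by (auto simp: linear2_def)

lemma linear2_cmult_op: "linear2 M M (\<lambda>f x. l * f x)"
  by (auto simp: linear2_def L2_cmult algebra_simps)

lemma linear2_shift: "linear2 M M A \<Longrightarrow> linear2 M M (shift_op A l)"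
  unfolding shift_op_def[abs_def] by (intro linear2_diff_op linear2_cmult_op)

lemma bounded_op_linear: "bounded_op M A \<Longrightarrow> linear2 M M A"
  by (simp add: bounded_op_def)

lemma has_sum2_op:
  assumes A: "linear2 M N A" and bound: "\<And>f. f \<in> L2 M \<Longrightarrow> norm2 N (A f) \<le> C * norm2 M f"
    and s: "has_sum2 M f I g"
  shows "has_sum2 N (\<lambda>i. A (f i)) I (A g)"
  unfolding has_sum2_def
proof (intro conjI ballI linear2_L2[OF A] has_sum2_L2[OF s])
  have "((\<lambda>F. C * norm2 M (\<lambda>x. g x - (\<Sum>i\<in>F. f i x))) \<longlongrightarrow> C * 0) (finite_subsets_at_top I)"
    by (intro tendsto_mult_left has_sum2_tendsto s)
  moreover have "\<forall>\<^sub>F F in finite_subsets_at_top I. norm2 N (\<lambda>x. A g x - (\<Sum>i\<in>F. A (f i) x)) \<le> C * norm2 M (\<lambda>x. g x - (\<Sum>i\<in>F. f i x))"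
  proof (rule eventually_finite_subsets_at_top_weakI)
    fix F assume F: "finite F" "F \<subseteq> I"
    have L: "f i \<in> L2 M" if "i \<in> F" for i using has_sum2_L2(1)[OF s] F that by auto
    note gL = has_sum2_L2(2)[OF s] and SL = has_sum2_sum_L2[OF s F(2)]
    have "AE y in N. A (\<lambda>x. \<Sum>i\<in>F. f i x) y = (\<Sum>i\<in>F. A (f i) y)"
      using L by (intro linear2_sum[OF A _ F(1)])
    then have "AE y in N. A (\<lambda>x. g x - (\<Sum>i\<in>F. f i x)) y = A g y - (\<Sum>i\<in>F. A (f i) y)"
      using linear2_diff[OF A gL SL] by eventually_elim simp
    then have "norm2 N (\<lambda>x. A g x - (\<Sum>i\<in>F. A (f i) x)) = norm2 N (A (\<lambda>x. g x - (\<Sum>i\<in>F. f i x)))"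
      using L by (intro norm2_cong_AE L2_meas L2_diff L2_sum linear2_L2[OF A] gL SL) (auto simp: eq_commute)
    also have "\<dots> \<le> C * norm2 M (\<lambda>x. g x - (\<Sum>i\<in>F. f i x))" by (intro bound L2_diff gL SL)
    finally show "norm2 N (\<lambda>x. A g x - (\<Sum>i\<in>F. A (f i) x)) \<le> C * norm2 M (\<lambda>x. g x - (\<Sum>i\<in>F. f i x))" .
  qed
  ultimately show "((\<lambda>F. norm2 N (\<lambda>x. A g x - (\<Sum>i\<in>F. A (f i) x))) \<longlongrightarrow> 0) (finite_subsets_at_top I)"
    by (rule tendsto_0_squeeze) (simp_all add: norm2_nonneg)
qed

lemma has_sum2_single:
  assumes j: "j \<in> I" and L: "h j \<in> L2 M" and z: "\<And>i. i \<in> I \<Longrightarrow> i \<noteq> j \<Longrightarrow> h i = (\<lambda>x. 0)"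
  shows "has_sum2 M h I (h j)"
  unfolding has_sum2_def
proof (intro conjI ballI L)
  show "h i \<in> L2 M" if "i \<in> I" for i using L z[OF that] L2_zero by (cases "i = j") auto
  have "\<forall>\<^sub>F F in finite_subsets_at_top I. norm2 M (\<lambda>x. h j x - (\<Sum>i\<in>F. h i x)) = 0"
    unfolding eventually_finite_subsets_at_top
  proof (intro exI conjI allI impI)
    show "finite {j}" "{j} \<subseteq> I" using j by auto
    fix Y assume Y: "finite Y \<and> {j} \<subseteq> Y \<and> Y \<subseteq> I"
    have "(\<Sum>i\<in>Y. h i x) = h j x" for x
    proof -
      have "(\<Sum>i\<in>Y. h i x) = (\<Sum>i\<in>{j}. h i x)"
        using Y z by (intro sum.mono_neutral_right) (auto dest!: z)
      then show ?thesis by simp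
    qed
    then show "norm2 M (\<lambda>x. h j x - (\<Sum>i\<in>Y. h i x)) = 0" by (simp add: norm2_def)
  qed
  then show "((\<lambda>F. norm2 M (\<lambda>x. h j x - (\<Sum>i\<in>F. h i x))) \<longlongrightarrow> 0) (finite_subsets_at_top I)"
    by (rule tendsto_eventually)
qed

subsection \<open>Unitary equivalence and spectral data\<close>

lemma isometry_linear: "surjective_isometry2 M N U \<Longrightarrow> linear2 M N U"
  and isometry_norm: "surjective_isometry2 M N U \<Longrightarrow> f \<in> L2 M \<Longrightarrow> norm2 N (U f) = norm2 M f"
  and isometry_surj: "surjective_isometry2 M N U \<Longrightarrow> g \<in> L2 N \<Longrightarrow> \<exists>f\<in>L2 M. AE y in N. U f y = g y"
  by (simp_all add: surjective_isometry2_def)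

lemma isometry_comp:
  assumes U: "surjective_isometry2 M N U" and V: "surjective_isometry2 N P V"
  shows "surjective_isometry2 M P (\<lambda>f. V (U f))"
  unfolding surjective_isometry2_def
proof (intro conjI ballI)
  note lU = isometry_linear[OF U] and lV = isometry_linear[OF V]
  show "linear2 M P (\<lambda>f. V (U f))" by (rule linear2_comp[OF lU lV])
  show "norm2 P (V (U f)) = norm2 M f" if "f \<in> L2 M" for f
    using isometry_norm[OF V linear2_L2[OF lU that]] isometry_norm[OF U that] by simp
  fix g assume "g \<in> L2 P"
  then obtain h where h: "h \<in> L2 N" "AE y in P. V h y = g y" using isometry_surj[OF V] by blast
  then obtain f where f: "f \<in> L2 M" "AE y in N. U f y = h y" using isometry_surj[OF U] by blast
  have "AE y in P. V (U f) y = V h y" by (rule linear2_cong[OF lV linear2_L2[OF lU f(1)] h(1) f(2)])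
  then have "AE y in P. V (U f) y = g y" using h(2) by eventually_elim simp
  then show "\<exists>f\<in>L2 M. AE y in P. V (U f) y = g y" by (rule bexI[OF _ f(1)])
qed

lemma isometry_AE_zero:
  assumes U: "surjective_isometry2 M N U" and f: "f \<in> L2 M" and "AE y in N. U f y = 0"
  shows "AE x in M. f x = 0"
  using assms norm2_eq_0_iff[OF linear2_L2[OF isometry_linear[OF U] f]] norm2_eq_0_iff[OF f] isometry_norm[OF U f] by simp

lemma isometry_inj:
  assumes U: "surjective_isometry2 M N U" and f: "f \<in> L2 M" and g: "g \<in> L2 M" and eq: "AE y in N. U f y = U g y"
  shows "AE x in M. f x = g x"
proof -
  have "AE y in N. U (\<lambda>x. f x - g x) y = 0"
    using linear2_diff[OF isometry_linear[OF U] f g] eq by eventually_elim simp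
  from isometry_AE_zero[OF U L2_diff[OF f g] this] show ?thesis by simp
qed

text \<open>A chosen preimage. By \<open>isometry_inj\<close> it is determined up to null sets,
  which makes the choice immaterial.\<close>

definition inverse2 :: "'a measure \<Rightarrow> 'b measure \<Rightarrow> (('a \<Rightarrow> complex) \<Rightarrow> 'b \<Rightarrow> complex) \<Rightarrow> ('b \<Rightarrow> complex) \<Rightarrow> 'a \<Rightarrow> complex" where
  "inverse2 M N U g = (SOME f. f \<in> L2 M \<and> (AE y in N. U f y = g y))"

lemma inverse2:
  assumes U: "surjective_isometry2 M N U" and g: "g \<in> L2 N"
  shows "inverse2 M N U g \<in> L2 M" "AE y in N. U (inverse2 M N U g) y = g y"
proof -
  have "\<exists>f. f \<in> L2 M \<and> (AE y in N. U f y = g y)" using isometry_surj[OF U g] by blast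
  from someI_ex[OF this, folded inverse2_def] show "inverse2 M N U g \<in> L2 M" "AE y in N. U (inverse2 M N U g) y = g y"
    by simp_all
qed

lemma inverse2_left:
  assumes U: "surjective_isometry2 M N U" and f: "f \<in> L2 M"
  shows "AE x in M. inverse2 M N U (U f) x = f x"
  using inverse2[OF U linear2_L2[OF isometry_linear[OF U] f]] by (intro isometry_inj[OF U] f)

lemma inverse2_isometry:
  assumes U: "surjective_isometry2 M N U"
  shows "surjective_isometry2 N M (inverse2 M N U)"
proof -
  let ?V = "inverse2 M N U"
  note lU = isometry_linear[OF U] and V = inverse2[OF U]
  have lin: "linear2 N M ?V"
    unfolding linear2_def
  proof (intro conjI ballI allI impI)
    fix f assume f: "f \<in> L2 N"
    show "?V f \<in> L2 M" by (rule V(1)[OF f])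
    fix g assume g: "g \<in> L2 N"
    show "AE y in M. ?V f y = ?V g y" if "AE x in N. f x = g x"
    proof (rule isometry_inj[OF U V(1)[OF f] V(1)[OF g]])
      show "AE y in N. U (?V f) y = U (?V g) y" using V(2)[OF f] V(2)[OF g] that by eventually_elim simp
    qed
    show "AE y in M. ?V (\<lambda>x. f x + g x) y = ?V f y + ?V g y"
    proof (rule isometry_inj[OF U V(1)[OF L2_add[OF f g]] L2_add[OF V(1)[OF f] V(1)[OF g]]])
      show "AE y in N. U (?V (\<lambda>x. f x + g x)) y = U (\<lambda>y. ?V f y + ?V g y) y"
        using V(2)[OF f] V(2)[OF g] V(2)[OF L2_add[OF f g]] linear2_add[OF lU V(1)[OF f] V(1)[OF g]]
        by eventually_elim simp
    qed
  next
    fix f c assume f: "f \<in> L2 N"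
    show "AE y in M. ?V (\<lambda>x. c * f x) y = c * ?V f y"
    proof (rule isometry_inj[OF U V(1)[OF L2_cmult[OF f]] L2_cmult[OF V(1)[OF f]]])
      show "AE y in N. U (?V (\<lambda>x. c * f x)) y = U (\<lambda>y. c * ?V f y) y"
        using V(2)[OF f] V(2)[OF L2_cmult[OF f, of c]] linear2_cmult[OF lU V(1)[OF f], of c]
        by eventually_elim simp
    qed
  qed
  show ?thesis
    unfolding surjective_isometry2_def
  proof (intro conjI lin ballI)
    fix g assume g: "g \<in> L2 N"
    have "norm2 M (?V g) = norm2 N (U (?V g))" by (rule isometry_norm[OF U V(1)[OF g], symmetric])
    also have "\<dots> = norm2 N g" by (intro norm2_cong_AE L2_meas linear2_L2[OF lU] V g)
    finally show "norm2 M (?V g) = norm2 N g" .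
  next
    fix f assume f: "f \<in> L2 M"
    show "\<exists>g\<in>L2 N. AE y in M. ?V g y = f y"
      by (rule bexI[of _ "U f"]) (rule inverse2_left[OF U f], rule linear2_L2[OF lU f])
  qed
qed

text \<open>Unitary equivalence in one direction. As the inverse of \<open>W\<close> intertwines
  back, each spectral property is proved as an implication or inequality and then used both
  ways.\<close>

locale intertwined =
  fixes M :: "'a measure" and N :: "'b measure" and W A B
  assumes W: "surjective_isometry2 M N W" and A: "linear2 M M A" and B: "linear2 N N B"
    and WA: "\<And>f. f \<in> L2 M \<Longrightarrow> AE y in N. W (A f) y = B (W f) y"
begin

lemma lW: "linear2 M N W" by (rule isometry_linear[OF W])

abbreviation "V \<equiv> inverse2 M N W"

lemma V: "surjective_isometry2 N M V" by (rule inverse2_isometry[OF W])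
lemma lV: "linear2 N M V" by (rule isometry_linear[OF V])

lemma VB:
  assumes g: "g \<in> L2 N" shows "AE x in M. V (B g) x = A (V g) x"
proof (rule isometry_inj[OF W])
  have Vg: "V g \<in> L2 M" "AE y in N. W (V g) y = g y" by (rule inverse2[OF W g])+
  show "V (B g) \<in> L2 M" "A (V g) \<in> L2 M" by (intro linear2_L2[OF lV] linear2_L2[OF A] linear2_L2[OF B] g)+
  have "AE y in N. B (W (V g)) y = B g y" by (rule linear2_cong[OF B linear2_L2[OF lW Vg(1)] g Vg(2)])
  then show "AE y in N. W (V (B g)) y = W (A (V g)) y"
    using inverse2(2)[OF W linear2_L2[OF B g]] WA[OF Vg(1)] by eventually_elim simp
qed

lemma inverse: "intertwined N M V B A"
  by unfold_locales (rule V A B VB, assumption?)+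

lemma invertible:
  assumes B': "bounded_op M B'"
    and inv: "\<forall>f\<in>L2 M. (AE x in M. B' (A f) x = f x) \<and> (AE x in M. A (B' f) x = f x)"
  shows "\<exists>B'. bounded_op N B' \<and> (\<forall>f\<in>L2 N. (AE x in N. B' (B f) x = f x) \<and> (AE x in N. B (B' f) x = f x))"
proof (intro exI conjI ballI)
  let ?B = "\<lambda>g. W (B' (V g))"
  have lB': "linear2 M M B'" using B' by (simp add: bounded_op_def)
  have l: "linear2 N N ?B" by (rule linear2_comp[OF linear2_comp[OF lV lB'] lW])
  obtain C where C: "\<And>f. f \<in> L2 M \<Longrightarrow> norm2 M (B' f) \<le> C * norm2 M f" using B' by (auto simp: bounded_op_def)
  have "norm2 N (?B g) \<le> C * norm2 N g" if g: "g \<in> L2 N" for g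
    using C[OF linear2_L2[OF lV g]] isometry_norm[OF V g] isometry_norm[OF W linear2_L2[OF lB' linear2_L2[OF lV g]]] by simp
  then show "bounded_op N ?B" unfolding bounded_op_def using l by blast
  fix g assume g: "g \<in> L2 N"
  have Vg: "V g \<in> L2 M" by (rule linear2_L2[OF lV g])
  have WVg: "AE y in N. W (V g) y = g y" by (rule inverse2[OF W g])
  have 1: "AE x in M. B' (V (B g)) x = B' (A (V g)) x"
    by (rule linear2_cong[OF lB' linear2_L2[OF lV linear2_L2[OF B g]] linear2_L2[OF A Vg] VB[OF g]])
  have "AE x in M. B' (V (B g)) x = V g x" using 1 inv Vg by (auto elim: eventually_elim2)
  from linear2_cong[OF lW linear2_L2[OF lB' linear2_L2[OF lV linear2_L2[OF B g]]] Vg this] WVg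
  show "AE x in N. ?B (B g) x = g x" by eventually_elim simp
  have B'V: "B' (V g) \<in> L2 M" by (rule linear2_L2[OF lB' Vg])
  have "AE y in N. W (A (B' (V g))) y = W (V g) y"
    by (rule linear2_cong[OF lW linear2_L2[OF A B'V] Vg]) (use inv Vg in blast)
  then show "AE x in N. B (?B g) x = g x" using WA[OF B'V] WVg by eventually_elim simp
qed

lemma W_combination:
  fixes n :: nat
  assumes "\<And>i. i < n \<Longrightarrow> e i \<in> L2 M"
  shows "AE y in N. W (\<lambda>x. \<Sum>i<n. c i * e i x) y = (\<Sum>i<n. c i * W (e i) y)"
proof -
  have "AE y in N. W (\<lambda>x. \<Sum>i<n. c i * e i x) y = (\<Sum>i<n. W (\<lambda>x. c i * e i x) y)"
    by (rule linear2_sum[where f = "\<lambda>i x. c i * e i x" and F = "{..<n}", OF lW]) (use assms in \<open>auto intro: L2_cmult\<close>)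
  moreover have "AE y in N. \<forall>i\<in>{..<n}. W (\<lambda>x. c i * e i x) y = c i * W (e i) y"
    using assms by (intro AE_finite_allI linear2_cmult[OF lW]) auto
  ultimately show ?thesis by eventually_elim simp
qed

lemma dim_kernel_le: "dim2 M (kernel2 M A) \<le> dim2 N (kernel2 N B)"
  unfolding dim2_def
proof (rule Sup_subset_mono, rule subsetI)
  fix k assume "k \<in> {enat n | n. \<exists>e :: nat \<Rightarrow> 'a \<Rightarrow> complex. (\<forall>i<n. e i \<in> kernel2 M A) \<and>
     (\<forall>c. (AE x in M. (\<Sum>i<n. c i * e i x) = 0) \<longrightarrow> (\<forall>i<n. c i = 0))}"
  then obtain n e where k: "k = enat n" and e: "\<And>i. i < n \<Longrightarrow> e i \<in> kernel2 M A"
    and ind: "\<And>c. (AE x in M. (\<Sum>i<n. c i * e i x) = 0) \<Longrightarrow> \<forall>i<n. c i = 0" by blast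
  have eL: "e i \<in> L2 M" "AE x in M. A (e i) x = 0" if "i < n" for i using e[OF that] by (auto simp: kernel2_def)
  have "\<forall>i<n. W (e i) \<in> kernel2 N B"
  proof (intro allI impI)
    fix i assume i: "i < n"
    have "AE y in N. W (A (e i)) y = 0" by (rule linear2_AE_zero[OF lW linear2_L2[OF A eL(1)[OF i]] eL(2)[OF i]])
    then have "AE y in N. B (W (e i)) y = 0" using WA[OF eL(1)[OF i]] by eventually_elim simp
    then show "W (e i) \<in> kernel2 N B" using linear2_L2[OF lW eL(1)[OF i]] by (simp add: kernel2_def)
  qed
  moreover have "\<forall>c. (AE x in N. (\<Sum>i<n. c i * W (e i) x) = 0) \<longrightarrow> (\<forall>i<n. c i = 0)"
  proof (intro allI impI)
    fix c i assume "AE x in N. (\<Sum>i<n. c i * W (e i) x) = 0" and i: "i < n"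
    then have "AE y in N. W (\<lambda>x. \<Sum>i<n. c i * e i x) y = 0"
      using W_combination[of n e c] eL(1) by (auto elim: eventually_elim2)
    then have "AE x in M. (\<Sum>i<n. c i * e i x) = 0"
      by (rule isometry_AE_zero[OF W, rotated]) (rule L2_sum, rule L2_cmult, rule eL(1), simp)
    then show "c i = 0" using ind i by blast
  qed
  ultimately show "k \<in> {enat n | n. \<exists>e :: nat \<Rightarrow> 'b \<Rightarrow> complex. (\<forall>i<n. e i \<in> kernel2 N B) \<and>
     (\<forall>c. (AE x in N. (\<Sum>i<n. c i * e i x) = 0) \<longrightarrow> (\<forall>i<n. c i = 0))}"
    using k by (intro CollectI exI[of _ n] conjI exI[of _ "\<lambda>i. W (e i)"]) auto
qed

text \<open>Vectors that span the space together with the range are carried over by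
  \<open>W\<close>. Finiteness of the kernel comes from the equality of dimensions, obtained outside
  because one direction of \<open>dim_kernel_le\<close> gives only an inequality.\<close>

lemma fredholm:
  assumes "fredholm2 M A" "dim2 N (kernel2 N B) = dim2 M (kernel2 M A)" shows "fredholm2 N B"
proof -
  obtain n and e :: "nat \<Rightarrow> 'a \<Rightarrow> complex" where e: "\<And>i. i < n \<Longrightarrow> e i \<in> L2 M"
    and *: "\<And>f. f \<in> L2 M \<Longrightarrow> \<exists>g\<in>L2 M. \<exists>c. AE x in M. f x = A g x + (\<Sum>i<n. c i * e i x)"
    using assms(1) unfolding fredholm2_def by blast
  have "\<exists>g\<in>L2 N. \<exists>c. AE x in N. f x = B g x + (\<Sum>i<n. c i * W (e i) x)" if f: "f \<in> L2 N" for f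
  proof -
    obtain g c where g: "g \<in> L2 M" and eq: "AE x in M. V f x = A g x + (\<Sum>i<n. c i * e i x)"
      using *[OF linear2_L2[OF lV f]] by blast
    have S: "(\<lambda>x. \<Sum>i<n. c i * e i x) \<in> L2 M" by (intro L2_sum L2_cmult) (use e in auto)
    note Ag = linear2_L2[OF A g]
    have "AE y in N. W (V f) y = W (\<lambda>x. A g x + (\<Sum>i<n. c i * e i x)) y"
      by (rule linear2_cong[OF lW linear2_L2[OF lV f] L2_add[OF Ag S] eq])
    moreover have "AE y in N. W (V f) y = f y" by (rule inverse2[OF W f])
    moreover have "AE y in N. W (\<lambda>x. \<Sum>i<n. c i * e i x) y = (\<Sum>i<n. c i * W (e i) y)" by (rule W_combination) (rule e)
    ultimately have "AE y in N. f y = B (W g) y + (\<Sum>i<n. c i * W (e i) y)"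
      using linear2_add[OF lW Ag S] WA[OF g] by eventually_elim simp
    then show ?thesis using linear2_L2[OF lW g] by (intro bexI[of _ "W g"] exI[of _ c])
  qed
  moreover have "\<forall>i<n. W (e i) \<in> L2 N" using linear2_L2[OF lW e] by blast
  ultimately show ?thesis
    using assms unfolding fredholm2_def by (intro conjI exI[of _ n] exI[of _ "\<lambda>i. W (e i)"]) auto
qed

end

lemma intertwined_shift:
  assumes "intertwined M N W A B" shows "intertwined M N W (shift_op A l) (shift_op B l)"
proof -
  interpret intertwined M N W A B by (rule assms)
  show ?thesis
  proof
    show "surjective_isometry2 M N W" by (rule W)
    show "linear2 M M (shift_op A l)" "linear2 N N (shift_op B l)" by (rule linear2_shift A B)+
    fix f assume f: "f \<in> L2 M"
    show "AE y in N. W (shift_op A l f) y = shift_op B l (W f) y"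
      unfolding shift_op_def
      using linear2_diff[OF lW linear2_L2[OF A f] L2_cmult[OF f, of l]] WA[OF f] linear2_cmult[OF lW f, of l]
      by eventually_elim simp
  qed
qed

lemma same_spectral_data_intertwined:
  assumes "intertwined M N W A B" shows "same_spectral_data M A N B"
proof -
  have 1: "intertwined M N W (shift_op A l) (shift_op B l)" for l by (rule intertwined_shift[OF assms])
  note 2 = intertwined.inverse[OF 1]
  have mult: "eigen_mult M A l = eigen_mult N B l" for l
    unfolding eigen_mult_def using intertwined.dim_kernel_le[OF 1] intertwined.dim_kernel_le[OF 2] by (rule antisym)
  have "l \<in> spectrum2 M A \<longleftrightarrow> l \<in> spectrum2 N B" for l
    unfolding spectrum2_def mem_Collect_eq
  proof (rule arg_cong[of _ _ Not], rule iffI; elim exE conjE)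
    fix B' assume "bounded_op M B'" "\<forall>f\<in>L2 M. (AE x in M. B' (shift_op A l f) x = f x) \<and> (AE x in M. shift_op A l (B' f) x = f x)"
    then show "\<exists>B'. bounded_op N B' \<and> (\<forall>f\<in>L2 N. (AE x in N. B' (shift_op B l f) x = f x) \<and> (AE x in N. shift_op B l (B' f) x = f x))"
      by (rule intertwined.invertible[OF 1])
  next
    fix B' assume "bounded_op N B'" "\<forall>f\<in>L2 N. (AE x in N. B' (shift_op B l f) x = f x) \<and> (AE x in N. shift_op B l (B' f) x = f x)"
    then show "\<exists>B'. bounded_op M B' \<and> (\<forall>f\<in>L2 M. (AE x in M. B' (shift_op A l f) x = f x) \<and> (AE x in M. shift_op A l (B' f) x = f x))"
      by (rule intertwined.invertible[OF 2])
  qed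
  then have "spectrum2 M A = spectrum2 N B" by blast
  moreover have "l \<in> ess_spectrum2 M A \<longleftrightarrow> l \<in> ess_spectrum2 N B" for l
    unfolding ess_spectrum2_def mem_Collect_eq
    using intertwined.fredholm[OF 1[of l]] intertwined.fredholm[OF 2[of l]] mult[of l] unfolding eigen_mult_def by metis
  then have "ess_spectrum2 M A = ess_spectrum2 N B" by blast
  ultimately show ?thesis unfolding same_spectral_data_def using mult by blast
qed

subsection \<open>Diagonal operators\<close>

text \<open>A sum of rank-one operators. The choice has the same shape as in \<open>leray\<close>,
  so that the two can later be identified as functions.\<close>

definition dsum :: "'a measure \<Rightarrow> 'i set \<Rightarrow> ('i \<Rightarrow> real) \<Rightarrow> ('i \<Rightarrow> 'a \<Rightarrow> complex) \<Rightarrow> ('i \<Rightarrow> 'a \<Rightarrow> complex) \<Rightarrow>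
    ('a \<Rightarrow> complex) \<Rightarrow> 'a \<Rightarrow> complex" where
  "dsum M I a Q P f = (SOME g. has_sum2 M (\<lambda>i x. complex_of_real (a i) * ip2 M f (Q i) * P i x) I g)"

text \<open>\<open>C\<close> bounds the norm of each rank-one block; orthogonality of both systems
  turns this into a bound for the sum. The conditions are symmetric in \<open>Q\<close> and
  \<open>P\<close>, so the adjoint is another instance.\<close>

locale diag2 =
  fixes M :: "'a measure" and I :: "'i set" and a :: "'i \<Rightarrow> real" and Q P :: "'i \<Rightarrow> 'a \<Rightarrow> complex" and C :: real
  assumes Q: "orthogonal2 M I Q" and P: "orthogonal2 M I P"
    and a: "\<And>i. i \<in> I \<Longrightarrow> 0 \<le> a i" and C: "\<And>i. i \<in> I \<Longrightarrow> a i * norm2 M (Q i) * norm2 M (P i) \<le> C"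
    and C0: "0 \<le> C"
begin

lemma swapped: "diag2 M I a P Q C"
  using Q P a C C0 by unfold_locales (auto simp: mult.assoc mult.commute mult.left_commute)

abbreviation "trm f i \<equiv> (\<lambda>x. complex_of_real (a i) * ip2 M f (Q i) * P i x)"

lemma trm_orthogonal: "orthogonal2 M I (trm f)"
  by (rule orthogonal2_cmult[OF P])

text \<open>Each block is controlled by \<open>C\<close> times a normalised coefficient of
  \<open>f\<close>, so that Bessel's inequality can sum the estimates.\<close>

lemma trm_bound:
  assumes f: "f \<in> L2 M" and i: "i \<in> I"
  shows "(norm2 M (trm f i))\<^sup>2 \<le> C\<^sup>2 * ((cmod (ip2 M f (Q i)))\<^sup>2 / (norm2 M (Q i))\<^sup>2)"
proof (cases "norm2 M (Q i) = 0")
  case True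
  then have "ip2 M f (Q i) = 0"
    using Cauchy_Schwarz2[OF f orthogonal2_L2[OF Q i]] by simp
  then show ?thesis by (simp add: norm2_def)
next
  case False
  then have q: "norm2 M (Q i) > 0" using norm2_nonneg[of M "Q i"] by linarith
  have "norm2 M (trm f i) * norm2 M (Q i) = a i * norm2 M (Q i) * norm2 M (P i) * cmod (ip2 M f (Q i))"
    using a[OF i] by (simp add: norm2_cmult norm_mult)
  also have "\<dots> \<le> C * cmod (ip2 M f (Q i))" by (rule mult_right_mono[OF C[OF i]]) simp
  finally have "norm2 M (trm f i) \<le> C * (cmod (ip2 M f (Q i)) / norm2 M (Q i))"
    using q by (simp add: pos_le_divide_eq)
  then have "(norm2 M (trm f i))\<^sup>2 \<le> (C * (cmod (ip2 M f (Q i)) / norm2 M (Q i)))\<^sup>2"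
    by (intro power_mono norm2_nonneg)
  then show ?thesis by (simp add: power_mult_distrib power_divide)
qed

lemma trm_sum_bound:
  assumes f: "f \<in> L2 M" and F: "finite F" "F \<subseteq> I"
  shows "(\<Sum>i\<in>F. (norm2 M (trm f i))\<^sup>2) \<le> C\<^sup>2 * (norm2 M f)\<^sup>2"
proof -
  have "(\<Sum>i\<in>F. (norm2 M (trm f i))\<^sup>2) \<le> (\<Sum>i\<in>F. C\<^sup>2 * ((cmod (ip2 M f (Q i)))\<^sup>2 / (norm2 M (Q i))\<^sup>2))"
    by (rule sum_mono, rule trm_bound[OF f]) (use F in auto)
  also have "\<dots> = C\<^sup>2 * (\<Sum>i\<in>F. (cmod (ip2 M f (Q i)))\<^sup>2 / (norm2 M (Q i))\<^sup>2)" by (simp add: sum_distrib_left)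
  also have "\<dots> \<le> C\<^sup>2 * (norm2 M f)\<^sup>2" by (rule mult_left_mono[OF bessel2[OF Q F f]]) simp
  finally show ?thesis .
qed

abbreviation "K \<equiv> dsum M I a Q P"

lemma K_has_sum: assumes f: "f \<in> L2 M" shows "has_sum2 M (trm f) I (K f)"
proof -
  have "(\<lambda>i. (norm2 M (trm f i))\<^sup>2) summable_on I"
    by (rule nonneg_bounded_partial_sums_imp_summable_on[where C = "C\<^sup>2 * (norm2 M f)\<^sup>2"])
      (auto intro!: eventually_finite_subsets_at_top_weakI trm_sum_bound[OF f])
  then have "\<exists>g. has_sum2 M (trm f) I g" by (rule orthogonal_has_sum2[OF trm_orthogonal])
  then show ?thesis unfolding dsum_def by (rule someI_ex)
qed

lemma K_L2: "f \<in> L2 M \<Longrightarrow> K f \<in> L2 M"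
  using has_sum2_L2(2)[OF K_has_sum] .

lemma K_eqI: "f \<in> L2 M \<Longrightarrow> has_sum2 M (trm f) I g \<Longrightarrow> AE x in M. K f x = g x"
  using has_sum2_unique[OF K_has_sum] .

lemma K_bound: assumes f: "f \<in> L2 M" shows "norm2 M (K f) \<le> C * norm2 M f"
proof (rule norm2_has_sum2_le[OF K_has_sum[OF f]])
  fix F assume F: "finite F" "F \<subseteq> I"
  show "norm2 M (\<lambda>x. \<Sum>i\<in>F. trm f i x) \<le> C * norm2 M f"
  proof (rule power2_le_imp_le)
    show "(norm2 M (\<lambda>x. \<Sum>i\<in>F. trm f i x))\<^sup>2 \<le> (C * norm2 M f)\<^sup>2"
      using trm_sum_bound[OF f F] pythagoras2[OF trm_orthogonal F] by (simp add: power_mult_distrib)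
  qed (simp add: C0 norm2_nonneg)
qed

lemma linear_K: "linear2 M M K"
  unfolding linear2_def
proof (intro conjI ballI allI impI)
  fix f assume f: "f \<in> L2 M"
  show "K f \<in> L2 M" by (rule K_L2[OF f])
  fix g assume g: "g \<in> L2 M"
  show "AE y in M. K f y = K g y" if eq: "AE x in M. f x = g x"
  proof -
    have ip: "ip2 M f (Q i) = ip2 M g (Q i)" if "i \<in> I" for i
      using ip2_cong_AE[OF f orthogonal2_L2[OF Q that] g orthogonal2_L2[OF Q that] eq] by simp
    then have "has_sum2 M (trm f) I (K g)"
      by (intro has_sum2_cong_AE[OF K_has_sum[OF g]] orthogonal2_L2[OF trm_orthogonal] K_L2 g)
        (auto simp: ip)
    then show ?thesis by (rule K_eqI[OF f])
  qed
  show "AE y in M. K (\<lambda>x. f x + g x) y = K f y + K g y"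
  proof (rule K_eqI[OF L2_add[OF f g]])
    show "has_sum2 M (trm (\<lambda>x. f x + g x)) I (\<lambda>x. K f x + K g x)"
      by (rule has_sum2_cong_AE[OF has_sum2_add[OF K_has_sum[OF f] K_has_sum[OF g]]])
        (auto intro!: orthogonal2_L2[OF trm_orthogonal] L2_add K_L2 f g
          simp: ip2_add_left[OF f g orthogonal2_L2[OF Q]] distrib_left distrib_right)
  qed
next
  fix f c assume f: "f \<in> L2 M"
  show "AE y in M. K (\<lambda>x. c * f x) y = c * K f y"
  proof (rule K_eqI[OF L2_cmult[OF f]])
    show "has_sum2 M (trm (\<lambda>x. c * f x)) I (\<lambda>x. c * K f x)"
      by (rule has_sum2_cong_AE[OF has_sum2_cmult[OF K_has_sum[OF f]]])
        (auto intro!: orthogonal2_L2[OF P] L2_cmult K_L2 f simp: ip2_cmult_left)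
  qed
qed

lemma bounded_K: "bounded_op M K"
  unfolding bounded_op_def using linear_K K_bound by blast

text \<open>The two series of inner products agree term by term after conjugation: the
  \<open>a i\<close> are real, so only \<open>Q\<close> and \<open>P\<close> change places.\<close>

lemma K_adjoint:
  assumes f: "f \<in> L2 M" and g: "g \<in> L2 M"
  shows "ip2 M (K f) g = ip2 M f (dsum M I a P Q g)"
proof -
  interpret S: diag2 M I a P Q C by (rule swapped)
  have 1: "((\<lambda>i. ip2 M (trm f i) g) has_sum ip2 M (K f) g) I" by (rule has_sum2_ip[OF K_has_sum[OF f] g])
  have "((\<lambda>i. cnj (ip2 M (S.trm g i) f)) has_sum cnj (ip2 M (S.K g) f)) I"
    using has_sum2_ip[OF S.K_has_sum[OF g] f] by (simp only: has_sum_cnj_iff)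
  moreover have "cnj (ip2 M (S.trm g i) f) = ip2 M (trm f i) g" for i
    by (simp add: ip2_cmult_left ip2_commute[of M g "P i"] ip2_commute[of M "Q i" f])
  ultimately have "((\<lambda>i. ip2 M (trm f i) g) has_sum ip2 M f (S.K g)) I"
    by (simp add: ip2_commute[of M f "S.K g"])
  then show ?thesis by (rule has_sum_unique[OF 1])
qed

lemma K_single:
  assumes f: "f \<in> L2 M" and j: "j \<in> I" and z: "\<And>i. i \<in> I \<Longrightarrow> i \<noteq> j \<Longrightarrow> ip2 M f (Q i) = 0"
  shows "AE x in M. K f x = complex_of_real (a j) * ip2 M f (Q j) * P j x"
  by (rule K_eqI[OF f], rule has_sum2_single[OF j])
    (use j z orthogonal2_L2[OF trm_orthogonal] in auto)

end

subsection \<open>A reflection exchanging two orthogonal systems\<close>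

text \<open>For distinct unit vectors \<open>q\<close> and \<open>p\<close> the reflection along
  \<open>q - p\<close> maps \<open>q\<close> to \<open>p\<close> exactly when their inner product is
  real. Orthogonality of \<open>P i\<close> to \<open>Q j\<close> for different indices lets the
  reflections in all planes act independently.\<close>

locale reflection2 = diag2 +
  assumes Qpos: "\<And>i. i \<in> I \<Longrightarrow> 0 < norm2 M (Q i)" and Ppos: "\<And>i. i \<in> I \<Longrightarrow> 0 < norm2 M (P i)"
    and PQ: "\<And>i j. i \<in> I \<Longrightarrow> j \<in> I \<Longrightarrow> i \<noteq> j \<Longrightarrow> ip2 M (P i) (Q j) = 0"
    and real: "\<And>i. i \<in> I \<Longrightarrow> ip2 M (P i) (Q i) \<in> \<real>"
begin

definition "qn i = complex_of_real (1 / norm2 M (Q i))"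
definition "pn i = complex_of_real (1 / norm2 M (P i))"

lemma cnj_qn [simp]: "cnj (qn i) = qn i" and cnj_pn [simp]: "cnj (pn i) = pn i"
  by (simp_all add: qn_def pn_def)

definition e where "e i = (\<lambda>x. qn i * Q i x - pn i * P i x)"

text \<open>Makes each block of the diagonal operator twice the orthogonal projection onto the line
  of \<open>e i\<close>. When the normalised vectors coincide, \<open>e i\<close> vanishes and the
  value 0 leaves that plane untouched.\<close>

definition ec where "ec i = (if norm2 M (e i) = 0 then 0 else 2 / (norm2 M (e i))\<^sup>2)"

lemma e_L2: "i \<in> I \<Longrightarrow> e i \<in> L2 M"
  unfolding e_def by (intro L2_diff L2_cmult orthogonal2_L2[OF Q] orthogonal2_L2[OF P])

lemma ip_e:
  assumes f: "f \<in> L2 M" and i: "i \<in> I"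
  shows "ip2 M f (e i) = qn i * ip2 M f (Q i) - pn i * ip2 M f (P i)"
  unfolding e_def using f i orthogonal2_L2[OF Q i] orthogonal2_L2[OF P i]
  by (simp add: ip2_diff_right ip2_cmult_right L2_cmult)

lemma QP: "i \<in> I \<Longrightarrow> j \<in> I \<Longrightarrow> i \<noteq> j \<Longrightarrow> ip2 M (Q i) (P j) = 0"
  using PQ[of j i] by (simp add: ip2_commute[of M "Q i" "P j"])

lemma ip_Q_e: "i \<in> I \<Longrightarrow> j \<in> I \<Longrightarrow> i \<noteq> j \<Longrightarrow> ip2 M (Q i) (e j) = 0"
  and ip_P_e: "i \<in> I \<Longrightarrow> j \<in> I \<Longrightarrow> i \<noteq> j \<Longrightarrow> ip2 M (P i) (e j) = 0"
  using Q P by (simp_all add: ip_e orthogonal2_L2[OF Q] orthogonal2_L2[OF P] QP PQ orthogonal2_def)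

lemma e_orthogonal: "orthogonal2 M I e"
  unfolding orthogonal2_def
proof (intro conjI ballI impI e_L2)
  fix i j assume ij: "i \<in> I" "j \<in> I" "i \<noteq> j"
  have "ip2 M (e i) (e j) = qn i * ip2 M (Q i) (e j) - pn i * ip2 M (P i) (e j)"
    unfolding e_def[of i] using ij orthogonal2_L2[OF Q] orthogonal2_L2[OF P] e_L2
    by (simp add: ip2_diff_left ip2_cmult_left L2_cmult)
  then show "ip2 M (e i) (e j) = 0" using ip_Q_e[OF ij] ip_P_e[OF ij] by simp
qed

lemma diag_e: "diag2 M I ec e e 2"
  by unfold_locales (auto simp: e_orthogonal ec_def power2_eq_square)

sublocale E: diag2 M I ec e e 2 by (rule diag_e)

definition R where "R f x = f x - E.K f x"

lemma linear_R: "linear2 M M R"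
  unfolding R_def[abs_def] by (rule linear2_diff_op[OF linear2_id E.linear_K])

lemma R_adjoint: "f \<in> L2 M \<Longrightarrow> g \<in> L2 M \<Longrightarrow> ip2 M (R f) g = ip2 M f (R g)"
  unfolding R_def[abs_def] by (simp add: ip2_diff_left ip2_diff_right E.K_L2 E.K_adjoint)

text \<open>\<open>E.K\<close> is twice an orthogonal projection, which is what makes
  \<open>R\<close> an involution.\<close>

lemma E_E:
  assumes f: "f \<in> L2 M" shows "AE x in M. E.K (E.K f) x = 2 * E.K f x"
proof (rule E.K_eqI[OF E.K_L2[OF f]])
  have Ee: "ip2 M (E.K f) (e i) = complex_of_real (ec i * (norm2 M (e i))\<^sup>2) * ip2 M f (e i)" if i: "i \<in> I" for i
  proof -
    have "ip2 M (E.K f) (e i) = ip2 M f (E.K (e i))" by (rule E.K_adjoint[OF f e_L2[OF i]])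
    also have "AE x in M. E.K (e i) x = complex_of_real (ec i) * ip2 M (e i) (e i) * e i x"
      using e_orthogonal i by (intro E.K_single e_L2) (auto simp: orthogonal2_def)
    then have "ip2 M f (E.K (e i)) = ip2 M f (\<lambda>x. complex_of_real (ec i) * ip2 M (e i) (e i) * e i x)"
      by (intro ip2_cong_AE f E.K_L2 e_L2 i L2_cmult) auto
    finally show ?thesis by (simp add: ip2_cmult_right ip2_self)
  qed
  have cc: "complex_of_real (ec i) * ip2 M (E.K f) (e i) = 2 * (complex_of_real (ec i) * ip2 M f (e i))" if "i \<in> I" for i
    using Ee[OF that] by (auto simp: ec_def)
  have te: "E.trm (E.K f) i = (\<lambda>x. 2 * E.trm f i x)" if "i \<in> I" for i
    by (rule ext) (simp only: cc[OF that], simp only: mult.assoc)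
  show "has_sum2 M (E.trm (E.K f)) I (\<lambda>x. 2 * E.K f x)"
  proof (rule has_sum2_cong_AE[OF has_sum2_cmult[OF E.K_has_sum[OF f], of 2]])
    show "AE x in M. 2 * E.trm f i x = E.trm (E.K f) i x" if "i \<in> I" for i
      by (rule AE_I2, rule fun_cong[OF te[OF that], symmetric])
  qed (auto intro!: L2_cmult E.K_L2 e_L2 f)
qed

lemma R_R: assumes f: "f \<in> L2 M" shows "AE x in M. R (R f) x = f x"
  using E_E[OF f] linear2_diff[OF E.linear_K f E.K_L2[OF f]]
  by eventually_elim (simp add: R_def[abs_def])

lemma R_L2: "f \<in> L2 M \<Longrightarrow> R f \<in> L2 M" by (rule linear2_L2[OF linear_R])

lemma R_norm: assumes f: "f \<in> L2 M" shows "norm2 M (R f) = norm2 M f"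
proof -
  have "ip2 M (R f) (R f) = ip2 M f (R (R f))" by (rule R_adjoint[OF f R_L2[OF f]])
  also have "\<dots> = ip2 M f f" by (intro ip2_cong_AE f R_L2 R_R) auto
  finally have "complex_of_real ((norm2 M (R f))\<^sup>2) = complex_of_real ((norm2 M f)\<^sup>2)" by (simp only: ip2_self)
  then have "(norm2 M (R f))\<^sup>2 = (norm2 M f)\<^sup>2" by (simp only: of_real_eq_iff)
  then show ?thesis by (simp add: norm2_nonneg power2_eq_iff_nonneg)
qed

lemma R_isometry: "surjective_isometry2 M M R"
  unfolding surjective_isometry2_def using linear_R R_norm R_R R_L2 by blast

text \<open>Reality enters here: it makes the inner product of \<open>Q i\<close> with
  \<open>e i\<close> equal to \<open>norm2 M (Q i) * (norm2 M (e i))\<^sup>2 / 2\<close>, so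
  \<open>R\<close> subtracts exactly \<open>norm2 M (Q i)\<close> times \<open>e i\<close>.\<close>

lemma R_Q: assumes i: "i \<in> I" shows "AE x in M. R (Q i) x = complex_of_real (norm2 M (Q i) / norm2 M (P i)) * P i x"
proof -
  let ?q = "norm2 M (Q i)" and ?p = "norm2 M (P i)"
  have q: "?q > 0" and p: "?p > 0" using Qpos Ppos i by auto
  have QL: "Q i \<in> L2 M" and PL: "P i \<in> L2 M" using orthogonal2_L2[OF Q i] orthogonal2_L2[OF P i] .
  obtain r where r: "ip2 M (P i) (Q i) = complex_of_real r" using real[OF i] Reals_cases by blast
  then have r': "ip2 M (Q i) (P i) = complex_of_real r" using ip2_commute[of M "Q i" "P i"] by simp
  have Qe: "ip2 M (Q i) (e i) = complex_of_real (?q - r / ?p)"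
    using q by (simp add: ip_e[OF QL i] ip2_self r' qn_def pn_def power2_eq_square)
  have Pe: "ip2 M (P i) (e i) = complex_of_real (r / ?q - ?p)"
    using p by (simp add: ip_e[OF PL i] ip2_self r qn_def pn_def power2_eq_square)
  have "ip2 M (e i) (e i) = qn i * ip2 M (Q i) (e i) - pn i * ip2 M (P i) (e i)"
    unfolding e_def[of i] using QL PL L2_diff[OF L2_cmult[OF QL] L2_cmult[OF PL]]
    by (simp add: ip2_diff_left ip2_cmult_left L2_cmult)
  also have "\<dots> = complex_of_real (2 * (?q - r / ?p) / ?q)"
    using q p unfolding Qe Pe qn_def pn_def of_real_mult[symmetric] of_real_diff[symmetric] of_real_eq_iff
    by (simp add: field_simps)
  finally have "(norm2 M (e i))\<^sup>2 = 2 * (?q - r / ?p) / ?q"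
    unfolding ip2_self by (simp only: of_real_eq_iff)
  then have half: "?q - r / ?p = ?q * (norm2 M (e i))\<^sup>2 / 2" using q by (simp add: field_simps)
  have "AE x in M. E.K (Q i) x = complex_of_real (ec i) * ip2 M (Q i) (e i) * e i x"
    by (rule E.K_single[OF QL i]) (use ip_Q_e i in auto)
  moreover have "AE x in M. complex_of_real (ec i) * ip2 M (Q i) (e i) * e i x = complex_of_real ?q * e i x"
  proof (cases "norm2 M (e i) = 0")
    case True
    then have "AE x in M. e i x = 0" using norm2_eq_0_iff[OF e_L2[OF i]] by simp
    then show ?thesis by eventually_elim simp
  next
    case False
    then have "ec i * (?q - r / ?p) = ?q" unfolding half by (simp add: ec_def)
    then show ?thesis unfolding Qe of_real_mult[symmetric] by simp
  qed
  ultimately show ?thesis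
  proof eventually_elim
    case (elim x)
    have "E.K (Q i) x = complex_of_real ?q * e i x" by (rule trans[OF elim])
    then have "R (Q i) x = Q i x - complex_of_real ?q * (qn i * Q i x - pn i * P i x)" by (simp add: R_def e_def)
    then have R: "R (Q i) x = (1 - complex_of_real ?q * qn i) * Q i x + (complex_of_real ?q * pn i) * P i x"
      by (simp add: algebra_simps)
    have "complex_of_real ?q * qn i = 1" "complex_of_real ?q * pn i = complex_of_real (?q / ?p)"
      using q by (simp_all add: qn_def pn_def)
    then show ?case unfolding R by simp
  qed
qed

lemma R_P: assumes i: "i \<in> I" shows "AE x in M. R (P i) x = complex_of_real (norm2 M (P i) / norm2 M (Q i)) * Q i x"
proof -
  let ?q = "norm2 M (Q i)" and ?p = "norm2 M (P i)"
  have q: "?q > 0" and p: "?p > 0" using Qpos Ppos i by auto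
  have QL: "Q i \<in> L2 M" and PL: "P i \<in> L2 M" using orthogonal2_L2[OF Q i] orthogonal2_L2[OF P i] .
  have "AE x in M. R (R (Q i)) x = R (\<lambda>x. complex_of_real (?q / ?p) * P i x) x"
    by (rule linear2_cong[OF linear_R R_L2[OF QL] L2_cmult[OF PL] R_Q[OF i]])
  then show ?thesis using R_R[OF QL] linear2_cmult[OF linear_R PL, of "complex_of_real (?q / ?p)"]
  proof eventually_elim
    case (elim x)
    then have "Q i x = complex_of_real (?q / ?p) * R (P i) x" by simp
    then show ?case using q p by simp
  qed
qed

text \<open>\<open>R\<close> turns \<open>P i\<close> into a multiple of \<open>Q i\<close>, and by
  self-adjointness the coefficient of \<open>R f\<close> against \<open>P i\<close> is that of
  \<open>f\<close> against \<open>Q i\<close> times the same ratio of norms.\<close>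

lemma R_K:
  assumes f: "f \<in> L2 M" shows "AE x in M. R (K f) x = dsum M I a P Q (R f) x"
proof -
  interpret S: diag2 M I a P Q C by (rule swapped)
  have "has_sum2 M (\<lambda>i. R (trm f i)) I (R (K f))"
    by (rule has_sum2_op[OF linear_R _ K_has_sum[OF f], of 1]) (simp add: R_norm)
  then have "has_sum2 M (S.trm (R f)) I (R (K f))"
  proof (rule has_sum2_cong_AE)
    fix i assume i: "i \<in> I"
    have PL: "P i \<in> L2 M" and QL: "Q i \<in> L2 M" using orthogonal2_L2[OF P i] orthogonal2_L2[OF Q i] .
    have "ip2 M (R f) (P i) = ip2 M f (R (P i))" by (rule R_adjoint[OF f PL])
    also have "\<dots> = ip2 M f (\<lambda>x. complex_of_real (norm2 M (P i) / norm2 M (Q i)) * Q i x)"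
      by (intro ip2_cong_AE f R_L2 L2_cmult PL QL R_P i) simp
    also have "\<dots> = complex_of_real (norm2 M (P i) / norm2 M (Q i)) * ip2 M f (Q i)"
      by (simp only: ip2_cmult_right complex_cnj_complex_of_real)
    finally have *: "ip2 M (R f) (P i) = complex_of_real (norm2 M (P i) / norm2 M (Q i)) * ip2 M f (Q i)" .
    show "AE x in M. R (trm f i) x = S.trm (R f) i x"
      using linear2_cmult[OF linear_R PL, of "complex_of_real (a i) * ip2 M f (Q i)"] R_P[OF i]
      by eventually_elim (simp add: * algebra_simps)
  qed (auto intro: orthogonal2_L2[OF S.trm_orthogonal] R_L2 K_L2 f)
  then have "AE x in M. S.K (R f) x = R (K f) x" by (rule S.K_eqI[OF R_L2[OF f]])
  then show ?thesis by eventually_elim simp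
qed

end

section \<open>The boundary measures\<close>

definition pbox :: "(real \<times> real \<times> real) set" where
  "pbox = {0<..<1} \<times> {0..<2*pi} \<times> {0..<2*pi}"

definition lbox :: "(real \<times> real \<times> real) measure" where
  "lbox = restrict_space lborel pbox"

lemma pbox_sets [measurable]: "pbox \<in> sets borel"
  unfolding pbox_def by (intro borel_Times) auto

lemma space_lbox: "space lbox = pbox"
  by (simp add: lbox_def space_restrict_space)

lemma measurable_lbox: "measurable lbox N = measurable (restrict_space borel pbox) N"
  unfolding lbox_def by (intro measurable_cong_sets sets_restrict_space_cong) auto

lemma measurable_lboxI: "f \<in> measurable borel N \<Longrightarrow> f \<in> measurable lbox N"
  unfolding measurable_lbox by (rule measurable_restrict_space1)

lemma fst_lbox [measurable]: "fst \<in> measurable lbox borel"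
  by (rule measurable_lboxI) (simp add: borel_prod[symmetric])

text \<open>The constant is the area of the square of angles.\<close>

lemma distr_fst_lbox:
  "distr lbox borel fst = density lborel (\<lambda>\<sigma>. ennreal (4 * pi\<^sup>2) * indicator {0<..<1} \<sigma>)"
proof (rule measure_eqI)
  fix A :: "real set" assume "A \<in> sets (distr lbox borel fst)"
  then have A[measurable]: "A \<in> sets borel" by simp
  have eq: "fst -` A \<inter> pbox = (A \<inter> {0<..<1}) \<times> ({0..<2*pi} \<times> {0..<2*pi})"
    by (auto simp: pbox_def)
  have [measurable]: "fst -` A \<inter> pbox \<in> sets borel"
    unfolding eq by (intro borel_Times) auto
  have "emeasure (distr lbox borel fst) A = emeasure lborel (fst -` A \<inter> pbox)"
    by (subst emeasure_distr[OF fst_lbox A], simp only: space_lbox, unfold lbox_def, rule emeasure_restrict_space) auto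
  also have "\<dots> = emeasure (lborel \<Otimes>\<^sub>M (lborel \<Otimes>\<^sub>M lborel)) ((A \<inter> {0<..<1}) \<times> ({0..<2*pi} \<times> {0..<2*pi}))"
    unfolding eq by (simp add: lborel_prod)
  also have "\<dots> = emeasure lborel (A \<inter> {0<..<1}) * emeasure (lborel \<Otimes>\<^sub>M lborel) ({0..<2*pi} \<times> {0..<2*pi :: real})"
    unfolding lborel_prod by (subst lborel_prod[symmetric], rule lborel.emeasure_pair_measure_Times) (auto intro!: borel_Times)
  also have "emeasure (lborel \<Otimes>\<^sub>M lborel) ({0..<2*pi} \<times> {0..<2*pi :: real}) = ennreal (4 * pi\<^sup>2)"
    by (subst lborel.emeasure_pair_measure_Times) (auto simp: ennreal_mult[symmetric] power2_eq_square)
  also have "emeasure lborel (A \<inter> {0<..<1}) * ennreal (4 * pi\<^sup>2) =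
      emeasure (density lborel (\<lambda>\<sigma>. ennreal (4 * pi\<^sup>2) * indicator {0<..<1} \<sigma>)) A"
  proof -
    have "emeasure (density lborel (\<lambda>\<sigma>. ennreal (4 * pi\<^sup>2) * indicator {0<..<1} \<sigma>)) A =
        (\<integral>\<^sup>+\<sigma>. ennreal (4 * pi\<^sup>2) * indicator (A \<inter> {0<..<1}) \<sigma> \<partial>lborel)"
      by (subst emeasure_density) (auto intro!: nn_integral_cong split: split_indicator)
    also have "\<dots> = ennreal (4 * pi\<^sup>2) * emeasure lborel (A \<inter> {0<..<1})"
      by (rule nn_integral_cmult_indicator) auto
    finally show ?thesis by (simp add: mult.commute)
  qed
  finally show "emeasure (distr lbox borel fst) A = emeasure (density lborel (\<lambda>\<sigma>. ennreal (4 * pi\<^sup>2) * indicator {0<..<1} \<sigma>)) A" .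
qed simp

lemma AE_lbox:
  assumes "AE \<sigma> in lborel. \<sigma> \<in> {0<..<1} \<longrightarrow> P \<sigma>" shows "AE x in lbox. P (fst x)"
proof (rule AE_distrD[OF fst_lbox])
  show "AE \<sigma> in distr lbox borel fst. P \<sigma>"
    unfolding distr_fst_lbox using assms by (subst AE_density) (auto split: split_indicator elim!: eventually_mono)
qed

lemma nn_integral_lbox:
  assumes [measurable]: "g \<in> borel_measurable borel"
  shows "(\<integral>\<^sup>+x. g (fst x) \<partial>lbox) = (\<integral>\<^sup>+\<sigma>. ennreal (4 * pi\<^sup>2) * indicator {0<..<1} \<sigma> * g \<sigma> \<partial>lborel)"
proof -
  have "(\<integral>\<^sup>+x. g (fst x) \<partial>lbox) = (\<integral>\<^sup>+\<sigma>. g \<sigma> \<partial>distr lbox borel fst)"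
    by (rule nn_integral_distr[symmetric]) auto
  also have "\<dots> = (\<integral>\<^sup>+\<sigma>. ennreal (4 * pi\<^sup>2) * indicator {0<..<1} \<sigma> * g \<sigma> \<partial>lborel)"
    unfolding distr_fst_lbox by (rule nn_integral_density) auto
  finally show ?thesis .
qed

lemma nn_integral_lbox_finite:
  assumes "set_integrable lborel {0<..<1} h" and [measurable]: "h \<in> borel_measurable borel"
  shows "(\<integral>\<^sup>+x. ennreal \<bar>h (fst x)\<bar> \<partial>lbox) < \<infinity>"
proof -
  have "(\<integral>\<^sup>+x. ennreal \<bar>h (fst x)\<bar> \<partial>lbox) = (\<integral>\<^sup>+\<sigma>. ennreal (4 * pi\<^sup>2) * indicator {0<..<1} \<sigma> * ennreal \<bar>h \<sigma>\<bar> \<partial>lborel)"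
    by (rule nn_integral_lbox) simp
  also have "\<dots> = ennreal (4 * pi\<^sup>2) * (\<integral>\<^sup>+\<sigma>. ennreal (norm (indicator {0<..<1} \<sigma> *\<^sub>R h \<sigma>)) \<partial>lborel)"
    by (subst nn_integral_cmult[symmetric]) (auto intro!: nn_integral_cong split: split_indicator)
  also have "\<dots> < \<infinity>"
    using assms(1) unfolding set_integrable_def integrable_iff_bounded by (simp add: ennreal_mult_less_top)
  finally show ?thesis .
qed

lemma integral_cis_period:
  fixes k :: int assumes "k \<noteq> 0"
  shows "(\<integral>\<theta>. indicator {0..<2*pi} \<theta> *\<^sub>R cis (of_int k * \<theta>) \<partial>lborel) = 0"
proof -
  let ?F = "\<lambda>\<theta>. cis (of_int k * \<theta>) / (\<i> * of_int k)"
  have "has_bochner_integral lborel (\<lambda>\<theta>. indicator {0..2*pi} \<theta> *\<^sub>R cis (of_int k * \<theta>)) (?F (2*pi) - ?F 0)"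
  proof (rule has_bochner_integral_FTC_Icc)
    fix x :: real
    have "((\<lambda>z. exp (\<i> * of_int k * z)) has_field_derivative of_int k * (\<i> * exp (\<i> * of_int k * of_real x))) (at (of_real x))"
      by (auto intro!: derivative_eq_intros simp: algebra_simps)
    from has_vector_derivative_real_field[OF this]
    have "((\<lambda>\<theta>. cis (of_int k * \<theta>)) has_vector_derivative (of_int k * (\<i> * cis (of_int k * x)))) (at x within {0..2*pi})"
      by (simp add: cis_conv_exp mult.assoc)
    from has_vector_derivative_divide[OF this, of "\<i> * of_int k"]
    show "(?F has_vector_derivative cis (of_int k * x)) (at x within {0..2*pi})" using assms by simp
  qed (auto intro!: continuous_intros)
  moreover have "cis (of_int k * (2 * pi)) = 1"
    using cis_multiple_2pi[of "of_int k"] by (simp add: mult.commute)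
  ultimately have "(\<integral>\<theta>. indicator {0..2*pi} \<theta> *\<^sub>R cis (of_int k * \<theta>) \<partial>lborel) = 0"
    by (simp add: has_bochner_integral_iff)
  moreover have "(\<integral>\<theta>. indicator {0..<2*pi} \<theta> *\<^sub>R cis (of_int k * \<theta>) \<partial>lborel) = (\<integral>\<theta>. indicator {0..2*pi} \<theta> *\<^sub>R cis (of_int k * \<theta>) \<partial>lborel)"
  proof (rule integral_cong_AE)
    show "AE \<theta> in lborel. indicator {0..<2*pi} \<theta> *\<^sub>R cis (of_int k * \<theta>) = indicator {0..2*pi} \<theta> *\<^sub>R cis (of_int k * \<theta>)"
      using AE_lborel_singleton[of "2*pi"] by eventually_elim (auto split: split_indicator)
    have [measurable]: "(\<lambda>\<theta>. cis (of_int k * \<theta>)) \<in> borel_measurable borel"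
      by (intro borel_measurable_continuous_onI continuous_intros)
    show "(\<lambda>\<theta>. indicator {0..<2*pi} \<theta> *\<^sub>R cis (of_int k * \<theta>)) \<in> borel_measurable lborel"
      "(\<lambda>\<theta>. indicator {0..2*pi} \<theta> *\<^sub>R cis (of_int k * \<theta>)) \<in> borel_measurable lborel" by measurable
  qed
  ultimately show ?thesis by simp
qed

text \<open>Fubini splits off the angular factor, one of whose two integrals over a period
  vanishes.\<close>

lemma integral_lbox_fourier:
  fixes k l :: int
  assumes int: "integrable lbox (\<lambda>x. G (fst x) * cis (of_int k * fst (snd x) + of_int l * snd (snd x)))"
    and kl: "(k, l) \<noteq> (0, 0)"
  shows "(\<integral>x. G (fst x) * cis (of_int k * fst (snd x) + of_int l * snd (snd x)) \<partial>lbox) = 0"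
proof -
  let ?c = "\<lambda>k \<theta>. indicator {0..<2*pi} \<theta> *\<^sub>R cis (of_int k * \<theta>)"
  define f where "f x = (indicator {0<..<1} (fst x) *\<^sub>R G (fst x)) * (?c k (fst (snd x)) * ?c l (snd (snd x)))" for x
  have f: "indicator pbox x *\<^sub>R (G (fst x) * cis (of_int k * fst (snd x) + of_int l * snd (snd x))) = f x" for x
    by (cases x) (auto simp: f_def pbox_def cis_mult split: split_indicator)
  have "integrable (lborel \<Otimes>\<^sub>M (lborel \<Otimes>\<^sub>M lborel)) f"
    using int unfolding lbox_def lborel_prod by (subst (asm) integrable_restrict_space) (simp_all add: f)
  then have intf: "integrable (lborel \<Otimes>\<^sub>M lborel) f" by (simp add: lborel_prod)
  have inner: "(\<integral>y. ?c k (fst y) * ?c l (snd y) \<partial>lborel) = (\<integral>\<theta>. ?c k \<theta> \<partial>lborel) * (\<integral>\<theta>. ?c l \<theta> \<partial>lborel)"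
  proof -
    have "integrable (lborel \<Otimes>\<^sub>M lborel) (\<lambda>y. ?c k (fst y) * ?c l (snd y))"
    proof (rule Bochner_Integration.integrable_bound)
      let ?B = "{0..<2*pi} \<times> {0..<2*pi :: real}"
      have [measurable]: "(\<lambda>\<theta>. cis (of_int k * \<theta>)) \<in> borel_measurable borel" for k :: int
        by (intro borel_measurable_continuous_onI continuous_intros)
      show "(\<lambda>y. ?c k (fst y) * ?c l (snd y)) \<in> borel_measurable (lborel \<Otimes>\<^sub>M lborel)" by measurable
      show "integrable (lborel \<Otimes>\<^sub>M lborel) (indicator ?B :: _ \<Rightarrow> real)"
        by (subst integrable_indicator_iff) (auto simp: lborel.emeasure_pair_measure_Times ennreal_mult_less_top)
      show "AE y in lborel \<Otimes>\<^sub>M lborel. norm (?c k (fst y) * ?c l (snd y)) \<le> norm (indicator ?B y :: real)"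
        by (auto split: split_indicator simp: norm_mult)
    qed
    from lborel_pair.integral_fst'[OF this]
    have "(\<integral>y. ?c k (fst y) * ?c l (snd y) \<partial>(lborel \<Otimes>\<^sub>M lborel)) = (\<integral>x. (\<integral>y. ?c k x * ?c l y \<partial>lborel) \<partial>lborel)" by simp
    also have "\<dots> = (\<integral>\<theta>. ?c k \<theta> \<partial>lborel) * (\<integral>\<theta>. ?c l \<theta> \<partial>lborel)" by (simp only: integral_mult_right_zero integral_mult_left_zero)
    finally show ?thesis by (simp add: lborel_prod)
  qed
  have "(\<integral>\<theta>. ?c k \<theta> \<partial>lborel) * (\<integral>\<theta>. ?c l \<theta> \<partial>lborel) = 0"
    using kl integral_cis_period[of k] integral_cis_period[of l] by (cases "k = 0") auto
  then have inner0: "(\<integral>y. ?c k (fst y) * ?c l (snd y) \<partial>lborel) = 0" using inner by simp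
  have "(\<integral>x. G (fst x) * cis (of_int k * fst (snd x) + of_int l * snd (snd x)) \<partial>lbox) = (\<integral>x. f x \<partial>lborel)"
    unfolding lbox_def by (subst integral_restrict_space) (simp_all add: f)
  also have "\<dots> = (\<integral>x. f x \<partial>(lborel \<Otimes>\<^sub>M lborel))" by (simp add: lborel_prod)
  also have "\<dots> = (\<integral>x. (\<integral>y. f (x, y) \<partial>lborel) \<partial>lborel)"
    by (rule lborel_pair.integral_fst'[OF intf, symmetric])
  also have "\<dots> = (\<integral>x. (indicator {0<..<1} x *\<^sub>R G x) * (\<integral>y. ?c k (fst y) * ?c l (snd y) \<partial>lborel) \<partial>lborel)"
    unfolding f_def fst_conv snd_conv by (simp only: integral_mult_right_zero)
  also have "\<dots> = 0" unfolding inner0 by simp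
  finally show ?thesis .
qed

text \<open>Weights are measurable on the open interval, but \<open>s_coord\<close> also takes the
  values 0 and 1. Keeping both end values makes the compositions with \<open>s_coord\<close> equal
  at every boundary point.\<close>

lemma weight_extension:
  assumes "\<omega> \<in> borel_measurable (restrict_space borel {0<..<1::real})"
  obtains \<omega>' :: "real \<Rightarrow> real" where "\<omega>' \<in> borel_measurable borel" "\<And>\<sigma>. \<sigma> \<in> {0..1} \<Longrightarrow> \<omega>' \<sigma> = \<omega> \<sigma>"
proof
  let ?w = "\<lambda>\<sigma>. if \<sigma> \<in> {0<..<1} then \<omega> \<sigma> else if \<sigma> = 0 then \<omega> 0 else \<omega> 1"
  show "?w \<in> borel_measurable borel"
  proof (subst measurable_If_restrict_space_iff, simp, intro conjI)
    show "\<omega> \<in> borel_measurable (restrict_space borel {\<sigma>. \<sigma> \<in> {0<..<1}})" using assms by (simp only: Collect_mem_eq)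
    show "(\<lambda>\<sigma>::real. if \<sigma> = 0 then \<omega> 0 else \<omega> 1) \<in> borel_measurable (restrict_space borel {\<sigma>. \<sigma> \<notin> {0<..<1}})"
      by (rule measurable_restrict_space1, rule measurable_If) auto
  qed
  show "?w \<sigma> = \<omega> \<sigma>" if "\<sigma> \<in> {0..1}" for \<sigma> using that by (auto simp: less_le)
qed

section \<open>Coordinates and the reference measure on the boundary\<close>

context rtilde begin

definition bd :: "C2 measure" where "bd = restrict_space borel (frontier D)"

lemma space_bd: "space bd = frontier D"
  by (simp add: bd_def space_restrict_space)

lemma continuous_measurable_bd: "continuous_on (frontier D) f \<Longrightarrow> f \<in> borel_measurable bd"
  unfolding bd_def by (rule borel_measurable_continuous_on_restrict)

lemma bd_param_eq:
  assumes "\<sigma> \<in> {0<..<1}"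
  shows "bd_param D (\<sigma>, \<theta>\<^sub>1, \<theta>\<^sub>2) = (cis \<theta>\<^sub>1 * fst (s_inv D \<sigma>), cis \<theta>\<^sub>2 * snd (s_inv D \<sigma>))"
  using r_s_inv(3)[OF assms] by (simp add: bd_param_def) (metis fst_conv mult.commute snd_conv)

lemma bd_param_frontier:
  assumes "\<sigma> \<in> {0<..<1}" shows "bd_param D (\<sigma>, \<theta>\<^sub>1, \<theta>\<^sub>2) \<in> frontier D"
  unfolding bd_param_eq[OF assms]
  by (rule frontier_rotate[OF gamma_plus_frontier[OF s_inv(1)[OF assms]]]) (simp_all add: norm_mult)

lemma T_bd_param:
  assumes "\<sigma> \<in> {0<..<1}" shows "T D (bd_param D (\<sigma>, \<theta>\<^sub>1, \<theta>\<^sub>2)) = bd_param (polar D) (\<sigma>, \<theta>\<^sub>1, \<theta>\<^sub>2)"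
proof -
  interpret P: rtilde "polar D" by (rule rtilde_polar)
  show ?thesis
    unfolding bd_param_eq[OF assms] P.bd_param_eq[OF assms] s_inv_polar[OF assms]
    by (rule T_rotate[OF gamma_plus_frontier[OF s_inv(1)[OF assms]]]) simp_all
qed

lemma r_bd_param:
  assumes "\<sigma> \<in> {0<..<1}"
  shows "r1 (bd_param D (\<sigma>, \<theta>\<^sub>1, \<theta>\<^sub>2)) = r1 (s_inv D \<sigma>)" "r2 (bd_param D (\<sigma>, \<theta>\<^sub>1, \<theta>\<^sub>2)) = r2 (s_inv D \<sigma>)"
  unfolding bd_param_eq[OF assms] by (simp_all add: r1_def r2_def norm_mult)

text \<open>Written as \<open>r1\<close> times \<open>r1 \<circ> T\<close>, the coordinate is
  visibly invariant under rotations.\<close>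

lemma s_bd_param:
  assumes "\<sigma> \<in> {0<..<1}" shows "s_coord D (bd_param D (\<sigma>, \<theta>\<^sub>1, \<theta>\<^sub>2)) = \<sigma>"
proof -
  interpret P: rtilde "polar D" by (rule rtilde_polar)
  have "s_coord D (bd_param D (\<sigma>, \<theta>\<^sub>1, \<theta>\<^sub>2)) = s_coord D (s_inv D \<sigma>)"
    by (simp only: s_coord_frontier[OF bd_param_frontier[OF assms]] s_coord_frontier[OF gamma_plus_frontier[OF s_inv(1)[OF assms]]]
        T_bd_param[OF assms] r_bd_param[OF assms] P.r_bd_param[OF assms] s_inv_polar[OF assms])
  then show ?thesis using s_inv(2)[OF assms] by simp
qed

lemma bd_param_off_axes:
  assumes "\<sigma> \<in> {0<..<1}" shows "bd_param D (\<sigma>, \<theta>\<^sub>1, \<theta>\<^sub>2) \<in> off_axes"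
  using r_bd_param[OF assms, of \<theta>\<^sub>1 \<theta>\<^sub>2] r_s_inv(1,2)[OF assms] by (auto simp: off_axes_def r1_def r2_def)

lemma bd_param_measurable [measurable]: "bd_param D \<in> measurable lbox bd"
  unfolding measurable_lbox bd_def
proof (rule measurable_restrict_space2)
  show "bd_param D \<in> space (restrict_space borel pbox) \<rightarrow> frontier D"
    using bd_param_frontier by (auto simp: pbox_def space_restrict_space)
  have "continuous_on pbox (\<lambda>x. r1 (s_inv D (fst x)))" "continuous_on pbox (\<lambda>x. r2 (s_inv D (fst x)))"
    by (rule continuous_on_compose2[OF continuous_on_r_s_inv(1)] continuous_on_compose2[OF continuous_on_r_s_inv(2)];
        auto simp: pbox_def intro!: continuous_intros)+
  then have "continuous_on pbox (\<lambda>x. (complex_of_real (r1 (s_inv D (fst x))) * cis (fst (snd x)),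
      complex_of_real (r2 (s_inv D (fst x))) * cis (snd (snd x))))"
    by (intro continuous_intros)
  then show "bd_param D \<in> borel_measurable (restrict_space borel pbox)"
    unfolding bd_param_def case_prod_beta' by (rule borel_measurable_continuous_on_restrict)
qed

lemma s_coord_measurable [measurable]: "s_coord D \<in> borel_measurable bd"
  by (rule continuous_measurable_bd[OF continuous_on_s_coord])

lemma T_measurable [measurable]: "T D \<in> measurable bd (rtilde.bd (polar D))"
proof -
  interpret P: rtilde "polar D" by (rule rtilde_polar)
  show ?thesis
    unfolding bd_def P.bd_def
    by (rule measurable_restrict_space2)
      (use T_frontier(1) in \<open>auto simp: space_restrict_space intro!: borel_measurable_continuous_on_restrict continuous_on_T\<close>)
qed

lemma s_coord_bounds: "\<zeta> \<in> frontier D \<Longrightarrow> s_coord D \<zeta> \<in> {0..1}"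
proof -
  assume \<zeta>: "\<zeta> \<in> frontier D"
  have "0 \<le> r1 \<zeta> * r1 (T D \<zeta>)" "0 \<le> r2 \<zeta> * r2 (T D \<zeta>)" by (simp_all add: r1_def r2_def)
  then show ?thesis using T_cmod[OF \<zeta>] s_coord_frontier[OF \<zeta>] by simp
qed

lemma one_minus_s: "\<zeta> \<in> frontier D \<Longrightarrow> 1 - s_coord D \<zeta> = r2 \<zeta> * r2 (T D \<zeta>)"
  using T_cmod s_coord_frontier by (metis add_diff_cancel_left')

text \<open>The reference measure with weight 1, which is also the one in
  \<open>leray_integral\<close>; weighted boundary measures become densities over it in
  \<open>bd_measure_eq\<close>.\<close>

definition nu :: "C2 measure" where "nu = distr lbox bd (bd_param D)"

lemma sets_nu [simp, measurable_cong]: "sets nu = sets bd" and space_nu [simp]: "space nu = frontier D"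
  by (simp_all add: nu_def space_bd)

lemma AE_nuI:
  assumes "\<And>\<sigma> \<theta>\<^sub>1 \<theta>\<^sub>2. \<sigma> \<in> {0<..<1} \<Longrightarrow> P (bd_param D (\<sigma>, \<theta>\<^sub>1, \<theta>\<^sub>2))" and "{\<zeta> \<in> space bd. P \<zeta>} \<in> sets bd"
  shows "AE \<zeta> in nu. P \<zeta>"
  unfolding nu_def
  by (subst AE_distr_iff[OF bd_param_measurable assms(2)], rule AE_I2) (use assms(1) in \<open>auto simp: space_lbox pbox_def\<close>)

lemma AE_off_axes: "AE \<zeta> in nu. \<zeta> \<in> off_axes"
proof (rule AE_nuI[where P = "\<lambda>\<zeta>. \<zeta> \<in> off_axes"])
  show "bd_param D (\<sigma>, \<theta>\<^sub>1, \<theta>\<^sub>2) \<in> off_axes" if "\<sigma> \<in> {0<..<1}" for \<sigma> \<theta>\<^sub>1 \<theta>\<^sub>2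
    by (rule bd_param_off_axes[OF that])
  have "off_axes \<inter> frontier D \<in> sets bd"
    unfolding bd_def using open_off_axes by (intro sets_restrict_space_iff[THEN iffD2]) auto
  then show "{\<zeta> \<in> space bd. \<zeta> \<in> off_axes} \<in> sets bd" by (simp add: space_bd Int_def conj_commute)
qed

lemma weight_measurable:
  fixes \<omega> :: "real \<Rightarrow> real"
  assumes "\<omega> \<in> borel_measurable (restrict_space borel {0<..<1})"
  shows "(\<lambda>\<zeta>. \<omega> (s_coord D \<zeta>)) \<in> borel_measurable bd"
proof -
  obtain \<omega>' where w: "\<omega>' \<in> borel_measurable borel" "\<And>\<sigma>. \<sigma> \<in> {0..1} \<Longrightarrow> \<omega>' \<sigma> = \<omega> \<sigma>"
    using weight_extension[OF assms] by blast
  have "(\<lambda>\<zeta>. \<omega>' (s_coord D \<zeta>)) \<in> borel_measurable bd" using w(1) by measurable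
  moreover have "(\<lambda>\<zeta>. \<omega>' (s_coord D \<zeta>)) \<in> borel_measurable bd \<longleftrightarrow> (\<lambda>\<zeta>. \<omega> (s_coord D \<zeta>)) \<in> borel_measurable bd"
    by (rule measurable_cong) (use w(2) s_coord_bounds in \<open>simp add: space_bd\<close>)
  ultimately show ?thesis by simp
qed

lemma bd_measure_eq:
  assumes \<omega>: "\<omega> \<in> borel_measurable (restrict_space borel {0<..<1})"
  shows "bd_measure D \<omega> = density nu (\<lambda>\<zeta>. ennreal (\<omega> (s_coord D \<zeta>)))"
proof -
  have [measurable]: "(\<lambda>\<zeta>. \<omega> (s_coord D \<zeta>)) \<in> borel_measurable bd" by (rule weight_measurable[OF \<omega>])
  have "density nu (\<lambda>\<zeta>. ennreal (\<omega> (s_coord D \<zeta>))) = distr (density lbox (\<lambda>x. ennreal (\<omega> (s_coord D (bd_param D x))))) bd (bd_param D)"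
    unfolding nu_def by (rule density_distr) measurable
  also have "density lbox (\<lambda>x. ennreal (\<omega> (s_coord D (bd_param D x)))) = density lbox (\<lambda>(\<sigma>, \<theta>\<^sub>1, \<theta>\<^sub>2). ennreal (\<omega> \<sigma>))"
  proof (rule density_cong)
    have eq: "ennreal (\<omega> (s_coord D (bd_param D x))) = (\<lambda>(\<sigma>, \<theta>\<^sub>1, \<theta>\<^sub>2). ennreal (\<omega> \<sigma>)) x" if "x \<in> space lbox" for x
      using that s_bd_param by (auto simp: space_lbox pbox_def)
    show m: "(\<lambda>x. ennreal (\<omega> (s_coord D (bd_param D x)))) \<in> borel_measurable lbox" by measurable
    have "(\<lambda>x. ennreal (\<omega> (s_coord D (bd_param D x)))) \<in> borel_measurable lbox \<longleftrightarrow>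
        (\<lambda>(\<sigma>, \<theta>\<^sub>1, \<theta>\<^sub>2). ennreal (\<omega> \<sigma>)) \<in> borel_measurable lbox"
      by (rule measurable_cong) (rule eq)
    then show "(\<lambda>(\<sigma>, \<theta>\<^sub>1, \<theta>\<^sub>2). ennreal (\<omega> \<sigma>)) \<in> borel_measurable lbox" using m by blast
    show "AE x in lbox. ennreal (\<omega> (s_coord D (bd_param D x))) = (\<lambda>(\<sigma>, \<theta>\<^sub>1, \<theta>\<^sub>2). ennreal (\<omega> \<sigma>)) x"
      by (rule AE_I2) (rule eq)
  qed
  finally show ?thesis by (simp add: bd_measure_def lbox_def pbox_def bd_def)
qed

lemma bd_measure_1: "bd_measure D (\<lambda>_. 1) = nu"
  by (subst bd_measure_eq) (simp_all add: density_1)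

text \<open>\<open>T\<close> preserves \<open>s\<close> and both angles, so in coordinates it is the
  identity.\<close>

lemma distr_nu_T: "distr nu (rtilde.bd (polar D)) (T D) = rtilde.nu (polar D)"
proof -
  interpret P: rtilde "polar D" by (rule rtilde_polar)
  have "distr nu P.bd (T D) = distr lbox P.bd (T D \<circ> bd_param D)"
    unfolding nu_def by (rule distr_distr) measurable
  also have "\<dots> = P.nu"
    unfolding P.nu_def by (rule distr_cong) (auto simp: space_lbox pbox_def T_bd_param)
  finally show ?thesis .
qed

lemma AE_nu_s:
  assumes "AE \<sigma> in lborel. \<sigma> \<in> {0<..<1} \<longrightarrow> P \<sigma>" and [measurable]: "{\<zeta> \<in> space bd. P (s_coord D \<zeta>)} \<in> sets bd"
  shows "AE \<zeta> in nu. P (s_coord D \<zeta>)"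
proof -
  have "AE x in lbox. P (s_coord D (bd_param D x))"
    using AE_lbox[OF assms(1)] AE_space[of lbox]
    by eventually_elim (auto simp: space_lbox pbox_def s_bd_param)
  then show ?thesis unfolding nu_def by (subst AE_distr_iff[OF bd_param_measurable]) auto
qed

lemma integrable_nu_s:
  fixes h :: "real \<Rightarrow> real"
  assumes h: "set_integrable lborel {0<..<1} h" and m: "h \<in> borel_measurable (restrict_space borel {0<..<1})"
  shows "integrable nu (\<lambda>\<zeta>. h (s_coord D \<zeta>))"
proof -
  obtain h' where h': "h' \<in> borel_measurable borel" "\<And>\<sigma>. \<sigma> \<in> {0..1} \<Longrightarrow> h' \<sigma> = h \<sigma>"
    using weight_extension[OF m] by blast
  have si: "set_integrable lborel {0<..<1} h'"
    using h by (rule set_integrable_cong[THEN iffD1, rotated -1]) (use h' in auto)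
  have [measurable]: "(\<lambda>\<zeta>. h (s_coord D \<zeta>)) \<in> borel_measurable bd" by (rule weight_measurable[OF m])
  have "integrable lbox (\<lambda>x. h (s_coord D (bd_param D x)))"
  proof (rule integrableI_bounded)
    have "(\<integral>\<^sup>+x. ennreal (norm (h (s_coord D (bd_param D x)))) \<partial>lbox) = (\<integral>\<^sup>+x. ennreal \<bar>h' (fst x)\<bar> \<partial>lbox)"
      by (rule nn_integral_cong) (auto simp: space_lbox pbox_def s_bd_param h')
    also have "\<dots> < \<infinity>" by (rule nn_integral_lbox_finite[OF si h'(1)])
    finally show "(\<integral>\<^sup>+x. ennreal (norm (h (s_coord D (bd_param D x)))) \<partial>lbox) < \<infinity>" .
  qed measurable
  then show ?thesis unfolding nu_def by (subst integrable_distr_eq[OF bd_param_measurable]) auto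
qed

lemma emeasure_nu: "emeasure nu (space nu) = ennreal (4 * pi\<^sup>2)"
proof -
  have "emeasure nu (space nu) = emeasure lbox (space lbox)"
  proof -
    have "bd_param D -` space bd \<inter> space lbox = space lbox" using measurable_space[OF bd_param_measurable] by auto
    then show ?thesis unfolding nu_def space_distr by (subst emeasure_distr[OF bd_param_measurable]) auto
  qed
  also have "\<dots> = emeasure (distr lbox borel fst) UNIV"
    by (subst emeasure_distr) auto
  also have "\<dots> = ennreal (4 * pi\<^sup>2)"
    unfolding distr_fst_lbox by (subst emeasure_density) (auto simp: nn_integral_cmult)
  finally show ?thesis .
qed

lemma nu_not_null: "\<not> (AE \<zeta> in nu. False)"
proof
  assume "AE \<zeta> in nu. False"
  then obtain N where "{\<zeta> \<in> space nu. \<not> False} \<subseteq> N" "emeasure nu N = 0" "N \<in> sets nu" by (rule AE_E)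
  then have "emeasure nu (space nu) \<le> 0" by (metis (no_types, lifting) Collect_mem_eq Collect_cong emeasure_mono)
  then show False using emeasure_nu by simp
qed

end

section \<open>The isometry \<open>U\<close>\<close>

text \<open>The weight itself and its reciprocal are integrable, without the free constant of
  \<open>admissible_measure\<close>; \<open>rtilde_weightI\<close> makes the passage. The conditions
  are symmetric under inversion of the weight, hence under duality.\<close>

locale rtilde_weight = rtilde +
  fixes \<omega> :: "real \<Rightarrow> real"
  assumes weight: "positive_weight \<omega>" and int_weight: "set_integrable lborel {0<..<1} \<omega>"
    and int_inverse: "set_integrable lborel {0<..<1} (\<lambda>\<sigma>. 1 / \<omega> \<sigma>)"
begin

definition mu :: "C2 measure" where "mu = bd_measure D \<omega>"

abbreviation w :: "C2 \<Rightarrow> real" where "w \<zeta> \<equiv> \<omega> (s_coord D \<zeta>)"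

lemma weight_meas: "\<omega> \<in> borel_measurable (restrict_space borel {0<..<1})"
  using weight by (simp add: positive_weight_def)

lemma w_meas [measurable]: "w \<in> borel_measurable bd"
  by (rule weight_measurable[OF weight_meas])

lemma mu_eq: "mu = density nu (\<lambda>\<zeta>. ennreal (w \<zeta>))"
  unfolding mu_def by (rule bd_measure_eq[OF weight_meas])

lemma sets_mu [simp, measurable_cong]: "sets mu = sets bd" and space_mu [simp]: "space mu = frontier D"
  by (simp_all add: mu_eq)

lemma measurable_mu: "measurable mu N = measurable bd N"
  by (rule measurable_cong_sets) simp_all

lemma AE_w_pos: "AE \<zeta> in nu. 0 < w \<zeta>"
proof (rule AE_nu_s[where P = "\<lambda>\<sigma>. 0 < \<omega> \<sigma>"])
  show "AE \<sigma> in lborel. \<sigma> \<in> {0<..<1} \<longrightarrow> 0 < \<omega> \<sigma>" using weight by (simp add: positive_weight_def)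
qed measurable

lemma AE_mu_iff: "(AE \<zeta> in mu. P \<zeta>) \<longleftrightarrow> (AE \<zeta> in nu. P \<zeta>)"
proof
  assume "AE \<zeta> in mu. P \<zeta>"
  then have "AE \<zeta> in nu. 0 < ennreal (w \<zeta>) \<longrightarrow> P \<zeta>" unfolding mu_eq by (subst (asm) AE_density) measurable
  then show "AE \<zeta> in nu. P \<zeta>" using AE_w_pos by eventually_elim simp
next
  assume "AE \<zeta> in nu. P \<zeta>"
  then show "AE \<zeta> in mu. P \<zeta>" unfolding mu_eq by (subst AE_density) (auto elim: eventually_mono)
qed

lemma AE_w_nonneg: "AE \<zeta> in nu. 0 \<le> w \<zeta>"
  using AE_w_pos by eventually_elim simp

lemma integral_mu:
  fixes f :: "C2 \<Rightarrow> 'b::{banach, second_countable_topology}"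
  assumes [measurable]: "f \<in> borel_measurable bd"
  shows "integral\<^sup>L mu f = (\<integral>\<zeta>. w \<zeta> *\<^sub>R f \<zeta> \<partial>nu)" "integrable mu f \<longleftrightarrow> integrable nu (\<lambda>\<zeta>. w \<zeta> *\<^sub>R f \<zeta>)"
  unfolding mu_eq by (rule integral_density[OF _ _ AE_w_nonneg]; measurable) (rule integrable_density[OF _ _ AE_w_nonneg]; measurable)

lemma integrable_w: "integrable nu w" "integrable nu (\<lambda>\<zeta>. 1 / w \<zeta>)"
  by (rule integrable_nu_s[OF int_weight weight_meas])
    (rule integrable_nu_s[OF int_inverse], use weight_meas in measurable)

lemma bounded_L2:
  assumes f: "f \<in> borel_measurable bd" and B: "\<And>\<zeta>. \<zeta> \<in> frontier D \<Longrightarrow> cmod (f \<zeta>) \<le> B"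
  shows "f \<in> L2 mu"
proof (rule L2_I)
  show "f \<in> borel_measurable mu" unfolding measurable_mu by (rule f)
  have [measurable]: "f \<in> borel_measurable bd" by (rule f)
  have "integrable nu (\<lambda>\<zeta>. w \<zeta> *\<^sub>R (cmod (f \<zeta>))\<^sup>2)"
  proof (rule Bochner_Integration.integrable_bound)
    show "integrable nu (\<lambda>\<zeta>. w \<zeta> * B\<^sup>2)" using integrable_w(1) by simp
    show "(\<lambda>\<zeta>. w \<zeta> *\<^sub>R (cmod (f \<zeta>))\<^sup>2) \<in> borel_measurable nu" by measurable
    show "AE \<zeta> in nu. norm (w \<zeta> *\<^sub>R (cmod (f \<zeta>))\<^sup>2) \<le> norm (w \<zeta> * B\<^sup>2)"
      using AE_w_nonneg AE_space by eventually_elim (auto intro!: mult_left_mono power_mono B simp: abs_mult)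
  qed
  then show "integrable mu (\<lambda>x. (cmod (f x))\<^sup>2)" by (subst integral_mu) auto
qed

text \<open>Completing the square bounds \<open>2 * cmod (f \<zeta>)\<close> by the sum of the
  weighted square and \<open>1 / w \<zeta>\<close>. This is where integrability of the reciprocal
  weight makes the Leray integral meaningful on all of \<open>L2 mu\<close>.\<close>

lemma L2_integrable_nu:
  assumes f: "f \<in> L2 mu" shows "integrable nu f"
proof (rule Bochner_Integration.integrable_bound)
  have [measurable]: "f \<in> borel_measurable bd" using L2_meas[OF f] by (simp add: measurable_mu)
  show "f \<in> borel_measurable nu" by measurable
  have "integrable nu (\<lambda>\<zeta>. w \<zeta> *\<^sub>R (cmod (f \<zeta>))\<^sup>2)" using L2_int[OF f] by (subst (asm) integral_mu) auto
  then show "integrable nu (\<lambda>\<zeta>. w \<zeta> *\<^sub>R (cmod (f \<zeta>))\<^sup>2 + 1 / w \<zeta>)" using integrable_w(2) by simp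
  show "AE \<zeta> in nu. norm (f \<zeta>) \<le> norm (w \<zeta> *\<^sub>R (cmod (f \<zeta>))\<^sup>2 + 1 / w \<zeta>)"
    using AE_w_pos
  proof eventually_elim
    case (elim \<zeta>)
    let ?c = "cmod (f \<zeta>)"
    have "0 \<le> (w \<zeta> * ?c - 1)\<^sup>2 / w \<zeta>" using elim by simp
    also have "(w \<zeta> * ?c - 1)\<^sup>2 / w \<zeta> = w \<zeta> * ?c\<^sup>2 - 2 * ?c + 1 / w \<zeta>"
      using elim by (simp add: power2_eq_square field_simps)
    finally have "2 * ?c \<le> w \<zeta> * ?c\<^sup>2 + 1 / w \<zeta>" by simp
    moreover have "0 \<le> ?c" by simp
    ultimately have "?c \<le> w \<zeta> * ?c\<^sup>2 + 1 / w \<zeta>" by linarith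
    then show ?case by (simp add: abs_if split: if_splits)
  qed
qed

lemma integrable_nu_mult_bounded:
  fixes f g :: "C2 \<Rightarrow> complex"
  assumes f: "integrable nu f" and g: "g \<in> borel_measurable bd" and B: "\<And>\<zeta>. \<zeta> \<in> frontier D \<Longrightarrow> cmod (g \<zeta>) \<le> B"
  shows "integrable nu (\<lambda>\<zeta>. f \<zeta> * g \<zeta>)"
proof (rule Bochner_Integration.integrable_bound)
  show "integrable nu (\<lambda>\<zeta>. B * norm (f \<zeta>))" using f by simp
  have [measurable]: "g \<in> borel_measurable bd" by (rule g)
  have [measurable]: "f \<in> borel_measurable nu" using f by simp
  show "(\<lambda>\<zeta>. f \<zeta> * g \<zeta>) \<in> borel_measurable nu" by measurable
  show "AE \<zeta> in nu. norm (f \<zeta> * g \<zeta>) \<le> norm (B * norm (f \<zeta>))"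
  proof (rule AE_I2)
    fix \<zeta> assume "\<zeta> \<in> space nu"
    then have "cmod (g \<zeta>) \<le> \<bar>B\<bar>" using B[of \<zeta>] by simp
    then show "norm (f \<zeta> * g \<zeta>) \<le> norm (B * norm (f \<zeta>))"
      using mult_right_mono[of "cmod (g \<zeta>)" "\<bar>B\<bar>" "cmod (f \<zeta>)"] by (simp add: norm_mult abs_mult mult.commute)
  qed
qed

lemma polar_weight: "rtilde_weight (polar D) (\<lambda>\<sigma>. 1 / \<omega> \<sigma>)"
proof -
  interpret P: rtilde "polar D" by (rule rtilde_polar)
  have "positive_weight (\<lambda>\<sigma>. 1 / \<omega> \<sigma>)"
    using weight unfolding positive_weight_def by (auto elim: eventually_mono)
  then show ?thesis
    using int_weight int_inverse by unfold_locales simp_all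
qed

abbreviation U :: "(C2 \<Rightarrow> complex) \<Rightarrow> C2 \<Rightarrow> complex" where "U \<equiv> U_op D \<omega>"
abbreviation U' :: "(C2 \<Rightarrow> complex) \<Rightarrow> C2 \<Rightarrow> complex" where "U' \<equiv> U_op (polar D) (\<lambda>\<sigma>. 1 / \<omega> \<sigma>)"
abbreviation "mu' \<equiv> rtilde_weight.mu (polar D) (\<lambda>\<sigma>. 1 / \<omega> \<sigma>)"
abbreviation "bd' \<equiv> rtilde.bd (polar D)"

lemma polar_polar_mu [simp]: "rtilde_weight.mu (polar (polar D)) \<omega> = mu"
proof -
  interpret P: rtilde_weight "polar D" "\<lambda>\<sigma>. 1 / \<omega> \<sigma>" by (rule polar_weight)
  interpret PP: rtilde_weight "polar (polar D)" \<omega> using P.polar_weight by simp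
  show ?thesis unfolding PP.mu_def mu_def by (simp add: bipolar)
qed

lemma U_measurable:
  assumes [measurable]: "f \<in> borel_measurable bd'" shows "U f \<in> borel_measurable bd"
  unfolding U_op_def by measurable

text \<open>The squared factor \<open>1 / w\<close> in \<open>U f\<close> against the density
  \<open>w\<close> leaves \<open>1 / w\<close>, which is the dual density at
  \<open>T D \<zeta>\<close>; \<open>distr_nu_T\<close> changes variables.\<close>

lemma U_nn_integral:
  assumes f [measurable]: "f \<in> borel_measurable bd'"
  shows "(\<integral>\<^sup>+\<zeta>. ennreal ((cmod (U f \<zeta>))\<^sup>2) \<partial>mu) = (\<integral>\<^sup>+z. ennreal ((cmod (f z))\<^sup>2) \<partial>mu')"
proof -
  interpret P: rtilde_weight "polar D" "\<lambda>\<sigma>. 1 / \<omega> \<sigma>" by (rule polar_weight)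
  have [measurable]: "U f \<in> borel_measurable bd" by (rule U_measurable[OF f])
  have "(\<integral>\<^sup>+\<zeta>. ennreal ((cmod (U f \<zeta>))\<^sup>2) \<partial>mu) = (\<integral>\<^sup>+\<zeta>. ennreal (w \<zeta>) * ennreal ((cmod (U f \<zeta>))\<^sup>2) \<partial>nu)"
    unfolding mu_eq by (rule nn_integral_density) measurable
  also have "\<dots> = (\<integral>\<^sup>+\<zeta>. ennreal (P.w (T D \<zeta>)) * ennreal ((cmod (f (T D \<zeta>)))\<^sup>2) \<partial>nu)"
  proof (rule nn_integral_cong_AE)
    show "AE \<zeta> in nu. ennreal (w \<zeta>) * ennreal ((cmod (U f \<zeta>))\<^sup>2) = ennreal (P.w (T D \<zeta>)) * ennreal ((cmod (f (T D \<zeta>)))\<^sup>2)"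
      using AE_w_pos AE_space
    proof eventually_elim
      case (elim \<zeta>)
      then show ?case
        by (simp add: U_op_def s_coord_T norm_mult norm_divide power_divide power_mult_distrib power2_eq_square flip: ennreal_mult)
    qed
  qed
  also have "\<dots> = (\<integral>\<^sup>+z. ennreal (P.w z) * ennreal ((cmod (f z))\<^sup>2) \<partial>distr nu bd' (T D))"
    by (rule nn_integral_distr[symmetric]) measurable
  also have "\<dots> = (\<integral>\<^sup>+z. ennreal (P.w z) * ennreal ((cmod (f z))\<^sup>2) \<partial>P.nu)" by (simp add: distr_nu_T)
  also have "\<dots> = (\<integral>\<^sup>+z. ennreal ((cmod (f z))\<^sup>2) \<partial>mu')"
    unfolding P.mu_eq by (rule nn_integral_density[symmetric]) measurable
  finally show ?thesis .
qed

lemma U_L2_norm: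
  assumes f: "f \<in> L2 mu'" shows "U f \<in> L2 mu" "norm2 mu (U f) = norm2 mu' f"
proof -
  interpret P: rtilde_weight "polar D" "\<lambda>\<sigma>. 1 / \<omega> \<sigma>" by (rule polar_weight)
  have fm [measurable]: "f \<in> borel_measurable bd'" using L2_meas[OF f] by (simp add: P.measurable_mu)
  have [measurable]: "U f \<in> borel_measurable bd" by (rule U_measurable[OF fm])
  have fin: "(\<integral>\<^sup>+\<zeta>. ennreal ((cmod (U f \<zeta>))\<^sup>2) \<partial>mu) = ennreal ((norm2 mu' f)\<^sup>2)"
    unfolding U_nn_integral[OF fm] by (rule nn_integral_eq_norm2[OF f])
  show L: "U f \<in> L2 mu"
  proof (rule L2_I)
    show "integrable mu (\<lambda>\<zeta>. (cmod (U f \<zeta>))\<^sup>2)"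
      by (rule integrableI_bounded) (auto simp: fin)
  qed measurable
  have "ennreal ((norm2 mu (U f))\<^sup>2) = ennreal ((norm2 mu' f)\<^sup>2)"
    using fin nn_integral_eq_norm2[OF L] by simp
  then have "(norm2 mu (U f))\<^sup>2 = (norm2 mu' f)\<^sup>2" by simp
  then show "norm2 mu (U f) = norm2 mu' f" by (simp add: norm2_nonneg power2_eq_iff_nonneg)
qed

lemma U_U': "AE \<zeta> in mu. U (U' g) \<zeta> = g \<zeta>"
  unfolding AE_mu_iff using AE_w_pos AE_space
  by eventually_elim (simp add: U_op_def T_T s_coord_T)

lemma U'_U: "AE z in mu'. U' (U f) z = f z"
proof -
  interpret P: rtilde_weight "polar D" "\<lambda>\<sigma>. 1 / \<omega> \<sigma>" by (rule polar_weight)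
  have "U_op (polar (polar D)) (\<lambda>\<sigma>. 1 / (1 / \<omega> \<sigma>)) = U" by (simp add: bipolar)
  then show ?thesis using P.U_U'[of f] by simp
qed

lemma U'_L2_norm:
  assumes g: "g \<in> L2 mu" shows "U' g \<in> L2 mu'" "norm2 mu' (U' g) = norm2 mu g"
proof -
  interpret P: rtilde_weight "polar D" "\<lambda>\<sigma>. 1 / \<omega> \<sigma>" by (rule polar_weight)
  show "U' g \<in> L2 mu'" "norm2 mu' (U' g) = norm2 mu g"
    using P.U_L2_norm[of g] g by simp_all
qed

lemma U_linear: "linear2 mu' mu U"
  unfolding linear2_def
proof (intro conjI ballI allI impI)
  fix f g assume f: "f \<in> L2 mu'" and g: "g \<in> L2 mu'"
  show add: "AE y in mu. U (\<lambda>x. f x + g x) y = U f y + U g y" by (simp add: U_op_def algebra_simps)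
  assume "AE x in mu'. f x = g x"
  then have "norm2 mu' (\<lambda>x. f x - g x) = 0"
    using norm2_eq_0_iff[OF L2_diff[OF f g]] by (auto elim: eventually_mono)
  then have "norm2 mu (U (\<lambda>x. f x - g x)) = 0" using U_L2_norm(2)[OF L2_diff[OF f g]] by simp
  then have "AE y in mu. U (\<lambda>x. f x - g x) y = 0" using norm2_eq_0_iff[OF U_L2_norm(1)[OF L2_diff[OF f g]]] by simp
  then show "AE y in mu. U f y = U g y" by eventually_elim (auto simp: U_op_def left_diff_distrib)
next
  show "U f \<in> L2 mu" if "f \<in> L2 mu'" for f by (rule U_L2_norm(1)[OF that])
  show "AE y in mu. U (\<lambda>x. c * f x) y = c * U f y" for f c by (simp add: U_op_def)
qed

lemma U_isometry: "surjective_isometry2 mu' mu U"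
  unfolding surjective_isometry2_def using U_linear U_L2_norm U'_L2_norm U_U' by blast

lemma U'_isometry: "surjective_isometry2 mu mu' U'"
proof -
  interpret P: rtilde_weight "polar D" "\<lambda>\<sigma>. 1 / \<omega> \<sigma>" by (rule polar_weight)
  show ?thesis using P.U_isometry by simp
qed

text \<open>The density of the measure cancels the reciprocal weight in \<open>U g\<close>. In this
  way an integral over the weight-free \<open>nu\<close> becomes an inner product in
  \<open>L2 mu\<close>.\<close>

lemma ip_U_nu:
  assumes f [measurable]: "f \<in> borel_measurable bd" and g [measurable]: "g \<in> borel_measurable bd'"
  shows "ip2 mu f (U g) = (\<integral>\<zeta>. f \<zeta> * cnj (g (T D \<zeta>)) \<partial>nu)"
proof -
  have [measurable]: "U g \<in> borel_measurable bd" by (rule U_measurable[OF g])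
  have "ip2 mu f (U g) = (\<integral>\<zeta>. w \<zeta> *\<^sub>R (f \<zeta> * cnj (U g \<zeta>)) \<partial>nu)"
    unfolding ip2_def by (rule integral_mu(1)) measurable
  also have "\<dots> = (\<integral>\<zeta>. f \<zeta> * cnj (g (T D \<zeta>)) \<partial>nu)"
  proof (rule integral_cong_AE)
    show "AE \<zeta> in nu. w \<zeta> *\<^sub>R (f \<zeta> * cnj (U g \<zeta>)) = f \<zeta> * cnj (g (T D \<zeta>))"
      using AE_w_pos by eventually_elim (simp add: U_op_def scaleR_conv_of_real)
  qed measurable
  finally show ?thesis .
qed

lemma ip_U:
  assumes f: "f \<in> L2 mu'" and g: "g \<in> L2 mu"
  shows "ip2 mu (U f) g = ip2 mu' f (U' g)"
proof -
  interpret P: rtilde_weight "polar D" "\<lambda>\<sigma>. 1 / \<omega> \<sigma>" by (rule polar_weight)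
  have fm [measurable]: "f \<in> borel_measurable bd'" using L2_meas[OF f] by (simp add: P.measurable_mu)
  have gm [measurable]: "g \<in> borel_measurable bd" using L2_meas[OF g] by (simp add: measurable_mu)
  have gm' [measurable]: "g \<in> borel_measurable (rtilde.bd (polar (polar D)))" using gm by (simp add: bipolar)
  have "ip2 mu' f (U' g) = (\<integral>z. f z * cnj (g (T (polar D) z)) \<partial>P.nu)" by (rule P.ip_U_nu[OF fm gm'])
  also have "\<dots> = (\<integral>z. f z * cnj (g (T (polar D) z)) \<partial>distr nu bd' (T D))" by (simp add: distr_nu_T)
  also have "\<dots> = (\<integral>\<zeta>. f (T D \<zeta>) * cnj (g (T (polar D) (T D \<zeta>))) \<partial>nu)"
    by (rule integral_distr) measurable
  also have "\<dots> = (\<integral>\<zeta>. f (T D \<zeta>) * cnj (g \<zeta>) \<partial>nu)"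
    by (rule Bochner_Integration.integral_cong) (simp_all add: T_T)
  also have "\<dots> = cnj (\<integral>\<zeta>. g \<zeta> * cnj (f (T D \<zeta>)) \<partial>nu)"
    by (subst Bochner_Integration.integral_cnj[symmetric]) (simp add: mult.commute)
  also have "\<dots> = cnj (ip2 mu g (U f))" by (simp add: ip_U_nu[OF gm fm])
  also have "\<dots> = ip2 mu (U f) g" by (simp add: ip2_commute[of mu "U f" g])
  finally show ?thesis by simp
qed

end

section \<open>Monomials and the Leray integral\<close>

definition mono_fun :: "int \<times> int \<Rightarrow> C2 \<Rightarrow> complex" where
  "mono_fun i \<zeta> = fst \<zeta> ^ nat (fst i) * snd \<zeta> ^ nat (snd i)"

text \<open>For \<open>i = (n, m)\<close> in \<open>idx\<close>, the coefficient of
  \<open>a ^ n * b ^ m\<close> in the expansion of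
  \<open>1 / (4 * pi\<^sup>2 * (1 - a - b)\<^sup>2)\<close>.\<close>

definition leray_coeff :: "int \<times> int \<Rightarrow> real" where
  "leray_coeff i = real (nat (fst i) + nat (snd i) + 1) * real ((nat (fst i) + nat (snd i)) choose nat (fst i)) / (4 * pi\<^sup>2)"

lemma leray_coeff_pos: "0 < leray_coeff i"
  by (simp add: leray_coeff_def zero_less_binomial_iff)

lemma continuous_mono_fun: "continuous_on A (mono_fun i)"
  unfolding mono_fun_def by (intro continuous_intros)

text \<open>\<open>Arg\<close> jumps across a ray; in this form measurability of the kernel is
  evident. The value 1 at 0 reflects \<open>Arg 0 = 0\<close>.\<close>

lemma cis_minus_Arg: "cis (- Arg u) = (if u = 0 then 1 else cnj (u / complex_of_real (cmod u)))"
  using Arg_zero by (auto simp: cis_cnj[symmetric] cis_Arg sgn_eq)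

lemma cis_of_int_mult: "cis (of_int k * t) = cis t powi k"
  by (simp add: cis_power_int)

section \<open>Angular homogeneity and the kernel in terms of \<open>T\<close>\<close>

context rtilde begin

text \<open>Working substitute for \<open>monomial\<close>: it uses the boundary coordinates instead
  of \<open>Arg\<close>, and bidegrees add under products and change sign under conjugation.\<close>

definition bihom :: "(C2 \<Rightarrow> complex) \<Rightarrow> int \<Rightarrow> int \<Rightarrow> bool" where
  "bihom f k l \<longleftrightarrow> (\<forall>\<sigma>\<in>{0<..<1}. \<forall>\<theta>\<^sub>1 \<theta>\<^sub>2. f (bd_param D (\<sigma>, \<theta>\<^sub>1, \<theta>\<^sub>2)) =
     f (bd_param D (\<sigma>, 0, 0)) * cis (of_int k * \<theta>\<^sub>1 + of_int l * \<theta>\<^sub>2))"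

lemma monomial_bihom:
  assumes "monomial D n m f" shows "bihom f n m"
  unfolding bihom_def
proof (intro ballI allI)
  obtain g where g: "\<And>\<zeta>. \<zeta> \<in> frontier D \<Longrightarrow> fst \<zeta> * snd \<zeta> \<noteq> 0 \<Longrightarrow>
      f \<zeta> = g (s_coord D \<zeta>) * cis (of_int n * Arg (fst \<zeta>) + of_int m * Arg (snd \<zeta>))"
    using assms unfolding monomial_def by blast
  fix \<sigma> \<theta>\<^sub>1 \<theta>\<^sub>2 :: real assume \<sigma>: "\<sigma> \<in> {0<..<1}"
  have *: "f (bd_param D (\<sigma>, \<theta>\<^sub>1, \<theta>\<^sub>2)) = g \<sigma> * cis (of_int n * \<theta>\<^sub>1 + of_int m * \<theta>\<^sub>2)" for \<theta>\<^sub>1 \<theta>\<^sub>2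
  proof -
    let ?z = "bd_param D (\<sigma>, \<theta>\<^sub>1, \<theta>\<^sub>2)"
    have nz: "fst ?z * snd ?z \<noteq> 0" "fst ?z \<noteq> 0" "snd ?z \<noteq> 0" using bd_param_off_axes[OF \<sigma>] by (auto simp: off_axes_def)
    have sg: "sgn (fst ?z) = cis \<theta>\<^sub>1" "sgn (snd ?z) = cis \<theta>\<^sub>2"
      using r_s_inv(1,2)[OF \<sigma>] by (simp_all add: bd_param_def sgn_mult sgn_of_real sgn_cis)
    have "cis (of_int n * Arg (fst ?z) + of_int m * Arg (snd ?z)) = cis (Arg (fst ?z)) powi n * cis (Arg (snd ?z)) powi m"
      by (simp add: cis_mult[symmetric] cis_of_int_mult)
    also have "\<dots> = cis (of_int n * \<theta>\<^sub>1 + of_int m * \<theta>\<^sub>2)"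
      by (simp add: cis_Arg nz sg cis_mult[symmetric] cis_of_int_mult)
    finally show ?thesis using g[OF bd_param_frontier[OF \<sigma>] nz(1)] s_bd_param[OF \<sigma>] by simp
  qed
  show "f (bd_param D (\<sigma>, \<theta>\<^sub>1, \<theta>\<^sub>2)) = f (bd_param D (\<sigma>, 0, 0)) * cis (of_int n * \<theta>\<^sub>1 + of_int m * \<theta>\<^sub>2)"
    using *[of \<theta>\<^sub>1 \<theta>\<^sub>2] *[of 0 0] by simp
qed

lemma bihom_mult: "bihom f k l \<Longrightarrow> bihom g k' l' \<Longrightarrow> bihom (\<lambda>\<zeta>. f \<zeta> * g \<zeta>) (k + k') (l + l')"
  unfolding bihom_def
proof (intro ballI allI)
  fix \<sigma> \<theta>\<^sub>1 \<theta>\<^sub>2 :: real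
  assume *: "\<forall>\<sigma>\<in>{0<..<1}. \<forall>\<theta>\<^sub>1 \<theta>\<^sub>2. f (bd_param D (\<sigma>, \<theta>\<^sub>1, \<theta>\<^sub>2)) = f (bd_param D (\<sigma>, 0, 0)) * cis (of_int k * \<theta>\<^sub>1 + of_int l * \<theta>\<^sub>2)"
    "\<forall>\<sigma>\<in>{0<..<1}. \<forall>\<theta>\<^sub>1 \<theta>\<^sub>2. g (bd_param D (\<sigma>, \<theta>\<^sub>1, \<theta>\<^sub>2)) = g (bd_param D (\<sigma>, 0, 0)) * cis (of_int k' * \<theta>\<^sub>1 + of_int l' * \<theta>\<^sub>2)"
    and \<sigma>: "\<sigma> \<in> {0<..<1}"
  have c: "cis (of_int (k + k') * \<theta>\<^sub>1 + of_int (l + l') * \<theta>\<^sub>2) = cis (of_int k * \<theta>\<^sub>1 + of_int l * \<theta>\<^sub>2) * cis (of_int k' * \<theta>\<^sub>1 + of_int l' * \<theta>\<^sub>2)"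
    by (simp add: cis_mult algebra_simps)
  show "f (bd_param D (\<sigma>, \<theta>\<^sub>1, \<theta>\<^sub>2)) * g (bd_param D (\<sigma>, \<theta>\<^sub>1, \<theta>\<^sub>2)) =
    f (bd_param D (\<sigma>, 0, 0)) * g (bd_param D (\<sigma>, 0, 0)) * cis (of_int (k + k') * \<theta>\<^sub>1 + of_int (l + l') * \<theta>\<^sub>2)"
    unfolding c using *(1)[rule_format, OF \<sigma>, of \<theta>\<^sub>1 \<theta>\<^sub>2] *(2)[rule_format, OF \<sigma>, of \<theta>\<^sub>1 \<theta>\<^sub>2] by (simp only: mult.assoc mult.left_commute)
qed

lemma bihom_cnj: assumes "bihom f k l" shows "bihom (\<lambda>\<zeta>. cnj (f \<zeta>)) (- k) (- l)"
  unfolding bihom_def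
proof (intro ballI allI)
  fix \<sigma> \<theta>\<^sub>1 \<theta>\<^sub>2 :: real assume "\<sigma> \<in> {0<..<1}"
  then have f: "f (bd_param D (\<sigma>, \<theta>\<^sub>1, \<theta>\<^sub>2)) = f (bd_param D (\<sigma>, 0, 0)) * cis (of_int k * \<theta>\<^sub>1 + of_int l * \<theta>\<^sub>2)"
    using assms unfolding bihom_def by blast
  show "cnj (f (bd_param D (\<sigma>, \<theta>\<^sub>1, \<theta>\<^sub>2))) = cnj (f (bd_param D (\<sigma>, 0, 0))) * cis (of_int (- k) * \<theta>\<^sub>1 + of_int (- l) * \<theta>\<^sub>2)"
    by (subst f) (simp add: cis_cnj algebra_simps)
qed

lemma bihom_s: "bihom (\<lambda>\<zeta>. h (s_coord D \<zeta>)) 0 0"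
  unfolding bihom_def by (auto simp: s_bd_param)

lemma bihom_mono: assumes "0 \<le> k" "0 \<le> l" shows "bihom (mono_fun (k, l)) k l"
  unfolding bihom_def mono_fun_def
proof (intro ballI allI)
  fix \<sigma> \<theta>\<^sub>1 \<theta>\<^sub>2 :: real
  have "cis (of_int k * \<theta>\<^sub>1 + of_int l * \<theta>\<^sub>2) = cis \<theta>\<^sub>1 ^ nat k * cis \<theta>\<^sub>2 ^ nat l"
    using assms by (simp add: cis_mult[symmetric] cis_of_int_mult power_int_def)
  then show "fst (bd_param D (\<sigma>, \<theta>\<^sub>1, \<theta>\<^sub>2)) ^ nat (fst (k, l)) * snd (bd_param D (\<sigma>, \<theta>\<^sub>1, \<theta>\<^sub>2)) ^ nat (snd (k, l)) =
    fst (bd_param D (\<sigma>, 0, 0)) ^ nat (fst (k, l)) * snd (bd_param D (\<sigma>, 0, 0)) ^ nat (snd (k, l)) * cis (of_int k * \<theta>\<^sub>1 + of_int l * \<theta>\<^sub>2)"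
    by (simp add: bd_param_def power_mult_distrib)
qed

lemma bihom_compose_T:
  assumes "rtilde.bihom (polar D) f k l" shows "bihom (\<lambda>\<zeta>. f (T D \<zeta>)) k l"
proof -
  interpret P: rtilde "polar D" by (rule rtilde_polar)
  show ?thesis unfolding bihom_def
  proof (intro ballI allI)
    fix \<sigma> \<theta>\<^sub>1 \<theta>\<^sub>2 :: real assume \<sigma>: "\<sigma> \<in> {0<..<1}"
    then have "f (bd_param (polar D) (\<sigma>, \<theta>\<^sub>1, \<theta>\<^sub>2)) =
        f (bd_param (polar D) (\<sigma>, 0, 0)) * cis (of_int k * \<theta>\<^sub>1 + of_int l * \<theta>\<^sub>2)"
      using assms unfolding P.bihom_def by blast
    then show "f (T D (bd_param D (\<sigma>, \<theta>\<^sub>1, \<theta>\<^sub>2))) = f (T D (bd_param D (\<sigma>, 0, 0))) * cis (of_int k * \<theta>\<^sub>1 + of_int l * \<theta>\<^sub>2)"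
      unfolding T_bd_param[OF \<sigma>] .
  qed
qed

lemma bihom_integral:
  assumes f: "f \<in> borel_measurable bd" "integrable nu f" and bi: "bihom f k l" "(k, l) \<noteq> (0, 0)"
  shows "(\<integral>\<zeta>. f \<zeta> \<partial>nu) = 0"
proof -
  have eq: "f (bd_param D x) = f (bd_param D (fst x, 0, 0)) * cis (of_int k * fst (snd x) + of_int l * snd (snd x))"
    if "x \<in> space lbox" for x
  proof -
    obtain \<sigma> \<theta>\<^sub>1 \<theta>\<^sub>2 where x: "x = (\<sigma>, \<theta>\<^sub>1, \<theta>\<^sub>2)" by (rule prod_cases3)
    have "\<sigma> \<in> {0<..<1}" using that unfolding space_lbox pbox_def x by simp
    then show ?thesis using bi(1) unfolding bihom_def x fst_conv snd_conv by blast
  qed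
  have "integrable lbox (\<lambda>x. f (bd_param D x))"
    using f unfolding nu_def by (subst (asm) integrable_distr_eq[OF bd_param_measurable]) auto
  then have "integrable lbox (\<lambda>x. f (bd_param D (fst x, 0, 0)) * cis (of_int k * fst (snd x) + of_int l * snd (snd x)))"
    by (rule Bochner_Integration.integrable_cong[THEN iffD1, rotated -1]) (use eq in auto)
  from integral_lbox_fourier[OF this bi(2)]
  have "(\<integral>x. f (bd_param D x) \<partial>lbox) = 0"
    by (subst Bochner_Integration.integral_cong[OF refl eq]) assumption+
  then show ?thesis unfolding nu_def using f(1) by (subst integral_distr[OF bd_param_measurable]) auto
qed

text \<open>\<open>s / r1\<close> and \<open>(1 - s) / r2\<close> are the moduli of the coordinates
  of \<open>T D \<zeta>\<close>, and the arguments are those of \<open>\<zeta>\<close>, so the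
  bracket is one minus a Hermitian product.\<close>

lemma leray_kernel_eq:
  assumes \<zeta>: "\<zeta> \<in> frontier D" "\<zeta> \<in> off_axes"
  shows "leray_kernel D \<zeta> z = 1 / (4 * complex_of_real pi ^ 2 * (1 - herm z (T D \<zeta>)) ^ 2)"
proof -
  have nz: "fst \<zeta> \<noteq> 0" "snd \<zeta> \<noteq> 0" "r1 \<zeta> \<noteq> 0" "r2 \<zeta> \<noteq> 0" using \<zeta> by (auto simp: off_axes_def r1_def r2_def)
  have s: "s_coord D \<zeta> / r1 \<zeta> = r1 (T D \<zeta>)" "(1 - s_coord D \<zeta>) / r2 \<zeta> = r2 (T D \<zeta>)"
    using nz one_minus_s[OF \<zeta>(1)] s_coord_frontier[OF \<zeta>(1)] by simp_all
  have "cnj (fst (T D \<zeta>)) = cis (- Arg (fst \<zeta>)) * complex_of_real (r1 (T D \<zeta>))"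
    by (subst T_aligned(1)[OF \<zeta>(1)]) (simp add: cis_Arg[OF nz(1), symmetric] cis_cnj)
  moreover have "cnj (snd (T D \<zeta>)) = cis (- Arg (snd \<zeta>)) * complex_of_real (r2 (T D \<zeta>))"
    by (subst T_aligned(2)[OF \<zeta>(1)]) (simp add: cis_Arg[OF nz(2), symmetric] cis_cnj)
  ultimately show ?thesis
    unfolding leray_kernel_def s herm_def by (simp add: algebra_simps)
qed

text \<open>A slightly larger multiple of \<open>z\<close> still lies in \<open>D\<close>, hence in
  the bipolar, which leaves room for a geometric series that is uniform in
  \<open>\<zeta>\<close>.\<close>

lemma herm_T_bound:
  assumes "z \<in> D" obtains \<rho> where "0 \<le> \<rho>" "\<rho> < 1" "\<And>\<zeta>. \<zeta> \<in> frontier D \<Longrightarrow> cmod (herm z (T D \<zeta>)) \<le> \<rho>"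
proof -
  interpret P: rtilde "polar D" by (rule rtilde_polar)
  obtain e where e: "e > 0" "ball z e \<subseteq> D" using open_D assms open_contains_ball by blast
  \<comment> \<open>Moves \<open>z\<close> by at most \<open>e / 2\<close>; the summand 1 in the
    denominator covers \<open>z = 0\<close>.\<close>
  define t where "t = 1 + e / (2 * (norm z + 1))"
  have t: "t > 1" using e(1) by (simp add: t_def add_nonneg_pos)
  have np: "norm z + 1 > 0" using norm_ge_zero[of z] by linarith
  have "norm (z - t *\<^sub>R z) = (t - 1) * norm z" using t by (simp add: scaleR_left_diff_distrib[of 1 t z, simplified, symmetric])
  also have "\<dots> = e / 2 * (norm z / (norm z + 1))" using np by (simp add: t_def field_simps)
  also have "\<dots> \<le> e / 2 * 1" using e(1) np by (intro mult_left_mono) (simp_all add: divide_simps)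
  also have "\<dots> < e" using e(1) by simp
  finally have "t *\<^sub>R z \<in> D" using e(2) by (auto simp: dist_norm subset_eq)
  then have tz: "t *\<^sub>R z \<in> polar (polar D)" by (simp add: bipolar)
  have "cmod (herm z (T D \<zeta>)) \<le> 1 / t" if "\<zeta> \<in> frontier D" for \<zeta>
  proof -
    have "cmod (fst (t *\<^sub>R z)) * cmod (fst (T D \<zeta>)) + cmod (snd (t *\<^sub>R z)) * cmod (snd (T D \<zeta>)) < 1"
      using tz T_in_closure[OF that] unfolding P.polar_iff_cmod by blast
    then have "t * (cmod (fst z) * cmod (fst (T D \<zeta>)) + cmod (snd z) * cmod (snd (T D \<zeta>))) < 1"
      using t by (simp add: algebra_simps)
    moreover have "cmod (herm z (T D \<zeta>)) \<le> cmod (fst z) * cmod (fst (T D \<zeta>)) + cmod (snd z) * cmod (snd (T D \<zeta>))"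
      unfolding herm_def by (rule norm_triangle_le) (simp add: norm_mult)
    then have "t * cmod (herm z (T D \<zeta>)) \<le> t * (cmod (fst z) * cmod (fst (T D \<zeta>)) + cmod (snd z) * cmod (snd (T D \<zeta>)))"
      using t by (intro mult_left_mono) auto
    ultimately have "t * cmod (herm z (T D \<zeta>)) < 1" by linarith
    then show ?thesis using t by (simp add: field_simps)
  qed
  then show thesis using t by (intro that[of "1 / t"]) auto
qed

end

context rtilde_weight begin

lemma continuous_L2: "continuous_on (frontier D) f \<Longrightarrow> f \<in> L2 mu"
proof -
  assume f: "continuous_on (frontier D) f"
  have "bounded (f ` frontier D)" by (rule compact_imp_bounded[OF compact_continuous_image[OF f compact_frontier]])
  then obtain B where "\<And>\<zeta>. \<zeta> \<in> frontier D \<Longrightarrow> cmod (f \<zeta>) \<le> B" unfolding bounded_iff by auto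
  then show "f \<in> L2 mu" by (intro bounded_L2 continuous_measurable_bd f)
qed

lemma mono_L2: "mono_fun i \<in> L2 mu"
  by (rule continuous_L2[OF continuous_mono_fun])

lemma mono_L2': "mono_fun i \<in> L2 mu'"
proof -
  interpret P: rtilde_weight "polar D" "\<lambda>\<sigma>. 1 / \<omega> \<sigma>" by (rule polar_weight)
  show ?thesis by (rule P.mono_L2)
qed

definition Q :: "int \<times> int \<Rightarrow> C2 \<Rightarrow> complex" where "Q i = U (mono_fun i)"

lemma Q_L2: "Q i \<in> L2 mu"
  unfolding Q_def by (rule U_L2_norm(1)[OF mono_L2'])

lemma bihom_ip:
  assumes f: "f \<in> L2 mu" "bihom f n m" and h: "h \<in> L2 mu" "bihom h k l" and ne: "(n, m) \<noteq> (k, l)"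
  shows "ip2 mu f h = 0"
proof -
  have [measurable]: "f \<in> borel_measurable bd" "h \<in> borel_measurable bd"
    using L2_meas[OF f(1)] L2_meas[OF h(1)] by (simp_all add: measurable_mu)
  have m: "(\<lambda>\<zeta>. f \<zeta> * cnj (h \<zeta>)) \<in> borel_measurable bd" by measurable
  have "integrable mu (\<lambda>\<zeta>. f \<zeta> * cnj (h \<zeta>))" by (rule L2_mult_integrable[OF f(1) h(1)])
  then have int: "integrable nu (\<lambda>\<zeta>. complex_of_real (w \<zeta>) * (f \<zeta> * cnj (h \<zeta>)))"
    using integral_mu(2)[OF m] by (simp add: scaleR_conv_of_real)
  have "bihom (\<lambda>\<zeta>. complex_of_real (w \<zeta>) * (f \<zeta> * cnj (h \<zeta>))) (0 + (n + - k)) (0 + (m + - l))"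
    by (intro bihom_mult bihom_s[where h = "\<lambda>\<sigma>. complex_of_real (\<omega> \<sigma>)"] f(2) bihom_cnj h(2))
  then have "(\<integral>\<zeta>. complex_of_real (w \<zeta>) * (f \<zeta> * cnj (h \<zeta>)) \<partial>nu) = 0"
    using ne by (intro bihom_integral[OF _ int]) auto
  then show ?thesis unfolding ip2_def integral_mu(1)[OF m] by (simp add: scaleR_conv_of_real)
qed

lemma bihom_Q: assumes "0 \<le> k" "0 \<le> l" shows "bihom (Q (k, l)) k l"
proof -
  interpret P: rtilde_weight "polar D" "\<lambda>\<sigma>. 1 / \<omega> \<sigma>" by (rule polar_weight)
  have "bihom (\<lambda>\<zeta>. mono_fun (k, l) (T D \<zeta>) * complex_of_real (1 / \<omega> (s_coord D \<zeta>))) (k + 0) (l + 0)"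
    by (intro bihom_mult bihom_compose_T P.bihom_mono assms bihom_s[where h = "\<lambda>\<sigma>. complex_of_real (1 / \<omega> \<sigma>)"])
  then show ?thesis by (simp add: Q_def U_op_def[abs_def])
qed

text \<open>The coordinates of \<open>\<zeta>\<close> and \<open>T D \<zeta>\<close> have equal
  arguments, so the integrand over \<open>nu\<close> is a product of powers of the nonnegative
  functions in \<open>T_cmod\<close>. The reflection rests on this.\<close>

lemma ip_mono_Q_real: "ip2 mu (mono_fun i) (Q i) \<in> \<real>"
proof -
  interpret P: rtilde_weight "polar D" "\<lambda>\<sigma>. 1 / \<omega> \<sigma>" by (rule polar_weight)
  define h where "h \<zeta> = (r1 \<zeta> * r1 (T D \<zeta>)) ^ nat (fst i) * (r2 \<zeta> * r2 (T D \<zeta>)) ^ nat (snd i)" for \<zeta>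
  have "ip2 mu (mono_fun i) (Q i) = (\<integral>\<zeta>. mono_fun i \<zeta> * cnj (mono_fun i (T D \<zeta>)) \<partial>nu)"
    unfolding Q_def by (rule ip_U_nu) (rule continuous_measurable_bd P.continuous_measurable_bd, rule continuous_mono_fun)+
  also have "\<dots> = (\<integral>\<zeta>. complex_of_real (h \<zeta>) \<partial>nu)"
  proof (rule Bochner_Integration.integral_cong[OF refl])
    fix \<zeta> assume "\<zeta> \<in> space nu"
    then have \<zeta>: "\<zeta> \<in> frontier D" by simp
    have c: "u * cnj (sgn u) = complex_of_real (cmod u)" for u :: complex
      by (cases "u = 0") (simp_all add: sgn_eq complex_norm_square[symmetric] power2_eq_square)
    have "fst \<zeta> * cnj (fst (T D \<zeta>)) = complex_of_real (r1 (T D \<zeta>)) * (fst \<zeta> * cnj (sgn (fst \<zeta>)))"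
      by (subst T_aligned(1)[OF \<zeta>]) simp
    then have 1: "fst \<zeta> * cnj (fst (T D \<zeta>)) = complex_of_real (r1 \<zeta> * r1 (T D \<zeta>))" by (simp add: c r1_def)
    have "snd \<zeta> * cnj (snd (T D \<zeta>)) = complex_of_real (r2 (T D \<zeta>)) * (snd \<zeta> * cnj (sgn (snd \<zeta>)))"
      by (subst T_aligned(2)[OF \<zeta>]) simp
    then have 2: "snd \<zeta> * cnj (snd (T D \<zeta>)) = complex_of_real (r2 \<zeta> * r2 (T D \<zeta>))" by (simp add: c r2_def)
    have "mono_fun i \<zeta> * cnj (mono_fun i (T D \<zeta>)) = (fst \<zeta> * cnj (fst (T D \<zeta>))) ^ nat (fst i) * (snd \<zeta> * cnj (snd (T D \<zeta>))) ^ nat (snd i)"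
      by (simp add: mono_fun_def power_mult_distrib)
    then show "mono_fun i \<zeta> * cnj (mono_fun i (T D \<zeta>)) = complex_of_real (h \<zeta>)"
      unfolding 1 2 h_def by simp
  qed
  also have "\<dots> = complex_of_real (\<integral>\<zeta>. h \<zeta> \<partial>nu)" by (rule integral_complex_of_real)
  finally show ?thesis by simp
qed

text \<open>Expanding \<open>(1 - \<langle>z, T \<zeta>\<rangle>)\<^sup>-\<^sup>2 = \<Sum> (N + 1) \<langle>z, T \<zeta>\<rangle>\<^sup>N\<close> binomially, only the term of the
  bidegree of \<open>f\<close> survives integration over the torus.\<close>

lemma leray_integral_monomial:
  assumes f: "f \<in> L2 mu" and bi: "bihom f (int n) (int m)" and z: "z \<in> D"
  shows "leray_integral D f z = complex_of_real (leray_coeff (int n, int m)) * ip2 mu f (Q (int n, int m)) * mono_fun (int n, int m) z"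
proof -
  interpret P: rtilde_weight "polar D" "\<lambda>\<sigma>. 1 / \<omega> \<sigma>" by (rule polar_weight)
  obtain \<rho> where \<rho>: "0 \<le> \<rho>" "\<rho> < 1" "\<And>\<zeta>. \<zeta> \<in> frontier D \<Longrightarrow> cmod (herm z (T D \<zeta>)) \<le> \<rho>" using herm_T_bound[OF z] by blast
  have fm [measurable]: "f \<in> borel_measurable bd" using L2_meas[OF f] by (simp add: measurable_mu)
  have fint: "integrable nu f" by (rule L2_integrable_nu[OF f])
  define u where "u \<zeta> = herm z (T D \<zeta>)" for \<zeta>
  have cu: "continuous_on (frontier D) u" unfolding u_def herm_def by (intro continuous_intros continuous_on_T)
  have ub: "cmod (u \<zeta>) \<le> \<rho>" if "\<zeta> \<in> frontier D" for \<zeta> using \<rho>(3)[OF that] by (simp add: u_def)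
  have um [measurable]: "u \<in> borel_measurable bd" by (rule continuous_measurable_bd[OF cu])
  define J where "J k l = (\<integral>\<zeta>. f \<zeta> * cnj (mono_fun (int k, int l) (T D \<zeta>)) \<partial>nu)" for k l
  have mT: "continuous_on (frontier D) (\<lambda>\<zeta>. cnj (mono_fun i (T D \<zeta>)))" for i
    by (intro continuous_intros continuous_on_compose2[OF continuous_mono_fun continuous_on_T]) auto
  have bdd: "\<exists>B. \<forall>\<zeta>\<in>frontier D. cmod (h \<zeta>) \<le> B" if "continuous_on (frontier D) h" for h :: "C2 \<Rightarrow> complex"
    using compact_imp_bounded[OF compact_continuous_image[OF that compact_frontier]] unfolding bounded_iff by auto
  have Jint: "integrable nu (\<lambda>\<zeta>. f \<zeta> * cnj (mono_fun i (T D \<zeta>)))" for i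
    using bdd[OF mT] integrable_nu_mult_bounded[OF fint continuous_measurable_bd[OF mT]] by blast
  \<comment> \<open>The product has the difference of the two bidegrees as its own, so it integrates
    to 0 unless they agree.\<close>
  have J0: "J k l = 0" if "(k, l) \<noteq> (n, m)" for k l
  proof -
    have "bihom (\<lambda>\<zeta>. f \<zeta> * cnj (mono_fun (int k, int l) (T D \<zeta>))) (int n + - int k) (int m + - int l)"
      by (intro bihom_mult bi bihom_cnj bihom_compose_T P.bihom_mono) auto
    then show ?thesis unfolding J_def using that Jint continuous_measurable_bd[OF mT]
      by (intro bihom_integral[OF _ Jint]) auto
  qed
  have power_eq: "(\<integral>\<zeta>. f \<zeta> * (of_nat (Suc N) * u \<zeta> ^ N) \<partial>nu) =
      (if N = n + m then of_nat (Suc (n + m)) * of_nat ((n + m) choose n) * mono_fun (int n, int m) z * J n m else 0)" for N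
  proof -
    define c where "c k = of_nat (Suc N) * of_nat (N choose k) * mono_fun (int k, int (N - k)) z" for k
    have "f \<zeta> * (of_nat (Suc N) * u \<zeta> ^ N) = (\<Sum>k\<le>N. c k * (f \<zeta> * cnj (mono_fun (int k, int (N - k)) (T D \<zeta>))))" for \<zeta>
      unfolding u_def herm_def binomial_ring c_def mono_fun_def sum_distrib_left
      by (intro sum.cong refl) (simp add: power_mult_distrib algebra_simps del: of_nat_diff)
    then have "(\<integral>\<zeta>. f \<zeta> * (of_nat (Suc N) * u \<zeta> ^ N) \<partial>nu) = (\<Sum>k\<le>N. c k * J k (N - k))"
      unfolding J_def by (simp add: Jint)
    also have "\<dots> = (\<Sum>k\<le>N. if k = n \<and> N = n + m then c n * J n m else 0)"
    proof (intro sum.cong refl)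
      fix k assume "k \<in> {..N}"
      then have k: "k = n \<and> N = n + m \<longleftrightarrow> (k, N - k) = (n, m)" by auto
      show "c k * J k (N - k) = (if k = n \<and> N = n + m then c n * J n m else 0)"
        unfolding k using J0[of k "N - k"] by auto
    qed
    also have "\<dots> = (if N = n + m then c n * J n m else 0)"
      by (cases "N = n + m") (simp_all add: sum.delta)
    finally show ?thesis by (simp add: c_def)
  qed
  \<comment> \<open>Sum and integral are exchanged under the bound
    \<open>norm (f \<zeta>) * (N + 1) * \<rho> ^ N\<close>.\<close>
  have "(\<lambda>N. \<integral>\<zeta>. f \<zeta> * (of_nat (Suc N) * u \<zeta> ^ N) \<partial>nu) sums (\<integral>\<zeta>. (\<Sum>N. f \<zeta> * (of_nat (Suc N) * u \<zeta> ^ N)) \<partial>nu)"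
  proof (rule sums_integral)
    have bound: "cmod (of_nat (Suc N) * u \<zeta> ^ N) \<le> of_nat (Suc N) * \<rho> ^ N" if "\<zeta> \<in> frontier D" for \<zeta> N
      using ub[OF that] by (simp add: norm_mult norm_power power_mono mult_left_mono del: of_nat_Suc)
    have sr: "summable (\<lambda>N. of_nat (Suc N) * \<rho> ^ N)"
      using geometric_deriv_sums[of \<rho>] \<rho> by (auto simp: sums_iff)
    show int: "integrable nu (\<lambda>\<zeta>. f \<zeta> * (of_nat (Suc N) * u \<zeta> ^ N))" for N
      by (rule integrable_nu_mult_bounded[OF fint _ bound]) measurable
    show "AE \<zeta> in nu. summable (\<lambda>N. norm (f \<zeta> * (of_nat (Suc N) * u \<zeta> ^ N)))"
    proof (rule AE_I2)
      fix \<zeta> assume "\<zeta> \<in> space nu"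
      then have \<zeta>: "\<zeta> \<in> frontier D" by simp
      show "summable (\<lambda>N. norm (f \<zeta> * (of_nat (Suc N) * u \<zeta> ^ N)))"
        by (rule summable_comparison_test'[OF summable_mult[OF sr, of "norm (f \<zeta>)"], of 0])
          (use bound[OF \<zeta>] in \<open>simp add: norm_mult[of "f \<zeta>"] mult_left_mono del: of_nat_Suc\<close>)
    qed
    show "summable (\<lambda>N. \<integral>\<zeta>. norm (f \<zeta> * (of_nat (Suc N) * u \<zeta> ^ N)) \<partial>nu)"
    proof (rule summable_comparison_test'[OF summable_mult[OF sr, of "\<integral>\<zeta>. norm (f \<zeta>) \<partial>nu"], of 0])
      fix N :: nat
      have "(\<integral>\<zeta>. norm (f \<zeta> * (of_nat (Suc N) * u \<zeta> ^ N)) \<partial>nu) \<le> (\<integral>\<zeta>. norm (f \<zeta>) * (of_nat (Suc N) * \<rho> ^ N) \<partial>nu)"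
      proof (rule integral_mono)
        show "integrable nu (\<lambda>\<zeta>. norm (f \<zeta> * (of_nat (Suc N) * u \<zeta> ^ N)))" by (rule integrable_norm[OF int])
        show "integrable nu (\<lambda>\<zeta>. norm (f \<zeta>) * (of_nat (Suc N) * \<rho> ^ N))" using fint by simp
        show "norm (f \<zeta> * (of_nat (Suc N) * u \<zeta> ^ N)) \<le> norm (f \<zeta>) * (of_nat (Suc N) * \<rho> ^ N)"
          if "\<zeta> \<in> space nu" for \<zeta>
          unfolding norm_mult[of "f \<zeta>"] using that by (intro mult_left_mono bound) simp_all
      qed
      then show "norm (\<integral>\<zeta>. norm (f \<zeta> * (of_nat (Suc N) * u \<zeta> ^ N)) \<partial>nu) \<le> (\<integral>\<zeta>. norm (f \<zeta>) \<partial>nu) * (of_nat (Suc N) * \<rho> ^ N)"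
        by (simp add: integral_nonneg_AE del: of_nat_Suc)
    qed
  qed
  then have "(\<lambda>N. if N = n + m then of_nat (Suc (n + m)) * of_nat ((n + m) choose n) * mono_fun (int n, int m) z * J n m else 0) sums
      (\<integral>\<zeta>. (\<Sum>N. f \<zeta> * (of_nat (Suc N) * u \<zeta> ^ N)) \<partial>nu)" unfolding power_eq .
  then have S: "(\<integral>\<zeta>. (\<Sum>N. f \<zeta> * (of_nat (Suc N) * u \<zeta> ^ N)) \<partial>nu) =
      of_nat (Suc (n + m)) * of_nat ((n + m) choose n) * mono_fun (int n, int m) z * J n m"
    using sums_single[of "n + m" "\<lambda>_. of_nat (Suc (n + m)) * of_nat ((n + m) choose n) * mono_fun (int n, int m) z * J n m"]
      sums_unique2 by blast
  have pw: "(\<Sum>N. f \<zeta> * (of_nat (Suc N) * u \<zeta> ^ N)) = f \<zeta> * (1 / (1 - u \<zeta>)\<^sup>2)" if "\<zeta> \<in> frontier D" for \<zeta>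
  proof -
    have "norm (u \<zeta>) < 1" using ub[OF that] \<rho> by linarith
    from sums_mult[OF geometric_deriv_sums[OF this], of "f \<zeta>"] show ?thesis by (simp add: sums_iff)
  qed
  have "leray_integral D f z = (\<integral>\<zeta>. f \<zeta> * leray_kernel D \<zeta> z \<partial>nu)"
    unfolding leray_integral_def bd_measure_1 ..
  also have "\<dots> = (\<integral>\<zeta>. (1 / (4 * complex_of_real pi ^ 2)) * (f \<zeta> * (1 / (1 - u \<zeta>)\<^sup>2)) \<partial>nu)"
  proof (rule integral_cong_AE)
    show m2: "(\<lambda>\<zeta>. (1 / (4 * complex_of_real pi ^ 2)) * (f \<zeta> * (1 / (1 - u \<zeta>)\<^sup>2))) \<in> borel_measurable nu" by measurable
    show "AE \<zeta> in nu. f \<zeta> * leray_kernel D \<zeta> z = (1 / (4 * complex_of_real pi ^ 2)) * (f \<zeta> * (1 / (1 - u \<zeta>)\<^sup>2))"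
      using AE_off_axes AE_space by eventually_elim (simp add: leray_kernel_eq u_def)
    have [measurable]: "(\<lambda>\<zeta>. fst \<zeta>) \<in> borel_measurable bd" "(\<lambda>\<zeta>. snd \<zeta>) \<in> borel_measurable bd"
      "r1 \<in> borel_measurable bd" "r2 \<in> borel_measurable bd"
      unfolding r1_def[abs_def] r2_def[abs_def] by (intro continuous_measurable_bd continuous_intros)+
    show "(\<lambda>\<zeta>. f \<zeta> * leray_kernel D \<zeta> z) \<in> borel_measurable nu"
      unfolding leray_kernel_def cis_minus_Arg by measurable
  qed
  also have "\<dots> = (1 / (4 * complex_of_real pi ^ 2)) * (\<integral>\<zeta>. (\<Sum>N. f \<zeta> * (of_nat (Suc N) * u \<zeta> ^ N)) \<partial>nu)"
  proof -
    have "(\<integral>\<zeta>. f \<zeta> * (1 / (1 - u \<zeta>)\<^sup>2) \<partial>nu) = (\<integral>\<zeta>. (\<Sum>N. f \<zeta> * (of_nat (Suc N) * u \<zeta> ^ N)) \<partial>nu)"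
      by (rule Bochner_Integration.integral_cong[OF refl], rule pw[symmetric]) simp
    then show ?thesis by (simp only: integral_mult_right_zero)
  qed
  also have "\<dots> = complex_of_real (leray_coeff (int n, int m)) * J n m * mono_fun (int n, int m) z"
    unfolding S by (simp add: leray_coeff_def field_simps)
  also have "J n m = ip2 mu f (Q (int n, int m))"
    unfolding J_def Q_def by (rule ip_U_nu[symmetric, OF fm P.continuous_measurable_bd[OF continuous_mono_fun]])
  finally show ?thesis .
qed

end

section \<open>The Leray transform as a diagonal operator\<close>

lemma L2_cong: "(\<And>x. x \<in> space M \<Longrightarrow> f x = g x) \<Longrightarrow> f \<in> L2 M \<longleftrightarrow> g \<in> L2 M"
  by (simp add: L2_def cong: measurable_cong Bochner_Integration.integrable_cong)

lemma linear2_cong_op: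
  assumes A: "linear2 M N A" and B: "\<And>f. f \<in> L2 M \<Longrightarrow> B f \<in> L2 N" and eq: "\<And>f. f \<in> L2 M \<Longrightarrow> AE y in N. A f y = B f y"
  shows "linear2 M N B"
  unfolding linear2_def
proof (intro conjI ballI allI impI)
  show "B f \<in> L2 N" if "f \<in> L2 M" for f by (rule B[OF that])
  fix f assume f: "f \<in> L2 M"
  show "AE y in N. B (\<lambda>x. c * f x) y = c * B f y" for c
    using linear2_cmult[OF A f, of c] eq[OF f] eq[OF L2_cmult[OF f, of c]] by eventually_elim simp
  fix g assume g: "g \<in> L2 M"
  show "AE y in N. B (\<lambda>x. f x + g x) y = B f y + B g y"
    using linear2_add[OF A f g] eq[OF f] eq[OF g] eq[OF L2_add[OF f g]] by eventually_elim simp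
  assume "AE x in M. f x = g x"
  from linear2_cong[OF A f g this] eq[OF f] eq[OF g] show "AE y in N. B f y = B g y" by eventually_elim simp
qed

lemma bounded_op_cong:
  assumes A: "bounded_op M A" and B: "\<And>f. f \<in> L2 M \<Longrightarrow> B f \<in> L2 M" and eq: "\<And>f. f \<in> L2 M \<Longrightarrow> AE y in M. A f y = B f y"
  shows "bounded_op M B"
proof -
  have lA: "linear2 M M A" by (rule bounded_op_linear[OF A])
  obtain C where C: "\<And>f. f \<in> L2 M \<Longrightarrow> norm2 M (A f) \<le> C * norm2 M f" using A by (auto simp: bounded_op_def)
  have "norm2 M (B f) \<le> C * norm2 M f" if f: "f \<in> L2 M" for f
    using C[OF f] norm2_cong_AE[OF L2_meas[OF linear2_L2[OF lA f]] L2_meas[OF B[OF f]] eq[OF f]] by simp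
  then show ?thesis unfolding bounded_op_def using linear2_cong_op[OF lA B eq] by blast
qed

text \<open>The adjoint is a choice. Testing two candidates on their difference shows that they
  agree almost everywhere, so one explicit adjoint describes it.\<close>

lemma adjoint2_eq:
  assumes B: "bounded_op M B" and adj: "\<And>f g. f \<in> L2 M \<Longrightarrow> g \<in> L2 M \<Longrightarrow> ip2 M (A f) g = ip2 M f (B g)"
  shows "bounded_op M (adjoint2 M A)" and "g \<in> L2 M \<Longrightarrow> AE x in M. adjoint2 M A g x = B g x"
proof -
  have *: "bounded_op M (adjoint2 M A) \<and> (\<forall>f\<in>L2 M. \<forall>g\<in>L2 M. ip2 M (A f) g = ip2 M f (adjoint2 M A g))"
    unfolding adjoint2_def by (rule someI[of _ B]) (use B adj in blast)
  then show b: "bounded_op M (adjoint2 M A)" by blast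
  assume g: "g \<in> L2 M"
  let ?h = "\<lambda>x. adjoint2 M A g x - B g x"
  have L: "adjoint2 M A g \<in> L2 M" "B g \<in> L2 M"
    using linear2_L2[OF bounded_op_linear[OF b] g] linear2_L2[OF bounded_op_linear[OF B] g] .
  have h: "?h \<in> L2 M" by (rule L2_diff[OF L])
  have "ip2 M ?h ?h = ip2 M ?h (adjoint2 M A g) - ip2 M ?h (B g)" by (rule ip2_diff_right[OF L h])
  also have "\<dots> = 0" using * adj[OF h g] h g by auto
  finally have "norm2 M ?h = 0" by (simp add: ip2_self)
  then have "AE x in M. ?h x = 0" using norm2_eq_0_iff[OF h] by simp
  then show "AE x in M. adjoint2 M A g x = B g x" by eventually_elim simp
qed

lemma intertwined_norm_bound:
  assumes "intertwined M N W A B" and C: "\<And>f. f \<in> L2 M \<Longrightarrow> norm2 M (A f) \<le> C * norm2 M f" and g: "g \<in> L2 N"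
  shows "norm2 N (B g) \<le> C * norm2 N g"
proof -
  interpret intertwined M N W A B by (rule assms)
  have Vg: "V g \<in> L2 M" by (rule linear2_L2[OF lV g])
  have "norm2 N (B g) = norm2 M (V (B g))" by (rule isometry_norm[OF V linear2_L2[OF B g], symmetric])
  also have "\<dots> = norm2 M (A (V g))"
    by (rule norm2_cong_AE[OF L2_meas[OF linear2_L2[OF lV linear2_L2[OF B g]]] L2_meas[OF linear2_L2[OF A Vg]] VB[OF g]])
  also have "\<dots> \<le> C * norm2 M (V g)" by (rule C[OF Vg])
  finally show ?thesis by (simp add: isometry_norm[OF V g])
qed

lemma op_norm_intertwined:
  assumes i: "intertwined M N W A B" shows "op_norm M A = op_norm N B"
proof -
  have "(\<forall>f\<in>L2 M. norm2 M (A f) \<le> C * norm2 M f) \<longleftrightarrow> (\<forall>g\<in>L2 N. norm2 N (B g) \<le> C * norm2 N g)" for C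
    using intertwined_norm_bound[OF i, of C] intertwined_norm_bound[OF intertwined.inverse[OF i], of C] by blast
  then show ?thesis unfolding op_norm_def by simp
qed

lemma intertwined_comp:
  assumes i: "intertwined M N W A B" and i': "intertwined M N W A' B'"
  shows "intertwined M N W (A \<circ> A') (B \<circ> B')"
proof -
  interpret intertwined M N W A B by (rule i)
  interpret I': intertwined M N W A' B' by (rule i')
  show ?thesis
  proof
    show "surjective_isometry2 M N W" by (rule W)
    show "linear2 M M (A \<circ> A')" "linear2 N N (B \<circ> B')"
      using linear2_comp[OF I'.A A] linear2_comp[OF I'.B B] by (simp_all add: o_def)
    fix f assume f: "f \<in> L2 M"
    have A': "A' f \<in> L2 M" by (rule linear2_L2[OF I'.A f])
    have "AE y in N. B (W (A' f)) y = B (B' (W f)) y"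
      by (rule linear2_cong[OF B linear2_L2[OF lW A'] linear2_L2[OF I'.B linear2_L2[OF lW f]] I'.WA[OF f]])
    with WA[OF A'] show "AE y in N. W ((A \<circ> A') f) y = (B \<circ> B') (W f) y" by eventually_elim simp
  qed
qed

lemma intertwined_diff:
  assumes i: "intertwined M N W A B" and i': "intertwined M N W A' B'"
  shows "intertwined M N W (\<lambda>f x. A f x - A' f x) (\<lambda>f x. B f x - B' f x)"
proof -
  interpret intertwined M N W A B by (rule i)
  interpret I': intertwined M N W A' B' by (rule i')
  show ?thesis
  proof
    show "surjective_isometry2 M N W" by (rule W)
    show "linear2 M M (\<lambda>f x. A f x - A' f x)" "linear2 N N (\<lambda>f x. B f x - B' f x)"
      by (rule linear2_diff_op A B I'.A I'.B)+
    fix f assume f: "f \<in> L2 M"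
    show "AE y in N. W (\<lambda>x. A f x - A' f x) y = B (W f) y - B' (W f) y"
      using linear2_diff[OF lW linear2_L2[OF A f] linear2_L2[OF I'.A f]] WA[OF f] I'.WA[OF f]
      by eventually_elim simp
  qed
qed

text \<open>Conjugates \<open>R_K\<close> by the involution, giving the exchange in the opposite
  direction.\<close>

lemma (in reflection2) R_K_swapped:
  assumes f: "f \<in> L2 M" shows "AE x in M. R (dsum M I a P Q f) x = K (R f) x"
proof -
  interpret S: diag2 M I a P Q C by (rule swapped)
  have "AE x in M. S.K (R (R f)) x = S.K f x"
    by (rule linear2_cong[OF S.linear_K R_L2[OF R_L2[OF f]] f R_R[OF f]])
  with R_K[OF R_L2[OF f]] have "AE x in M. R (K (R f)) x = S.K f x" by eventually_elim simp
  from linear2_cong[OF linear_R R_L2[OF K_L2[OF R_L2[OF f]]] S.K_L2[OF f] this] R_R[OF K_L2[OF R_L2[OF f]]]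
  show ?thesis by eventually_elim simp
qed

lemma (in rtilde) T_off_axes:
  assumes \<zeta>: "\<zeta> \<in> frontier D" "\<zeta> \<in> off_axes"
  shows "T D \<zeta> \<in> off_axes" "Arg (fst (T D \<zeta>)) = Arg (fst \<zeta>)" "Arg (snd (T D \<zeta>)) = Arg (snd \<zeta>)"
proof -
  interpret P: rtilde "polar D" by (rule rtilde_polar)
  have nz: "fst \<zeta> \<noteq> 0" "snd \<zeta> \<noteq> 0" using \<zeta>(2) by (auto simp: off_axes_def)
  have "fst (T D \<zeta>) \<noteq> 0" "snd (T D \<zeta>) \<noteq> 0"
    using P.T_aligned[OF T_frontier(1)[OF \<zeta>(1)]] nz by (auto simp: T_T[OF \<zeta>(1)])
  then show "T D \<zeta> \<in> off_axes" by (simp add: off_axes_def)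
  have "0 < r1 (T D \<zeta>)" "0 < r2 (T D \<zeta>)"
    using \<open>fst (T D \<zeta>) \<noteq> 0\<close> \<open>snd (T D \<zeta>) \<noteq> 0\<close> by (simp_all add: r1_def r2_def)
  moreover have "Arg (sgn u) = Arg u" if "u \<noteq> 0" for u :: complex
    using that Arg_times_of_real[of "inverse (cmod u)" u] by (simp add: sgn_div_norm scaleR_conv_of_real)
  ultimately show "Arg (fst (T D \<zeta>)) = Arg (fst \<zeta>)" "Arg (snd (T D \<zeta>)) = Arg (snd \<zeta>)"
    using nz by (subst T_aligned[OF \<zeta>(1)], simp)+
qed

abbreviation "idx \<equiv> {0..} \<times> {0..} :: (int \<times> int) set"

context rtilde_weight begin

lemma monomial_U:
  assumes "monomial (polar D) n m F" shows "monomial D n m (U F)"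
proof -
  obtain g where g: "\<And>z. z \<in> frontier (polar D) \<Longrightarrow> fst z * snd z \<noteq> 0 \<Longrightarrow>
      F z = g (s_coord (polar D) z) * cis (of_int n * Arg (fst z) + of_int m * Arg (snd z))"
    using assms unfolding monomial_def by blast
  have "U F \<zeta> = g (s_coord D \<zeta>) * complex_of_real (1 / \<omega> (s_coord D \<zeta>)) * cis (of_int n * Arg (fst \<zeta>) + of_int m * Arg (snd \<zeta>))"
    if "\<zeta> \<in> frontier D" "fst \<zeta> * snd \<zeta> \<noteq> 0" for \<zeta>
  proof -
    have oa: "\<zeta> \<in> off_axes" using that(2) by (simp add: off_axes_def)
    have "fst (T D \<zeta>) * snd (T D \<zeta>) \<noteq> 0" using T_off_axes(1)[OF that(1) oa] by (simp add: off_axes_def)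
    from g[OF T_frontier(1)[OF that(1)] this] show ?thesis
      using T_off_axes(2,3)[OF that(1) oa] s_coord_T[OF that(1)] by (simp add: U_op_def)
  qed
  then show ?thesis unfolding monomial_def by (intro exI[of _ "\<lambda>\<sigma>. g \<sigma> * complex_of_real (1 / \<omega> \<sigma>)"]) blast
qed

text \<open>On \<open>D\<close> the integral is a constant times a polynomial, hence extends
  continuously; boundary points are limit points of \<open>D\<close>, so \<open>Lim\<close> is
  determined.\<close>

lemma leray_boundary_monomial:
  assumes f: "f \<in> L2 mu" and bi: "bihom f (fst i) (snd i)" and i: "i \<in> idx" and \<zeta>: "\<zeta> \<in> frontier D"
  shows "leray_boundary D f \<zeta> = complex_of_real (leray_coeff i) * ip2 mu f (Q i) * mono_fun i \<zeta>"
  unfolding leray_boundary_def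
proof (rule tendsto_Lim)
  have "\<zeta> \<in> closure D" "\<zeta> \<notin> D" using \<zeta> open_D by (simp_all add: frontier_def interior_open)
  then show "\<not> trivial_limit (at \<zeta> within D)" by (simp add: trivial_limit_within closure_def)
  let ?c = "complex_of_real (leray_coeff i) * ip2 mu f (Q i)"
  have i': "i = (int (nat (fst i)), int (nat (snd i)))" using i by (cases i) simp
  have "(mono_fun i \<longlongrightarrow> mono_fun i \<zeta>) (at \<zeta> within D)"
    by (rule tendsto_within_subset[OF continuous_mono_fun[of UNIV i, unfolded continuous_on_def, rule_format, OF UNIV_I] subset_UNIV])
  then have "((\<lambda>z. ?c * mono_fun i z) \<longlongrightarrow> ?c * mono_fun i \<zeta>) (at \<zeta> within D)" by (intro tendsto_intros)
  moreover have "leray_integral D f z = ?c * mono_fun i z" if "z \<in> D" for z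
    using leray_integral_monomial[of f "nat (fst i)" "nat (snd i)" z] f bi that i i' by auto
  then have "\<forall>\<^sub>F z in at \<zeta> within D. leray_integral D f z = ?c * mono_fun i z"
    by (auto simp: eventually_at_filter)
  ultimately show "(leray_integral D f \<longlongrightarrow> ?c * mono_fun i \<zeta>) (at \<zeta> within D)"
    by (simp add: tendsto_cong)
qed

lemma bihom_Q_mono:
  assumes "i \<in> idx" shows "bihom (Q i) (fst i) (snd i)" "bihom (mono_fun i) (fst i) (snd i)"
  using assms bihom_Q[of "fst i" "snd i"] bihom_mono[of "fst i" "snd i"] by (cases i; simp)+

lemma ip_Q_mono:
  assumes "i \<in> idx" "j \<in> idx" "i \<noteq> j"
  shows "ip2 mu (Q i) (Q j) = 0" "ip2 mu (mono_fun i) (mono_fun j) = 0" "ip2 mu (mono_fun i) (Q j) = 0"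
  using assms by (auto intro!: bihom_ip Q_L2 mono_L2 bihom_Q_mono simp: prod_eq_iff)

text \<open>Pairing with \<open>Q i\<close>, which has bidegree \<open>i\<close>, filters out a
  single component of the decomposition.\<close>

lemma ip_decomposition:
  assumes dec: "monomial_decomposition D mu f F" and i: "i \<in> idx"
  shows "ip2 mu (F (fst i) (snd i)) (Q i) = ip2 mu f (Q i)"
proof -
  let ?F = "\<lambda>(n, m). F n m"
  have hs: "has_sum2 mu ?F UNIV f" and mono: "\<And>n m. monomial D n m (F n m)"
    using dec by (auto simp: monomial_decomposition_def)
  have L: "F n m \<in> L2 mu" for n m using has_sum2_L2(1)[OF hs, of "(n, m)"] by simp
  have "((\<lambda>j. ip2 mu (?F j) (Q i)) has_sum ip2 mu f (Q i)) UNIV" by (rule has_sum2_ip[OF hs Q_L2])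
  also have "?this \<longleftrightarrow> ((\<lambda>j. ip2 mu (?F j) (Q i)) has_sum ip2 mu f (Q i)) {i}"
  proof (rule has_sum_cong_neutral)
    fix j :: "int \<times> int" assume "j \<in> UNIV - {i}"
    then have "(fst j, snd j) \<noteq> (fst i, snd i)" by (simp add: prod_eq_iff)
    from bihom_ip[OF L monomial_bihom[OF mono] Q_L2 bihom_Q_mono(1)[OF i] this]
    show "ip2 mu (?F j) (Q i) = 0" by (simp add: case_prod_beta)
  qed auto
  finally have "ip2 mu (?F i) (Q i) = ip2 mu f (Q i)"
    using has_sum_finite[of "{i}" "\<lambda>j. ip2 mu (?F j) (Q i)"] by (auto dest: has_sum_unique)
  then show ?thesis by (simp add: case_prod_beta)
qed

text \<open>Once the coefficients are inner products of \<open>f\<close> with \<open>Q i\<close>,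
  the series no longer mentions the decomposition, whose existence is left over as a side
  condition.\<close>

lemma leray_value_iff:
  "leray_value D mu f h \<longleftrightarrow> (\<exists>F. monomial_decomposition D mu f F) \<and>
     has_sum2 mu (\<lambda>i \<zeta>. complex_of_real (leray_coeff i) * ip2 mu f (Q i) * mono_fun i \<zeta>) idx h"
proof -
  let ?t = "\<lambda>i \<zeta>. complex_of_real (leray_coeff i) * ip2 mu f (Q i) * mono_fun i \<zeta>"
  have "has_sum2 mu (\<lambda>(n, m). leray_boundary D (F n m)) idx h \<longleftrightarrow> has_sum2 mu ?t idx h"
    if dec: "monomial_decomposition D mu f F" for F
  proof -
    let ?b = "\<lambda>(n, m). leray_boundary D (F n m)"
    have eq: "?b i \<zeta> = ?t i \<zeta>" if "i \<in> idx" "\<zeta> \<in> space mu" for i \<zeta>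
    proof -
      have "F (fst i) (snd i) \<in> L2 mu" "monomial D (fst i) (snd i) (F (fst i) (snd i))"
        using dec has_sum2_L2(1)[of mu "\<lambda>(n, m). F n m" UNIV f i] by (auto simp: monomial_decomposition_def case_prod_beta)
      then show ?thesis
        using leray_boundary_monomial[OF _ monomial_bihom that(1), of "F (fst i) (snd i)" \<zeta>] that(2)
          ip_decomposition[OF dec that(1)] by (simp add: case_prod_beta)
    qed
    have t: "?t i \<in> L2 mu" for i by (rule L2_cmult[OF mono_L2])
    then have b: "?b i \<in> L2 mu" if "i \<in> idx" for i using L2_cong[of mu "?b i" "?t i"] eq[OF that] by blast
    have AE: "AE \<zeta> in mu. ?b i \<zeta> = ?t i \<zeta>" if "i \<in> idx" for i by (rule AE_I2) (rule eq[OF that])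
    show ?thesis
    proof
      assume h: "has_sum2 mu ?b idx h"
      show "has_sum2 mu ?t idx h" by (rule has_sum2_cong_AE[OF h t has_sum2_L2(2)[OF h] AE]) auto
    next
      assume h: "has_sum2 mu ?t idx h"
      have AE': "AE \<zeta> in mu. ?t i \<zeta> = ?b i \<zeta>" if "i \<in> idx" for i by (rule AE_I2) (rule eq[OF that, symmetric])
      show "has_sum2 mu ?b idx h" by (rule has_sum2_cong_AE[OF h b has_sum2_L2(2)[OF h] AE']) auto
    qed
  qed
  then show ?thesis unfolding leray_value_def by blast
qed

abbreviation "K \<equiv> dsum mu idx leray_coeff Q mono_fun"
abbreviation "K_adj \<equiv> dsum mu idx leray_coeff mono_fun Q"

text \<open>Both sides choose from the same predicate, so they are equal as functions and not merely
  almost everywhere.\<close>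

lemma leray_eq_K:
  assumes "monomial_decomposition D mu f F" shows "leray D mu f = K f"
  unfolding leray_def dsum_def
  by (rule arg_cong[of _ _ Eps], rule ext) (use leray_value_iff assms in blast)

lemma mono_fun_pos: "0 < norm2 mu (mono_fun i)"
proof (rule ccontr)
  assume "\<not> 0 < norm2 mu (mono_fun i)"
  then have "norm2 mu (mono_fun i) = 0" using norm2_nonneg[of mu "mono_fun i"] by simp
  then have "AE \<zeta> in nu. mono_fun i \<zeta> = 0" using norm2_eq_0_iff[OF mono_L2] by (simp add: AE_mu_iff)
  with AE_off_axes have "AE \<zeta> in nu. False" by eventually_elim (simp add: mono_fun_def off_axes_def)
  then show False using nu_not_null by simp
qed

lemma Q_pos: "0 < norm2 mu (Q i)"
proof -
  interpret P: rtilde_weight "polar D" "\<lambda>\<sigma>. 1 / \<omega> \<sigma>" by (rule polar_weight)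
  show ?thesis unfolding Q_def U_L2_norm(2)[OF mono_L2'] by (rule P.mono_fun_pos)
qed

lemma leray_value_leray:
  assumes "leray_bounded D mu" "f \<in> L2 mu" shows "leray_value D mu f (leray D mu f)"
  using assms unfolding leray_bounded_def leray_def by (metis someI_ex)

text \<open>Testing the bounded transform on \<open>Q i\<close> isolates one rank-one block, and the
  operator bound becomes the uniform block bound that \<open>diag2\<close> asks for.\<close>

lemma leray_reflection:
  assumes bd: "leray_bounded D mu"
  shows "\<exists>C. reflection2 mu idx leray_coeff Q mono_fun C"
proof -
  obtain C where C: "\<And>f. f \<in> L2 mu \<Longrightarrow> norm2 mu (leray D mu f) \<le> C * norm2 mu f"
    using bd unfolding leray_bounded_def bounded_op_def by blast
  have bound: "leray_coeff i * norm2 mu (Q i) * norm2 mu (mono_fun i) \<le> C" if i: "i \<in> idx" for i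
  proof -
    let ?t = "\<lambda>j \<zeta>. complex_of_real (leray_coeff j) * ip2 mu (Q i) (Q j) * mono_fun j \<zeta>"
    have t: "?t i \<in> L2 mu" by (rule L2_cmult[OF mono_L2])
    have "has_sum2 mu ?t idx (?t i)"
      by (rule has_sum2_single[where h = ?t, OF i t]) (use ip_Q_mono(1)[OF i] in auto)
    moreover have h: "has_sum2 mu ?t idx (leray D mu (Q i))"
      using leray_value_leray[OF bd Q_L2, of i] unfolding leray_value_iff by blast
    ultimately have "AE \<zeta> in mu. ?t i \<zeta> = leray D mu (Q i) \<zeta>" by (rule has_sum2_unique)
    then have "norm2 mu (leray D mu (Q i)) = norm2 mu (?t i)"
      using norm2_cong_AE[OF L2_meas[OF t] L2_meas[OF has_sum2_L2(2)[OF h]]] by simp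
    also have "\<dots> = leray_coeff i * (norm2 mu (Q i))\<^sup>2 * norm2 mu (mono_fun i)"
      using leray_coeff_pos[of i] by (simp add: norm2_cmult ip2_self norm_mult norm_power norm2_nonneg)
    finally have "leray_coeff i * norm2 mu (Q i) * norm2 mu (mono_fun i) * norm2 mu (Q i) \<le> C * norm2 mu (Q i)"
      using C[OF Q_L2[of i]] by (simp add: power2_eq_square mult_ac)
    then show ?thesis using Q_pos[of i] by (rule mult_right_le_imp_le)
  qed
  \<comment> \<open>The locale asks for a nonnegative constant, hence the maximum.\<close>
  have "reflection2 mu idx leray_coeff Q mono_fun (max C 0)"
  proof
    show "orthogonal2 mu idx Q" "orthogonal2 mu idx mono_fun"
      unfolding orthogonal2_def using Q_L2 mono_L2 ip_Q_mono by blast+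
    show "0 \<le> leray_coeff i" for i using leray_coeff_pos[of i] by simp
    show "leray_coeff i * norm2 mu (Q i) * norm2 mu (mono_fun i) \<le> max C 0" if "i \<in> idx" for i
      using bound[OF that] by simp
    show "ip2 mu (mono_fun i) (Q j) = 0" if "i \<in> idx" "j \<in> idx" "i \<noteq> j" for i j by (rule ip_Q_mono(3)[OF that])
  qed (simp_all add: Q_pos mono_fun_pos ip_mono_Q_real)
  then show ?thesis ..
qed

end

section \<open>Transfer of the transform to the polar domain\<close>

locale leray_bounded_weight = rtilde_weight +
  assumes bounded: "leray_bounded D mu"
begin

definition "C = (SOME C. reflection2 mu idx leray_coeff Q mono_fun C)"

sublocale K: reflection2 mu idx leray_coeff Q mono_fun C
  unfolding C_def by (rule someI_ex[OF leray_reflection[OF bounded]])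

sublocale K_adj: diag2 mu idx leray_coeff mono_fun Q C
  by (rule K.swapped)

lemma leray_K: assumes "f \<in> L2 mu" shows "leray D mu f = K f"
proof -
  obtain F where "monomial_decomposition D mu f F"
    using leray_value_leray[OF bounded assms] unfolding leray_value_def by blast
  then show ?thesis by (rule leray_eq_K)
qed

lemma bounded_leray_adj: "bounded_op mu (leray_adj D mu)"
  and leray_adj_K: "f \<in> L2 mu \<Longrightarrow> AE \<zeta> in mu. leray_adj D mu f \<zeta> = K_adj f \<zeta>"
  unfolding leray_adj_def
  by (rule adjoint2_eq[OF K_adj.bounded_K]; simp add: leray_K K.K_adjoint)+

lemma bounded_leray: "bounded_op mu (leray D mu)"
  using bounded by (simp add: leray_bounded_def)

text \<open>\<open>U'\<close> carries \<open>Q i\<close> back to a monomial on the polar and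
  \<open>ip_U\<close> rewrites the coefficients, so the conjugated adjoint series is the Leray
  series of the polar.\<close>

lemma has_sum2_U':
  assumes g: "g \<in> L2 mu'"
  shows "has_sum2 mu' (\<lambda>i z. complex_of_real (leray_coeff i) * ip2 mu' g (rtilde_weight.Q (polar D) (\<lambda>\<sigma>. 1 / \<omega> \<sigma>) i) * mono_fun i z)
    idx (U' (K_adj (U g)))"
proof -
  interpret P: rtilde_weight "polar D" "\<lambda>\<sigma>. 1 / \<omega> \<sigma>" by (rule polar_weight)
  note lU' = isometry_linear[OF U'_isometry]
  have Ug: "U g \<in> L2 mu" by (rule U_L2_norm(1)[OF g])
  have "has_sum2 mu' (\<lambda>i. U' (K_adj.trm (U g) i)) idx (U' (K_adj (U g)))"
    by (rule has_sum2_op[OF lU' _ K_adj.K_has_sum[OF Ug], of 1]) (simp add: U'_L2_norm)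
  then show ?thesis
  proof (rule has_sum2_cong_AE)
    fix i assume "i \<in> idx"
    show "(\<lambda>z. complex_of_real (leray_coeff i) * ip2 mu' g (P.Q i) * mono_fun i z) \<in> L2 mu'"
      by (rule L2_cmult[OF mono_L2'])
    have ip: "ip2 mu (U g) (mono_fun i) = ip2 mu' g (P.Q i)"
      using ip_U[OF g mono_L2[of i]] by (simp add: P.Q_def bipolar)
    show "AE z in mu'. U' (K_adj.trm (U g) i) z = complex_of_real (leray_coeff i) * ip2 mu' g (P.Q i) * mono_fun i z"
      using linear2_cmult[OF lU' Q_L2[of i], of "complex_of_real (leray_coeff i) * ip2 mu (U g) (mono_fun i)"] U'_U[of "mono_fun i"]
      by eventually_elim (simp add: Q_def ip)
  qed (auto intro: U'_L2_norm K_adj.K_L2 Ug)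
qed

text \<open>Obtained by transport: the assumption on \<open>D\<close> provides a decomposition of
  \<open>U g\<close>, and \<open>U'\<close> maps monomials to monomials of the same
  bidegree.\<close>

lemma polar_decomposition:
  assumes g: "g \<in> L2 mu'" shows "\<exists>F. monomial_decomposition (polar D) mu' g F"
proof -
  interpret P: rtilde_weight "polar D" "\<lambda>\<sigma>. 1 / \<omega> \<sigma>" by (rule polar_weight)
  note lU' = isometry_linear[OF U'_isometry]
  have Ug: "U g \<in> L2 mu" by (rule U_L2_norm(1)[OF g])
  obtain F where F: "monomial_decomposition D mu (U g) F"
    using leray_value_leray[OF bounded Ug] unfolding leray_value_def by blast
  have "monomial (polar D) n m (U' (F n m))" for n m
    using P.monomial_U[of n m "F n m"] F by (simp add: bipolar monomial_decomposition_def)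
  moreover have hs: "has_sum2 mu (\<lambda>(n, m). F n m) UNIV (U g)" using F by (simp add: monomial_decomposition_def)
  have "has_sum2 mu' (\<lambda>i. U' ((\<lambda>(n, m). F n m) i)) UNIV (U' (U g))"
    by (rule has_sum2_op[OF lU' _ hs, of 1]) (simp add: U'_L2_norm)
  then have "has_sum2 mu' (\<lambda>i. U' ((\<lambda>(n, m). F n m) i)) UNIV g"
    by (rule has_sum2_cong_AE) (use U'_U[of g] g has_sum2_L2(1)[OF hs] in \<open>auto intro: U'_L2_norm\<close>)
  then have "has_sum2 mu' (\<lambda>(n, m). U' (F n m)) UNIV g" by (simp add: case_prod_beta')
  ultimately show ?thesis unfolding monomial_decomposition_def by (intro exI[of _ "\<lambda>n m. U' (F n m)"]) blast
qed

lemma polar_leray_value: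
  assumes g: "g \<in> L2 mu'" shows "leray_value (polar D) mu' g (U' (K_adj (U g)))"
proof -
  interpret P: rtilde_weight "polar D" "\<lambda>\<sigma>. 1 / \<omega> \<sigma>" by (rule polar_weight)
  show ?thesis unfolding P.leray_value_iff using polar_decomposition[OF g] has_sum2_U'[OF g] by blast
qed

lemma polar_leray:
  assumes g: "g \<in> L2 mu'"
  shows "leray (polar D) mu' g \<in> L2 mu'" "AE z in mu'. U' (K_adj (U g)) z = leray (polar D) mu' g z"
proof -
  interpret P: rtilde_weight "polar D" "\<lambda>\<sigma>. 1 / \<omega> \<sigma>" by (rule polar_weight)
  have "leray_value (polar D) mu' g (leray (polar D) mu' g)"
    unfolding leray_def by (rule someI[of "leray_value (polar D) mu' g", OF polar_leray_value[OF g]])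
  then have "has_sum2 mu' (\<lambda>i z. complex_of_real (leray_coeff i) * ip2 mu' g (P.Q i) * mono_fun i z) idx (leray (polar D) mu' g)"
    unfolding P.leray_value_iff by blast
  then show "leray (polar D) mu' g \<in> L2 mu'" "AE z in mu'. U' (K_adj (U g)) z = leray (polar D) mu' g z"
    by (rule has_sum2_L2(2), rule has_sum2_unique[OF has_sum2_U'[OF g]])
qed

lemma polar_leray_bounded: "leray_bounded (polar D) mu'"
  unfolding leray_bounded_def
proof (intro conjI ballI)
  show "\<exists>h. leray_value (polar D) mu' g h" if "g \<in> L2 mu'" for g using polar_leray_value[OF that] by (rule exI[of _ "U' (K_adj (U g))"])
  have "linear2 mu' mu' (\<lambda>g. U' (K_adj (U g)))"
    by (rule linear2_comp[OF linear2_comp[OF U_linear K_adj.linear_K] isometry_linear[OF U'_isometry]])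
  moreover have "norm2 mu' (U' (K_adj (U g))) \<le> C * norm2 mu' g" if g: "g \<in> L2 mu'" for g
    using K_adj.K_bound[OF U_L2_norm(1)[OF g]] U'_L2_norm(2)[OF K_adj.K_L2[OF U_L2_norm(1)[OF g]]] U_L2_norm(2)[OF g] by simp
  ultimately have "bounded_op mu' (\<lambda>g. U' (K_adj (U g)))" unfolding bounded_op_def by blast
  then show "bounded_op mu' (leray (polar D) mu')" by (rule bounded_op_cong) (rule polar_leray, assumption)+
qed

lemma leray_adj_U:
  assumes g: "g \<in> L2 mu'" shows "AE \<zeta> in mu. leray_adj D mu (U g) \<zeta> = U (leray (polar D) mu' g) \<zeta>"
proof -
  have Ug: "U g \<in> L2 mu" by (rule U_L2_norm(1)[OF g])
  have "AE \<zeta> in mu. U (U' (K_adj (U g))) \<zeta> = U (leray (polar D) mu' g) \<zeta>"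
    by (rule linear2_cong[OF U_linear U'_L2_norm(1)[OF K_adj.K_L2[OF Ug]] polar_leray(1)[OF g] polar_leray(2)[OF g]])
  with leray_adj_K[OF Ug] U_U'[of "K_adj (U g)"] show ?thesis by eventually_elim simp
qed

lemma polar_leray_bounded_weight: "leray_bounded_weight (polar D) (\<lambda>\<sigma>. 1 / \<omega> \<sigma>)"
proof -
  interpret P: rtilde_weight "polar D" "\<lambda>\<sigma>. 1 / \<omega> \<sigma>" by (rule polar_weight)
  show ?thesis by unfold_locales (rule polar_leray_bounded)
qed

text \<open>\<open>leray_adj_U\<close> applied to the polar, with \<open>bipolar\<close> leading
  back to \<open>D\<close>, and then conjugated by \<open>U\<close>.\<close>

lemma leray_U:
  assumes g: "g \<in> L2 mu'" shows "AE \<zeta> in mu. leray D mu (U g) \<zeta> = U (leray_adj (polar D) mu' g) \<zeta>"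
proof -
  interpret P: leray_bounded_weight "polar D" "\<lambda>\<sigma>. 1 / \<omega> \<sigma>" by (rule polar_leray_bounded_weight)
  note lA = bounded_op_linear[OF P.bounded_leray_adj]
  have Ug: "U g \<in> L2 mu" by (rule U_L2_norm(1)[OF g])
  have L: "leray D mu (U g) \<in> L2 mu" by (rule linear2_L2[OF bounded_op_linear[OF bounded_leray] Ug])
  have "AE z in mu'. leray_adj (polar D) mu' (U' (U g)) z = U' (leray D mu (U g)) z"
    using P.leray_adj_U[of "U g"] Ug by (simp add: bipolar)
  moreover have "AE z in mu'. leray_adj (polar D) mu' (U' (U g)) z = leray_adj (polar D) mu' g z"
    by (rule linear2_cong[OF lA U'_L2_norm(1)[OF Ug] g U'_U])
  ultimately have "AE z in mu'. U' (leray D mu (U g)) z = leray_adj (polar D) mu' g z" by eventually_elim simp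
  from linear2_cong[OF U_linear U'_L2_norm(1)[OF L] linear2_L2[OF lA g] this] U_U'[of "leray D mu (U g)"]
  show ?thesis by eventually_elim simp
qed

text \<open>The map \<open>U\<close> exchanges the transforms with their adjoints; the reflection \<open>R\<close>, which
  swaps the normalised \<open>Q i\<close> and monomials, undoes this exchange.\<close>

lemma intertwined_leray:
  "intertwined mu' mu (\<lambda>g. K.R (U g)) (leray (polar D) mu') (leray D mu)"
  "intertwined mu' mu (\<lambda>g. K.R (U g)) (leray_adj (polar D) mu') (leray_adj D mu)"
proof -
  interpret P: leray_bounded_weight "polar D" "\<lambda>\<sigma>. 1 / \<omega> \<sigma>" by (rule polar_leray_bounded_weight)
  note l = bounded_op_linear[OF bounded_leray] bounded_op_linear[OF bounded_leray_adj]
    bounded_op_linear[OF P.bounded_leray] bounded_op_linear[OF P.bounded_leray_adj]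
  have W: "surjective_isometry2 mu' mu (\<lambda>g. K.R (U g))" by (rule isometry_comp[OF U_isometry K.R_isometry])
  show "intertwined mu' mu (\<lambda>g. K.R (U g)) (leray (polar D) mu') (leray D mu)"
  proof (rule intertwined.intro[OF W l(3) l(1)])
    fix g assume g: "g \<in> L2 mu'"
    note Ug = U_L2_norm(1)[OF g]
    have "AE \<zeta> in mu. K_adj (U g) \<zeta> = U (leray (polar D) mu' g) \<zeta>"
      using leray_adj_U[OF g] leray_adj_K[OF Ug] by eventually_elim simp
    from linear2_cong[OF K.linear_R K_adj.K_L2[OF Ug] U_L2_norm(1)[OF linear2_L2[OF l(3) g]] this] K.R_K_swapped[OF Ug]
    show "AE \<zeta> in mu. K.R (U (leray (polar D) mu' g)) \<zeta> = leray D mu (K.R (U g)) \<zeta>"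
      by eventually_elim (simp add: leray_K[OF K.R_L2[OF Ug]])
  qed
  show "intertwined mu' mu (\<lambda>g. K.R (U g)) (leray_adj (polar D) mu') (leray_adj D mu)"
  proof (rule intertwined.intro[OF W l(4) l(2)])
    fix g assume g: "g \<in> L2 mu'"
    note Ug = U_L2_norm(1)[OF g]
    have "AE \<zeta> in mu. K (U g) \<zeta> = U (leray_adj (polar D) mu' g) \<zeta>"
      using leray_U[OF g] by (simp add: leray_K[OF Ug])
    from linear2_cong[OF K.linear_R K.K_L2[OF Ug] U_L2_norm(1)[OF linear2_L2[OF l(4) g]] this] K.R_K[OF Ug] leray_adj_K[OF K.R_L2[OF Ug]]
    show "AE \<zeta> in mu. K.R (U (leray_adj (polar D) mu' g)) \<zeta> = leray_adj D mu (K.R (U g)) \<zeta>"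
      by eventually_elim simp
  qed
qed

end

section \<open>Admissible measures\<close>

context rtilde begin

text \<open>Pushing forward under \<open>s_coord\<close> integrates out the angles, so that weights
  can be compared on the line.\<close>

lemma emeasure_bd_s:
  assumes \<omega>: "\<omega> \<in> borel_measurable (restrict_space borel {0<..<1})"
    and \<omega>' [measurable]: "\<omega>' \<in> borel_measurable borel" and eq: "\<And>\<sigma>. \<sigma> \<in> {0..1} \<Longrightarrow> \<omega>' \<sigma> = \<omega> \<sigma>"
    and A [measurable]: "A \<in> sets borel"
  shows "emeasure (bd_measure D \<omega>) (s_coord D -` A \<inter> frontier D) =
    emeasure (density lborel (\<lambda>\<sigma>. ennreal (4 * pi\<^sup>2) * indicator {0<..<1} \<sigma> * ennreal (\<omega>' \<sigma>))) A"
proof -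
  have [measurable]: "(\<lambda>\<zeta>. \<omega> (s_coord D \<zeta>)) \<in> borel_measurable bd" by (rule weight_measurable[OF \<omega>])
  have [measurable]: "frontier D \<in> sets bd" using sets.top[of bd] by (simp add: space_bd)
  have [measurable]: "s_coord D -` A \<inter> frontier D \<in> sets bd"
    using measurable_sets[OF s_coord_measurable A] by (simp add: space_bd)
  have "emeasure (bd_measure D \<omega>) (s_coord D -` A \<inter> frontier D) =
      (\<integral>\<^sup>+\<zeta>. ennreal (\<omega> (s_coord D \<zeta>)) * indicator (s_coord D -` A \<inter> frontier D) \<zeta> \<partial>nu)"
    unfolding bd_measure_eq[OF \<omega>] by (rule emeasure_density) measurable
  also have "\<dots> = (\<integral>\<^sup>+\<zeta>. ennreal (\<omega>' (s_coord D \<zeta>)) * indicator A (s_coord D \<zeta>) \<partial>nu)"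
    by (rule nn_integral_cong) (use eq[OF s_coord_bounds] in \<open>auto split: split_indicator\<close>)
  also have "\<dots> = (\<integral>\<^sup>+x. ennreal (\<omega>' (s_coord D (bd_param D x))) * indicator A (s_coord D (bd_param D x)) \<partial>lbox)"
    unfolding nu_def by (rule nn_integral_distr) measurable
  also have "\<dots> = (\<integral>\<^sup>+x. ennreal (\<omega>' (fst x)) * indicator A (fst x) \<partial>lbox)"
    by (rule nn_integral_cong) (auto simp: space_lbox pbox_def s_bd_param)
  also have "\<dots> = (\<integral>\<^sup>+\<sigma>. ennreal (4 * pi\<^sup>2) * indicator {0<..<1} \<sigma> * (ennreal (\<omega>' \<sigma>) * indicator A \<sigma>) \<partial>lborel)"
    by (rule nn_integral_lbox) measurable
  also have "\<dots> = emeasure (density lborel (\<lambda>\<sigma>. ennreal (4 * pi\<^sup>2) * indicator {0<..<1} \<sigma> * ennreal (\<omega>' \<sigma>))) A"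
    by (subst emeasure_density) (auto simp: mult.assoc intro!: measurable_lborel2)
  finally show ?thesis .
qed

text \<open>The pushed-forward measures on the line have densities with respect to Lebesgue measure,
  and these are unique up to null sets.\<close>

lemma admissible_weight_unique:
  assumes \<omega>: "positive_weight \<omega>" and \<omega>': "positive_weight \<omega>'" and c: "0 < c"
    and eq: "bd_measure D \<omega> = scale_measure (ennreal c) (bd_measure D \<omega>')"
  shows "AE \<sigma> in lborel. \<sigma> \<in> {0<..<1} \<longrightarrow> \<omega> \<sigma> = c * \<omega>' \<sigma>"
proof -
  have m: "\<omega> \<in> borel_measurable (restrict_space borel {0<..<1})" "\<omega>' \<in> borel_measurable (restrict_space borel {0<..<1})"
    and pos: "AE \<sigma> in lborel. \<sigma> \<in> {0<..<1} \<longrightarrow> 0 < \<omega> \<sigma>" "AE \<sigma> in lborel. \<sigma> \<in> {0<..<1} \<longrightarrow> 0 < \<omega>' \<sigma>"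
    using \<omega> \<omega>' by (simp_all add: positive_weight_def)
  obtain h where h [measurable]: "h \<in> borel_measurable borel" and h': "\<And>\<sigma>. \<sigma> \<in> {0..1} \<Longrightarrow> h \<sigma> = \<omega> \<sigma>"
    using weight_extension[OF m(1)] by blast
  obtain k where k [measurable]: "k \<in> borel_measurable borel" and k': "\<And>\<sigma>. \<sigma> \<in> {0..1} \<Longrightarrow> k \<sigma> = \<omega>' \<sigma>"
    using weight_extension[OF m(2)] by blast
  let ?d = "\<lambda>h \<sigma>. ennreal (4 * pi\<^sup>2) * indicator {0<..<1} \<sigma> * ennreal (h \<sigma>)"
  have "density lborel (?d h) = density lborel (\<lambda>\<sigma>. ennreal c * ?d k \<sigma>)"
  proof (rule measure_eqI)
    fix A assume "A \<in> sets (density lborel (?d h))"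
    then have A [measurable]: "A \<in> sets borel" by simp
    have "emeasure (density lborel (?d h)) A = emeasure (bd_measure D \<omega>) (s_coord D -` A \<inter> frontier D)"
      by (rule emeasure_bd_s[OF m(1) h h' A, symmetric])
    also have "\<dots> = ennreal c * emeasure (density lborel (?d k)) A"
      using emeasure_bd_s[OF m(2) k k' A] by (simp add: eq)
    also have "\<dots> = (\<integral>\<^sup>+\<sigma>. ennreal c * (?d k \<sigma> * indicator A \<sigma>) \<partial>lborel)"
      by (subst emeasure_density) (auto simp: nn_integral_cmult)
    also have "\<dots> = emeasure (density lborel (\<lambda>\<sigma>. ennreal c * ?d k \<sigma>)) A"
      by (subst emeasure_density) (auto simp: mult.assoc)
    finally show "emeasure (density lborel (?d h)) A = emeasure (density lborel (\<lambda>\<sigma>. ennreal c * ?d k \<sigma>)) A" .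
  qed simp
  then have "AE \<sigma> in lborel. ?d h \<sigma> = ennreal c * ?d k \<sigma>"
    by (subst (asm) sigma_finite_measure.density_unique_iff[OF sigma_finite_lborel]) auto
  then show ?thesis using pos
  proof eventually_elim
    case (elim \<sigma>)
    show ?case
    proof
      assume \<sigma>: "\<sigma> \<in> {0<..<1}"
      then have p: "0 < h \<sigma>" "0 < k \<sigma>" using elim h'[of \<sigma>] k'[of \<sigma>] by auto
      have "ennreal (4 * pi\<^sup>2 * h \<sigma>) = ennreal (c * (4 * pi\<^sup>2 * k \<sigma>))"
        using elim(1) \<sigma> p c by (simp add: ennreal_mult)
      then have "4 * pi\<^sup>2 * h \<sigma> = c * (4 * pi\<^sup>2 * k \<sigma>)" using p c by (subst (asm) ennreal_inj) auto
      then show "\<omega> \<sigma> = c * \<omega>' \<sigma>" using h'[of \<sigma>] k'[of \<sigma>] \<sigma> by (simp add: field_simps)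
    qed
  qed
qed

text \<open>Admissibility yields some weight and constant representing the same measure, not
  directly the integrability of the given \<open>\<omega>\<close>; uniqueness of densities
  identifies the two.\<close>

lemma rtilde_weightI:
  assumes \<omega>: "positive_weight \<omega>" and adm: "admissible_measure D (bd_measure D \<omega>)"
  shows "rtilde_weight D \<omega>"
proof -
  obtain c \<omega>' where c: "0 < c" and \<omega>': "positive_weight \<omega>'" "set_integrable lborel {0<..<1} \<omega>'"
      "set_integrable lborel {0<..<1} (\<lambda>\<sigma>. 1 / \<omega>' \<sigma>)"
    and eq: "bd_measure D \<omega> = scale_measure (ennreal c) (bd_measure D \<omega>')"
    using adm unfolding admissible_measure_def by blast
  have AE: "AE \<sigma> in lborel. \<sigma> \<in> {0<..<1} \<longrightarrow> \<omega> \<sigma> = c * \<omega>' \<sigma>"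
    by (rule admissible_weight_unique[OF \<omega> \<omega>'(1) c eq])
  have m: "\<omega> \<in> borel_measurable (restrict_space borel {0<..<1})" using \<omega> by (simp add: positive_weight_def)
  have int: "set_integrable lborel {0<..<1} g"
    if i: "set_integrable lborel {0<..<1} (\<lambda>\<sigma>. d * f \<sigma>)" and g: "g \<in> borel_measurable (restrict_space borel {0<..<1})"
      and AE: "AE \<sigma> in lborel. \<sigma> \<in> {0<..<1} \<longrightarrow> g \<sigma> = d * f \<sigma>" for d and f g :: "real \<Rightarrow> real"
    unfolding set_integrable_def
  proof (rule integrable_cong_AE_imp[OF i[unfolded set_integrable_def]])
    show "(\<lambda>\<sigma>. indicator {0<..<1} \<sigma> *\<^sub>R g \<sigma>) \<in> borel_measurable lborel"
      using g by (simp add: borel_measurable_restrict_space_iff)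
    show "AE \<sigma> in lborel. indicator {0<..<1} \<sigma> *\<^sub>R (d * f \<sigma>) = indicator {0<..<1} \<sigma> *\<^sub>R g \<sigma>"
      using AE by eventually_elim (auto split: split_indicator)
  qed
  show ?thesis
  proof (unfold_locales, rule \<omega>)
    show "set_integrable lborel {0<..<1} \<omega>" by (rule int[OF set_integrable_mult_right[OF \<omega>'(2), of c] m AE])
    have "(\<lambda>\<sigma>. 1 / \<omega> \<sigma>) \<in> borel_measurable (restrict_space borel {0<..<1})" using m by measurable
    moreover have "AE \<sigma> in lborel. \<sigma> \<in> {0<..<1} \<longrightarrow> 1 / \<omega> \<sigma> = 1 / c * (1 / \<omega>' \<sigma>)" using AE by eventually_elim simp
    ultimately show "set_integrable lborel {0<..<1} (\<lambda>\<sigma>. 1 / \<omega> \<sigma>)"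
      by (rule int[OF set_integrable_mult_right[OF \<omega>'(3), of "1 / c"]])
  qed
qed

end

lemma (in rtilde_weight) admissible: "admissible_measure D mu"
  unfolding admissible_measure_def mu_def
  by (rule exI[of _ 1], rule exI[of _ \<omega>]) (simp add: weight int_weight int_inverse scale_measure_1)

theorem theorem47:
  fixes D :: "(complex \<times> complex) set"
  assumes D: "D \<in> Rtilde"
  shows
   "\<comment> \<open>(a)\<close> polar D \<in> Rtilde \<and>
    \<comment> \<open>(b)\<close> (D \<in> Rclass \<longrightarrow> polar D \<in> Rclass) \<and>
    \<comment> \<open>(c)\<close> C1_diffeomorphism (gamma_plus D) (gamma_plus (polar D)) (T D) \<and>
    \<comment> \<open>(d)\<close>
    (\<forall>\<zeta>\<in>gamma_plus D. r1 \<zeta> * r1 (T D \<zeta>) + r2 \<zeta> * r2 (T D \<zeta>) = 1) \<and>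
    one_form_vanishes_along (gamma_plus D) (r1 \<circ> T D) r1 (r2 \<circ> T D) r2 \<and>
    one_form_vanishes_along (gamma_plus D) r1 (r1 \<circ> T D) r2 (r2 \<circ> T D) \<and>
    (\<forall>\<zeta>\<in>gamma_plus D.
        r1 \<zeta> * r1 (T D \<zeta>) = s_coord D \<zeta> \<and>
        r2 \<zeta> * r2 (T D \<zeta>) = 1 - s_coord D \<zeta> \<and>
        s_coord (polar D) (T D \<zeta>) = s_coord D \<zeta> \<and>
        1 / p_fun D \<zeta> + 1 / p_fun (polar D) (T D \<zeta>) = 1) \<and>
    \<comment> \<open>(e)\<close>
    (\<forall>q \<beta>\<^sub>2 \<beta>\<^sub>1. generated_by D q \<beta>\<^sub>2 \<beta>\<^sub>1 \<longrightarrow>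
        generated_by (polar D) (\<lambda>\<sigma>. conjugate_exponent (q \<sigma>)) (inverse \<beta>\<^sub>2) (inverse \<beta>\<^sub>1)) \<and>
    (\<forall>\<omega>. positive_weight \<omega> \<and> admissible_measure D (bd_measure D \<omega>) \<longrightarrow>
       (let \<mu> = bd_measure D \<omega>;
            \<mu>' = bd_measure (polar D) (\<lambda>\<sigma>. 1 / \<omega> \<sigma>);
            U = U_op D \<omega>
        in
         \<comment> \<open>(f)\<close> admissible_measure (polar D) \<mu>' \<and>
         \<comment> \<open>(g)\<close> surjective_isometry2 \<mu>' \<mu> U \<and>
         \<comment> \<open>(h)\<close>
         (leray_bounded D \<mu> \<longrightarrow>
            leray_bounded (polar D) \<mu>' \<and>
            (\<forall>g\<in>L2 \<mu>'. AE \<zeta> in \<mu>. leray_adj D \<mu> (U g) \<zeta> = U (leray (polar D) \<mu>' g) \<zeta>) \<and>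
            (\<forall>g\<in>L2 \<mu>'. AE \<zeta> in \<mu>. leray D \<mu> (U g) \<zeta> = U (leray_adj (polar D) \<mu>' g) \<zeta>) \<and>
            op_norm \<mu>' (leray (polar D) \<mu>') = op_norm \<mu> (leray D \<mu>) \<and>
            same_spectral_data
              \<mu>' (leray_adj (polar D) \<mu>' \<circ> leray (polar D) \<mu>')
              \<mu> (leray_adj D \<mu> \<circ> leray D \<mu>) \<and>
            same_spectral_data
              \<mu>' (leray_anti (polar D) \<mu>')
              \<mu> (leray_anti D \<mu>))))"
proof -
  interpret rtilde D by unfold_locales (rule D)
  have d: "\<forall>\<zeta>\<in>gamma_plus D.
        r1 \<zeta> * r1 (T D \<zeta>) = s_coord D \<zeta> \<and>
        r2 \<zeta> * r2 (T D \<zeta>) = 1 - s_coord D \<zeta> \<and>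
        s_coord (polar D) (T D \<zeta>) = s_coord D \<zeta> \<and>
        1 / p_fun D \<zeta> + 1 / p_fun (polar D) (T D \<zeta>) = 1"
    using s_coord_frontier one_minus_s s_coord_T p_fun_T(1) gamma_plus_frontier by simp
  have d0: "\<forall>\<zeta>\<in>gamma_plus D. r1 \<zeta> * r1 (T D \<zeta>) + r2 \<zeta> * r2 (T D \<zeta>) = 1"
    using T_cmod gamma_plus_frontier by blast
  have fgh: "let \<mu> = bd_measure D \<omega>; \<mu>' = bd_measure (polar D) (\<lambda>\<sigma>. 1 / \<omega> \<sigma>); U = U_op D \<omega>
     in admissible_measure (polar D) \<mu>' \<and> surjective_isometry2 \<mu>' \<mu> U \<and>
       (leray_bounded D \<mu> \<longrightarrow>
          leray_bounded (polar D) \<mu>' \<and>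
          (\<forall>g\<in>L2 \<mu>'. AE \<zeta> in \<mu>. leray_adj D \<mu> (U g) \<zeta> = U (leray (polar D) \<mu>' g) \<zeta>) \<and>
          (\<forall>g\<in>L2 \<mu>'. AE \<zeta> in \<mu>. leray D \<mu> (U g) \<zeta> = U (leray_adj (polar D) \<mu>' g) \<zeta>) \<and>
          op_norm \<mu>' (leray (polar D) \<mu>') = op_norm \<mu> (leray D \<mu>) \<and>
          same_spectral_data \<mu>' (leray_adj (polar D) \<mu>' \<circ> leray (polar D) \<mu>') \<mu> (leray_adj D \<mu> \<circ> leray D \<mu>) \<and>
          same_spectral_data \<mu>' (leray_anti (polar D) \<mu>') \<mu> (leray_anti D \<mu>))"
    if "positive_weight \<omega>" "admissible_measure D (bd_measure D \<omega>)" for \<omega>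
  proof -
    interpret rtilde_weight D \<omega> by (rule rtilde_weightI[OF that])
    interpret P: rtilde_weight "polar D" "\<lambda>\<sigma>. 1 / \<omega> \<sigma>" by (rule polar_weight)
    have h: "leray_bounded (polar D) mu' \<and>
        (\<forall>g\<in>L2 mu'. AE \<zeta> in mu. leray_adj D mu (U g) \<zeta> = U (leray (polar D) mu' g) \<zeta>) \<and>
        (\<forall>g\<in>L2 mu'. AE \<zeta> in mu. leray D mu (U g) \<zeta> = U (leray_adj (polar D) mu' g) \<zeta>) \<and>
        op_norm mu' (leray (polar D) mu') = op_norm mu (leray D mu) \<and>
        same_spectral_data mu' (leray_adj (polar D) mu' \<circ> leray (polar D) mu') mu (leray_adj D mu \<circ> leray D mu) \<and>
        same_spectral_data mu' (leray_anti (polar D) mu') mu (leray_anti D mu)"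
      if "leray_bounded D mu"
    proof -
      interpret leray_bounded_weight D \<omega> by unfold_locales (rule that)
      note i = intertwined_leray
      show ?thesis
      proof (intro conjI ballI)
        show "same_spectral_data mu' (leray_anti (polar D) mu') mu (leray_anti D mu)"
          using same_spectral_data_intertwined[OF intertwined_diff[OF i(2) i(1)]] unfolding leray_anti_def[abs_def] .
      qed (rule polar_leray_bounded leray_adj_U leray_U op_norm_intertwined[OF i(1)]
        same_spectral_data_intertwined[OF intertwined_comp[OF i(2) i(1)]]; assumption?)+
    qed
    show ?thesis
      unfolding Let_def mu_def[symmetric] P.mu_def[symmetric] using P.admissible U_isometry h by blast
  qed
  show ?thesis
    by (intro conjI allI impI polar_Rtilde Rclass_polar C1_diffeomorphism_T d0 one_form_1 one_form_2 d generated_by_polar fgh)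
      (assumption | erule conjunct1 conjunct2)+
qed

end
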